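(* Let $\mathcal{D}$ be a set of discounting functions, and assume that the functions in $\mathcal{D}$ can be computed in polynomial space. Then the threshold model-checking problem for $\mathrm{SL}^{\mathrm{disc}}[\mathcal{D}]$ with memoryless agents, that is, given an $\mathrm{SL}^{\mathrm{disc}}[\mathcal{D}]$ formula $\varphi$, a concurrent game structure $\mathcal{G}$ and a threshold $\vartheta\in[0,1]$, decide whether $[\![\varphi]\!]^{\mathcal{G},\mathrm{r}}\ge\vartheta$, is PSPACE-complete.
   Context: **Discounting functions.** A function $d:\mathbb{N}\to[0,1]$ is a discounting function if it is non-increasing and $\lim_{i\to\infty}d(i)=0$. Fix a set $\mathcal{D}$ of discounting functions, a set $\mathrm{AP}$ of atomic propositions, a finite set $\mathrm{Ag}$ of agents and a set $\mathrm{Var}$ of strategy variables. **Syntax.** Formulas of $\mathrm{SL}^{\mathrm{disc}}[\mathcal{D}]$ (Strategy Logic with discounting) are given by $$\varphi ::= p\mid\neg\varphi\mid\varphi\vee\varphi\mid\exists x\,\varphi\mid(a,x)\varphi\mid\mathbf{X}\varphi\mid\varphi\,\mathbf{U}\,\varphi\mid\varphi\,\mathbf{U}_d\,\varphi$$ with $p\in\mathrm{AP}$, $x\in\mathrm{Var}$, $a\in\mathrm{Ag}$, $d\in\mathcal{D}$. A variable is free in $\varphi$ if it is bound to an agent (via $(a,x)$) without being quantified upon; an agent $a$ is free in $\varphi$ if $\varphi$ contains a temporal operator ($\mathbf{X},\mathbf{U},\mathbf{U}_d$) not in the scope of any binding for $a$. $\mathrm{free}(\varphi)$ is the set of free variables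 and agents, and $\varphi$ is a sentence if $\mathrm{free}(\varphi)=\emptyset$. **Models.** A concurrent game structure (CGS) is a tuple $\mathcal{G}=(\mathrm{Ac},V,v_\iota,\delta,\ell)$ with $\mathrm{Ac}$ a finite set of actions, $V$ a finite set of positions, $v_\iota\in V$ the initial position, $\delta:V\times\mathrm{Ac}^{\mathrm{Ag}}\to V$ a transition function and $\ell:V\to2^{\mathrm{AP}}$ a labeling function. **Memoryless strategies.** A memoryless strategy is a function $\sigma:V\to\mathrm{Ac}$; let $\mathrm{Str}^{\mathrm r}$ be the set of these (the superscript $\mathrm r$ stands for memoryless). An assignment is a function $\chi:\mathrm{Ag}\cup\mathrm{Var}\to\mathrm{Str}^{\mathrm r}$; $\chi[l\mapsto\sigma]$ is $\chi$ with the value at $l$ changed to $\sigma$. For $v\in V$, $\mathrm{Out}(\chi,v)$ is the unique infinite sequence $\pi=\pi_0\pi_1\ldots$ with $\pi_0=v$ and $\pi_{i+1}=\delta(\pi_i,(\chi(a)(\pi_i))_{a\in\mathrm{Ag}})$ for all $i\ge0$. **Semantics.** With $\pi=\mathrm{Out}(\chi,v)$, the satisfaction value $[\![\varphi]\!]^{\mathcal{G},\mathrm r}_\chi(v)\in[0,1]$, written $[\![\varphi]\!]_\chi(v)$, is defined by: - $[\![p]\!]_\chi(v)=1$ if $p\in\ell(v)$, and $0$ otherwise; - $[\![\exists x\,\varphi]\!]_\chi(v)=\max_{\sigma\in\mathrm{Str}^{\mathrm r}}[\![\varphi]\!]_{\chi[x\mapsto\sigma]}(v)$; - $[\![(a,x)\varphi]\!]_\chi(v)=[\![\varphi]\!]_{\chi[a\mapsto\chi(x)]}(v)$;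 - $[\![\varphi_1\vee\varphi_2]\!]_\chi(v)=\max([\![\varphi_1]\!]_\chi(v),[\![\varphi_2]\!]_\chi(v))$; - $[\![\neg\varphi]\!]_\chi(v)=1-[\![\varphi]\!]_\chi(v)$; - $[\![\mathbf{X}\varphi]\!]_\chi(v)=[\![\varphi]\!]_\chi(\pi_1)$; - $[\![\varphi_1\mathbf{U}\varphi_2]\!]_\chi(v)=\sup_{i\ge0}\min\big([\![\varphi_2]\!]_\chi(\pi_i),\min_{0\le j<i}[\![\varphi_1]\!]_\chi(\pi_j)\big)$; - $[\![\varphi_1\mathbf{U}_d\varphi_2]\!]_\chi(v)=\sup_{i\ge0}\min\big(d(i)[\![\varphi_2]\!]_\chi(\pi_i),\min_{0\le j<i}d(j)[\![\varphi_1]\!]_\chi(\pi_j)\big)$. (The minimum over an empty set is $1$.) For a sentence $\varphi$ the value does not depend on $\chi$, and $[\![\varphi]\!]^{\mathcal{G},\mathrm r}$ denotes its value at $v_\iota$. In the model-checking problem, $\varphi$ is a sentence, so that this value is defined. *)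

theory Defs
  imports Complex_Main "HOL-Library.FuncSet" "HOL-Computational_Algebra.Polynomial"
begin

section \<open>Strategy Logic with discounting\<close>

definition discounting :: "(nat \<Rightarrow> real) \<Rightarrow> bool" where
  "discounting d \<longleftrightarrow> range d \<subseteq> {0..1} \<and> antimono d \<and> d \<longlonglongrightarrow> 0"

datatype ('ap, 'ag, 'var) form =
    Atom 'ap
  | Neg "('ap, 'ag, 'var) form"
  | Or "('ap, 'ag, 'var) form" "('ap, 'ag, 'var) form"
  | Ex 'var "('ap, 'ag, 'var) form"
  | Bind 'ag 'var "('ap, 'ag, 'var) form"
  | Next "('ap, 'ag, 'var) form"
  | Until "('ap, 'ag, 'var) form" "('ap, 'ag, 'var) form"
  | DUntil "nat \<Rightarrow> real" "('ap, 'ag, 'var) form" "('ap, 'ag, 'var) form"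

text \<open>Membership in the language over the agents \<open>Ag\<close> and the discounting functions \<open>D\<close>.\<close>

primrec form_over :: "'ag set \<Rightarrow> (nat \<Rightarrow> real) set \<Rightarrow> ('ap, 'ag, 'var) form \<Rightarrow> bool" where
  "form_over Ag D (Atom p) \<longleftrightarrow> True"
| "form_over Ag D (Neg \<phi>) \<longleftrightarrow> form_over Ag D \<phi>"
| "form_over Ag D (Or \<phi> \<psi>) \<longleftrightarrow> form_over Ag D \<phi> \<and> form_over Ag D \<psi>"
| "form_over Ag D (Ex x \<phi>) \<longleftrightarrow> form_over Ag D \<phi>"
| "form_over Ag D (Bind a x \<phi>) \<longleftrightarrow> a \<in> Ag \<and> form_over Ag D \<phi>"
| "form_over Ag D (Next \<phi>) \<longleftrightarrow> form_over Ag D \<phi>"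
| "form_over Ag D (Until \<phi> \<psi>) \<longleftrightarrow> form_over Ag D \<phi> \<and> form_over Ag D \<psi>"
| "form_over Ag D (DUntil d \<phi> \<psi>) \<longleftrightarrow> d \<in> D \<and> form_over Ag D \<phi> \<and> form_over Ag D \<psi>"

text \<open>Agents are tagged \<open>Inl\<close> and variables \<open>Inr\<close>, here and in assignments.  A temporal operator
  makes every agent of \<open>Ag\<close> free, including agents not mentioned in the formula, because the
  outcome depends on the strategies of all of them.\<close>

primrec free :: "'ag set \<Rightarrow> ('ap, 'ag, 'var) form \<Rightarrow> ('ag + 'var) set" where
  "free Ag (Atom p) = {}"
| "free Ag (Neg \<phi>) = free Ag \<phi>"
| "free Ag (Or \<phi> \<psi>) = free Ag \<phi> \<union> free Ag \<psi>"
| "free Ag (Ex x \<phi>) = free Ag \<phi> - {Inr x}"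
| "free Ag (Bind a x \<phi>) = insert (Inr x) (free Ag \<phi> - {Inl a})"
| "free Ag (Next \<phi>) = Inl ` Ag \<union> free Ag \<phi>"
| "free Ag (Until \<phi> \<psi>) = Inl ` Ag \<union> free Ag \<phi> \<union> free Ag \<psi>"
| "free Ag (DUntil d \<phi> \<psi>) = Inl ` Ag \<union> free Ag \<phi> \<union> free Ag \<psi>"

definition sentence :: "'ag set \<Rightarrow> ('ap, 'ag, 'var) form \<Rightarrow> bool" where
  "sentence Ag \<phi> \<longleftrightarrow> free Ag \<phi> = {}"

record ('v, 'ac, 'ag, 'ap) cgs =
  actions :: "'ac set"
  positions :: "'v set"
  init_pos :: 'v
  move :: "'v \<Rightarrow> ('ag \<Rightarrow> 'ac) \<Rightarrow> 'v"
  label :: "'v \<Rightarrow> 'ap set"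

text \<open>Action profiles are the extensional functions from \<open>Ag\<close> to actions, memoryless strategies
  the extensional functions from positions to actions.\<close>

definition cgs :: "'ag set \<Rightarrow> ('v, 'ac, 'ag, 'ap) cgs \<Rightarrow> bool" where
  "cgs Ag G \<longleftrightarrow>
     finite (actions G) \<and> actions G \<noteq> {} \<and> finite (positions G) \<and> init_pos G \<in> positions G \<and>
     (\<forall>v\<in>positions G. \<forall>c\<in>Ag \<rightarrow>\<^sub>E actions G. move G v c \<in> positions G)"

definition strategies :: "('v, 'ac, 'ag, 'ap) cgs \<Rightarrow> ('v \<Rightarrow> 'ac) set" where
  "strategies G = positions G \<rightarrow>\<^sub>E actions G"

primrec outcome ::
  "'ag set \<Rightarrow> ('v, 'ac, 'ag, 'ap) cgs \<Rightarrow> ('ag + 'var \<Rightarrow> 'v \<Rightarrow> 'ac) \<Rightarrow> 'v \<Rightarrow> nat \<Rightarrow> 'v"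
where
  "outcome Ag G \<chi> v 0 = v"
| "outcome Ag G \<chi> v (Suc i) =
     move G (outcome Ag G \<chi> v i) (\<lambda>a\<in>Ag. \<chi> (Inl a) (outcome Ag G \<chi> v i))"

text \<open>All satisfaction values lie in \<open>[0,1]\<close>, so inserting \<open>1\<close> below only fixes the minimum over
  the empty set.\<close>

primrec sat_value ::
  "'ag set \<Rightarrow> ('v, 'ac, 'ag, 'ap) cgs \<Rightarrow> ('ap, 'ag, 'var) form \<Rightarrow>
   ('ag + 'var \<Rightarrow> 'v \<Rightarrow> 'ac) \<Rightarrow> 'v \<Rightarrow> real"
where
  "sat_value Ag G (Atom p) \<chi> v = (if p \<in> label G v then 1 else 0)"
| "sat_value Ag G (Neg \<phi>) \<chi> v = 1 - sat_value Ag G \<phi> \<chi> v"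
| "sat_value Ag G (Or \<phi> \<psi>) \<chi> v = max (sat_value Ag G \<phi> \<chi> v) (sat_value Ag G \<psi> \<chi> v)"
| "sat_value Ag G (Ex x \<phi>) \<chi> v =
     Max ((\<lambda>\<sigma>. sat_value Ag G \<phi> (\<chi>(Inr x := \<sigma>)) v) ` strategies G)"
| "sat_value Ag G (Bind a x \<phi>) \<chi> v = sat_value Ag G \<phi> (\<chi>(Inl a := \<chi> (Inr x))) v"
| "sat_value Ag G (Next \<phi>) \<chi> v = sat_value Ag G \<phi> \<chi> (outcome Ag G \<chi> v 1)"
| "sat_value Ag G (Until \<phi> \<psi>) \<chi> v =
     (SUP i. min (sat_value Ag G \<psi> \<chi> (outcome Ag G \<chi> v i))
                 (Min (insert 1 ((\<lambda>j. sat_value Ag G \<phi> \<chi> (outcome Ag G \<chi> v j)) ` {..<i}))))"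
| "sat_value Ag G (DUntil d \<phi> \<psi>) \<chi> v =
     (SUP i. min (d i * sat_value Ag G \<psi> \<chi> (outcome Ag G \<chi> v i))
                 (Min (insert 1 ((\<lambda>j. d j * sat_value Ag G \<phi> \<chi> (outcome Ag G \<chi> v j)) ` {..<i}))))"

definition sentence_value ::
  "'ag set \<Rightarrow> ('v, 'ac, 'ag, 'ap) cgs \<Rightarrow> ('ap, 'ag, 'var) form \<Rightarrow> real" where
  "sentence_value Ag G \<phi> =
     (THE r. \<forall>\<chi>. range \<chi> \<subseteq> strategies G \<longrightarrow> sat_value Ag G \<phi> \<chi> (init_pos G) = r)"

text \<open>The value of a sentence does not depend on the assignment.\<close>

lemma outcome_cong:
  assumes "\<forall>a\<in>Ag. \<chi> (Inl a) = \<chi>' (Inl a)"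
  shows "outcome Ag G \<chi> v i = outcome Ag G \<chi>' v i"
proof (induction i)
  case (Suc i)
  have "(\<lambda>a\<in>Ag. \<chi> (Inl a) (outcome Ag G \<chi> v i)) = (\<lambda>a\<in>Ag. \<chi>' (Inl a) (outcome Ag G \<chi>' v i))"
    using assms Suc by (intro restrict_ext) simp
  then show ?case using Suc by simp
qed simp

lemma sat_value_cong:
  assumes "\<forall>l\<in>free Ag \<phi>. \<chi> l = \<chi>' l"
  shows "sat_value Ag G \<phi> \<chi> v = sat_value Ag G \<phi> \<chi>' v"
  using assms
proof (induction \<phi> arbitrary: \<chi> \<chi>' v)
  case (Neg \<phi>)
  have "sat_value Ag G \<phi> \<chi> v = sat_value Ag G \<phi> \<chi>' v"
    using Neg.prems by (intro Neg.IH) simp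
  then show ?case by simp
next
  case (Or \<phi> \<psi>)
  have "sat_value Ag G \<phi> \<chi> v = sat_value Ag G \<phi> \<chi>' v"
    "sat_value Ag G \<psi> \<chi> v = sat_value Ag G \<psi> \<chi>' v"
    using Or.prems by (auto intro!: Or.IH)
  then show ?case by simp
next
  case (Ex x \<phi>)
  have "sat_value Ag G \<phi> (\<chi>(Inr x := \<sigma>)) v = sat_value Ag G \<phi> (\<chi>'(Inr x := \<sigma>)) v" for \<sigma>
    using Ex.prems by (intro Ex.IH) auto
  then show ?case by simp
next
  case (Bind a x \<phi>)
  have "sat_value Ag G \<phi> (\<chi>(Inl a := \<chi> (Inr x))) v
      = sat_value Ag G \<phi> (\<chi>'(Inl a := \<chi>' (Inr x))) v"
    using Bind.prems by (intro Bind.IH) auto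
  then show ?case by simp
next
  case (Next \<phi>)
  then have "outcome Ag G \<chi> v i = outcome Ag G \<chi>' v i" for i
    by (intro outcome_cong) auto
  moreover have "sat_value Ag G \<phi> \<chi> u = sat_value Ag G \<phi> \<chi>' u" for u
    using Next.prems by (intro Next.IH) auto
  ultimately show ?case by (simp only: sat_value.simps)
next
  case (Until \<phi> \<psi>)
  then have "outcome Ag G \<chi> v i = outcome Ag G \<chi>' v i" for i
    by (intro outcome_cong) auto
  moreover have "sat_value Ag G \<phi> \<chi> u = sat_value Ag G \<phi> \<chi>' u"
    "sat_value Ag G \<psi> \<chi> u = sat_value Ag G \<psi> \<chi>' u" for u
    using Until.prems by (auto intro!: Until.IH)
  ultimately show ?case by (simp only: sat_value.simps)
next
  case (DUntil d \<phi> \<psi>)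
  then have "outcome Ag G \<chi> v i = outcome Ag G \<chi>' v i" for i
    by (intro outcome_cong) auto
  moreover have "sat_value Ag G \<phi> \<chi> u = sat_value Ag G \<phi> \<chi>' u"
    "sat_value Ag G \<psi> \<chi> u = sat_value Ag G \<psi> \<chi>' u" for u
    using DUntil.prems by (auto intro!: DUntil.IH)
  ultimately show ?case by (simp only: sat_value.simps)
qed simp

lemma sentence_value_eq:
  fixes \<chi> :: "'ag + 'var \<Rightarrow> 'v \<Rightarrow> 'ac"
  assumes "sentence Ag \<phi>" and "range \<chi> \<subseteq> strategies G"
  shows "sentence_value Ag G \<phi> = sat_value Ag G \<phi> \<chi> (init_pos G)"
  unfolding sentence_value_def
proof (rule the_equality)
  show "\<forall>\<chi>'. range \<chi>' \<subseteq> strategies G \<longrightarrow>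
          sat_value Ag G \<phi> \<chi>' (init_pos G) = sat_value Ag G \<phi> \<chi> (init_pos G)"
    using assms(1) by (auto simp: sentence_def intro: sat_value_cong)
qed (use assms(2) in blast)

section \<open>Turing machines and polynomial space\<close>

text \<open>Deterministic machines with finitely many two-way infinite tapes.  State \<open>0\<close> is initial and
  state \<open>1\<close> halting; symbol \<open>0\<close> is the blank, and \<open>1\<close>, \<open>2\<close> represent the bits.  Tape \<open>0\<close> holds the
  input, tape \<open>1\<close> the output.\<close>

record tm =
  num_tapes :: nat
  num_states :: nat
  num_symbols :: nat
  tm_trans :: "nat \<Rightarrow> nat list \<Rightarrow> nat \<times> (nat \<times> int) list"

definition tm :: "tm \<Rightarrow> bool" where
  "tm M \<longleftrightarrow>
     2 \<le> num_tapes M \<and> 2 \<le> num_states M \<and> 3 \<le> num_symbols M \<and>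
     (\<forall>q<num_states M. \<forall>ss. length ss = num_tapes M \<and> set ss \<subseteq> {..<num_symbols M} \<longrightarrow>
        fst (tm_trans M q ss) < num_states M \<and>
        length (snd (tm_trans M q ss)) = num_tapes M \<and>
        set (snd (tm_trans M q ss)) \<subseteq> {..<num_symbols M} \<times> {-1, 0, 1})"

type_synonym tape = "(int \<Rightarrow> nat) \<times> int"
type_synonym config = "nat \<times> tape list"

fun tape_read :: "tape \<Rightarrow> nat" where
  "tape_read (c, h) = c h"

fun tape_act :: "nat \<times> int \<Rightarrow> tape \<Rightarrow> tape" where
  "tape_act (s, m) (c, h) = (c(h := s), h + m)"

fun tm_step :: "tm \<Rightarrow> config \<Rightarrow> config" where
  "tm_step M (q, ts) =
     (if q = 1 then (q, ts)
      else (case tm_trans M q (map tape_read ts) of (q', as) \<Rightarrow> (q', map2 tape_act as ts)))"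

definition bit_symbol :: "bool \<Rightarrow> nat" where
  "bit_symbol b = (if b then 2 else 1)"

definition tm_init :: "tm \<Rightarrow> bool list \<Rightarrow> config" where
  "tm_init M w =
     (0, (\<lambda>i. if 0 \<le> i \<and> i < int (length w) then bit_symbol (w ! nat i) else 0, 0)
         # replicate (num_tapes M - 1) (\<lambda>_. 0, 0))"

definition tm_config :: "tm \<Rightarrow> bool list \<Rightarrow> nat \<Rightarrow> config" where
  "tm_config M w t = (tm_step M ^^ t) (tm_init M w)"

text \<open>The output ends at the first blank to the right of the origin.\<close>

definition tape_holds :: "tape \<Rightarrow> bool list \<Rightarrow> bool" where
  "tape_holds T w \<longleftrightarrow>
     (\<forall>i<length w. fst T (int i) = bit_symbol (w ! i)) \<and> fst T (int (length w)) = 0"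

definition tm_outputs :: "tm \<Rightarrow> bool list \<Rightarrow> nat \<Rightarrow> bool list \<Rightarrow> bool" where
  "tm_outputs M w t y \<longleftrightarrow>
     fst (tm_config M w t) = 1 \<and> tape_holds (snd (tm_config M w t) ! 1) y"

definition computes_in_time :: "tm \<Rightarrow> (bool list \<Rightarrow> bool list) \<Rightarrow> (nat \<Rightarrow> nat) \<Rightarrow> bool" where
  "computes_in_time M f b \<longleftrightarrow> (\<forall>w. \<exists>t\<le>b (length w). tm_outputs M w t (f w))"

text \<open>The space bound applies to all tapes, including the input and the output tape.\<close>

definition computes_in_space :: "tm \<Rightarrow> (bool list \<Rightarrow> bool list) \<Rightarrow> (nat \<Rightarrow> nat) \<Rightarrow> bool" where
  "computes_in_space M f b \<longleftrightarrow>
     (\<forall>w. (\<exists>t. tm_outputs M w t (f w)) \<and>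
          (\<forall>t. \<forall>T\<in>set (snd (tm_config M w t)). \<bar>snd T\<bar> \<le> int (b (length w))))"

definition polytime_computable :: "(bool list \<Rightarrow> bool list) \<Rightarrow> bool" where
  "polytime_computable f \<longleftrightarrow> (\<exists>M (p :: nat poly). tm M \<and> computes_in_time M f (poly p))"

definition pspace_computable :: "(bool list \<Rightarrow> bool list) \<Rightarrow> bool" where
  "pspace_computable f \<longleftrightarrow> (\<exists>M (p :: nat poly). tm M \<and> computes_in_space M f (poly p))"

definition PSPACE :: "bool list set set" where
  "PSPACE = {L. pspace_computable (\<lambda>w. [w \<in> L])}"

definition polytime_reducible :: "bool list set \<Rightarrow> bool list set \<Rightarrow> bool" where
  "polytime_reducible A B \<longleftrightarrow> (\<exists>f. polytime_computable f \<and> (\<forall>w. w \<in> A \<longleftrightarrow> f w \<in> B))"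

definition PSPACE_hard :: "bool list set \<Rightarrow> bool" where
  "PSPACE_hard B \<longleftrightarrow> (\<forall>A\<in>PSPACE. polytime_reducible A B)"

definition PSPACE_complete :: "bool list set \<Rightarrow> bool" where
  "PSPACE_complete B \<longleftrightarrow> B \<in> PSPACE \<and> PSPACE_hard B"

section \<open>Encoding of instances\<close>

text \<open>Binary notation, least significant bit first.\<close>

fun bin :: "nat \<Rightarrow> bool list" where
  "bin n = (if n = 0 then [] else odd n # bin (n div 2))"

declare bin.simps [simp del]

text \<open>Every code below is prefix-free, hence codes can be concatenated without separators.\<close>

definition enc_word :: "bool list \<Rightarrow> bool list" where
  "enc_word w = concat (map (\<lambda>b. [True, b]) w) @ [False]"

definition enc_nat :: "nat \<Rightarrow> bool list" where
  "enc_nat n = enc_word (bin n)"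

definition enc_list :: "('a \<Rightarrow> bool list) \<Rightarrow> 'a list \<Rightarrow> bool list" where
  "enc_list e xs = enc_nat (length xs) @ concat (map e xs)"

text \<open>Nonnegative rationals only, in lowest terms.\<close>

definition enc_rat :: "rat \<Rightarrow> bool list" where
  "enc_rat r = (case quotient_of r of (a, b) \<Rightarrow> enc_nat (nat a) @ enc_nat (nat b))"

primrec enc_form :: "((nat \<Rightarrow> real) \<Rightarrow> bool list) \<Rightarrow> (nat, nat, nat) form \<Rightarrow> bool list" where
  "enc_form code (Atom p) = enc_nat 0 @ enc_nat p"
| "enc_form code (Neg \<phi>) = enc_nat 1 @ enc_form code \<phi>"
| "enc_form code (Or \<phi> \<psi>) = enc_nat 2 @ enc_form code \<phi> @ enc_form code \<psi>"
| "enc_form code (Ex x \<phi>) = enc_nat 3 @ enc_nat x @ enc_form code \<phi>"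
| "enc_form code (Bind a x \<phi>) = enc_nat 4 @ enc_nat a @ enc_nat x @ enc_form code \<phi>"
| "enc_form code (Next \<phi>) = enc_nat 5 @ enc_form code \<phi>"
| "enc_form code (Until \<phi> \<psi>) = enc_nat 6 @ enc_form code \<phi> @ enc_form code \<psi>"
| "enc_form code (DUntil d \<phi> \<psi>) =
     enc_nat 7 @ enc_word (code d) @ enc_form code \<phi> @ enc_form code \<psi>"

text \<open>To be written down, a game is presented with initial segments of the naturals as positions and
  actions and with finite labels.  The move function is listed explicitly, profile by profile, so
  the length of the code is at least \<open>card (positions G)\<close> and \<open>card (actions G)\<close> when there is at
  least one agent.\<close>

definition presented :: "(nat, nat, nat, nat) cgs \<Rightarrow> bool" where
  "presented G \<longleftrightarrow>
     positions G = {..<card (positions G)} \<and> actions G = {..<card (actions G)} \<and>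
     (\<forall>v\<in>positions G. finite (label G v))"

definition enc_cgs :: "nat \<Rightarrow> (nat, nat, nat, nat) cgs \<Rightarrow> bool list" where
  "enc_cgs k G =
     enc_nat (card (positions G)) @ enc_nat (card (actions G)) @ enc_nat (init_pos G) @
     concat (map (\<lambda>v.
         concat (map (\<lambda>as. enc_nat (move G v (\<lambda>a\<in>{..<k}. as ! a)))
                     (List.n_lists k [0..<card (actions G)]))
         @ enc_list enc_nat (sorted_list_of_set (label G v)))
       [0..<card (positions G)])"

section \<open>The model-checking problem\<close>

text \<open>Formulas name the functions of \<open>D\<close> by words, through \<open>code\<close>.  The functions of \<open>D\<close> are
  computed by a single machine, which receives the name of \<open>d\<close> and the argument \<open>i\<close> in unary, writes
  the exact rational value \<open>d i\<close>, and answers with the empty word on words naming nothing in \<open>D\<close>.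
  The argument is unary because the value may need a number of bits linear in \<open>i\<close>, as for
  exponential discounting.\<close>

definition pspace_computable_family ::
  "((nat \<Rightarrow> real) \<Rightarrow> bool list) \<Rightarrow> (nat \<Rightarrow> real) set \<Rightarrow> bool" where
  "pspace_computable_family code D \<longleftrightarrow>
     inj_on code D \<and>
     (\<exists>f. pspace_computable f \<and>
          (\<forall>d\<in>D. \<forall>i. \<exists>r. d i = of_rat r \<and> f (enc_word (code d) @ replicate i True) = enc_rat r) \<and>
          (\<forall>w. w \<notin> code ` D \<longrightarrow> (\<forall>i. f (enc_word w @ replicate i True) = [])))"

text \<open>The agents are \<open>{..<k}\<close>.  The language of codes of the positive instances.\<close>

definition threshold_model_checking ::
  "nat \<Rightarrow> (nat \<Rightarrow> real) set \<Rightarrow> ((nat \<Rightarrow> real) \<Rightarrow> bool list) \<Rightarrow> bool list set" where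
  "threshold_model_checking k D code =
     {enc_form code \<phi> @ enc_cgs k G @ enc_rat \<theta> | \<phi> G \<theta>.
        form_over {..<k} D \<phi> \<and> sentence {..<k} \<phi> \<and> cgs {..<k} G \<and> presented G \<and>
        0 \<le> \<theta> \<and> \<theta> \<le> 1 \<and> sentence_value {..<k} G \<phi> \<ge> of_rat \<theta>}"

end

theory Submission
  imports Defs
begin

text \<open>Membership: the value of a formula is computed by recursion on the formula.  The strategies of
  a quantifier are tried one after the other, and the supremum of an until over a path is a maximum
  over its first \<open>card V\<close> positions: cutting a cycle out of a path reaches the same position earlier,
  with a larger discount and fewer obligations.  The recursion has depth at most the size of the
  formula, and every value is a fraction whose denominator is a product of that many denominators of
  discounts, so that polynomial space suffices.

  Hardness: in a game whose positions and actions are the letters of an alphabet, a quantified variable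
  holds a letter, namely the action its strategy plays in the initial position, and a binding followed
  by \<open>Next\<close> tests it.  Encoding configurations of a polynomial space machine by tuples of variables,
  reachability is expressed by Savitch's formula, which halves a path and quantifies universally over
  the two halves so that the recursive formula occurs only once.

  Both parts need programs that run in polynomial space or time.  They are built from functions on
  typed data that are represented by trees, serialized on a stack, and manipulated by programs for
  stack machines, which are compiled to Turing machines; conversely, polynomial space Turing machines are
  simulated by such programs.\<close>

section \<open>Stack programs\<close>

text \<open>A reduction must run in polynomial time while membership needs polynomial space. One
  calculus \<open>cmp b\<close> serves both: the flag decides whether time is bounded, and the
  closure lemmas for lists are shared. Addition and multiplication exist in the space class only, by
  counting loops of exponential length; the reduction therefore works with unary lengths, and
  variables are numbered so that their binary numerals can be written without arithmetic. For
  membership, exponentially many strategies are no obstacle, because a strategy is a numeral of N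
  digits in base c, for N positions and c actions, and a loop counter of that length enumerates
  them. Discounts are queried only at arguments up to N, so unary arguments stay short. The hard
  instances take only the values 0 and 1 and have threshold 1, so one construction serves every
  \<open>D\<close>. A polynomial space machine may run exponentially long, and its running time is
  never estimated: the formula looks 4^T steps ahead, where 4^T is at least the number of
  configuration words, and a deterministic sequence that is eventually constant has settled by
  then.\<close>

datatype com =
    Nop
  | Push nat nat
  | Pop nat
  | Seq com com
  | Branch nat nat com com
  | Loop nat nat com

type_synonym stacks = "nat \<Rightarrow> nat list"

definition peek :: "nat list \<Rightarrow> nat" where
  "peek xs = (case xs of [] \<Rightarrow> 0 | x # _ \<Rightarrow> x)"

text \<open>A machine sees only the scanned cell and takes the symbol 0 for the bottom; leaving such
  a stack unchanged mirrors the compiled step, which does not move on a blank.\<close>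

definition pop :: "nat list \<Rightarrow> nat list" where
  "pop xs = (if peek xs = 0 then xs else tl xs)"

lemma peek_simps [simp]: "peek [] = 0" "peek (x # xs) = x"
  by (simp_all add: peek_def)

lemma pop_simps [simp]: "pop [] = []" "x \<noteq> 0 \<Longrightarrow> pop (x # xs) = xs"
  by (simp_all add: pop_def)

definition low :: "nat \<Rightarrow> stacks \<Rightarrow> bool" where
  "low m s \<longleftrightarrow> (\<forall>j. length (s j) \<le> m)"

text \<open>\<open>Loop j a c\<close> repeats \<open>c\<close> until the top of stack \<open>j\<close> is \<open>a\<close>, where \<open>0\<close> stands for the
  top of an empty stack.  In \<open>exec m c s t s'\<close> the number \<open>m\<close> bounds the heights of all stacks and \<open>t\<close> is
  the time.\<close>

inductive exec :: "nat \<Rightarrow> com \<Rightarrow> stacks \<Rightarrow> nat \<Rightarrow> stacks \<Rightarrow> bool" for m where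
  exec_Nop: "low m s \<Longrightarrow> exec m Nop s (Suc 0) s"
| exec_Push: "low m s \<Longrightarrow> s' = s(j := a # s j) \<Longrightarrow> low m s' \<Longrightarrow> exec m (Push j a) s (Suc 0) s'"
| exec_Pop: "low m s \<Longrightarrow> s' = s(j := pop (s j)) \<Longrightarrow> exec m (Pop j) s (Suc 0) s'"
| exec_Seq: "exec m c s t s' \<Longrightarrow> exec m d s' t' s'' \<Longrightarrow> exec m (Seq c d) s (Suc (t + t')) s''"
| exec_Branch1: "peek (s j) = a \<Longrightarrow> exec m c s t s' \<Longrightarrow> exec m (Branch j a c d) s (Suc t) s'"
| exec_Branch2: "peek (s j) \<noteq> a \<Longrightarrow> exec m d s t s' \<Longrightarrow> exec m (Branch j a c d) s (Suc t) s'"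
| exec_Loop1: "peek (s j) = a \<Longrightarrow> low m s \<Longrightarrow> exec m (Loop j a c) s (Suc 0) s"
| exec_Loop2: "peek (s j) \<noteq> a \<Longrightarrow> exec m c s t s' \<Longrightarrow> exec m (Loop j a c) s' t' s'' \<Longrightarrow>
    exec m (Loop j a c) s (Suc (t + t')) s''"

lemma exec_low: "exec m c s t s' \<Longrightarrow> low m s \<and> low m s'"
proof (induction rule: exec.induct)
  case (exec_Pop s s' j)
  then show ?case
    by (auto simp: low_def pop_def) (metis diff_le_self le_trans)
qed (simp_all del: fun_upd_apply)

text \<open>Only 1 and 2 may be pushed. The symbol 0 remains the blank, so an empty stack is never
  confused with a stored symbol and three tape symbols suffice.\<close>

primrec wf_com :: "nat \<Rightarrow> com \<Rightarrow> bool" where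
  "wf_com k Nop \<longleftrightarrow> True"
| "wf_com k (Push j a) \<longleftrightarrow> j < k \<and> a \<in> {1, 2}"
| "wf_com k (Pop j) \<longleftrightarrow> j < k"
| "wf_com k (Seq c d) \<longleftrightarrow> wf_com k c \<and> wf_com k d"
| "wf_com k (Branch j a c d) \<longleftrightarrow> j < k \<and> wf_com k c \<and> wf_com k d"
| "wf_com k (Loop j a c) \<longleftrightarrow> j < k \<and> wf_com k c"

section \<open>Compilation to Turing machines\<close>

text \<open>The control states are the lists of commands still to be executed; \<open>Go True\<close> marks the
  second half of a push, which takes two steps because a machine writes before it moves.  In state
  \<open>Start\<close> the head is brought to the right end of the input, so that tape \<open>0\<close> becomes a stack.\<close>

datatype ctl = Start | Go bool "com list"

definition keep :: "nat list \<Rightarrow> (nat \<times> int) list" where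
  "keep ss = map (\<lambda>s. (s, 0)) ss"

fun ctl_step :: "com \<Rightarrow> ctl \<Rightarrow> nat list \<Rightarrow> ctl \<times> (nat \<times> int) list" where
  "ctl_step c0 Start ss =
     (if ss ! 0 = 0 then (Go False [c0], map (\<lambda>s. (s, -1)) ss)
      else (Start, (keep ss)[0 := (ss ! 0, 1)]))"
| "ctl_step c0 (Go b []) ss = (Go False [], keep ss)"
| "ctl_step c0 (Go b (Nop # K)) ss = (Go False K, keep ss)"
| "ctl_step c0 (Go b (Push j a # K)) ss =
     (if b then (Go False K, (keep ss)[j := (a, 0)])
      else (Go True (Push j a # K), (keep ss)[j := (ss ! j, 1)]))"
| "ctl_step c0 (Go b (Pop j # K)) ss =
     (Go False K, (keep ss)[j := (0, if ss ! j = 0 then 0 else -1)])"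
| "ctl_step c0 (Go b (Seq c d # K)) ss = (Go False (c # d # K), keep ss)"
| "ctl_step c0 (Go b (Branch j a c d # K)) ss =
     (Go False ((if ss ! j = a then c else d) # K), keep ss)"
| "ctl_step c0 (Go b (Loop j a c # K)) ss =
     (Go False (if ss ! j = a then K else c # Loop j a c # K), keep ss)"

text \<open>The continuations that can arise while \<open>c\<close> runs in front of
  \<open>K\<close>. The body of a loop runs in front of the loop itself, so iterating does not
  lengthen the list and the control states stay finite.\<close>

primrec conts :: "com \<Rightarrow> com list \<Rightarrow> com list set" where
  "conts Nop K = {Nop # K}"
| "conts (Push j a) K = {Push j a # K}"
| "conts (Pop j) K = {Pop j # K}"
| "conts (Seq c d) K = insert (Seq c d # K) (conts c (d # K) \<union> conts d K)"
| "conts (Branch j a c d) K = insert (Branch j a c d # K) (conts c K \<union> conts d K)"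
| "conts (Loop j a c) K = insert (Loop j a c # K) (conts c (Loop j a c # K))"

lemma finite_conts: "finite (conts c K)"
  by (induction c arbitrary: K) auto

lemma conts_self: "c # K \<in> conts c K"
  by (cases c) auto

text \<open>\<open>K\<close> joins the conclusion because the last step of \<open>c\<close> leaves
  its own continuations, and \<open>b'\<close> may be true because a push stops halfway.\<close>

lemma conts_closed:
  "L \<in> conts c K \<Longrightarrow> \<exists>b' L'. fst (ctl_step c0 (Go b L) ss) = Go b' L' \<and> L' \<in> insert K (conts c K)"
proof (induction c arbitrary: K L)
  case (Seq c d)
  from Seq.prems consider "L = Seq c d # K" | "L \<in> conts c (d # K)" | "L \<in> conts d K"
    by auto
  then show ?case
  proof cases
    case 2
    from Seq.IH(1)[OF this] conts_self[of d K] show ?thesis by auto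
  next
    case 3
    from Seq.IH(2)[OF this] show ?thesis by auto
  qed (auto simp: conts_self ex_bool_eq)
next
  case (Branch j a c d)
  from Branch.prems consider "L = Branch j a c d # K" | "L \<in> conts c K" | "L \<in> conts d K"
    by auto
  then show ?case
  proof cases
    case 2
    from Branch.IH(1)[OF this] show ?thesis by auto
  next
    case 3
    from Branch.IH(2)[OF this] show ?thesis by auto
  qed (auto simp: conts_self ex_bool_eq)
next
  case (Loop j a c)
  from Loop.prems consider "L = Loop j a c # K" | "L \<in> conts c (Loop j a c # K)"
    by auto
  then show ?case
  proof cases
    case 2
    from Loop.IH[OF this] show ?thesis by auto
  qed (auto simp: conts_self ex_bool_eq)
qed (auto simp: ex_bool_eq split: if_splits)

lemma conts_wf:
  "L \<in> conts c K \<Longrightarrow> wf_com k c \<Longrightarrow> \<forall>x\<in>set K. wf_com k x \<Longrightarrow> \<forall>x\<in>set L. wf_com k x"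
proof (induction c arbitrary: K L)
  case (Seq c d)
  show ?case
    using Seq.prems Seq.IH(1)[of L "d # K"] Seq.IH(2)[of L K] by auto
next
  case (Branch j a c d)
  show ?case
    using Branch.prems Branch.IH(1)[of L K] Branch.IH(2)[of L K] by auto
next
  case (Loop j a c)
  show ?case
    using Loop.prems Loop.IH(1)[of L "Loop j a c # K"] by auto
qed auto

definition ctls :: "com \<Rightarrow> ctl set" where
  "ctls c0 = insert Start (case_prod Go ` (UNIV \<times> insert [] (conts c0 [])))"

lemma finite_ctls: "finite (ctls c0)"
  by (simp add: ctls_def finite_conts)

lemma ctls_memb:
  "Start \<in> ctls c0" "Go b L \<in> ctls c0 \<longleftrightarrow> L = [] \<or> L \<in> conts c0 []"
  unfolding ctls_def by (simp_all add: image_iff) blast?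

lemma ctls_closed:
  assumes "q \<in> ctls c0"
  shows "fst (ctl_step c0 q ss) \<in> ctls c0"
proof (cases q)
  case Start
  then show ?thesis by (simp add: ctls_memb conts_self)
next
  case (Go b L)
  show ?thesis
  proof (cases L)
    case Nil
    with Go show ?thesis by (simp add: ctls_memb)
  next
    case (Cons x K)
    then have "L \<in> conts c0 []"
      using assms Go by (simp add: ctls_memb)
    from conts_closed[OF this, of c0 b ss] Go show ?thesis
      by (auto simp: ctls_memb)
  qed
qed

lemma keep_set: "set ss \<subseteq> A \<Longrightarrow> set (keep ss) \<subseteq> A \<times> {-1, 0, 1}"
  by (auto simp: keep_def)

lemma ctl_step_actions:
  assumes "q \<in> ctls c0" "wf_com k c0" "0 < k" "length ss = k" "set ss \<subseteq> {..<3}"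
  shows "length (snd (ctl_step c0 q ss)) = k"
    and "set (snd (ctl_step c0 q ss)) \<subseteq> {..<3} \<times> {-1, 0, 1}"
proof -
  have ks: "set (keep ss) \<subseteq> {..<3} \<times> {-1, 0, 1}" "length (keep ss) = k"
    using keep_set[OF assms(5)] assms(4) by (auto simp: keep_def)
  have nth: "ss ! j < 3" if "j < k" for j
    using that assms(4,5) by (auto simp: subset_iff)
  have upd: "set ((keep ss)[j := (s, m)]) \<subseteq> {..<3} \<times> {-1, 0, 1}"
    if "s < 3" "m \<in> {-1, 0, 1}" for j s m
    using set_update_subset_insert[of "keep ss" j "(s, m)"] ks that by auto
  have wfL: "\<forall>x\<in>set L. wf_com k x" if "q = Go b L" for b L
    using assms(1) that conts_wf[of L c0 "[]" k] assms(2) by (auto simp: ctls_memb)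
  have "length (snd (ctl_step c0 q ss)) = k \<and>
      set (snd (ctl_step c0 q ss)) \<subseteq> {..<3} \<times> {-1, 0, 1}"
  proof (cases "(c0, q, ss)" rule: ctl_step.cases)
    case (1 c0 ss)
    then show ?thesis
      using ks assms upd[of "ss ! 0" 1 0] nth[of 0] by auto
  next
    case (4 c0 b j a K ss)
    then show ?thesis
      using ks(2) assms(4) upd[of a 0 j] upd[of "ss ! j" 1 j] nth[of j] wfL[of b] by force
  next
    case (5 c0 b j K ss)
    then show ?thesis
      using ks assms(4) upd[of 0 _ j] wfL by auto
  qed (use ks in auto)
  then show "length (snd (ctl_step c0 q ss)) = k"
    "set (snd (ctl_step c0 q ss)) \<subseteq> {..<3} \<times> {-1, 0, 1}"
    by auto
qed

definition tapes_step :: "com \<Rightarrow> ctl \<times> tape list \<Rightarrow> ctl \<times> tape list" where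
  "tapes_step c0 = (\<lambda>(q, ts). case ctl_step c0 q (map tape_read ts) of
     (q', as) \<Rightarrow> (q', map2 tape_act as ts))"

definition heads_le :: "nat \<Rightarrow> tape list \<Rightarrow> bool" where
  "heads_le m ts \<longleftrightarrow> (\<forall>T\<in>set ts. \<bar>snd T\<bar> \<le> int m)"

definition steps ::
  "com \<Rightarrow> nat \<Rightarrow> ctl \<times> tape list \<Rightarrow> nat \<Rightarrow> ctl \<times> tape list \<Rightarrow> bool" where
  "steps c0 m a n b \<longleftrightarrow> (tapes_step c0 ^^ n) a = b \<and>
     (\<forall>i\<le>n. heads_le m (snd ((tapes_step c0 ^^ i) a)))"

lemma steps_0: "heads_le m (snd a) \<Longrightarrow> steps c0 m a 0 a"
  by (simp add: steps_def)

lemma steps_trans: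
  assumes "steps c0 m a n b" "steps c0 m b n' c"
  shows "steps c0 m a (n + n') c"
proof -
  have "heads_le m (snd ((tapes_step c0 ^^ i) a))" if "i \<le> n + n'" for i
  proof (cases "i \<le> n")
    case False
    then have "(tapes_step c0 ^^ i) a = (tapes_step c0 ^^ (i - n)) b"
      using assms(1) funpow_add[of "i - n" n "tapes_step c0"] by (simp add: steps_def)
    then show ?thesis using assms(2) that False by (simp add: steps_def)
  qed (use assms(1) in \<open>auto simp: steps_def\<close>)
  then show ?thesis
    using assms funpow_add[of n' n "tapes_step c0"] by (simp add: steps_def add.commute)
qed

lemma steps_Suc:
  assumes "heads_le m (snd a)" "steps c0 m (tapes_step c0 a) n b"
  shows "steps c0 m a (Suc n) b"
proof -
  have "steps c0 m a 1 (tapes_step c0 a)"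
    using assms by (auto simp: steps_def le_Suc_eq)
  from steps_trans[OF this assms(2)] show ?thesis by simp
qed

definition cells :: "nat list \<Rightarrow> int \<Rightarrow> nat" where
  "cells xs i = (if 0 \<le> i \<and> i < int (length xs) then rev xs ! nat i else 0)"

text \<open>The head stands on the top element. For the empty stack that is cell -1, which is blank,
  so reading gives 0 there as well.\<close>

definition stack_tape :: "nat list \<Rightarrow> tape" where
  "stack_tape xs = (cells xs, int (length xs) - 1)"

definition stack_tapes :: "nat \<Rightarrow> stacks \<Rightarrow> tape list" where
  "stack_tapes k s = map (\<lambda>j. stack_tape (s j)) [0..<k]"

lemma read_stack [simp]: "tape_read (stack_tape xs) = peek xs"
  by (cases xs) (auto simp: stack_tape_def cells_def nth_append)

lemma act_keep: "tape_act (tape_read T, 0) T = T"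
  by (cases T) simp

lemma act_keep' [simp]: "tape_act (peek xs, 0) (stack_tape xs) = stack_tape xs"
  using act_keep[of "stack_tape xs"] by simp

lemma act_push:
  "tape_act (a, 0) (tape_act (peek xs, 1) (stack_tape xs)) = stack_tape (a # xs)"
proof -
  have "(cells xs)(int (length xs) - 1 := peek xs) = cells xs"
    using act_keep'[of xs] by (auto simp: stack_tape_def)
  moreover have "(cells xs)(int (length xs) := a) = cells (a # xs)"
    by (auto simp: cells_def fun_eq_iff nth_append)
  ultimately show ?thesis by (simp add: stack_tape_def)
qed

lemma act_pop:
  "tape_act (0, if peek xs = 0 then 0 else -1) (stack_tape xs) = stack_tape (pop xs)"
proof (cases "peek xs = 0")
  case True
  then show ?thesis using act_keep'[of xs] by (simp add: pop_def)
next
  case False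
  then obtain y ys where "xs = y # ys" by (cases xs) auto
  then show ?thesis using False
    by (auto simp: stack_tape_def cells_def fun_eq_iff nth_append)
qed

lemma map2_keep:
  "map2 tape_act (keep (map tape_read ts)) ts = ts"
  by (rule nth_equalityI) (auto simp: keep_def act_keep)

lemma map2_keep_upd:
  assumes "j < length ts"
  shows "map2 tape_act ((keep (map tape_read ts))[j := x]) ts = ts[j := tape_act x (ts ! j)]"
  using assms
  by (intro nth_equalityI) (auto simp: keep_def act_keep nth_list_update)

lemma stack_tapes_simps:
  "length (stack_tapes k s) = k"
  "j < k \<Longrightarrow> stack_tapes k s ! j = stack_tape (s j)"
  "j < k \<Longrightarrow> (stack_tapes k s)[j := stack_tape xs] = stack_tapes k (s(j := xs))"
  by (auto simp: stack_tapes_def nth_list_update intro!: nth_equalityI)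

text \<open>One more than \<open>m\<close>, because the head of an empty stack is at -1, which
  matters when \<open>m\<close> is 0.\<close>

lemma low_heads: "low m s \<Longrightarrow> heads_le (Suc m) (stack_tapes k s)"
  unfolding heads_le_def
proof
  fix T assume "low m s" "T \<in> set (stack_tapes k s)"
  then obtain j where "T = stack_tape (s j)" "length (s j) \<le> m"
    by (auto simp: stack_tapes_def low_def)
  then show "\<bar>snd T\<bar> \<le> int (Suc m)" by (auto simp: stack_tape_def)
qed

text \<open>The first step of every command other than a push leaves the tapes alone or pops.\<close>

lemma exec_steps:
  assumes "exec m c s t s'" "wf_com k c"
  shows "\<exists>n\<le>2 * t. steps c0 (Suc m) (Go False (c # K), stack_tapes k s) n
            (Go False K, stack_tapes k s')"
  using assms
proof (induction arbitrary: K rule: exec.induct)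
  case (exec_Nop s)
  have "steps c0 (Suc m) (Go False (Nop # K), stack_tapes k s) (Suc 0) (Go False K, stack_tapes k s)"
    by (rule steps_Suc)
      (use low_heads[OF exec_Nop(1)] in \<open>auto simp: tapes_step_def map2_keep intro!: steps_0\<close>)
  then show ?case by (intro exI[of _ 1]) simp
next
  case (exec_Push s s' j a)
  define T where "T = (stack_tapes k s)[j := tape_act (peek (s j), 1) (stack_tape (s j))]"
  have j: "j < k" and l: "length T = k" using exec_Push by (auto simp: T_def stack_tapes_simps)
  have r: "map tape_read (stack_tapes k s) ! j = peek (s j)"
    using j by (simp add: stack_tapes_simps)
  have 1: "tapes_step c0 (Go False (Push j a # K), stack_tapes k s) = (Go True (Push j a # K), T)"
    using j r by (simp add: tapes_step_def map2_keep_upd stack_tapes_simps T_def)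
  have 2: "tapes_step c0 (Go True (Push j a # K), T) = (Go False K, stack_tapes k (s(j := a # s j)))"
    using j l by (simp add: tapes_step_def map2_keep_upd T_def stack_tapes_simps act_push del: fun_upd_apply)
  have "heads_le (Suc m) T"
    unfolding heads_le_def
  proof
    fix U assume "U \<in> set T"
    then consider "U \<in> set (stack_tapes k s)" | "U = tape_act (peek (s j), 1) (stack_tape (s j))"
      using set_update_subset_insert[of "stack_tapes k s" j "tape_act (peek (s j), 1) (stack_tape (s j))"]
      unfolding T_def by blast
    then show "\<bar>snd U\<bar> \<le> int (Suc m)"
    proof cases
      case 1
      then show ?thesis using low_heads[OF exec_Push(1), of k] by (auto simp: heads_le_def)
    next
      case 2
      moreover have "length (s j) \<le> m" using exec_Push(1) by (simp add: low_def)
      ultimately show ?thesis by (simp add: stack_tape_def)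
    qed
  qed
  then have "steps c0 (Suc m) (Go False (Push j a # K), stack_tapes k s) (Suc (Suc 0))
       (Go False K, stack_tapes k (s(j := a # s j)))"
    using low_heads[OF exec_Push(1)] low_heads[OF exec_Push(3)] exec_Push(2)
    by (intro steps_Suc) (auto simp: 1 2 intro!: steps_0)
  then show ?case using exec_Push(2) by (intro exI[of _ 2]) (simp add: numeral_2_eq_2 del: fun_upd_apply)
next
  case (exec_Pop s s' j)
  then have j: "j < k" by simp
  have r: "map tape_read (stack_tapes k s) ! j = peek (s j)"
    using j by (simp add: stack_tapes_simps)
  have 1: "tapes_step c0 (Go False (Pop j # K), stack_tapes k s)
      = (Go False K, stack_tapes k (s(j := pop (s j))))"
    using j r act_pop[of "s j"] by (simp add: tapes_step_def map2_keep_upd stack_tapes_simps)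
  have "low m (s(j := pop (s j)))"
    using exec_low[OF exec.exec_Pop[OF exec_Pop(1,2)]] exec_Pop(2) by blast
  then have "steps c0 (Suc m) (Go False (Pop j # K), stack_tapes k s) (Suc 0)
      (Go False K, stack_tapes k (s(j := pop (s j))))"
    by (intro steps_Suc) (use low_heads[OF exec_Pop(1)] low_heads in \<open>auto simp: 1 intro!: steps_0\<close>)
  then show ?case unfolding exec_Pop(2) by (intro exI[of _ 1]) (simp del: fun_upd_apply)
next
  case (exec_Seq c s t s' d t' s'')
  then obtain n n' where n: "n \<le> 2 * t" "n' \<le> 2 * t'"
    "steps c0 (Suc m) (Go False (c # d # K), stack_tapes k s) n (Go False (d # K), stack_tapes k s')"
    "steps c0 (Suc m) (Go False (d # K), stack_tapes k s') n' (Go False K, stack_tapes k s'')"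
    by (metis wf_com.simps(4))
  have "steps c0 (Suc m) (Go False (Seq c d # K), stack_tapes k s) (Suc (n + n')) (Go False K, stack_tapes k s'')"
    using exec_low[OF exec_Seq(1)] low_heads steps_trans[OF n(3,4)]
    by (intro steps_Suc) (auto simp: tapes_step_def map2_keep)
  then show ?case using n(1,2) by (intro exI[of _ "Suc (n + n')"]) simp
next
  case (exec_Branch1 s j a c t s' d)
  then obtain n where n: "n \<le> 2 * t"
    "steps c0 (Suc m) (Go False (c # K), stack_tapes k s) n (Go False K, stack_tapes k s')"
    by (metis wf_com.simps(5))
  have "steps c0 (Suc m) (Go False (Branch j a c d # K), stack_tapes k s) (Suc n) (Go False K, stack_tapes k s')"
    using exec_low[OF exec_Branch1(2)] low_heads exec_Branch1.hyps exec_Branch1.prems n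
    by (intro steps_Suc) (auto simp: tapes_step_def map2_keep stack_tapes_simps)
  then show ?case using n(1) by (intro exI[of _ "Suc n"]) simp
next
  case (exec_Branch2 s j a d t s' c)
  then obtain n where n: "n \<le> 2 * t"
    "steps c0 (Suc m) (Go False (d # K), stack_tapes k s) n (Go False K, stack_tapes k s')"
    by (metis wf_com.simps(5))
  have "steps c0 (Suc m) (Go False (Branch j a c d # K), stack_tapes k s) (Suc n) (Go False K, stack_tapes k s')"
    using exec_low[OF exec_Branch2(2)] low_heads exec_Branch2.hyps exec_Branch2.prems n
    by (intro steps_Suc) (auto simp: tapes_step_def map2_keep stack_tapes_simps)
  then show ?case using n(1) by (intro exI[of _ "Suc n"]) simp
next
  case (exec_Loop1 s j a c)
  have "steps c0 (Suc m) (Go False (Loop j a c # K), stack_tapes k s) (Suc 0) (Go False K, stack_tapes k s)"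
    using exec_Loop1 low_heads
    by (intro steps_Suc) (auto simp: tapes_step_def map2_keep stack_tapes_simps intro!: steps_0)
  then show ?case by (intro exI[of _ 1]) simp
next
  case (exec_Loop2 s j a c t s' t' s'')
  then obtain n n' where n: "n \<le> 2 * t" "n' \<le> 2 * t'"
    "steps c0 (Suc m) (Go False (c # Loop j a c # K), stack_tapes k s) n
       (Go False (Loop j a c # K), stack_tapes k s')"
    "steps c0 (Suc m) (Go False (Loop j a c # K), stack_tapes k s') n' (Go False K, stack_tapes k s'')"
    by (metis wf_com.simps(6))
  have "steps c0 (Suc m) (Go False (Loop j a c # K), stack_tapes k s) (Suc (n + n')) (Go False K, stack_tapes k s'')"
    using exec_low[OF exec_Loop2(2)] low_heads steps_trans[OF n(3,4)] exec_Loop2.hyps(1) exec_Loop2.prems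
    by (intro steps_Suc) (auto simp: tapes_step_def map2_keep stack_tapes_simps)
  then show ?case using n(1,2) by (intro exI[of _ "Suc (n + n')"]) simp
qed

text \<open>Any numbering of the control states would do, except that the machine model prescribes 0
  for the initial and 1 for the halting state.\<close>

lemma enumerate_ctls:
  obtains f where "inj_on f (ctls c0)" "f ` ctls c0 = {..<card (ctls c0)}"
    "f Start = (0::nat)" "f (Go False []) = 1"
proof -
  define R where "R = ctls c0 - {Start, Go False []}"
  have fin: "finite R" by (simp add: R_def finite_ctls)
  then obtain g where g: "bij_betw g R {0..<card R}"
    using ex_bij_betw_finite_nat by blast
  define f where "f q = (if q = Start then 0 else if q = Go False [] then 1 else g q + 2)" for q
  have Q: "ctls c0 = insert Start (insert (Go False []) R)"
    by (auto simp: R_def ctls_memb)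
  have "Go False [] \<notin> R" "Start \<notin> insert (Go False []) R"
    by (auto simp: R_def)
  then have card: "card (ctls c0) = card R + 2"
    using fin unfolding Q by simp
  have "inj_on f (ctls c0)"
  proof (rule inj_onI)
    fix x y assume "x \<in> ctls c0" "y \<in> ctls c0" "f x = f y"
    then show "x = y"
      using inj_onD[OF bij_betw_imp_inj_on[OF g], of x y] unfolding Q
      by (simp add: f_def split: if_splits)
  qed
  moreover have "f ` ctls c0 = {..<card (ctls c0)}"
  proof -
    have "f ` R = (\<lambda>n. n + 2) ` (g ` R)"
      unfolding image_image by (rule image_cong) (auto simp: f_def R_def)
    also have "g ` R = {0..<card R}" using g by (simp add: bij_betw_def)
    also have "(\<lambda>n. n + 2) ` {0..<card R} = {2..<card R + 2}"
      using image_add_atLeastLessThan'[of 2 0 "card R"] by (simp add: numeral_2_eq_2)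
    finally have "f ` R = {2..<card R + 2}" .
    then show ?thesis unfolding Q card[unfolded Q] by (auto simp: f_def)
  qed
  ultimately show thesis using that by (auto simp: f_def)
qed

text \<open>A machine freezes in state 1 by definition, whereas \<open>ctl_step\<close> goes on. The
  two agree because the empty continuation steps to itself and rewrites every scanned
  symbol.\<close>

lemma compile:
  assumes "wf_com k c0" "2 \<le> k"
  obtains M f where "tm M" "num_tapes M = k" "f Start = 0"
    "\<And>q. q \<in> ctls c0 \<Longrightarrow> f q = 1 \<longleftrightarrow> q = Go False []"
    "\<And>q ts. q \<in> ctls c0 \<Longrightarrow> tm_step M (f q, ts) = map_prod f id (tapes_step c0 (q, ts))"
proof -
  obtain f where f: "inj_on f (ctls c0)" "f ` ctls c0 = {..<card (ctls c0)}"
    "f Start = 0" "f (Go False []) = 1"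
    by (rule enumerate_ctls)
  define tr where "tr n ss = map_prod f id (ctl_step c0 (the_inv_into (ctls c0) f n) ss)" for n ss
  define M where "M = \<lparr>num_tapes = k, num_states = card (ctls c0), num_symbols = 3, tm_trans = tr\<rparr>"
  have halt: "f q = 1 \<longleftrightarrow> q = Go False []" if "q \<in> ctls c0" for q
    using f(1,4) that ctls_memb(2)[of False "[]" c0] by (auto simp: inj_on_def)
  have tr: "tr (f q) ss = map_prod f id (ctl_step c0 q ss)" if "q \<in> ctls c0" for q ss
    using the_inv_into_f_f[OF f(1) that] by (simp add: tr_def)
  have "2 \<le> card (ctls c0)"
    using card_mono[of "ctls c0" "{Start, Go False []}"] finite_ctls by (simp add: ctls_memb)
  moreover have "fst (tr n ss) < card (ctls c0) \<and> length (snd (tr n ss)) = k \<and>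
      set (snd (tr n ss)) \<subseteq> {..<3} \<times> {-1, 0, 1}"
    if "n < card (ctls c0)" "length ss = k" "set ss \<subseteq> {..<3}" for n ss
  proof -
    have "n \<in> f ` ctls c0" using that(1) f(2) by simp
    then obtain q where q: "q \<in> ctls c0" "n = f q" by (elim imageE)
    have "f (fst (ctl_step c0 q ss)) \<in> f ` ctls c0"
      by (intro imageI ctls_closed q)
    then have "f (fst (ctl_step c0 q ss)) < card (ctls c0)"
      using f(2) by simp
    with ctl_step_actions[OF q(1) assms(1) _ that(2,3)] assms(2) q show ?thesis by (simp add: tr)
  qed
  ultimately have "tm M" using assms(2) by (simp add: tm_def M_def)
  moreover have "tm_step M (f q, ts) = map_prod f id (tapes_step c0 (q, ts))" if "q \<in> ctls c0" for q ts
  proof (cases "q = Go False []")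
    case True
    then show ?thesis by (simp add: f(4) tapes_step_def map2_keep)
  next
    case False
    then show ?thesis using halt[OF that]
      by (simp add: M_def tr[OF that] tapes_step_def case_prod_beta)
  qed
  ultimately show thesis using that[of M f] halt f(3) by (simp add: M_def)
qed

definition input_stacks :: "bool list \<Rightarrow> stacks" where
  "input_stacks w = (\<lambda>_. [])(0 := map bit_symbol (rev w))"

text \<open>The head of tape 0 runs to the first blank, then all heads step back by one. This puts
  it on the last input bit and the others on cell -1, which is exactly the layout of one full and
  otherwise empty stacks.\<close>

lemma start_steps:
  assumes "0 < k"
  shows "steps c0 (Suc (length w)) (Start, snd (tm_init \<lparr>num_tapes = k, num_states = n, num_symbols = a, tm_trans = b\<rparr> w))
     (Suc (length w)) (Go False [c0], stack_tapes k (input_stacks w))"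
proof -
  define xs where "xs = map bit_symbol (rev w)"
  define ts where "ts i = (cells xs, int i) # replicate (k - 1) (\<lambda>_. 0, 0)" for i
  have init: "snd (tm_init \<lparr>num_tapes = k, num_states = n, num_symbols = a, tm_trans = b\<rparr> w) = ts 0"
    by (auto simp: tm_init_def ts_def cells_def xs_def fun_eq_iff rev_map)
  have bit: "bit_symbol x \<noteq> 0" for x by (simp add: bit_symbol_def)
  have heads: "heads_le (Suc (length w)) (ts i)" if "i \<le> length w" for i
    using that by (auto simp: heads_le_def ts_def)
  have "steps c0 (Suc (length w)) (Start, ts i) (Suc (length w - i))
      (Go False [c0], stack_tapes k (input_stacks w))" if "i \<le> length w" for i
    using that
  proof (induction "length w - i" arbitrary: i)
    case 0
    then have i: "i = length w" by simp
    have "map2 tape_act (map (\<lambda>s. (s, -1)) (map tape_read ts)) ts = map (\<lambda>(c, h). (c, h - 1)) ts" for ts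
      by (rule nth_equalityI) (auto split: prod.split)
    moreover have "cells xs (int (length w)) = 0" by (simp add: cells_def xs_def)
    moreover have "map (\<lambda>(c, h). (c, h - 1)) (ts i) = stack_tapes k (input_stacks w)"
    proof (rule nth_equalityI)
      fix j assume "j < length (map (\<lambda>(c, h). (c, h - 1)) (ts i))"
      then have "j < k" using assms by (simp add: ts_def)
      then show "map (\<lambda>(c, h). (c, h - 1)) (ts i) ! j = stack_tapes k (input_stacks w) ! j"
        by (cases j) (simp_all add: ts_def i stack_tapes_def stack_tape_def input_stacks_def xs_def
            cells_def fun_eq_iff del: upt_Suc)
    qed (use assms in \<open>simp add: ts_def stack_tapes_def\<close>)
    ultimately have "tapes_step c0 (Start, ts i) = (Go False [c0], stack_tapes k (input_stacks w))"
      by (simp add: tapes_step_def) (simp add: ts_def i)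
    moreover have "low (length w) (input_stacks w)" by (simp add: low_def input_stacks_def)
    ultimately show ?case using i heads[of i] low_heads
      by (auto intro!: steps_Suc steps_0)
  next
    case (Suc d)
    then have i: "i < length w" by simp
    then have "cells xs (int i) \<noteq> 0" using bit by (simp add: cells_def xs_def rev_map)
    then have "tapes_step c0 (Start, ts i)
        = (Start, (ts i)[0 := tape_act (cells xs (int i), 1) (ts i ! 0)])"
      using map2_keep_upd[of 0 "ts i"] by (simp add: tapes_step_def ts_def)
    then have "tapes_step c0 (Start, ts i) = (Start, ts (Suc i))"
      by (simp add: ts_def)
    with Suc i heads[of i] show ?case
      by (metis Suc_diff_Suc Suc_leI diff_Suc_1 less_imp_le_nat snd_conv steps_Suc)
  qed
  from this[of 0] show ?thesis unfolding init by simp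
qed

text \<open>The last conjunct fixes contents and head of the output tape at every halting time. The
  encoding of configurations used for hardness reads acceptance from the symbol under the head, so
  the answer must be found there.\<close>

theorem exec_tm:
  fixes F :: "bool list \<Rightarrow> bool list"
  assumes wf: "wf_com k c0" and k: "2 \<le> k"
    and ex: "\<And>w. exec (m w) c0 (input_stacks w) (t w) (s' w)"
    and out: "\<And>w. s' w 1 = map bit_symbol (rev (F w))"
  shows "\<exists>M. tm M \<and> (\<forall>w. (\<exists>n\<le>2 * t w + length w + 1. tm_outputs M w n (F w)) \<and>
     (\<forall>i. \<forall>T\<in>set (snd (tm_config M w i)). \<bar>snd T\<bar> \<le> int (Suc (m w))) \<and>
     (\<forall>i. fst (tm_config M w i) = 1 \<longrightarrow> snd (tm_config M w i) ! 1 = stack_tape (s' w 1)))"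
proof -
  obtain M f where M: "tm M" "num_tapes M = k" "f Start = 0"
    and halt: "\<And>q. q \<in> ctls c0 \<Longrightarrow> f q = 1 \<longleftrightarrow> q = Go False []"
    and step: "\<And>q ts. q \<in> ctls c0 \<Longrightarrow> tm_step M (f q, ts) = map_prod f id (tapes_step c0 (q, ts))"
    using compile[OF wf k] by metis
  show ?thesis
  proof (intro exI[of _ M] conjI allI)
    show "tm M" by (rule M)
    fix w
    define a where "a = (Start, snd (tm_init M w))"
    define c where "c i = (tapes_step c0 ^^ i) a" for i
    have q: "fst (c i) \<in> ctls c0" for i
      by (induction i)
        (auto simp: c_def a_def ctls_memb tapes_step_def case_prod_beta ctls_closed)
    have conf: "tm_config M w i = map_prod f id (c i)" for i
    proof (induction i)
      case 0
      then show ?case by (simp add: tm_config_def c_def a_def M(3) tm_init_def)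
    next
      case (Suc i)
      then show ?case using step[OF q[of i], of "snd (c i)"]
        by (simp add: tm_config_def c_def map_prod_def case_prod_beta)
    qed
    have len: "length w \<le> m w"
      using exec_low[OF ex[of w]] by (force simp: low_def input_stacks_def dest: spec[of _ 0])
    obtain n where n: "n \<le> 2 * t w" "steps c0 (Suc (m w)) (Go False [c0], stack_tapes k (input_stacks w)) n
        (Go False [], stack_tapes k (s' w))"
      using exec_steps[OF ex wf] by blast
    have "steps c0 (Suc (length w)) a (Suc (length w)) (Go False [c0], stack_tapes k (input_stacks w))"
      using start_steps[of k c0 w "num_states M" "num_symbols M" "tm_trans M"] k M(2)
      by (simp add: a_def tm_init_def)
    then have "steps c0 (Suc (m w)) a (Suc (length w)) (Go False [c0], stack_tapes k (input_stacks w))"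
      using len by (fastforce simp: steps_def heads_le_def)
    from steps_trans[OF this n(2)]
    have run: "steps c0 (Suc (m w)) a (Suc (length w) + n) (Go False [], stack_tapes k (s' w))" .
    define N where "N = Suc (length w) + n"
    have end_: "c i = (Go False [], stack_tapes k (s' w))" if "N \<le> i" for i
      using that
    proof (induction i rule: dec_induct)
      case base
      then show ?case using run by (simp add: steps_def N_def c_def)
    next
      case (step i)
      then show ?case by (simp add: c_def tapes_step_def map2_keep)
    qed
    have tape1: "stack_tapes k (s' w) ! 1 = stack_tape (map bit_symbol (rev (F w)))"
      using k out by (simp add: stack_tapes_simps)
    have "tm_outputs M w N (F w)"
      unfolding tm_outputs_def tape_holds_def conf end_[OF order.refl]
      using halt[of "Go False []"] tape1
      by (auto simp: ctls_memb stack_tape_def cells_def rev_map)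
    then show "\<exists>n\<le>2 * t w + length w + 1. tm_outputs M w n (F w)"
      using n(1) by (intro exI[of _ N]) (simp add: N_def)
    show "\<forall>T\<in>set (snd (tm_config M w i)). \<bar>snd T\<bar> \<le> int (Suc (m w))" for i
    proof (cases "i \<le> N")
      case True
      then show ?thesis using run unfolding conf
        by (simp add: steps_def N_def c_def heads_le_def)
    next
      case False
      then have "c i = c N" using end_[of i] end_[of N] by simp
      moreover have "heads_le (Suc (m w)) (snd (c N))"
        using run unfolding steps_def N_def c_def by blast
      ultimately show ?thesis unfolding conf by (simp add: heads_le_def)
    qed
    show "fst (tm_config M w i) = 1 \<longrightarrow> snd (tm_config M w i) ! 1 = stack_tape (s' w 1)" for i
    proof
      assume "fst (tm_config M w i) = 1"
      then have "fst (c i) = Go False []" using halt[OF q[of i]] by (simp add: conf)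
      \<comment> \<open>A configuration in the halting state is a fixed point, so comparing it with
        a time after \<open>N\<close> identifies it with the final one.\<close>
      then have "c (i + j) = c i" for j
        by (induction j) (simp_all add: c_def tapes_step_def map2_keep case_prod_beta prod_eq_iff)
      from this[of N] have "c i = (Go False [], stack_tapes k (s' w))"
        using end_[of "i + N"] by simp
      then show "snd (tm_config M w i) ! 1 = stack_tape (s' w 1)"
        using tape1 out[of w] by (simp add: conf)
    qed
  qed
qed

section \<open>Trees on a stack\<close>

datatype tree = Leaf | Node tree tree

primrec ser :: "tree \<Rightarrow> nat list" where
  "ser Leaf = [1]"
| "ser (Node l r) = 2 # ser l @ ser r"

lemma ser_bits: "set (ser t) \<subseteq> {1, 2}"
  by (induction t) auto

text \<open>Arbitrary remainders are allowed so that in the induction the left subtree can be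
  stripped before the right one is compared.\<close>

lemma ser_prefix_free: "ser t @ u = ser t' @ u' \<Longrightarrow> t = t' \<and> u = u'"
proof (induction t arbitrary: t' u u')
  case Leaf
  then show ?case by (cases t') auto
next
  case (Node l r)
  show ?case
  proof (cases t')
    case Leaf
    then show ?thesis using Node.prems by simp
  next
    case (Node l' r')
    then have "ser l @ ser r @ u = ser l' @ ser r' @ u'" using Node.prems by simp
    from Node.IH(1)[OF this] have l: "l = l'" "ser r @ u = ser r' @ u'" by auto
    from Node.IH(2)[OF this(2)] l Node show ?thesis by simp
  qed
qed

lemma ser_inj: "ser t = ser t' \<longleftrightarrow> t = t'"
  using ser_prefix_free[of t "[]" t' "[]"] by auto

lemma ser_nonempty [simp]: "ser t \<noteq> []"
  by (cases t) auto

lemma length_ser_Suc: "\<exists>n. length (ser t) = Suc n"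
  by (cases t) auto

definition ex :: "nat \<Rightarrow> com \<Rightarrow> stacks \<Rightarrow> nat \<Rightarrow> stacks \<Rightarrow> bool" where
  "ex m c s T s' \<longleftrightarrow> (\<exists>t\<le>T. exec m c s t s')"

lemma ex_low: "ex m c s T s' \<Longrightarrow> low m s \<and> low m s'"
  by (auto simp: ex_def dest: exec_low)

lemma ex_mono: "ex m c s T s' \<Longrightarrow> T \<le> T' \<Longrightarrow> ex m c s T' s'"
  by (auto simp: ex_def intro: le_trans)

lemma ex_Seq: "ex m c s T s' \<Longrightarrow> ex m d s' T' s'' \<Longrightarrow> ex m (Seq c d) s (Suc (T + T')) s''"
  unfolding ex_def by (meson add_le_mono exec_Seq not_less_eq_eq)

lemma ex_Push: "low m s \<Longrightarrow> length (s j) < m \<Longrightarrow> ex m (Push j a) s 1 (s(j := a # s j))"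
  unfolding ex_def by (intro exI[of _ 1]) (auto simp: low_def intro!: exec_Push)

lemma ex_Pop: "low m s \<Longrightarrow> ex m (Pop j) s 1 (s(j := pop (s j)))"
  unfolding ex_def by (intro exI[of _ 1]) (auto intro!: exec_Pop)

lemma ex_Branch1: "peek (s j) = a \<Longrightarrow> ex m c s T s' \<Longrightarrow> ex m (Branch j a c d) s (Suc T) s'"
  unfolding ex_def by (meson exec_Branch1 not_less_eq_eq)

lemma ex_Branch2: "peek (s j) \<noteq> a \<Longrightarrow> ex m d s T s' \<Longrightarrow> ex m (Branch j a c d) s (Suc T) s'"
  unfolding ex_def by (meson exec_Branch2 not_less_eq_eq)

lemma ex_Loop1: "peek (s j) = a \<Longrightarrow> low m s \<Longrightarrow> ex m (Loop j a c) s 1 s"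
  unfolding ex_def by (intro exI[of _ 1]) (auto intro!: exec_Loop1)

lemma ex_Loop2: "peek (s j) \<noteq> a \<Longrightarrow> ex m c s T s' \<Longrightarrow> ex m (Loop j a c) s' T' s'' \<Longrightarrow>
    ex m (Loop j a c) s (Suc (T + T')) s''"
  unfolding ex_def by (meson add_le_mono exec_Loop2 not_less_eq_eq)

primrec pushes :: "nat list \<Rightarrow> nat \<Rightarrow> com" where
  "pushes [] x = Nop"
| "pushes (b # bs) x = Seq (Push b x) (pushes bs x)"

text \<open>Pours stack \<open>a\<close> onto every stack of \<open>bs\<close>, reversing it. An
  empty \<open>bs\<close> erases, and two targets copy.\<close>

definition xfer :: "nat \<Rightarrow> nat list \<Rightarrow> com" where
  "xfer a bs = Loop a 0
     (Branch a 1 (Seq (Pop a) (pushes bs 1)) (Seq (Pop a) (pushes bs 2)))"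

lemma ex_Nop: "low m s \<Longrightarrow> ex m Nop s 1 s"
  unfolding ex_def by (intro exI[of _ 1]) (auto intro!: exec_Nop)

lemma ex_pushes:
  assumes "low m s" "\<forall>b\<in>set bs. length (s b) < m" "distinct bs"
  shows "ex m (pushes bs x) s (2 * length bs + 1) (\<lambda>j. if j \<in> set bs then x # s j else s j)"
  using assms
proof (induction bs arbitrary: s)
  case Nil
  then show ?case using ex_Nop by simp
next
  case (Cons b bs)
  have low: "low m (s(b := x # s b))"
    using Cons.prems(1,2) by (auto simp: low_def Suc_le_eq)
  have "ex m (pushes bs x) (s(b := x # s b)) (2 * length bs + 1)
      (\<lambda>j. if j \<in> set bs then x # (s(b := x # s b)) j else (s(b := x # s b)) j)"
    by (rule Cons.IH[OF low]) (use Cons.prems in auto)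
  moreover have "(\<lambda>j. if j \<in> set bs then x # (s(b := x # s b)) j else (s(b := x # s b)) j)
      = (\<lambda>j. if j \<in> set (b # bs) then x # s j else s j)"
    using Cons.prems by (auto simp: fun_eq_iff)
  ultimately have "ex m (pushes bs x) (s(b := x # s b)) (2 * length bs + 1)
      (\<lambda>j. if j \<in> set (b # bs) then x # s j else s j)" by (simp only:)
  moreover have "ex m (Push b x) s 1 (s(b := x # s b))"
    using Cons.prems by (intro ex_Push) auto
  ultimately have "ex m (pushes (b # bs) x) s (Suc (1 + (2 * length bs + 1)))
      (\<lambda>j. if j \<in> set (b # bs) then x # s j else s j)"
    unfolding pushes.simps by (intro ex_Seq)
  then show ?case by (rule ex_mono) simp
qed

lemma ex_xfer:
  assumes "low m s" "set (s a) \<subseteq> {1, 2}" "a \<notin> set bs" "distinct bs"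
    "\<forall>b\<in>set bs. length (s a) + length (s b) \<le> m"
  shows "ex m (xfer a bs) s ((2 * length bs + 5) * length (s a) + 1)
     (\<lambda>j. if j = a then [] else if j \<in> set bs then rev (s a) @ s j else s j)"
  using assms
proof (induction "s a" arbitrary: s)
  case Nil
  then have "(\<lambda>j. if j = a then [] else if j \<in> set bs then rev (s a) @ s j else s j) = s"
    by (auto simp: fun_eq_iff)
  then show ?case
    unfolding xfer_def using Nil by (auto intro!: ex_mono[OF ex_Loop1] simp flip: Nil(1))
next
  case (Cons x xs)
  define s1 where "s1 = s(a := xs)"
  define s2 where "s2 = (\<lambda>j. if j \<in> set bs then x # s1 j else s1 j)"
  have x: "x = 1 \<or> x = 2" and sa: "s a = x # xs"
    using Cons by (auto simp flip: Cons.hyps(2))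
  have low1: "low m s1"
    using Cons.prems(1) sa by (force simp: low_def s1_def dest: spec[of _ a])
  have len: "\<forall>b\<in>set bs. length (s1 b) < m"
    using Cons.prems(3,5) sa by (auto simp: s1_def)
  have "ex m (Pop a) s 1 s1"
    using ex_Pop[OF Cons.prems(1), of a] x sa by (auto simp: s1_def simp del: fun_upd_apply)
  moreover have "ex m (pushes bs x) s1 (2 * length bs + 1) s2"
    unfolding s2_def by (rule ex_pushes[OF low1 len Cons.prems(4)])
  ultimately have *: "ex m (Seq (Pop a) (pushes bs x)) s (2 * length bs + 3) s2"
    using ex_mono[OF ex_Seq] by fastforce
  have "ex m (Branch a 1 (Seq (Pop a) (pushes bs 1)) (Seq (Pop a) (pushes bs 2))) s
      (2 * length bs + 4) s2"
  proof (cases "x = 1")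
    case True
    with * show ?thesis by (intro ex_mono[OF ex_Branch1]) (auto simp: sa)
  next
    case False
    with * x show ?thesis by (intro ex_mono[OF ex_Branch2]) (auto simp: sa)
  qed
  moreover have "ex m (xfer a bs) s2 ((2 * length bs + 5) * length (s2 a) + 1)
     (\<lambda>j. if j = a then [] else if j \<in> set bs then rev (s2 a) @ s2 j else s2 j)"
  proof (rule Cons.hyps(1))
    show "xs = s2 a" using Cons.prems(3) by (simp add: s2_def s1_def)
    show "low m s2" using low1 len by (auto simp: low_def s2_def Suc_le_eq)
  qed (use Cons.prems sa in \<open>auto simp: s2_def s1_def\<close>)
  moreover have "s2 a = xs" using Cons.prems(3) by (simp add: s2_def s1_def)
  moreover have "(\<lambda>j. if j = a then [] else if j \<in> set bs then rev xs @ s2 j else s2 j)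
      = (\<lambda>j. if j = a then [] else if j \<in> set bs then rev (s a) @ s j else s j)"
    by (auto simp: fun_eq_iff s2_def s1_def sa)
  ultimately have "ex m (xfer a bs) s (Suc (2 * length bs + 4 + ((2 * length bs + 5) * length xs + 1)))
      (\<lambda>j. if j = a then [] else if j \<in> set bs then rev (s a) @ s j else s j)"
    unfolding xfer_def using x by (intro ex_Loop2[where s' = s2]) (auto simp: sa)
  then show ?case by (rule ex_mono) (simp add: sa)
qed

text \<open>Stack \<open>3\<close> counts the trees that are still to be moved.\<close>

definition move_tree :: "nat \<Rightarrow> com" where
  "move_tree d = Seq (Push 3 1) (Loop 3 0 (Branch 2 2
     (Seq (Pop 2) (Seq (Push d 2) (Push 3 1)))
     (Seq (Pop 2) (Seq (Push d 1) (Pop 3)))))"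

text \<open>Generalised from one tree to a forest: reading a node replaces the first tree by its two
  children, reading a leaf removes it. The unary counter is the number of trees left, and the
  induction is on the length of the remaining code.\<close>

lemma ex_move_loop:
  assumes "low m s" "s 2 = concat (map ser ts) @ r" "s 3 = replicate (length ts) 1"
    "d \<noteq> 2" "d \<noteq> 3" "length (s 2) + length (s d) \<le> m"
    "length (s 3) + length (concat (map ser ts)) \<le> m"
  shows "ex m (Loop 3 0 (Branch 2 2
     (Seq (Pop 2) (Seq (Push d 2) (Push 3 1)))
     (Seq (Pop 2) (Seq (Push d 1) (Pop 3))))) s (8 * length (concat (map ser ts)) + 1)
     (s(2 := r, 3 := [], d := rev (concat (map ser ts)) @ s d))"
  using assms
proof (induction "length (concat (map ser ts))" arbitrary: s ts rule: less_induct)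
  case less
  let ?c = "Branch 2 2 (Seq (Pop 2) (Seq (Push d 2) (Push 3 1)))
     (Seq (Pop 2) (Seq (Push d 1) (Pop 3)))"
  note pr = less.prems
  show ?case
  proof (cases ts)
    case Nil
    then have "s(2 := r, 3 := [], d := rev (concat (map ser ts)) @ s d) = s"
      using pr by (simp add: fun_eq_iff)
    then show ?thesis using Nil pr by (auto intro!: ex_mono[OF ex_Loop1] simp del: fun_upd_apply)
  next
    case (Cons t ts')
    define u where "u = (case t of Leaf \<Rightarrow> ts' | Node a b \<Rightarrow> a # b # ts')"
    define x where "x = hd (ser t)"
    have 1: "concat (map ser ts) = x # concat (map ser u)" "x = 1 \<or> x = 2"
      by (cases t; simp add: Cons u_def x_def)+
    define s1 where "s1 = s(2 := concat (map ser u) @ r)"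
    define s2 where "s2 = s1(d := x # s d)"
    define s3 where "s3 = s2(3 := replicate (length u) 1)"
    have low1: "low m s1" using pr(1,2) 1 by (force simp: low_def s1_def dest: spec[of _ 2])
    have low2: "low m s2" using low1 pr(2,6) 1 by (auto simp: low_def s2_def)
    have len: "length u \<le> m" using pr(3,7) 1(1) Cons by (cases t) (auto simp: u_def)
    then have low3: "low m s3" using low2 by (auto simp: low_def s3_def)
    have e1: "ex m (Pop 2) s 1 s1"
      using ex_Pop[OF pr(1), of 2] pr(2) 1 by (auto simp: s1_def simp del: fun_upd_apply)
    have e2: "ex m (Push d x) s1 1 s2"
      using ex_Push[OF low1, of d x] pr(2,4,6) 1 unfolding s2_def by (simp add: s1_def)
    have e3: "ex m (if x = 2 then Push 3 1 else Pop 3) s2 1 s3"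
    proof (cases t)
      case Leaf
      have "s2 3 = 1 # replicate (length ts') 1" using pr(3,5) by (simp add: s2_def s1_def Cons)
      then show ?thesis using ex_Pop[OF low2, of 3] Leaf
        by (simp add: x_def s3_def u_def del: fun_upd_apply)
    next
      case (Node a b)
      have s23: "s2 3 = replicate (Suc (length ts')) 1" using pr(3,5) by (simp add: s2_def s1_def Cons)
      \<comment> \<open>The code of a node has at least three symbols, so the joint bound on counter
        and remaining code leaves room for one more counter symbol.\<close>
      have "length (ser t) \<ge> 3" using Node by (cases a; cases b; simp)
      then have "length (s2 3) < m" using pr(3,7) s23 by (simp add: Cons)
      from ex_Push[OF low2 this, of 1] show ?thesis unfolding s23 using Node
        by (simp add: x_def s3_def u_def del: fun_upd_apply)
    qed
    have "ex m ?c s 6 s3"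
    proof (cases "x = 2")
      case True
      then show ?thesis
        using ex_mono[OF ex_Branch1[OF _ ex_Seq[OF e1 ex_Seq[OF e2 e3]], of 2 2], of 6] pr(2) 1(1)
        by simp
    next
      case False
      then have "x = 1" using 1(2) by simp
      then show ?thesis
        using ex_mono[OF ex_Branch2[OF _ ex_Seq[OF e1 ex_Seq[OF e2 e3]], of 2 2], of 6] pr(2) 1(1)
        by simp
    qed
    moreover have "ex m (Loop 3 0 ?c) s3 (8 * length (concat (map ser u)) + 1)
        (s3(2 := r, 3 := [], d := rev (concat (map ser u)) @ s3 d))"
    proof (rule less.hyps)
      show "length (s3 3) + length (concat (map ser u)) \<le> m"
        using pr(3,7) 1(1) Cons by (cases t) (auto simp: u_def s3_def)
    qed (use pr 1 low3 in \<open>auto simp: s3_def s2_def s1_def\<close>)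
    moreover have "s3(2 := r, 3 := [], d := rev (concat (map ser u)) @ s3 d)
        = s(2 := r, 3 := [], d := rev (concat (map ser ts)) @ s d)"
      using pr(4,5) 1(1) by (auto simp: s3_def s2_def s1_def fun_eq_iff)
    moreover have "peek (s 3) \<noteq> 0" using pr(3) Cons by simp
    ultimately have "ex m (Loop 3 0 ?c) s (Suc (6 + (8 * length (concat (map ser u)) + 1)))
        (s(2 := r, 3 := [], d := rev (concat (map ser ts)) @ s d))"
      by (intro ex_Loop2) auto
    then show ?thesis by (rule ex_mono) (simp add: 1(1))
  qed
qed

lemma ex_move_tree:
  assumes "low m s" "s 2 = ser t @ r" "s 3 = []" "d \<noteq> 2" "d \<noteq> 3"
    "length (s 2) + length (s d) < m"
  shows "ex m (move_tree d) s (8 * length (ser t) + 3) (s(2 := r, d := rev (ser t) @ s d))"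
proof -
  have 1: "ex m (Push 3 1) s 1 (s(3 := [1]))"
    using ex_Push[OF assms(1), of 3 1] assms by simp
  then have low1: "low m (s(3 := [1]))" by (blast dest: ex_low)
  have "ex m (move_tree d) s (Suc (1 + (8 * length (concat (map ser [t])) + 1)))
    ((s(3 := [1]))(2 := r, 3 := [], d := rev (concat (map ser [t])) @ (s(3 := [1])) d))"
    unfolding move_tree_def
    by (rule ex_Seq[OF 1 ex_move_loop[OF low1]]) (use assms in auto)
  moreover have "(s(3 := [1]))(2 := r, 3 := [], d := rev (concat (map ser [t])) @ (s(3 := [1])) d)
    = s(2 := r, d := rev (ser t) @ s d)"
    using assms by (auto simp: fun_eq_iff)
  ultimately show ?thesis by (auto intro: ex_mono)
qed

text \<open>The roles of the six stacks: 0 input, 1 output, 2 main stack, 3 counter or flag, 4 and 5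
  scratch space.\<close>

definition stk :: "nat list \<Rightarrow> nat list \<Rightarrow> nat list \<Rightarrow> nat list \<Rightarrow> nat list \<Rightarrow> nat list \<Rightarrow> stacks" where
  "stk i u a b c d = (\<lambda>_. [])(0 := i, 1 := u, 2 := a, 3 := b, 4 := c, 5 := d)"

lemma stk_simps [simp]:
  "stk i u a b c d 0 = i" "stk i u a b c d (Suc 0) = u" "stk i u a b c d 1 = u"
  "stk i u a b c d 2 = a"
  "stk i u a b c d 3 = b" "stk i u a b c d 4 = c" "stk i u a b c d 5 = d"
  by (simp_all add: stk_def)

lemma stk_upd [simp]:
  "(stk i u a b c d)(0 := x) = stk x u a b c d"
  "(stk i u a b c d)(Suc 0 := x) = stk i x a b c d"
  "(stk i u a b c d)(2 := x) = stk i u x b c d"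
  "(stk i u a b c d)(3 := x) = stk i u a x c d"
  "(stk i u a b c d)(4 := x) = stk i u a b x d"
  "(stk i u a b c d)(5 := x) = stk i u a b c x"
  by (simp_all add: stk_def fun_eq_iff)

lemma low_stk: "low m (stk i u a b c d) \<longleftrightarrow> length i \<le> m \<and> length u \<le> m \<and> length a \<le> m \<and>
    length b \<le> m \<and> length c \<le> m \<and> length d \<le> m"
proof
  assume "low m (stk i u a b c d)"
  then have "length (stk i u a b c d j) \<le> m" for j by (simp add: low_def)
  from this[of 0] this[of 1] this[of 2] this[of 3] this[of 4] this[of 5]
  show "length i \<le> m \<and> length u \<le> m \<and> length a \<le> m \<and>
    length b \<le> m \<and> length c \<le> m \<and> length d \<le> m" by simp
qed (simp add: low_def stk_def)

abbreviation main :: "nat list \<Rightarrow> stacks" where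
  "main a \<equiv> stk [] [] a [] [] []"

text \<open>Stack \<open>2\<close> is the main stack: \<open>p\<close> on its top is replaced by \<open>q\<close>, whatever lies below.  The number
  \<open>T\<close> always bounds the space; it bounds the time as well if \<open>b\<close> holds.\<close>

definition does :: "bool \<Rightarrow> com \<Rightarrow> nat list \<Rightarrow> nat list \<Rightarrow> nat \<Rightarrow> bool" where
  "does b c p q T \<longleftrightarrow> wf_com 6 c \<and> (\<forall>r m. length r + T \<le> m \<longrightarrow>
     (\<exists>t. exec m c (main (p @ r)) t (main (q @ r)) \<and> (b \<longrightarrow> t \<le> T)))"

lemma doesI:
  assumes "wf_com 6 c"
    "\<And>r m. length r + T \<le> m \<Longrightarrow> ex m c (main (p @ r)) T (main (q @ r))"
  shows "does b c p q T"
  using assms unfolding does_def ex_def by blast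

lemma doesD: "does b c p q T \<Longrightarrow> length r + T \<le> m \<Longrightarrow>
    \<exists>t. exec m c (main (p @ r)) t (main (q @ r)) \<and> (b \<longrightarrow> t \<le> T)"
  by (simp add: does_def)

lemma does_wf: "does b c p q T \<Longrightarrow> wf_com 6 c"
  by (simp add: does_def)

text \<open>With nothing below and the limit set to \<open>T\<close>, input and output must fit
  under \<open>T\<close>. This is how costs later bound the sizes of results.\<close>

lemma does_length: "does b c p q T \<Longrightarrow> length p \<le> T \<and> length q \<le> T"
  using doesD[of b c p q T "[]" T] by (auto simp: low_stk dest: exec_low)

lemma does_mono: "does b c p q T \<Longrightarrow> T \<le> T' \<Longrightarrow> does b c p q T'"
  unfolding does_def by (meson add_le_mono1 le_trans nat_add_left_cancel_le)

text \<open>What lies deeper on the stack is not touched, but it is charged, since the cost also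
  bounds space.\<close>

lemma does_frame:
  assumes "does b c p q T"
  shows "does b c (p @ z) (q @ z) (T + length z)"
proof -
  have "\<exists>t. exec m c (main ((p @ z) @ r)) t (main ((q @ z) @ r)) \<and> (b \<longrightarrow> t \<le> T + length z)"
    if "length r + (T + length z) \<le> m" for r m
    using doesD[OF assms, of "z @ r" m] that by (auto intro: trans_le_add1)
  then show ?thesis using assms by (simp add: does_def)
qed

lemma does_Seq:
  assumes "does b c p q T" "does b d q u T'"
  shows "does b (Seq c d) p u (Suc (T + T'))"
proof -
  have "\<exists>t. exec m (Seq c d) (main (p @ r)) t (main (u @ r)) \<and> (b \<longrightarrow> t \<le> Suc (T + T'))"
    if m: "length r + Suc (T + T') \<le> m" for r m
  proof -
    obtain t t' where "exec m c (main (p @ r)) t (main (q @ r))" "b \<longrightarrow> t \<le> T"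
      "exec m d (main (q @ r)) t' (main (u @ r))" "b \<longrightarrow> t' \<le> T'"
      using doesD[OF assms(1), of r m] doesD[OF assms(2), of r m] m by auto
    then show ?thesis
      by (intro exI[of _ "Suc (t + t')"]) (auto intro: exec_Seq)
  qed
  then show ?thesis using assms by (simp add: does_def)
qed

lemma does_Branch1:
  assumes "does b c p q T" "p \<noteq> []" "hd p = a" "wf_com 6 d"
  shows "does b (Branch 2 a c d) p q (Suc T)"
proof -
  have "\<exists>t. exec m (Branch 2 a c d) (main (p @ r)) t (main (q @ r)) \<and> (b \<longrightarrow> t \<le> Suc T)"
    if m: "length r + Suc T \<le> m" for r m
  proof -
    obtain t where "exec m c (main (p @ r)) t (main (q @ r))" "b \<longrightarrow> t \<le> T"
      using doesD[OF assms(1), of r m] m by auto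
    moreover have "peek (main (p @ r) 2) = a" using assms(2,3) by (cases p) auto
    ultimately show ?thesis by (intro exI[of _ "Suc t"]) (auto intro: exec_Branch1)
  qed
  then show ?thesis using assms by (simp add: does_def)
qed

lemma does_Branch2:
  assumes "does b d p q T" "p \<noteq> []" "hd p \<noteq> a" "wf_com 6 c"
  shows "does b (Branch 2 a c d) p q (Suc T)"
proof -
  have "\<exists>t. exec m (Branch 2 a c d) (main (p @ r)) t (main (q @ r)) \<and> (b \<longrightarrow> t \<le> Suc T)"
    if m: "length r + Suc T \<le> m" for r m
  proof -
    obtain t where "exec m d (main (p @ r)) t (main (q @ r))" "b \<longrightarrow> t \<le> T"
      using doesD[OF assms(1), of r m] m by auto
    moreover have "peek (main (p @ r) 2) \<noteq> a" using assms(2,3) by (cases p) auto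
    ultimately show ?thesis by (intro exI[of _ "Suc t"]) (auto intro: exec_Branch2)
  qed
  then show ?thesis using assms by (simp add: does_def)
qed

lemma does_Nop: "does b Nop p p (length p + 1)"
  by (rule doesI) (auto simp: low_stk intro!: ex_mono[OF ex_Nop])

lemma ex_Push2: "low m (stk i u a x c d) \<Longrightarrow> length a < m \<Longrightarrow>
    ex m (Push 2 v) (stk i u a x c d) 1 (stk i u (v # a) x c d)"
  using ex_Push[of m "stk i u a x c d" 2 v] by simp

lemma ex_Pop2: "low m (stk i u (v # a) x c d) \<Longrightarrow> v \<noteq> 0 \<Longrightarrow>
    ex m (Pop 2) (stk i u (v # a) x c d) 1 (stk i u a x c d)"
  using ex_Pop[of m "stk i u (v # a) x c d" 2] by simp

lemma does_Push: "a \<in> {1, 2} \<Longrightarrow> does b (Push 2 a) p (a # p) (length p + 1)"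
  by (rule doesI) (auto simp: low_stk intro!: ex_mono[OF ex_Push2[unfolded One_nat_def]])

lemma does_Pop: "a \<noteq> 0 \<Longrightarrow> does b (Pop 2) (a # p) p (length p + 1)"
  by (rule doesI) (auto simp: low_stk intro!: ex_mono[OF ex_Pop2[unfolded One_nat_def]])

section \<open>Copying, exchanging, deleting and comparing trees\<close>

lemma ex_move4:
  assumes "low m (stk i u (ser t @ r) [] c d)" "length (ser t @ r) + length c < m"
  shows "ex m (move_tree 4) (stk i u (ser t @ r) [] c d) (8 * length (ser t) + 3)
     (stk i u r [] (rev (ser t) @ c) d)"
  using ex_move_tree[OF assms(1), of t r 4] assms(2) by simp

lemma ex_move5:
  assumes "low m (stk i u (ser t @ r) [] c d)" "length (ser t @ r) + length d < m"
  shows "ex m (move_tree 5) (stk i u (ser t @ r) [] c d) (8 * length (ser t) + 3)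
     (stk i u r [] c (rev (ser t) @ d))"
  using ex_move_tree[OF assms(1), of t r 5] assms(2) by simp

lemma ex_xfer_upd:
  assumes "low m s" "set (s a) \<subseteq> {1, 2}" "a \<noteq> b" "length (s a) + length (s b) \<le> m"
  shows "ex m (xfer a [b]) s (7 * length (s a) + 1) (s(a := [], b := rev (s a) @ s b))"
proof -
  have "(\<lambda>j. if j = a then [] else if j \<in> set [b] then rev (s a) @ s j else s j)
      = s(a := [], b := rev (s a) @ s b)"
    using assms(3) by (auto simp: fun_eq_iff)
  with ex_xfer[OF assms(1,2), of "[b]"] assms(3,4) show ?thesis by simp
qed

lemma ex_clear:
  assumes "low m s" "set (s a) \<subseteq> {1, 2}"
  shows "ex m (xfer a []) s (5 * length (s a) + 1) (s(a := []))"
proof -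
  have "(\<lambda>j. if j = a then [] else if j \<in> set [] then rev (s a) @ s j else s j) = s(a := [])"
    by (auto simp: fun_eq_iff)
  with ex_xfer[OF assms, of "[]"] show ?thesis by simp
qed

lemma ex_xfer_4_25:
  assumes "low m (stk i u a k c d)" "set c \<subseteq> {1, 2}" "length a + length c \<le> m" "length d + length c \<le> m"
  shows "ex m (xfer 4 [2, 5]) (stk i u a k c d) (9 * length c + 1)
    (stk i u (rev c @ a) k [] (rev c @ d))"
proof -
  have "(\<lambda>j. if j = 4 then [] else if j \<in> set [2, 5] then rev (stk i u a k c d 4) @ stk i u a k c d j
       else stk i u a k c d j) = (stk i u a k c d)(2 := rev c @ a, 4 := [], 5 := rev c @ d)"
    by (auto simp: fun_eq_iff stk_def)
  with ex_xfer[OF assms(1), of 4 "[2, 5]"] assms(2-) show ?thesis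
    by (simp add: add.commute)
qed

text \<open>Every pour reverses, so each copy must be poured an even number of times: the first goes
  through 4, the second through 4, 5 and 4 again.\<close>

definition dup :: com where
  "dup = Seq (move_tree 4) (Seq (xfer 4 [2, 5]) (Seq (xfer 5 [4]) (xfer 4 [2])))"

definition swap :: com where
  "swap = Seq (move_tree 4) (Seq (move_tree 5) (Seq (xfer 4 [2]) (xfer 5 [2])))"

definition drop_tree :: com where
  "drop_tree = Seq (move_tree 4) (xfer 4 [])"

lemma wf_ops [simp]:
  "d < k \<Longrightarrow> 4 \<le> k \<Longrightarrow> wf_com k (move_tree d)"
  "wf_com k (xfer a bs) \<longleftrightarrow> a < k \<and> (\<forall>b\<in>set bs. b < k)"
proof -
  have "wf_com k (pushes bs x) \<longleftrightarrow> (\<forall>b\<in>set bs. b < k)" if "x \<in> {1, 2}" for x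
    using that by (induction bs) auto
  then show "wf_com k (xfer a bs) \<longleftrightarrow> a < k \<and> (\<forall>b\<in>set bs. b < k)"
    by (auto simp: xfer_def)
qed (auto simp: move_tree_def)

lemma does_dup: "does b dup (ser x) (ser x @ ser x) (40 * length (ser x))"
proof (rule doesI)
  fix r :: "nat list" and m assume m: "length r + 40 * length (ser x) \<le> m"
  let ?l = "length (ser x)"
  have l: "0 < ?l" by simp
  note bits = ser_bits[of x]
  have "ex m (move_tree 4) (main (ser x @ r)) (8 * ?l + 3) (stk [] [] r [] (rev (ser x)) [])"
    using ex_move4[of m "[]" "[]" x r "[]" "[]"] m l by (simp add: low_stk)
  moreover have "ex m (xfer 4 [2, 5]) (stk [] [] r [] (rev (ser x)) []) (9 * ?l + 1)
      (stk [] [] (ser x @ r) [] [] (ser x))"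
    using ex_xfer_4_25[of m "[]" "[]" r "[]" "rev (ser x)" "[]"] bits m l by (simp add: low_stk)
  moreover have "ex m (xfer 5 [4]) (stk [] [] (ser x @ r) [] [] (ser x)) (7 * ?l + 1)
      (stk [] [] (ser x @ r) [] (rev (ser x)) [])"
    using ex_xfer_upd[of m "stk [] [] (ser x @ r) [] [] (ser x)" 5 4] bits m l by (simp add: low_stk)
  moreover have "ex m (xfer 4 [2]) (stk [] [] (ser x @ r) [] (rev (ser x)) []) (7 * ?l + 1)
      (stk [] [] (ser x @ ser x @ r) [] [] [])"
    using ex_xfer_upd[of m "stk [] [] (ser x @ r) [] (rev (ser x)) []" 4 2] bits m l by (simp add: low_stk)
  ultimately have "ex m dup (main (ser x @ r))
     (Suc (8 * ?l + 3 + Suc (9 * ?l + 1 + Suc (7 * ?l + 1 + (7 * ?l + 1)))))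
     (main (ser x @ ser x @ r))"
    unfolding dup_def by (intro ex_Seq)
  then have "ex m dup (main (ser x @ r)) (40 * ?l) (main (ser x @ ser x @ r))"
    by (rule ex_mono) (use l in linarith)
  then show "ex m dup (main (ser x @ r)) (40 * ?l) (main ((ser x @ ser x) @ r))" by simp
qed (simp add: dup_def)

lemma does_swap: "does b swap (ser x @ ser y) (ser y @ ser x) (30 * (length (ser x) + length (ser y)))"
proof (rule doesI)
  fix r :: "nat list" and m assume m: "length r + 30 * (length (ser x) + length (ser y)) \<le> m"
  let ?l = "length (ser x)" and ?k = "length (ser y)"
  have l: "0 < ?l" "0 < ?k" by simp_all
  obtain a b where ab: "?l = Suc a" "?k = Suc b" using length_ser_Suc by blast
  then have lm: "?l + (?k + length r) < m" using m by simp
  note bits = ser_bits[of x] ser_bits[of y]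
  have "ex m (move_tree 4) (main (ser x @ ser y @ r)) (8 * ?l + 3) (stk [] [] (ser y @ r) [] (rev (ser x)) [])"
    using ex_move4[of m "[]" "[]" x "ser y @ r" "[]" "[]"] lm by (simp add: low_stk)
  moreover have "ex m (move_tree 5) (stk [] [] (ser y @ r) [] (rev (ser x)) []) (8 * ?k + 3)
      (stk [] [] r [] (rev (ser x)) (rev (ser y)))"
    using ex_move5[of m "[]" "[]" y r "rev (ser x)" "[]"] lm by (simp add: low_stk)
  moreover have "ex m (xfer 4 [2]) (stk [] [] r [] (rev (ser x)) (rev (ser y))) (7 * ?l + 1)
      (stk [] [] (ser x @ r) [] [] (rev (ser y)))"
    using ex_xfer_upd[of m "stk [] [] r [] (rev (ser x)) (rev (ser y))" 4 2] bits lm by (simp add: low_stk)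
  moreover have "ex m (xfer 5 [2]) (stk [] [] (ser x @ r) [] [] (rev (ser y))) (7 * ?k + 1)
      (stk [] [] (ser y @ ser x @ r) [] [] [])"
    using ex_xfer_upd[of m "stk [] [] (ser x @ r) [] [] (rev (ser y))" 5 2] bits lm by (simp add: low_stk)
  ultimately have "ex m swap (main (ser x @ ser y @ r))
     (Suc (8 * ?l + 3 + Suc (8 * ?k + 3 + Suc (7 * ?l + 1 + (7 * ?k + 1)))))
     (main (ser y @ ser x @ r))"
    unfolding swap_def by (intro ex_Seq)
  then have "ex m swap (main (ser x @ ser y @ r)) (30 * (?l + ?k)) (main (ser y @ ser x @ r))"
    by (rule ex_mono) (simp add: ab)
  then show "ex m swap (main ((ser x @ ser y) @ r)) (30 * (?l + ?k)) (main ((ser y @ ser x) @ r))"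
    by simp
qed (simp add: swap_def)

lemma does_drop: "does b drop_tree (ser x) [] (20 * length (ser x))"
proof (rule doesI)
  fix r :: "nat list" and m assume m: "length r + 20 * length (ser x) \<le> m"
  let ?l = "length (ser x)"
  have l: "0 < ?l" by simp
  note bits = ser_bits[of x]
  have "ex m (move_tree 4) (main (ser x @ r)) (8 * ?l + 3) (stk [] [] r [] (rev (ser x)) [])"
    using ex_move4[of m "[]" "[]" x r "[]" "[]"] m l by (simp add: low_stk)
  moreover have "ex m (xfer 4 []) (stk [] [] r [] (rev (ser x)) []) (5 * ?l + 1) (main r)"
    using ex_clear[of m "stk [] [] r [] (rev (ser x)) []" 4] bits m l by (simp add: low_stk)
  ultimately have "ex m drop_tree (main (ser x @ r)) (Suc (8 * ?l + 3 + (5 * ?l + 1))) (main r)"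
    unfolding drop_tree_def by (intro ex_Seq)
  then have "ex m drop_tree (main (ser x @ r)) (20 * ?l) (main r)"
    by (rule ex_mono) (use l in linarith)
  then show "ex m drop_tree (main (ser x @ r)) (20 * ?l) (main ([] @ r))" by simp
qed (simp add: drop_tree_def)

text \<open>During a comparison stack 3 holds a single flag, 2 while no mismatch has been met and 1
  afterwards.\<close>

definition unequal :: com where
  "unequal = Seq (Pop 3) (Push 3 1)"

definition compare :: com where
  "compare = Loop 4 0 (Seq (Branch 4 1 (Branch 5 1 Nop unequal) (Branch 5 2 Nop unequal))
     (Seq (Pop 4) (Pop 5)))"

definition eq_tree :: com where
  "eq_tree = Seq (move_tree 4) (Seq (move_tree 5) (Seq (Push 3 2) (Seq compare
     (Seq (Branch 5 0 Nop unequal) (Seq (xfer 5 [])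
     (Branch 3 2 (Seq (Pop 3) (Seq (Push 2 1) (Seq (Push 2 1) (Push 2 2))))
        (Seq (Pop 3) (Push 2 1))))))))"

lemma wf_eq_tree [simp]: "wf_com 6 eq_tree"
  by (simp add: eq_tree_def compare_def unequal_def)

lemma ex_pop3: "low m (stk i u a [v] c d) \<Longrightarrow> v \<noteq> 0 \<Longrightarrow>
    ex m (Pop 3) (stk i u a [v] c d) 1 (stk i u a [] c d)"
  using ex_Pop[of m "stk i u a [v] c d" 3] by simp

lemma ex_unequal:
  assumes "low m (stk i u a [f] c d)" "f \<noteq> 0"
  shows "ex m unequal (stk i u a [f] c d) 3 (stk i u a [1] c d)"
proof -
  have "ex m (Push 3 1) (stk i u a [] c d) 1 (stk i u a [1] c d)"
    using ex_Push[of m "stk i u a [] c d" 3 1] assms by (simp add: low_stk)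
  from ex_Seq[OF ex_pop3[OF assms] this] show ?thesis
    by (simp add: unequal_def numeral_3_eq_3)
qed

text \<open>If the second word runs out first, its top reads as 0, which equals no bit and counts as
  a mismatch. If it is longer, its rest stays on stack 5 for the caller to notice.\<close>

lemma ex_compare:
  assumes "low m (stk i o1 a [f] u v)" "f \<in> {1, 2}" "set u \<subseteq> {1, 2}" "set v \<subseteq> {1, 2}"
  shows "ex m compare (stk i o1 a [f] u v) (12 * length u + 1)
    (stk i o1 a [if f = 2 \<and> take (length u) v = u then 2 else 1] [] (drop (length u) v))"
  using assms
proof (induction u arbitrary: f v)
  case Nil
  then show ?case unfolding compare_def by (auto intro!: ex_Loop1[unfolded One_nat_def])
next
  case (Cons x u)
  define g where "g = (if f = 2 \<and> peek v = x then 2 else (1::nat))"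
  let ?b = "Branch 4 1 (Branch 5 1 Nop unequal) (Branch 5 2 Nop unequal)"
  let ?s = "stk i o1 a [f] (x # u) v"
  have x: "x = 1 \<or> x = 2" and f: "f = 1 \<or> f = 2" using Cons.prems by auto
  have "ex m ?b ?s 5 (stk i o1 a [g] (x # u) v)"
  proof (cases "peek v = x")
    case True
    then have "g = f" using f by (auto simp: g_def)
    moreover have "ex m ?b ?s 5 ?s"
    proof (cases "x = 1")
      case True
      with \<open>peek v = x\<close> show ?thesis
        by (intro ex_mono[OF ex_Branch1[OF _ ex_Branch1[OF _ ex_Nop]]] Cons.prems(1)) auto
    next
      case False
      with \<open>peek v = x\<close> x show ?thesis
        by (intro ex_mono[OF ex_Branch2[OF _ ex_Branch1[OF _ ex_Nop]]] Cons.prems(1)) auto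
    qed
    ultimately show ?thesis by simp
  next
    case False
    then have "g = 1" by (simp add: g_def)
    moreover have "ex m ?b ?s 5 (stk i o1 a [1] (x # u) v)"
    proof (cases "x = 1")
      case True
      with False f show ?thesis
        by (intro ex_mono[OF ex_Branch1[OF _ ex_Branch2[OF _ ex_unequal]]] Cons.prems(1)) auto
    next
      case False
      with \<open>peek v \<noteq> x\<close> x f show ?thesis
        by (intro ex_mono[OF ex_Branch2[OF _ ex_Branch2[OF _ ex_unequal]]] Cons.prems(1)) auto
    qed
    ultimately show ?thesis by simp
  qed
  moreover from this have "low m (stk i o1 a [g] (x # u) v)" by (blast dest: ex_low)
  then have "ex m (Pop 4) (stk i o1 a [g] (x # u) v) 1 (stk i o1 a [g] u v)"
    using ex_Pop[of m "stk i o1 a [g] (x # u) v" 4] x by auto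
  moreover from this have "low m (stk i o1 a [g] u v)" by (blast dest: ex_low)
  then have "ex m (Pop 5) (stk i o1 a [g] u v) 1 (stk i o1 a [g] u (tl v))"
    using ex_Pop[of m "stk i o1 a [g] u v" 5] Cons.prems(4) by (cases v) auto
  ultimately have "ex m (Seq ?b (Seq (Pop 4) (Pop 5))) ?s (Suc (5 + Suc (1 + 1))) (stk i o1 a [g] u (tl v))"
    by (intro ex_Seq)
  moreover from this have "low m (stk i o1 a [g] u (tl v))" by (blast dest: ex_low)
  then have "ex m compare (stk i o1 a [g] u (tl v)) (12 * length u + 1)
    (stk i o1 a [if g = 2 \<and> take (length u) (tl v) = u then 2 else 1] [] (drop (length u) (tl v)))"
  proof (rule Cons.IH)
    show "set (tl v) \<subseteq> {1, 2}" using Cons.prems(4) by (cases v) auto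
  qed (use Cons.prems in \<open>auto simp: g_def\<close>)
  moreover have "(if g = 2 \<and> take (length u) (tl v) = u then 2 else (1::nat))
     = (if f = 2 \<and> take (length (x # u)) v = x # u then 2 else 1)"
    using x by (cases v) (auto simp: g_def)
  moreover have "drop (length u) (tl v) = drop (length (x # u)) v" by (cases v) auto
  moreover have "peek (?s 4) \<noteq> 0" using x by auto
  ultimately have "ex m compare ?s (Suc (Suc (5 + Suc (1 + 1)) + (12 * length u + 1)))
     (stk i o1 a [if f = 2 \<and> take (length (x # u)) v = x # u then 2 else 1] []
       (drop (length (x # u)) v))"
    unfolding compare_def by (intro ex_Loop2) auto
  then show ?case by (rule ex_mono) simp
qed

lemma does_eq:
  "does b eq_tree (ser x @ ser y) (if x = y then ser (Node Leaf Leaf) else ser Leaf)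
     (100 * (length (ser x) + length (ser y)))"
proof (rule doesI)
  fix r :: "nat list" and m assume m: "length r + 100 * (length (ser x) + length (ser y)) \<le> m"
  let ?l = "length (ser x)" and ?k = "length (ser y)"
  have l: "0 < ?l" "0 < ?k" by simp_all
  obtain a b where ab: "?l = Suc a" "?k = Suc b" using length_ser_Suc by blast
  then have lm: "?l + (?k + length r) + 10 < m" using m by simp
  note bits = ser_bits[of x] ser_bits[of y]
  define f where "f = (if x = y then 2 else (1::nat))"
  define f' where "f' = (if take ?l (rev (ser y)) = rev (ser x) then 2 else (1::nat))"
  define d where "d = drop ?l (rev (ser y))"
  \<comment> \<open>Equality means no mismatch along the first word and nothing left of the
    second.\<close>
  have f: "f = (if f' = 2 \<and> d = [] then 2 else 1)"
    using ser_inj[of x y] by (auto simp: f_def f'_def d_def)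
  have d: "set d \<subseteq> {1, 2}" "length d \<le> ?k"
    using bits(2) set_drop_subset[of ?l "rev (ser y)"] by (auto simp: d_def)
  have "ex m (move_tree 4) (main (ser x @ ser y @ r)) (8 * ?l + 3) (stk [] [] (ser y @ r) [] (rev (ser x)) [])"
    using ex_move4[of m "[]" "[]" x "ser y @ r" "[]" "[]"] lm by (simp add: low_stk)
  moreover have "ex m (move_tree 5) (stk [] [] (ser y @ r) [] (rev (ser x)) []) (8 * ?k + 3)
      (stk [] [] r [] (rev (ser x)) (rev (ser y)))"
    using ex_move5[of m "[]" "[]" y r "rev (ser x)" "[]"] lm by (simp add: low_stk)
  moreover have "ex m (Push 3 2) (stk [] [] r [] (rev (ser x)) (rev (ser y))) 1
      (stk [] [] r [2] (rev (ser x)) (rev (ser y)))"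
    using ex_Push[of m "stk [] [] r [] (rev (ser x)) (rev (ser y))" 3 2] lm by (simp add: low_stk)
  moreover have "ex m compare (stk [] [] r [2] (rev (ser x)) (rev (ser y))) (12 * ?l + 1)
      (stk [] [] r [f'] [] d)"
    using ex_compare[of m "[]" "[]" r 2 "rev (ser x)" "rev (ser y)"] lm bits
    by (simp add: low_stk f'_def d_def)
  moreover have "ex m (Branch 5 0 Nop unequal) (stk [] [] r [f'] [] d) 4 (stk [] [] r [f] [] d)"
  proof (cases "d = []")
    case True
    then have "f' = f" by (auto simp: f f'_def)
    moreover have "ex m (Branch 5 0 Nop unequal) (stk [] [] r [f] [] []) 4 (stk [] [] r [f] [] [])"
      using lm by (intro ex_mono[OF ex_Branch1[OF _ ex_Nop]]) (auto simp: low_stk)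
    ultimately show ?thesis using True by simp
  next
    case False
    then have "f = 1" "peek d \<noteq> 0" using d by (auto simp: f neq_Nil_conv)
    with False show ?thesis using lm d(2)
      by (simp only:, intro ex_mono[OF ex_Branch2[OF _ ex_unequal]]) (auto simp: low_stk f'_def)
  qed
  moreover have "ex m (xfer 5 []) (stk [] [] r [f] [] d) (5 * ?k + 1) (stk [] [] r [f] [] [])"
    using ex_clear[of m "stk [] [] r [f] [] d" 5] lm d by (auto simp: low_stk intro: ex_mono)
  moreover have "ex m (Branch 3 2 (Seq (Pop 3) (Seq (Push 2 1) (Seq (Push 2 1) (Push 2 2))))
        (Seq (Pop 3) (Push 2 1))) (stk [] [] r [f] [] []) 10
      (main ((if x = y then ser (Node Leaf Leaf) else ser Leaf) @ r))"
  proof (cases "x = y")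
    case True
    have "ex m (Seq (Pop 3) (Seq (Push 2 1) (Seq (Push 2 1) (Push 2 2)))) (stk [] [] r [2] [] [])
       (Suc (1 + Suc (1 + Suc (1 + 1)))) (main (2 # 1 # 1 # r))"
      by (rule ex_Seq[OF ex_pop3 ex_Seq[OF ex_Push2 ex_Seq[OF ex_Push2 ex_Push2]]])
        (use lm in \<open>auto simp: low_stk\<close>)
    then show ?thesis using True
      by (intro ex_mono[OF ex_Branch1]) (auto simp: f_def)
  next
    case False
    have "ex m (Seq (Pop 3) (Push 2 1)) (stk [] [] r [1] [] [])
       (Suc (1 + 1)) (main (1 # r))"
      by (rule ex_Seq[OF ex_pop3 ex_Push2]) (use lm in \<open>auto simp: low_stk\<close>)
    then show ?thesis using False
      by (intro ex_mono[OF ex_Branch2]) (auto simp: f_def)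
  qed
  ultimately have "ex m eq_tree (main (ser x @ ser y @ r))
     (Suc (8 * ?l + 3 + Suc (8 * ?k + 3 + Suc (1 + Suc (12 * ?l + 1 + Suc (4 + Suc (5 * ?k + 1 + 10)))))))
     (main ((if x = y then ser (Node Leaf Leaf) else ser Leaf) @ r))"
    unfolding eq_tree_def by (intro ex_Seq)
  then have "ex m eq_tree (main (ser x @ ser y @ r)) (100 * (?l + ?k))
      (main ((if x = y then ser (Node Leaf Leaf) else ser Leaf) @ r))"
    by (rule ex_mono) (simp add: ab)
  then show "ex m eq_tree (main ((ser x @ ser y) @ r)) (100 * (?l + ?k))
      (main ((if x = y then ser (Node Leaf Leaf) else ser Leaf) @ r))"
    by simp
qed simp

section \<open>Polynomially bounded computations on typed data\<close>

class rep =
  fixes tr :: "'a \<Rightarrow> tree"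
  assumes tr_inj: "tr x = tr y \<Longrightarrow> x = y"

lemma tr_eq_iff [simp]: "tr x = tr y \<longleftrightarrow> x = y"
  using tr_inj by blast

instantiation bool :: rep
begin
definition "tr_bool b = (if b then Node Leaf Leaf else Leaf)"
instance by standard (simp add: tr_bool_def split: if_splits)
end

instantiation prod :: (rep, rep) rep
begin
definition "tr_prod p = Node (tr (fst p)) (tr (snd p))"
instance by standard (auto simp: tr_prod_def prod_eq_iff dest: tr_inj)
end

text \<open>A nonempty list has the same tree as the pair of its head and tail. Hence consing is
  pairing, and a case distinction inspects a single symbol.\<close>

instantiation list :: (rep) rep
begin
definition "tr_list xs = foldr (\<lambda>x t. Node (tr x) t) xs Leaf"
instance
proof
  fix xs ys :: "'a list" assume "tr xs = tr ys"
  then show "xs = ys"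
  proof (induction xs arbitrary: ys)
    case Nil
    then show ?case by (cases ys) (auto simp: tr_list_def)
  next
    case (Cons x xs)
    then show ?case by (cases ys) (auto simp: tr_list_def dest: tr_inj)
  qed
qed
end

lemma tr_simps:
  "tr True = Node Leaf Leaf" "tr False = Leaf" "tr (x, y) = Node (tr x) (tr y)"
  "tr [] = Leaf" "tr (z # zs) = Node (tr z) (tr zs)"
  by (simp_all add: tr_bool_def tr_prod_def tr_list_def)

definition sz :: "'a::rep \<Rightarrow> nat" where
  "sz x = length (ser (tr x))"

lemma sz_simps [simp]:
  "sz True = 3" "sz False = 1" "sz (x, y) = Suc (sz x + sz y)"
  "sz [] = 1" "sz (z # zs) = Suc (sz z + sz zs)"
  by (simp_all add: sz_def tr_simps)

lemma sz_pos [simp]: "0 < sz x"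
  by (simp add: sz_def)

lemma poly_nat_mono: "x \<le> y \<Longrightarrow> poly (p :: nat poly) x \<le> poly p y"
  by (induction p) (auto intro: mult_le_mono)

definition polybd :: "('a::rep \<Rightarrow> nat) \<Rightarrow> bool" where
  "polybd F \<longleftrightarrow> (\<exists>p :: nat poly. \<forall>x. F x \<le> poly p (sz x))"

lemma polybd_le: "polybd G \<Longrightarrow> (\<And>x. F x \<le> G x) \<Longrightarrow> polybd F"
  unfolding polybd_def by (meson le_trans)

lemma polybd_const [intro]: "polybd (\<lambda>_. k)"
  unfolding polybd_def by (intro exI[of _ "[:k:]"]) simp

lemma polybd_sz_id: "polybd sz"
  unfolding polybd_def by (intro exI[of _ "[:0, 1:]"]) simp

lemma polybd_add [intro]: "polybd F \<Longrightarrow> polybd G \<Longrightarrow> polybd (\<lambda>x. F x + G x)"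
  unfolding polybd_def
proof (elim exE)
  fix p q :: "nat poly" assume "\<forall>x. F x \<le> poly p (sz x)" "\<forall>x. G x \<le> poly q (sz x)"
  then show "\<exists>p :: nat poly. \<forall>x. F x + G x \<le> poly p (sz x)"
    by (intro exI[of _ "p + q"]) (simp add: add_mono)
qed

lemma polybd_Suc [intro]: "polybd F \<Longrightarrow> polybd (\<lambda>x. Suc (F x))"
  using polybd_add[of F "\<lambda>_. 1"] by auto

lemma polybd_mult [intro]: "polybd F \<Longrightarrow> polybd G \<Longrightarrow> polybd (\<lambda>x. F x * G x)"
  unfolding polybd_def
proof (elim exE)
  fix p q :: "nat poly" assume "\<forall>x. F x \<le> poly p (sz x)" "\<forall>x. G x \<le> poly q (sz x)"
  then show "\<exists>p :: nat poly. \<forall>x. F x * G x \<le> poly p (sz x)"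
    by (intro exI[of _ "p * q"]) (simp add: mult_le_mono)
qed

lemma polybd_poly [intro]:
  assumes "polybd F"
  shows "polybd (\<lambda>x. poly p (F x))"
proof -
  from assms obtain q where "\<forall>x. F x \<le> poly q (sz x)" unfolding polybd_def by (elim exE)
  then show ?thesis unfolding polybd_def
    by (intro exI[of _ "pcompose p q"]) (auto simp: poly_pcompose intro: poly_nat_mono)
qed

lemma polybd_comp:
  assumes "polybd F" "polybd (\<lambda>x. sz (g x))"
  shows "polybd (\<lambda>x. F (g x))"
proof -
  from assms(1) obtain p where "\<forall>y. F y \<le> poly p (sz y)" unfolding polybd_def by (elim exE)
  then show ?thesis by (intro polybd_le[OF polybd_poly[OF assms(2), of p]]) simp
qed

text \<open>With \<open>b\<close> true these are the functions on typed data computable in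
  polynomial time, with \<open>b\<close> false those computable in polynomial space, the output
  counted as space.\<close>

definition cmp :: "bool \<Rightarrow> ('a::rep \<Rightarrow> 'b::rep) \<Rightarrow> bool" where
  "cmp b f \<longleftrightarrow> (\<exists>c T. polybd T \<and> (\<forall>x. does b c (ser (tr x)) (ser (tr (f x))) (T x)))"

lemma cmpI: "polybd T \<Longrightarrow> (\<And>x. does b c (ser (tr x)) (ser (tr (f x))) (T x)) \<Longrightarrow> cmp b f"
  unfolding cmp_def by blast

lemma cmpE:
  assumes "cmp b f"
  obtains c T where "polybd T" "\<And>x. does b c (ser (tr x)) (ser (tr (f x))) (T x)" "wf_com 6 c"
  using assms does_wf unfolding cmp_def by blast

text \<open>The result is written on a stack that the bound covers. So results stay polynomially
  long even in the space class, and an intermediate result can simply be stored when functions are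
  composed.\<close>

lemma polybd_sz [intro]:
  assumes "cmp b f"
  shows "polybd (\<lambda>x. sz (f x))"
proof -
  obtain c T where "polybd T" "\<And>x. does b c (ser (tr x)) (ser (tr (f x))) (T x)"
    by (rule cmpE[OF assms]) auto
  from this(1) show ?thesis
  proof (rule polybd_le)
    show "sz (f x) \<le> T x" for x
      using does_length[OF \<open>does b c (ser (tr x)) (ser (tr (f x))) (T x)\<close>] by (simp add: sz_def)
  qed
qed

lemma does_space: "does b c p q T \<Longrightarrow> does False c p q T"
  by (simp add: does_def) metis

lemma cmp_space: "cmp b f \<Longrightarrow> cmp False f"
  unfolding cmp_def by (meson does_space)

lemma cmp_id [intro]: "cmp b (\<lambda>x. x)"
proof (rule cmpI)
  show "does b Nop (ser (tr x)) (ser (tr x)) (sz x + 1)" for x :: 'a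
    unfolding sz_def by (rule does_Nop)
qed (intro polybd_add polybd_const polybd_sz_id)

lemma cmp_comp:
  assumes "cmp b g" "cmp b f"
  shows "cmp b (\<lambda>x. g (f x))"
proof -
  obtain c T where c: "polybd T" "\<And>x. does b c (ser (tr x)) (ser (tr (f x))) (T x)"
    by (rule cmpE[OF assms(2)]) auto
  obtain d U where d: "polybd U" "\<And>x. does b d (ser (tr x)) (ser (tr (g x))) (U x)"
    by (rule cmpE[OF assms(1)]) auto
  show ?thesis
    by (rule cmpI[of "\<lambda>x. Suc (T x + U (f x))", OF _ does_Seq[OF c(2) d(2)]])
      (intro polybd_Suc polybd_add c polybd_comp[OF d(1)] polybd_sz[OF assms(2)])
qed

lemma cmp_tr: "cmp b f \<Longrightarrow> (\<And>x. tr (g x) = tr (f x)) \<Longrightarrow> cmp b g"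
  unfolding cmp_def by simp

lemma does_word: "set w \<subseteq> {1, 2} \<Longrightarrow> \<exists>c T. does b c [] w T"
proof (induction w)
  case Nil
  then show ?case using does_Nop[of b "[]"] by blast
next
  case (Cons a w)
  then obtain c T where "does b c [] w T" by auto
  from does_Seq[OF this does_Push[of a b w]] Cons.prems show ?case by auto
qed

lemma cmp_const [intro]: "cmp b (\<lambda>_. k)"
proof -
  obtain c T where "does b c [] (ser (tr k)) T" using does_word[OF ser_bits] by blast
  from does_Seq[OF does_drop this]
  have "does b (Seq drop_tree c) (ser (tr x)) (ser (tr k)) (Suc (20 * sz x + T))" for x :: 'a
    by (simp add: sz_def)
  then show ?thesis
    by (rule cmpI[rotated]) (intro polybd_Suc polybd_add polybd_mult polybd_const polybd_sz_id)
qed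

text \<open>The second component is computed first, so that the first one ends on top of it and a
  single symbol 2 completes the node.\<close>

lemma cmp_Pair [intro]:
  assumes "cmp b f" "cmp b g"
  shows "cmp b (\<lambda>x. (f x, g x))"
proof -
  obtain c T where c: "polybd T" "\<And>x. does b c (ser (tr x)) (ser (tr (f x))) (T x)"
    by (rule cmpE[OF assms(1)]) auto
  obtain d U where d: "polybd U" "\<And>x. does b d (ser (tr x)) (ser (tr (g x))) (U x)"
    by (rule cmpE[OF assms(2)]) auto
  show ?thesis
  proof (rule cmpI)
    fix x
    note 1 = does_frame[OF d(2), of x "ser (tr x)"]
    note 2 = does_frame[OF c(2), of x "ser (tr (g x))"]
    note 3 = does_Push[of 2 b "ser (tr (f x)) @ ser (tr (g x))"]
    show "does b (Seq dup (Seq d (Seq swap (Seq c (Push 2 2))))) (ser (tr x)) (ser (tr (f x, g x)))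
       (Suc (40 * sz x + Suc (U x + sz x + Suc (30 * (sz (g x) + sz x) +
         Suc (T x + sz (g x) + (sz (f x) + sz (g x) + 1))))))"
      using does_Seq[OF does_dup does_Seq[OF 1 does_Seq[OF does_swap does_Seq[OF 2 3]]]]
      by (simp add: sz_def tr_simps)
  qed (intro polybd_Suc polybd_add polybd_mult polybd_const c(1) d(1) polybd_sz_id
      polybd_sz[OF assms(1)] polybd_sz[OF assms(2)])
qed

lemma cmp_fst':
  "cmp b (fst :: 'a::rep \<times> 'b::rep \<Rightarrow> 'a)"
proof (rule cmpI)
  fix p :: "'a \<times> 'b"
  show "does b (Seq (Pop 2) (Seq swap drop_tree)) (ser (tr p)) (ser (tr (fst p)))
    (Suc (sz p + Suc (30 * sz p + 21 * sz p)))"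
  proof (rule does_mono)
    show "does b (Seq (Pop 2) (Seq swap drop_tree)) (ser (tr p)) (ser (tr (fst p)))
       (Suc (length (ser (tr (fst p)) @ ser (tr (snd p))) + 1 + Suc (30 * (length (ser (tr (fst p))) +
         length (ser (tr (snd p)))) + (20 * length (ser (tr (snd p))) + length (ser (tr (fst p)))))))"
      using does_Seq[OF does_Pop[of 2 b "ser (tr (fst p)) @ ser (tr (snd p))"]
          does_Seq[OF does_swap does_frame[OF does_drop[of b "tr (snd p)"], of "ser (tr (fst p))"]]]
      by (simp add: tr_prod_def)
  qed (cases p, simp add: sz_def tr_simps)
qed (intro polybd_Suc polybd_add polybd_mult polybd_const polybd_sz_id)

lemma cmp_snd':
  "cmp b (snd :: 'a::rep \<times> 'b::rep \<Rightarrow> 'b)"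
proof (rule cmpI)
  fix p :: "'a \<times> 'b"
  show "does b (Seq (Pop 2) drop_tree) (ser (tr p)) (ser (tr (snd p)))
    (Suc (sz p + 21 * sz p))"
  proof (rule does_mono)
    show "does b (Seq (Pop 2) drop_tree) (ser (tr p)) (ser (tr (snd p)))
       (Suc (length (ser (tr (fst p)) @ ser (tr (snd p))) + 1 +
         (20 * length (ser (tr (fst p))) + length (ser (tr (snd p))))))"
      using does_Seq[OF does_Pop[of 2 b "ser (tr (fst p)) @ ser (tr (snd p))"]
          does_frame[OF does_drop[of b "tr (fst p)"], of "ser (tr (snd p))"]]
      by (simp add: tr_prod_def)
  qed (cases p, simp add: sz_def tr_simps)
qed (intro polybd_Suc polybd_add polybd_mult polybd_const polybd_sz_id)

lemmas cmp_fst [intro] = cmp_comp[OF cmp_fst']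
lemmas cmp_snd [intro] = cmp_comp[OF cmp_snd']

lemma cmp_Cons [intro]:
  assumes "cmp b f" "cmp b g"
  shows "cmp b (\<lambda>x. f x # g x)"
  by (rule cmp_tr[OF cmp_Pair[OF assms]]) (simp add: tr_simps)

lemma cmp_eq' : "cmp b (\<lambda>p :: 'a::rep \<times> 'a. fst p = snd p)"
proof (rule cmpI)
  fix p :: "'a \<times> 'a"
  show "does b (Seq (Pop 2) eq_tree) (ser (tr p)) (ser (tr (fst p = snd p))) (Suc (sz p + 100 * sz p))"
  proof (rule does_mono)
    show "does b (Seq (Pop 2) eq_tree) (ser (tr p)) (ser (tr (fst p = snd p)))
       (Suc (length (ser (tr (fst p)) @ ser (tr (snd p))) + 1 +
         100 * (length (ser (tr (fst p))) + length (ser (tr (snd p))))))"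
      using does_Seq[OF does_Pop[of 2 b "ser (tr (fst p)) @ ser (tr (snd p))"]
          does_eq[of b "tr (fst p)" "tr (snd p)"]]
      by (cases "fst p = snd p") (auto simp: tr_prod_def tr_simps dest: tr_inj)
  qed (cases p, simp add: sz_def tr_simps)
qed (intro polybd_Suc polybd_add polybd_mult polybd_const polybd_sz_id)

lemma cmp_eq [intro]:
  assumes "cmp b f" "cmp b g"
  shows "cmp b (\<lambda>x. f x = g x)"
  using cmp_comp[OF cmp_eq' cmp_Pair[OF assms]] by simp

lemma cmp_if [intro]:
  assumes "cmp b e" "cmp b f" "cmp b g"
  shows "cmp b (\<lambda>x. if e x then f x else g x)"
proof -
  obtain ce Te where e: "polybd Te" "\<And>x. does b ce (ser (tr x)) (ser (tr (e x))) (Te x)" "wf_com 6 ce"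
    by (rule cmpE[OF assms(1)]) auto
  obtain c T where c: "polybd T" "\<And>x. does b c (ser (tr x)) (ser (tr (f x))) (T x)" "wf_com 6 c"
    by (rule cmpE[OF assms(2)]) auto
  obtain d U where d: "polybd U" "\<And>x. does b d (ser (tr x)) (ser (tr (g x))) (U x)" "wf_com 6 d"
    by (rule cmpE[OF assms(3)]) auto
  \<comment> \<open>The code of \<open>True\<close> is 2 1 1 and that of \<open>False\<close> is 1;
    these are the symbols that the two branches remove.\<close>
  let ?t = "Seq (Pop 2) (Seq (Pop 2) (Seq (Pop 2) c))" and ?f = "Seq (Pop 2) d"
  show ?thesis
  proof (rule cmpI)
    fix x
    have "does b (Branch 2 1 ?f ?t) (ser (tr (e x)) @ ser (tr x)) (ser (tr (if e x then f x else g x)))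
       (10 + 3 * sz x + T x + U x)"
    proof (cases "e x")
      case True
      have *: "does b ?t (2 # 1 # 1 # ser (tr x)) (ser (tr (f x)))
         (Suc (length (1 # 1 # ser (tr x)) + 1 + Suc (length (1 # ser (tr x)) + 1 +
           Suc (length (ser (tr x)) + 1 + T x))))"
        by (rule does_Seq[OF does_Pop does_Seq[OF does_Pop does_Seq[OF does_Pop c(2)]]]) auto
      have "does b (Branch 2 1 ?f ?t) (2 # 1 # 1 # ser (tr x)) (ser (tr (f x))) (10 + 3 * sz x + T x + U x)"
        by (rule does_mono[OF does_Branch2[OF *]]) (use d(3) in \<open>auto simp: sz_def\<close>)
      then show ?thesis using True by (simp add: tr_simps)
    next
      case False
      have *: "does b ?f (1 # ser (tr x)) (ser (tr (g x))) (Suc (length (ser (tr x)) + 1 + U x))"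
        by (rule does_Seq[OF does_Pop d(2)]) auto
      have "does b (Branch 2 1 ?f ?t) (1 # ser (tr x)) (ser (tr (g x))) (10 + 3 * sz x + T x + U x)"
        by (rule does_mono[OF does_Branch1[OF *]]) (use c(3) in \<open>auto simp: sz_def\<close>)
      then show ?thesis using False by (simp add: tr_simps)
    qed
    from does_Seq[OF does_dup does_Seq[OF does_frame[OF e(2)] this]]
    show "does b (Seq dup (Seq ce (Branch 2 1 ?f ?t))) (ser (tr x)) (ser (tr (if e x then f x else g x)))
      (Suc (40 * sz x + Suc (Te x + sz x + (10 + 3 * sz x + T x + U x))))"
      by (simp add: sz_def)
  qed (intro polybd_Suc polybd_add polybd_mult polybd_const c(1) d(1) e(1) polybd_sz_id)
qed

lemma cmp_case_list [intro]:
  assumes "cmp b l" "cmp b f" "cmp b (\<lambda>p. g (fst p) (fst (snd p)) (snd (snd p)))"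
  shows "cmp b (\<lambda>x. case l x of [] \<Rightarrow> f x | y # ys \<Rightarrow> g x y ys)"
proof -
  obtain ce Te where e: "polybd Te" "\<And>x. does b ce (ser (tr x)) (ser (tr (l x))) (Te x)" "wf_com 6 ce"
    by (rule cmpE[OF assms(1)]) auto
  obtain c T where c: "polybd T" "\<And>x. does b c (ser (tr x)) (ser (tr (f x))) (T x)" "wf_com 6 c"
    by (rule cmpE[OF assms(2)]) auto
  obtain d U where d: "polybd U"
    "\<And>p. does b d (ser (tr p)) (ser (tr (g (fst p) (fst (snd p)) (snd (snd p))))) (U p)" "wf_com 6 d"
    by (rule cmpE[OF assms(3)]) auto
  define U' where "U' x = (case l x of [] \<Rightarrow> 0 | y # ys \<Rightarrow> U (x, y, ys))" for x
  from d(1) obtain p where p: "\<forall>x. U x \<le> poly p (sz x)" unfolding polybd_def by (elim exE)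
  have U': "polybd U'"
  proof (rule polybd_le)
    show "polybd (\<lambda>x. poly p (Suc (sz x + sz (l x))))"
      by (intro polybd_poly polybd_Suc polybd_add polybd_sz_id polybd_sz[OF assms(1)])
    show "U' x \<le> poly p (Suc (sz x + sz (l x)))" for x
      using p by (auto simp: U'_def split: list.split)
  qed
  \<comment> \<open>A nonempty list already has the code of its head and tail, so after the exchange
    one symbol 2 builds the argument of \<open>g\<close>.\<close>
  let ?n = "Seq (Pop 2) c" and ?c = "Seq swap (Seq (Push 2 2) d)"
  show ?thesis
  proof (rule cmpI)
    fix x
    let ?r = "case l x of [] \<Rightarrow> f x | y # ys \<Rightarrow> g x y ys"
    have "does b (Branch 2 1 ?n ?c) (ser (tr (l x)) @ ser (tr x)) (ser (tr ?r))
       (10 + 31 * (sz x + sz (l x)) + T x + U' x)"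
    proof (cases "l x")
      case Nil
      have *: "does b ?n (1 # ser (tr x)) (ser (tr (f x))) (Suc (length (ser (tr x)) + 1 + T x))"
        by (rule does_Seq[OF does_Pop c(2)]) auto
      have "does b (Branch 2 1 ?n ?c) (1 # ser (tr x)) (ser (tr (f x)))
          (10 + 31 * (sz x + sz (l x)) + T x + U' x)"
        by (rule does_mono[OF does_Branch1[OF *]]) (use d(3) in \<open>auto simp: sz_def swap_def\<close>)
      then show ?thesis using Nil by (simp add: tr_simps)
    next
      case (Cons y ys)
      have *: "does b ?c (ser (tr (l x)) @ ser (tr x)) (ser (tr (g x y ys)))
        (Suc (30 * (length (ser (tr (l x))) + length (ser (tr x))) +
         Suc (length (ser (tr x) @ ser (tr (l x))) + 1 + U (x, y, ys))))"
      proof (rule does_Seq[OF does_swap does_Seq[OF does_Push]])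
        show "does b d (2 # ser (tr x) @ ser (tr (l x))) (ser (tr (g x y ys))) (U (x, y, ys))"
          using d(2)[of "(x, y, ys)"] Cons by (simp add: tr_simps)
      qed simp
      have "does b (Branch 2 1 ?n ?c) (ser (tr (l x)) @ ser (tr x)) (ser (tr (g x y ys)))
          (10 + 31 * (sz x + sz (l x)) + T x + U' x)"
        by (rule does_mono[OF does_Branch2[OF *]])
          (use c(3) Cons in \<open>auto simp: sz_def tr_simps U'_def\<close>)
      then show ?thesis using Cons by simp
    qed
    from does_Seq[OF does_dup does_Seq[OF does_frame[OF e(2)] this]]
    show "does b (Seq dup (Seq ce (Branch 2 1 ?n ?c))) (ser (tr x)) (ser (tr ?r))
      (Suc (40 * sz x + Suc (Te x + sz x + (10 + 31 * (sz x + sz (l x)) + T x + U' x))))"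
      by (simp add: sz_def)
  qed (intro polybd_Suc polybd_add polybd_mult polybd_const c(1) U' e(1) polybd_sz_id
      polybd_sz[OF assms(1)])
qed

text \<open>Rounds reuse the same space, so only the time is multiplied by their number. This is
  what admits exponentially long loops when \<open>b\<close> is false.\<close>

lemma does_Loop:
  assumes body: "\<And>i. i < n \<Longrightarrow> does b c (p i) (p (Suc i)) K"
    and tops: "\<And>i. i < n \<Longrightarrow> p i \<noteq> [] \<and> hd (p i) \<noteq> a" "p n \<noteq> []" "hd (p n) = a"
    and K: "length (p n) \<le> K" and wf: "wf_com 6 c"
  shows "does b (Loop 2 a c) (p 0) (p n) (K + (if b then n * (K + 1) + 1 else 1))"
proof -
  have "\<exists>t. exec m (Loop 2 a c) (main (p i @ r)) t (main (p n @ r)) \<and> (b \<longrightarrow> t \<le> (n - i) * (K + 1) + 1)"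
    if m: "length r + K \<le> m" and "i \<le> n" for r m i
    using that(2)
  proof (induction "n - i" arbitrary: i)
    case 0
    then have i: "i = n" by simp
    have "peek (main (p n @ r) 2) = a" using tops(2,3) by (cases "p n") auto
    moreover have "low m (main (p n @ r))" using m K by (simp add: low_stk)
    ultimately show ?case unfolding i by (intro exI[of _ "Suc 0"]) (auto intro: exec_Loop1)
  next
    case (Suc k)
    then have i: "i < n" "k = n - Suc i" by auto
    obtain t where t: "exec m c (main (p i @ r)) t (main (p (Suc i) @ r))" "b \<longrightarrow> t \<le> K"
      using doesD[OF body[OF i(1)] m] by blast
    obtain t' where t': "exec m (Loop 2 a c) (main (p (Suc i) @ r)) t' (main (p n @ r))"
      "b \<longrightarrow> t' \<le> (n - Suc i) * (K + 1) + 1"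
      using Suc.hyps(1)[OF i(2)] i(1) by auto
    have "peek (main (p i @ r) 2) \<noteq> a" using tops(1)[OF i(1)] by (cases "p i") auto
    then have "exec m (Loop 2 a c) (main (p i @ r)) (Suc (t + t')) (main (p n @ r))"
      using t(1) t'(1) by (rule exec_Loop2)
    moreover have "n - i = Suc (n - Suc i)" using i by simp
    ultimately show ?case using t(2) t'(2) by (intro exI[of _ "Suc (t + t')"]) auto
  qed
  note run = this
  show ?thesis unfolding does_def
  proof (intro conjI allI impI)
    fix r :: "nat list" and m assume "length r + (K + (if b then n * (K + 1) + 1 else 1)) \<le> m"
    then have "length r + K \<le> m" by simp
    from run[OF this, of 0] obtain t where "exec m (Loop 2 a c) (main (p 0 @ r)) t (main (p n @ r))"
      "b \<longrightarrow> t \<le> n * (K + 1) + 1" by auto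
    then show "\<exists>t. exec m (Loop 2 a c) (main (p 0 @ r)) t (main (p n @ r)) \<and>
       (b \<longrightarrow> t \<le> K + (if b then n * (K + 1) + 1 else 1))"
      by (intro exI[of _ t]) auto
  qed (use wf in simp)
qed

text \<open>The truth value of the condition is cached above the state, where the loop test reads it
  as one symbol. All intermediate states must be polynomially small; the number of rounds is
  restricted only in the time class.\<close>

lemma cmp_while:
  fixes init :: "'a::rep \<Rightarrow> 's::rep" and f :: "'s \<Rightarrow> 's"
  assumes init: "cmp b init" and body: "cmp b f" and cond: "cmp b P" and G: "polybd G"
    and run: "\<And>x. \<exists>n. F x = (f ^^ n) (init x) \<and> \<not> P ((f ^^ n) (init x)) \<and>
      (\<forall>i<n. P ((f ^^ i) (init x))) \<and> (\<forall>i\<le>n. sz ((f ^^ i) (init x)) \<le> G x) \<and> (b \<longrightarrow> n \<le> G x)"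
  shows "cmp b F"
proof -
  obtain ci Ti where ci: "polybd Ti" "\<And>x. does b ci (ser (tr x)) (ser (tr (init x))) (Ti x)"
    by (rule cmpE[OF init]) auto
  obtain cb Tb where cb: "polybd Tb" "\<And>x. does b cb (ser (tr x)) (ser (tr (f x))) (Tb x)"
    "wf_com 6 cb"
    by (rule cmpE[OF body]) auto
  obtain cp Tp where cp: "polybd Tp" "\<And>x. does b cp (ser (tr x)) (ser (tr (P x))) (Tp x)"
    "wf_com 6 cp"
    by (rule cmpE[OF cond]) auto
  from cb(1) obtain pb where pb: "\<forall>x. Tb x \<le> poly pb (sz x)" unfolding polybd_def by (elim exE)
  from cp(1) obtain pp where pp: "\<forall>x. Tp x \<le> poly pp (sz x)" unfolding polybd_def by (elim exE)
  define K where "K g = 100 + 50 * g + poly pb g + poly pp g" for g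
  \<comment> \<open>The three pops remove the cached \<open>True\<close> that let the loop
    continue.\<close>
  let ?w = "Seq (Pop 2) (Seq (Pop 2) (Seq (Pop 2) (Seq cb (Seq dup cp))))"
  let ?T = "\<lambda>x. Suc (Ti x + Suc (40 * sz (init x) + Suc (K (G x) +
      Suc ((K (G x) + (G x * (K (G x) + 1) + 1)) + (G x + 1)))))"
  show ?thesis
  proof (rule cmpI)
    show "polybd ?T" unfolding K_def
      by (intro polybd_Suc polybd_add polybd_mult polybd_const polybd_poly ci(1) G polybd_sz[OF init])
  next
    fix x :: 'a
    obtain n where n: "F x = (f ^^ n) (init x)" "\<not> P ((f ^^ n) (init x))"
      "\<And>i. i < n \<Longrightarrow> P ((f ^^ i) (init x))" "\<And>i. i \<le> n \<Longrightarrow> sz ((f ^^ i) (init x)) \<le> G x" "b \<longrightarrow> n \<le> G x"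
      using run by metis
    define s :: "nat \<Rightarrow> 's" where "s i = (f ^^ i) (init x)" for i
    define p :: "nat \<Rightarrow> nat list" where "p i = ser (tr (P (s i))) @ ser (tr (s i))" for i
    have le: "Tb (s i) \<le> poly pb (G x)" "Tp (s i) \<le> poly pp (G x)" "sz (s i) \<le> G x" if "i \<le> n" for i
      using n(4)[OF that] pb pp poly_nat_mono[of "sz (s i)" "G x"]
      by (auto simp: s_def intro: le_trans)
    have w: "does b ?w (p i) (p (Suc i)) (K (G x))" if i: "i < n" for i
    proof -
      have s': "s (Suc i) = f (s i)" by (simp add: s_def)
      have "does b ?w (2 # 1 # 1 # ser (tr (s i))) (ser (tr (P (f (s i)))) @ ser (tr (f (s i))))
         (Suc (length (1 # 1 # ser (tr (s i))) + 1 + Suc (length (1 # ser (tr (s i))) + 1 +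
          Suc (length (ser (tr (s i))) + 1 +
          Suc (Tb (s i) + Suc (40 * length (ser (tr (f (s i)))) + (Tp (f (s i)) + length (ser (tr (f (s i)))))))))))"
        by (rule does_Seq[OF does_Pop does_Seq[OF does_Pop does_Seq[OF does_Pop does_Seq[OF cb(2)
              does_Seq[OF does_dup does_frame[OF cp(2)]]]]]]) auto
      then have "does b ?w (2 # 1 # 1 # ser (tr (s i))) (ser (tr (P (f (s i)))) @ ser (tr (f (s i)))) (K (G x))"
        by (rule does_mono) (use le[of i] le[of "Suc i"] i in \<open>simp add: K_def s' flip: sz_def\<close>)
      then show ?thesis using n(3)[OF i] by (simp add: p_def s' tr_simps flip: s_def)
    qed
    have "length (p n) \<le> K (G x)"
      using le(3)[of n] n(2) by (simp add: p_def tr_simps K_def flip: s_def sz_def)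
    then have "does b (Loop 2 1 ?w) (p 0) (p n) (K (G x) + (if b then n * (K (G x) + 1) + 1 else 1))"
      using n(2,3) cb(3) cp(3) by (intro does_Loop w) (auto simp: p_def tr_simps dup_def s_def)
    moreover have "(if b then n * (K (G x) + 1) + 1 else 1) \<le> G x * (K (G x) + 1) + 1"
      using n(5) mult_le_mono1[of n "G x" "K (G x) + 1"] by auto
    ultimately have "does b (Loop 2 1 ?w) (p 0) (p n) (K (G x) + (G x * (K (G x) + 1) + 1))"
      by (rule does_mono[OF _ add_left_mono])
    then have loop: "does b (Loop 2 1 ?w) (ser (tr (P (init x))) @ ser (tr (init x))) (1 # ser (tr (F x)))
        (K (G x) + (G x * (K (G x) + 1) + 1))"
      using n(1,2) by (simp add: p_def s_def tr_simps)
    have cond: "does b cp (ser (tr (init x)) @ ser (tr (init x))) (ser (tr (P (init x))) @ ser (tr (init x))) (K (G x))"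
      using le[of 0] by (intro does_mono[OF does_frame[OF cp(2)]]) (auto simp: K_def s_def sz_def)
    have pop: "does b (Pop 2) (1 # ser (tr (F x))) (ser (tr (F x))) (G x + 1)"
      using le(3)[of n] n(1) by (intro does_mono[OF does_Pop]) (auto simp: s_def sz_def)
    show "does b (Seq ci (Seq dup (Seq cp (Seq (Loop 2 1 ?w) (Pop 2))))) (ser (tr x)) (ser (tr (F x))) (?T x)"
      using does_Seq[OF ci(2) does_Seq[OF does_dup does_Seq[OF cond does_Seq[OF loop pop]]]]
      by (simp add: sz_def)
  qed
qed

section \<open>Programs as Turing machines\<close>

definition read_word :: com where
  "read_word = Seq (Push 2 1) (Loop 0 0 (Branch 0 2
     (Seq (Pop 0) (Seq (Push 2 1) (Seq (Push 2 1) (Seq (Push 2 2) (Push 2 2)))))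
     (Seq (Pop 0) (Seq (Push 2 1) (Push 2 2)))))"

definition write_word :: com where
  "write_word = Loop 2 1 (Seq (Pop 2) (Branch 2 2
     (Seq (Pop 2) (Seq (Pop 2) (Seq (Pop 2) (Push 1 2))))
     (Seq (Pop 2) (Push 1 1))))"

lemma sz_bool: "1 \<le> sz (b :: bool)" "sz b \<le> 3"
  by (cases b; simp)+

lemma sz_word: "sz (w :: bool list) \<le> 4 * length w + 1" "2 * length w + 1 \<le> sz w"
proof -
  have "sz w \<le> 4 * length w + 1 \<and> 2 * length w + 1 \<le> sz w"
  proof (induction w)
    case (Cons b w)
    then show ?case using sz_bool[of b] by simp
  qed simp
  then show "sz w \<le> 4 * length w + 1" "2 * length w + 1 \<le> sz w" by auto
qed

lemma ex_Pop0: "low m (stk (v # i) u a x c d) \<Longrightarrow> v \<noteq> 0 \<Longrightarrow>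
    ex m (Pop 0) (stk (v # i) u a x c d) 1 (stk i u a x c d)"
  using ex_Pop[of m "stk (v # i) u a x c d" 0] by simp

lemma ex_Push1: "low m (stk i u a x c d) \<Longrightarrow> length u < m \<Longrightarrow>
    ex m (Push 1 v) (stk i u a x c d) 1 (stk i (v # u) a x c d)"
  using ex_Push[of m "stk i u a x c d" 1 v] by simp

text \<open>The last input bit is on top, so the list is built from its end and needs no
  reversal.\<close>

lemma ex_read_loop:
  assumes "sz (u @ v) \<le> m"
  shows "ex m (Loop 0 0 (Branch 0 2
     (Seq (Pop 0) (Seq (Push 2 1) (Seq (Push 2 1) (Seq (Push 2 2) (Push 2 2)))))
     (Seq (Pop 0) (Seq (Push 2 1) (Push 2 2)))))
    (stk (map bit_symbol (rev u)) [] (ser (tr v)) [] [] []) (12 * length u + 1) (main (ser (tr (u @ v))))"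
  using assms
proof (induction u arbitrary: v rule: rev_induct)
  case Nil
  then show ?case by (auto intro!: ex_Loop1[unfolded One_nat_def] simp: low_stk sz_def)
next
  case (snoc x u)
  let ?s = "stk (map bit_symbol (rev (u @ [x]))) [] (ser (tr v)) [] [] []"
  have app: "sz (u @ v) = sz v + sz u - 1" for u v :: "bool list"
  proof (induction u)
    case (Cons b u)
    have "0 < sz u" by simp
    with Cons show ?case by simp
  qed simp
  have "2 * length u + 1 \<le> sz u" by (rule sz_word)
  then have m: "length u + sz (x # v) \<le> m" "0 < sz v"
    using snoc.prems app[of u "x # v"] by auto
  have B: "ex m (Branch 0 2
     (Seq (Pop 0) (Seq (Push 2 1) (Seq (Push 2 1) (Seq (Push 2 2) (Push 2 2)))))
     (Seq (Pop 0) (Seq (Push 2 1) (Push 2 2)))) ?s 10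
     (stk (map bit_symbol (rev u)) [] (ser (tr (x # v))) [] [] [])"
  proof (cases x)
    case True
    have "ex m (Seq (Pop 0) (Seq (Push 2 1) (Seq (Push 2 1) (Seq (Push 2 2) (Push 2 2)))))
      (stk (2 # map bit_symbol (rev u)) [] (ser (tr v)) [] [] [])
      (Suc (1 + Suc (1 + Suc (1 + Suc (1 + 1)))))
      (stk (map bit_symbol (rev u)) [] (2 # 2 # 1 # 1 # ser (tr v)) [] [] [])"
      by (rule ex_Seq[OF ex_Pop0 ex_Seq[OF ex_Push2 ex_Seq[OF ex_Push2 ex_Seq[OF ex_Push2 ex_Push2]]]])
        (use m True in \<open>auto simp: low_stk sz_def tr_simps\<close>)
    with True show ?thesis
      by (intro ex_mono[OF ex_Branch1]) (auto simp: bit_symbol_def tr_simps)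
  next
    case False
    have "ex m (Seq (Pop 0) (Seq (Push 2 1) (Push 2 2)))
      (stk (1 # map bit_symbol (rev u)) [] (ser (tr v)) [] [] [])
      (Suc (1 + Suc (1 + 1)))
      (stk (map bit_symbol (rev u)) [] (2 # 1 # ser (tr v)) [] [] [])"
      by (rule ex_Seq[OF ex_Pop0 ex_Seq[OF ex_Push2 ex_Push2]])
        (use m False in \<open>auto simp: low_stk sz_def tr_simps\<close>)
    with False show ?thesis
      by (intro ex_mono[OF ex_Branch2]) (auto simp: bit_symbol_def tr_simps)
  qed
  have IH: "ex m (Loop 0 0 (Branch 0 2
     (Seq (Pop 0) (Seq (Push 2 1) (Seq (Push 2 1) (Seq (Push 2 2) (Push 2 2)))))
     (Seq (Pop 0) (Seq (Push 2 1) (Push 2 2)))))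
    (stk (map bit_symbol (rev u)) [] (ser (tr (x # v))) [] [] []) (12 * length u + 1)
    (main (ser (tr ((u @ [x]) @ v))))"
    using snoc.IH[of "x # v"] snoc.prems by simp
  show ?case
    by (rule ex_mono[OF ex_Loop2[OF _ B IH]]) (simp_all add: bit_symbol_def)
qed

text \<open>Writing from the front puts the first bit at the bottom of stack 1, which is cell 0 of
  the output tape.\<close>

lemma ex_write_word:
  assumes "length u + length w + 10 + sz w \<le> m"
  shows "ex m write_word (stk [] u (ser (tr w)) [] [] []) (12 * length w + 1)
    (stk [] (map bit_symbol (rev w) @ u) [1] [] [] [])"
  using assms
proof (induction w arbitrary: u)
  case Nil
  then show ?case unfolding write_word_def
    by (auto intro!: ex_Loop1[unfolded One_nat_def] simp: low_stk tr_simps)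
next
  case (Cons x w)
  let ?s = "stk [] u (ser (tr (x # w))) [] [] []"
  note m = Cons.prems
  have B: "ex m (Seq (Pop 2) (Branch 2 2
     (Seq (Pop 2) (Seq (Pop 2) (Seq (Pop 2) (Push 1 2))))
     (Seq (Pop 2) (Push 1 1)))) ?s 10
     (stk [] (bit_symbol x # u) (ser (tr w)) [] [] [])"
  proof (cases x)
    case True
    have "ex m (Seq (Pop 2) (Seq (Pop 2) (Seq (Pop 2) (Push 1 2))))
      (stk [] u (2 # 1 # 1 # ser (tr w)) [] [] []) (Suc (1 + Suc (1 + Suc (1 + 1))))
      (stk [] (2 # u) (ser (tr w)) [] [] [])"
      by (rule ex_Seq[OF ex_Pop2 ex_Seq[OF ex_Pop2 ex_Seq[OF ex_Pop2 ex_Push1]]])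
        (use m True in \<open>auto simp: low_stk sz_def tr_simps\<close>)
    then have "ex m (Branch 2 2
     (Seq (Pop 2) (Seq (Pop 2) (Seq (Pop 2) (Push 1 2))))
     (Seq (Pop 2) (Push 1 1))) (stk [] u (2 # 1 # 1 # ser (tr w)) [] [] []) 8
      (stk [] (2 # u) (ser (tr w)) [] [] [])"
      by (intro ex_mono[OF ex_Branch1]) auto
    from ex_Seq[OF ex_Pop2[of m _ _ 2] this] have "ex m (Seq (Pop 2) (Branch 2 2
     (Seq (Pop 2) (Seq (Pop 2) (Seq (Pop 2) (Push 1 2))))
     (Seq (Pop 2) (Push 1 1)))) (stk [] u (2 # 2 # 1 # 1 # ser (tr w)) [] [] []) (Suc (1 + 8))
      (stk [] (2 # u) (ser (tr w)) [] [] [])"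
      using m True by (auto simp: low_stk sz_def tr_simps)
    with True show ?thesis by (simp add: bit_symbol_def tr_simps)
  next
    case False
    have "ex m (Seq (Pop 2) (Push 1 1))
      (stk [] u (1 # ser (tr w)) [] [] []) (Suc (1 + 1))
      (stk [] (1 # u) (ser (tr w)) [] [] [])"
      by (rule ex_Seq[OF ex_Pop2 ex_Push1])
        (use m False in \<open>auto simp: low_stk sz_def tr_simps\<close>)
    then have "ex m (Branch 2 2
     (Seq (Pop 2) (Seq (Pop 2) (Seq (Pop 2) (Push 1 2))))
     (Seq (Pop 2) (Push 1 1))) (stk [] u (1 # ser (tr w)) [] [] []) 8
      (stk [] (1 # u) (ser (tr w)) [] [] [])"
      by (intro ex_mono[OF ex_Branch2]) auto
    from ex_Seq[OF ex_Pop2[of m _ _ 2] this] have "ex m (Seq (Pop 2) (Branch 2 2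
     (Seq (Pop 2) (Seq (Pop 2) (Seq (Pop 2) (Push 1 2))))
     (Seq (Pop 2) (Push 1 1)))) (stk [] u (2 # 1 # ser (tr w)) [] [] []) (Suc (1 + 8))
      (stk [] (1 # u) (ser (tr w)) [] [] [])"
      using m False by (auto simp: low_stk sz_def tr_simps)
    with False show ?thesis by (simp add: bit_symbol_def tr_simps)
  qed
  have IH: "ex m write_word (stk [] (bit_symbol x # u) (ser (tr w)) [] [] []) (12 * length w + 1)
    (stk [] (map bit_symbol (rev (x # w)) @ u) [1] [] [] [])"
    using Cons.IH[of "bit_symbol x # u"] m by simp
  show ?case
    unfolding write_word_def
    by (rule ex_mono[OF ex_Loop2[OF _ B IH[unfolded write_word_def]]]) (simp_all add: tr_simps)
qed

theorem cmp_tm: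
  fixes f :: "bool list \<Rightarrow> bool list"
  assumes "cmp b f"
  shows "\<exists>M p. tm M \<and> computes_in_space M f (poly p) \<and> (b \<longrightarrow> computes_in_time M f (poly p)) \<and>
    (\<forall>w i. fst (tm_config M w i) = 1 \<longrightarrow>
       snd (tm_config M w i) ! 1 = stack_tape (map bit_symbol (rev (f w))))"
proof -
  obtain c T where c: "polybd T" "\<And>x. does b c (ser (tr x)) (ser (tr (f x))) (T x)" "wf_com 6 c"
    by (rule cmpE[OF assms]) auto
  from c(1) obtain q where q: "\<forall>w. T w \<le> poly q (sz w)" unfolding polybd_def by (elim exE)
  define m where "m w = T w + sz w + 2 * sz (f w) + 20" for w
  let ?c = "Seq read_word (Seq c write_word)"
  define s' where "s' w = stk [] (map bit_symbol (rev (f w))) [1] [] [] []" for w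
  have "\<exists>t. exec (m w) ?c (input_stacks w) t (s' w) \<and> (b \<longrightarrow> t \<le> 30 * m w)" for w
  proof -
    have l: "2 * length w + 1 \<le> sz w" "2 * length (f w) + 1 \<le> sz (f w)" by (rule sz_word)+
    have "input_stacks w = stk (map bit_symbol (rev w)) [] [] [] [] []"
      by (auto simp: input_stacks_def stk_def fun_eq_iff)
    moreover have "ex (m w) read_word (stk (map bit_symbol (rev w)) [] [] [] [] [])
        (Suc (1 + (12 * length w + 1))) (main (ser (tr w)))"
      unfolding read_word_def
    proof (rule ex_Seq[OF ex_Push2])
      show "ex (m w) (Loop 0 0 (Branch 0 2
         (Seq (Pop 0) (Seq (Push 2 1) (Seq (Push 2 1) (Seq (Push 2 2) (Push 2 2)))))
         (Seq (Pop 0) (Seq (Push 2 1) (Push 2 2)))))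
         (stk (map bit_symbol (rev w)) [] [1] [] [] []) (12 * length w + 1) (main (ser (tr w)))"
        using ex_read_loop[of w "[]" "m w"] by (simp add: tr_simps m_def)
    qed (use l in \<open>auto simp: low_stk m_def\<close>)
    ultimately obtain t1 where t1: "exec (m w) read_word (input_stacks w) t1 (main (ser (tr w)))"
      "t1 \<le> Suc (1 + (12 * length w + 1))" by (auto simp: ex_def)
    obtain t2 where t2: "exec (m w) c (main (ser (tr w))) t2 (main (ser (tr (f w))))" "b \<longrightarrow> t2 \<le> T w"
      using doesD[OF c(2)[of w], of "[]" "m w"] by (auto simp: m_def)
    obtain t3 where t3: "exec (m w) write_word (main (ser (tr (f w)))) t3 (s' w)" "t3 \<le> 12 * length (f w) + 1"
      using ex_write_word[of "[]" "f w" "m w"] l by (auto simp: ex_def m_def s'_def)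
    have "exec (m w) ?c (input_stacks w) (Suc (t1 + Suc (t2 + t3))) (s' w)"
      by (intro exec_Seq[OF t1(1) exec_Seq[OF t2(1) t3(1)]])
    moreover have "b \<longrightarrow> Suc (t1 + Suc (t2 + t3)) \<le> 30 * m w"
      using t1(2) t2(2) t3(2) l by (auto simp: m_def)
    ultimately show ?thesis by blast
  qed
  then obtain t where t: "\<And>w. exec (m w) ?c (input_stacks w) (t w) (s' w)" "\<And>w. b \<longrightarrow> t w \<le> 30 * m w"
    by metis
  have "wf_com 6 ?c" using c(3) by (simp add: read_word_def write_word_def)
  from exec_tm[OF this _ t(1), of f] obtain M where M: "tm M"
    "\<And>w. \<exists>n\<le>2 * t w + length w + 1. tm_outputs M w n (f w)"
    "\<And>w i. \<forall>T\<in>set (snd (tm_config M w i)). \<bar>snd T\<bar> \<le> int (Suc (m w))"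
    "\<And>w i. fst (tm_config M w i) = 1 \<Longrightarrow> snd (tm_config M w i) ! 1 = stack_tape (s' w 1)"
    by (auto simp: s'_def)
  obtain r where r: "\<forall>w. sz (f w) \<le> poly r (sz w)"
    using polybd_sz[OF assms] unfolding polybd_def by (elim exE)
  \<comment> \<open>The program takes at most 30 times \<open>m w\<close> steps and compilation
    doubles this; a further \<open>m w\<close> covers the head positions. Below,
    \<open>[:1, 4:]\<close> converts the length of a word into a bound on its tree size.\<close>
  define P where "P = [:61:] * (q + [:0, 1:] + [:2:] * r + [:20:])"
  define p where "p = pcompose P [:1, 4:] + [:1, 1:]"
  have "61 * m w \<le> poly P (sz w)" for w
    using q r by (simp add: m_def P_def add_mono)
  also have "poly P (sz w) \<le> poly P (4 * length w + 1)" for w :: "bool list"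
    by (rule poly_nat_mono[OF sz_word(1)])
  finally have p: "61 * m w + length w + 1 \<le> poly p (length w)" for w
    by (simp add: p_def poly_pcompose mult.commute)
  have "computes_in_space M f (poly p)"
    unfolding computes_in_space_def
  proof (intro allI conjI ballI)
    fix w i T assume "T \<in> set (snd (tm_config M w i))"
    then have "\<bar>snd T\<bar> \<le> int (Suc (m w))" using M(3) by blast
    also have "\<dots> \<le> int (poly p (length w))" using p[of w] by simp
    finally show "\<bar>snd T\<bar> \<le> int (poly p (length w))" .
  qed (use M(2) in blast)
  moreover have "computes_in_time M f (poly p)" if b
    unfolding computes_in_time_def
  proof
    fix w
    have "2 * t w + length w + 1 \<le> poly p (length w)"
      using p[of w] t(2)[of w] that by simp
    then show "\<exists>t\<le>poly p (length w). tm_outputs M w t (f w)"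
      using M(2)[of w] by (meson le_trans)
  qed
  moreover have "s' w 1 = map bit_symbol (rev (f w))" for w by (simp add: s'_def)
  ultimately show ?thesis using M(1,4) by (intro exI[of _ M] exI[of _ p]) auto
qed

section \<open>Closure properties\<close>

named_theorems cmp_intro

declare cmp_id [cmp_intro] cmp_const [cmp_intro] cmp_Pair [cmp_intro] cmp_Cons [cmp_intro]
  cmp_fst [cmp_intro] cmp_snd [cmp_intro] cmp_eq [cmp_intro] cmp_if [cmp_intro]

lemmas polybd_intro = polybd_Suc polybd_add polybd_mult polybd_const polybd_poly polybd_sz_id polybd_sz[of False]

lemma cmp_comp2:
  assumes "cmp b (\<lambda>q. g (fst q) (snd q))" "cmp b c" "cmp b d"
  shows "cmp b (\<lambda>x. g (c x) (d x))"
  using cmp_comp[OF assms(1) cmp_Pair[OF assms(2,3)]] by simp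

lemma cmp_comp3:
  assumes "cmp b (\<lambda>q. g (fst q) (fst (snd q)) (snd (snd q)))" "cmp b c" "cmp b d" "cmp b e"
  shows "cmp b (\<lambda>x. g (c x) (d x) (e x))"
  using cmp_comp[OF assms(1) cmp_Pair[OF assms(2) cmp_Pair[OF assms(3,4)]]] by simp

lemma cmp_comp4:
  assumes "cmp b (\<lambda>q. g (fst q) (fst (snd q)) (fst (snd (snd q))) (snd (snd (snd q))))"
    "cmp b c" "cmp b d" "cmp b e" "cmp b f"
  shows "cmp b (\<lambda>x. g (c x) (d x) (e x) (f x))"
  using cmp_comp[OF assms(1) cmp_Pair[OF assms(2) cmp_Pair[OF assms(3) cmp_Pair[OF assms(4,5)]]]]
  by simp

lemma cmp_not [cmp_intro]:
  assumes "cmp b P"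
  shows "cmp b (\<lambda>x. \<not> P x)"
proof -
  have "(\<lambda>x. \<not> P x) = (\<lambda>x. if P x then False else True)" by auto
  then show ?thesis by (simp only:) (intro cmp_intro assms)
qed

lemma cmp_conj [cmp_intro]:
  assumes "cmp b P" "cmp b Q"
  shows "cmp b (\<lambda>x. P x \<and> Q x)"
proof -
  have "(\<lambda>x. P x \<and> Q x) = (\<lambda>x. if P x then Q x else False)" by auto
  then show ?thesis by (simp only:) (intro cmp_intro assms)
qed

lemma cmp_disj [cmp_intro]:
  assumes "cmp b P" "cmp b Q"
  shows "cmp b (\<lambda>x. P x \<or> Q x)"
proof -
  have "(\<lambda>x. P x \<or> Q x) = (\<lambda>x. if P x then True else Q x)" by auto
  then show ?thesis by (simp only:) (intro cmp_intro assms)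
qed

lemma cmp_imp [cmp_intro]:
  assumes "cmp b P" "cmp b Q"
  shows "cmp b (\<lambda>x. P x \<longrightarrow> Q x)"
proof -
  have "(\<lambda>x. P x \<longrightarrow> Q x) = (\<lambda>x. if P x then Q x else True)" by auto
  then show ?thesis by (simp only:) (intro cmp_intro assms)
qed

declare cmp_case_list [cmp_intro]

text \<open>The unspecified \<open>hd []\<close> is still one fixed value and can be wired in as a
  constant. Thus \<open>hd (drop i l)\<close> serves as total, computable indexing.\<close>

lemma cmp_hd [cmp_intro]: "cmp b l \<Longrightarrow> cmp b (\<lambda>x. hd (l x))"
proof -
  assume l: "cmp b l"
  have "cmp b (\<lambda>x. case l x of [] \<Rightarrow> hd [] | y # ys \<Rightarrow> y)"
    by (intro cmp_intro l)
  moreover have "(case l x of [] \<Rightarrow> hd [] | y # ys \<Rightarrow> y) = hd (l x)" for x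
    by (cases "l x") auto
  ultimately show ?thesis by simp
qed

lemma cmp_tl [cmp_intro]: "cmp b l \<Longrightarrow> cmp b (\<lambda>x. tl (l x))"
proof -
  assume l: "cmp b l"
  have "cmp b (\<lambda>x. case l x of [] \<Rightarrow> [] | y # ys \<Rightarrow> ys)"
    by (intro cmp_intro l)
  moreover have "(case l x of [] \<Rightarrow> [] | y # ys \<Rightarrow> ys) = tl (l x)" for x
    by (cases "l x") auto
  ultimately show ?thesis by simp
qed

subsection \<open>Lists\<close>

lemma sz_list: "sz xs = Suc (\<Sum>x\<leftarrow>xs. Suc (sz x))"
  by (induction xs) auto

lemma sz_append: "sz (xs @ ys) + 1 = sz xs + sz ys"
  by (simp add: sz_list)

lemma sz_rev [simp]: "sz (rev xs) = sz xs"
  by (simp add: sz_list rev_map[symmetric])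

lemma sz_append_le: "sz xs \<le> sz (xs @ ys)" "sz ys \<le> sz (xs @ ys)"
  by (simp_all add: sz_list)

lemma sz_take: "sz (take n xs) \<le> sz xs"
  using sz_append_le(1)[of "take n xs" "drop n xs"] by simp

lemma sz_drop: "sz (drop n xs) \<le> sz xs"
  using sz_append_le(2)[of "drop n xs" "take n xs"] by simp

lemma length_le_sz: "length xs < sz xs"
  by (induction xs) auto

lemma sz_elem: "x \<in> set xs \<Longrightarrow> sz x < sz xs"
  by (induction xs) auto

lemma sz_list_le:
  assumes "\<And>x. x \<in> set xs \<Longrightarrow> sz x \<le> B"
  shows "sz xs \<le> Suc (length xs * Suc B)"
  using assms
proof (induction xs)
  case (Cons x xs)
  then have "sz x \<le> B" "sz xs \<le> Suc (length xs * Suc B)" by auto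
  then show ?case by simp
qed simp

lemma cmp_rev [cmp_intro]:
  fixes l :: "'a::rep \<Rightarrow> 'e::rep list"
  assumes l: "cmp b l"
  shows "cmp b (\<lambda>x. rev (l x))"
proof -
  define f where "f s = (case fst s of [] \<Rightarrow> s | y # ys \<Rightarrow> (ys, y # snd s))"
    for s :: "'e list \<times> 'e list"
  have it: "(f ^^ i) (xs, []) = (drop i xs, rev (take i xs))" if "i \<le> length xs" for i xs
    using that
  proof (induction i)
    case (Suc i)
    then have "drop i xs = xs ! i # drop (Suc i) xs" "take (Suc i) xs = take i xs @ [xs ! i]"
      by (auto simp: Cons_nth_drop_Suc take_Suc_conv_app_nth)
    with Suc show ?case by (simp add: f_def)
  qed simp
  have "cmp b (\<lambda>x. ([] :: 'e list, rev (l x)))"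
  proof (rule cmp_while)
    show "cmp b (\<lambda>x. (l x, []))" by (intro cmp_intro l)
    show "cmp b f" unfolding f_def by (intro cmp_intro)
    show "cmp b (\<lambda>s :: 'e list \<times> 'e list. fst s \<noteq> [])" by (intro cmp_intro)
    show "polybd (\<lambda>x. Suc (sz (l x) + sz (l x)))" by (intro polybd_intro l[THEN cmp_space])
    fix x
    have "sz ((f ^^ i) (l x, [])) \<le> Suc (sz (l x) + sz (l x))" if "i \<le> length (l x)" for i
      using it[OF that] sz_take[of i "l x"] sz_drop[of i "l x"] by simp
    then show "\<exists>n. ([], rev (l x)) = (f ^^ n) (l x, []) \<and> \<not> fst ((f ^^ n) (l x, [])) \<noteq> [] \<and>
      (\<forall>i<n. fst ((f ^^ i) (l x, [])) \<noteq> []) \<and>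
      (\<forall>i\<le>n. sz ((f ^^ i) (l x, [])) \<le> Suc (sz (l x) + sz (l x))) \<and>
      (b \<longrightarrow> n \<le> Suc (sz (l x) + sz (l x)))"
      using length_le_sz[of "l x"] by (intro exI[of _ "length (l x)"]) (auto simp: it)
  qed
  from cmp_snd[OF this] show ?thesis by simp
qed

text \<open>List recursion is run from the right end, on the reversed list.\<close>

lemma cmp_rec_list:
  fixes l :: "'a::rep \<Rightarrow> 'e::rep list" and z :: "'a \<Rightarrow> 'r::rep"
  assumes l: "cmp b l" and z: "cmp b z"
    and g: "cmp b (\<lambda>q. g (fst q) (fst (snd q)) (fst (snd (snd q))) (snd (snd (snd q))))"
    and G: "polybd G" "\<And>x ys zs. l x = zs @ ys \<Longrightarrow> sz (rec_list (z x) (g x) ys) \<le> G x"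
  shows "cmp b (\<lambda>x. rec_list (z x) (g x) (l x))"
proof -
  define R where "R x ys = rec_list (z x) (g x) ys" for x ys
  define f where "f s = (case fst (snd s) of [] \<Rightarrow> s | y # t \<Rightarrow>
      (fst s, t, y # fst (snd (snd s)), g (fst s) y (fst (snd (snd s))) (snd (snd (snd s)))))"
    for s :: "'a \<times> 'e list \<times> 'e list \<times> 'r"
  have it: "(f ^^ i) (x, rev xs, [], R x []) =
      (x, rev (take (length xs - i) xs), drop (length xs - i) xs, R x (drop (length xs - i) xs))"
    if "i \<le> length xs" for i x xs
    using that
  proof (induction i)
    case (Suc i)
    define k where "k = length xs - Suc i"
    have k: "length xs - i = Suc k" "k < length xs" using Suc.prems by (auto simp: k_def)
    then have "drop k xs = xs ! k # drop (Suc k) xs" "take (Suc k) xs = take k xs @ [xs ! k]"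
      by (auto simp: Cons_nth_drop_Suc take_Suc_conv_app_nth)
    with Suc k show ?case by (simp add: f_def R_def flip: k_def)
  qed simp
  let ?i = "\<lambda>x. (x, rev (l x), [], R x [])" and ?G = "\<lambda>x. 3 + sz x + (sz (l x) + sz (l x)) + G x"
  have "cmp b (\<lambda>x. (x, [] :: 'e list, l x, R x (l x)))"
  proof (rule cmp_while)
    show "cmp b ?i" unfolding R_def by (simp, intro cmp_intro l z)
    show "cmp b f" unfolding f_def by (intro cmp_intro cmp_comp4[OF g])
    show "cmp b (\<lambda>s :: 'a \<times> 'e list \<times> 'e list \<times> 'r. fst (snd s) \<noteq> [])" by (intro cmp_intro)
    show "polybd ?G" by (intro polybd_intro l[THEN cmp_space] G)
    fix x
    have "sz ((f ^^ i) (?i x)) \<le> ?G x" if "i \<le> length (l x)" for i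
    proof -
      have "sz (R x (drop (length (l x) - i) (l x))) \<le> G x"
        unfolding R_def by (rule G(2)[of _ "take (length (l x) - i) (l x)"]) simp
      then show ?thesis
        using sz_take[of "length (l x) - i" "l x"] sz_drop[of "length (l x) - i" "l x"]
        by (simp add: it[OF that])
    qed
    then show "\<exists>n. (x, [], l x, R x (l x)) = (f ^^ n) (?i x) \<and> \<not> fst (snd ((f ^^ n) (?i x))) \<noteq> [] \<and>
      (\<forall>i<n. fst (snd ((f ^^ i) (?i x))) \<noteq> []) \<and> (\<forall>i\<le>n. sz ((f ^^ i) (?i x)) \<le> ?G x) \<and> (b \<longrightarrow> n \<le> ?G x)"
      using length_le_sz[of "l x"] by (intro exI[of _ "length (l x)"]) (auto simp: it)
  qed
  from cmp_snd[OF cmp_snd[OF cmp_snd[OF this]]] show ?thesis by (simp add: R_def)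
qed

lemma cmp_append [cmp_intro]:
  assumes "cmp b f" "cmp b g"
  shows "cmp b (\<lambda>x. f x @ g x)"
proof -
  have rec: "rec_list ys (\<lambda>y _ r. y # r) xs = xs @ ys" for xs ys :: "'b list"
    by (induction xs) auto
  have "cmp b (\<lambda>x. rec_list (g x) (\<lambda>y _ r. y # r) (f x))"
  proof (rule cmp_rec_list[OF assms])
    show "cmp b (\<lambda>q. fst (snd q) # snd (snd (snd q)))" by (intro cmp_intro)
    show "polybd (\<lambda>x. sz (f x) + sz (g x))" by (intro polybd_intro assms[THEN cmp_space])
    show "sz (rec_list (g x) (\<lambda>y _ r. y # r) ys) \<le> sz (f x) + sz (g x)" if "f x = zs @ ys" for x ys zs
      using sz_append[of zs "ys @ g x"] sz_append[of ys "g x"] sz_append_le(2)[of ys zs] that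
      by (simp add: rec)
  qed
  then show ?thesis by (simp add: rec)
qed

lemma cmp_map [cmp_intro]:
  assumes f: "cmp b (\<lambda>q. f (fst q) (snd q))" and l: "cmp b l"
  shows "cmp b (\<lambda>x. map (f x) (l x))"
proof -
  have rec: "rec_list [] (\<lambda>y _ r. h y # r) xs = map h xs" for h xs
    by (induction xs) auto
  from polybd_sz[OF f] obtain p where p: "\<forall>q. sz (f (fst q) (snd q)) \<le> poly p (sz q)"
    unfolding polybd_def by (elim exE)
  let ?G = "\<lambda>x. Suc (sz (l x) * Suc (poly p (Suc (sz x + sz (l x)))))"
  have "cmp b (\<lambda>x. rec_list [] (\<lambda>y _ r. f x y # r) (l x))"
  proof (rule cmp_rec_list[OF l])
    show "cmp b (\<lambda>q. f (fst q) (fst (snd q)) # snd (snd (snd q)))"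
      by (intro cmp_intro cmp_comp2[OF f])
    show "polybd ?G" by (intro polybd_intro l[THEN cmp_space])
    fix x ys zs assume lx: "l x = zs @ ys"
    have "sz (f x y) \<le> poly p (Suc (sz x + sz (l x)))" if "y \<in> set ys" for y
    proof -
      have "sz (f x y) \<le> poly p (sz (x, y))" using p[rule_format, of "(x, y)"] by simp
      also have "\<dots> \<le> poly p (Suc (sz x + sz (l x)))"
        using sz_elem[of y "l x"] that lx by (intro poly_nat_mono) simp
      finally show ?thesis .
    qed
    then have "sz (map (f x) ys) \<le> Suc (length (map (f x) ys) * Suc (poly p (Suc (sz x + sz (l x)))))"
      by (intro sz_list_le) auto
    also have "\<dots> \<le> ?G x"
      using length_le_sz[of "l x"] lx by (simp add: add_mono mult_le_mono1 del: mult_Suc_right)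
    finally show "sz (rec_list [] (\<lambda>y _ r. f x y # r) ys) \<le> ?G x" by (simp add: rec)
  qed (rule cmp_const)
  then show ?thesis by (simp add: rec)
qed

lemma sz_concat: "sz (concat xs) \<le> sz xs"
proof (induction xs)
  case (Cons x xs)
  then show ?case using sz_append[of x "concat xs"] by simp
qed simp

lemma cmp_concat [cmp_intro]:
  assumes "cmp b l"
  shows "cmp b (\<lambda>x. concat (l x))"
proof -
  have rec: "rec_list [] (\<lambda>y _ r. y @ r) xs = concat xs" for xs :: "'b list list"
    by (induction xs) auto
  have "cmp b (\<lambda>x. rec_list [] (\<lambda>y _ r. y @ r) (l x))"
  proof (rule cmp_rec_list[OF assms])
    show "cmp b (\<lambda>q. fst (snd q) @ snd (snd (snd q)))" by (intro cmp_intro)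
    show "polybd (\<lambda>x. sz (l x))" by (intro polybd_intro assms[THEN cmp_space])
    show "sz (rec_list [] (\<lambda>y _ r. y @ r) ys) \<le> sz (l x)" if "l x = zs @ ys" for x ys zs
      using sz_concat[of ys] sz_append_le(2)[of ys zs] that by (simp add: rec)
  qed (rule cmp_const)
  then show ?thesis by (simp add: rec)
qed

lemma cmp_list_all [cmp_intro]:
  assumes f: "cmp b (\<lambda>q. P (fst q) (snd q))" and l: "cmp b l"
  shows "cmp b (\<lambda>x. \<forall>y\<in>set (l x). P x y)"
proof -
  have rec: "rec_list True (\<lambda>y _ r. Q y \<and> r) xs = (\<forall>y\<in>set xs. Q y)" for Q xs
    by (induction xs) auto
  have "cmp b (\<lambda>x. rec_list True (\<lambda>y _ r. P x y \<and> r) (l x))"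
  proof (rule cmp_rec_list[OF l])
    show "cmp b (\<lambda>q. P (fst q) (fst (snd q)) \<and> snd (snd (snd q)))"
      by (intro cmp_intro cmp_comp2[OF f])
    show "polybd (\<lambda>x :: 'a. 3)" by (intro polybd_intro)
    show "sz (rec_list True (\<lambda>y _ r. P x y \<and> r) ys) \<le> 3" for x ys
      by (rule sz_bool)
  qed (rule cmp_const)
  then show ?thesis by (simp add: rec)
qed

lemma cmp_list_ex [cmp_intro]:
  assumes f: "cmp b (\<lambda>q. P (fst q) (snd q))" and l: "cmp b l"
  shows "cmp b (\<lambda>x. \<exists>y\<in>set (l x). P x y)"
  using cmp_not[OF cmp_list_all[OF cmp_not[OF f] l]] by simp

lemma cmp_member [cmp_intro]:
  assumes "cmp b f" "cmp b l"
  shows "cmp b (\<lambda>x. f x \<in> set (l x))"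
proof -
  have "cmp b (\<lambda>x. \<exists>y\<in>set (l x). f x = y)"
    by (intro cmp_list_ex cmp_eq cmp_comp[OF assms(1)] cmp_intro assms)
  then show ?thesis by simp
qed

subsection \<open>Natural numbers in binary\<close>

definition unbin :: "bool list \<Rightarrow> nat" where
  "unbin = rec_list 0 (\<lambda>b _ r. of_bool b + 2 * r)"

lemma unbin_simps [simp]: "unbin [] = 0" "unbin (b # bs) = of_bool b + 2 * unbin bs"
  by (simp_all add: unbin_def)

lemma unbin_bin [simp]: "unbin (bin n) = n"
proof (induction n rule: bin.induct)
  case (1 n)
  show ?case
  proof (cases "n = 0")
    case True
    then show ?thesis by (simp add: bin.simps)
  next
    case False
    then show ?thesis using 1[OF False]
      by (subst bin.simps) (simp add: of_bool_odd_eq_mod_2)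
  qed
qed

lemma bin_0 [simp]: "bin 0 = []"
  by (simp add: bin.simps)

lemma bin_double: "bin (of_bool b + 2 * n) = (if b \<or> n \<noteq> 0 then b # bin n else [])"
  by (subst bin.simps) auto

lemma bin_inj [simp]: "bin m = bin n \<longleftrightarrow> m = n"
  by (metis unbin_bin)

instantiation nat :: rep
begin
definition "tr_nat n = tr (bin n)"
instance by standard (simp add: tr_nat_def)
end

lemma cmp_nat: "cmp b (\<lambda>x. bin (h x)) \<Longrightarrow> cmp b h"
  by (erule cmp_tr) (simp add: tr_nat_def)

lemma cmp_bin [cmp_intro]: "cmp b h \<Longrightarrow> cmp b (\<lambda>x. bin (h x))"
  by (erule cmp_tr) (simp add: tr_nat_def)

lemma sz_nat_bin: "sz (n :: nat) = sz (bin n)"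
  by (simp add: sz_def tr_nat_def)

lemma bin_length: "n < 2 ^ k \<Longrightarrow> length (bin n) \<le> k"
proof (induction k arbitrary: n)
  case (Suc k)
  show ?case
  proof (cases "n = 0")
    case False
    then have "bin n = odd n # bin (n div 2)" by (subst bin.simps) simp
    moreover have "n div 2 < 2 ^ k" using Suc.prems by auto
    ultimately show ?thesis using Suc.IH by simp
  qed simp
qed simp

lemma unbin_less: "unbin bs < 2 ^ length bs"
  by (induction bs) (auto simp: of_bool_def)

lemma sz_nat: "n < 2 ^ k \<Longrightarrow> sz (n :: nat) \<le> 4 * k + 1"
  using sz_word(1)[of "bin n"] bin_length[of n k] by (simp add: sz_nat_bin)

lemma nat_less_sz: "n < 2 ^ sz n" for n :: nat
proof -
  have "n < 2 ^ length (bin n)" using unbin_less[of "bin n"] by simp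
  also have "\<dots> \<le> 2 ^ sz n"
    using length_le_sz[of "bin n"] by (intro power_increasing) (auto simp: sz_nat_bin)
  finally show ?thesis .
qed

text \<open>The size of a numeral is not monotone, because the digit \<open>True\<close> has a
  larger tree than \<open>False\<close>; hence the factor.\<close>

lemma sz_nat_mono: "m \<le> n \<Longrightarrow> sz m \<le> 4 * sz n + 1" for m n :: nat
  using nat_less_sz[of n] by (intro sz_nat) simp

lemma sz_nat_le: "sz n \<le> 4 * n + 1" for n :: nat
  using sz_nat[of n n] by simp

lemma cmp_Suc [cmp_intro]:
  assumes "cmp b f"
  shows "cmp b (\<lambda>x. Suc (f x))"
proof -
  define inc where "inc = rec_list [True] (\<lambda>b bs r. if b then False # r else True # bs)"
  have inc: "inc [] = [True]" "inc (b # bs) = (if b then False # inc bs else True # bs)" for b bs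
    by (simp_all add: inc_def)
  have "inc (bin n) = bin (Suc n)" for n
  proof (induction n rule: bin.induct)
    case (1 n)
    show ?case
    proof (cases "n = 0")
      case False
      then have "bin n = odd n # bin (n div 2)" by (subst bin.simps) simp
      moreover have "bin (Suc n) = even n # bin (Suc n div 2)" by (subst bin.simps) simp
      ultimately show ?thesis using 1[OF False] by (auto simp: inc elim: oddE evenE)
    qed (simp add: inc bin.simps)
  qed
  moreover have "cmp b (\<lambda>x. inc (bin (f x)))"
    unfolding inc_def
  proof (rule cmp_rec_list)
    show "cmp b (\<lambda>x. bin (f x))" by (intro cmp_intro assms)
    show "cmp b (\<lambda>q. if fst (snd q) then False # snd (snd (snd q)) else True # fst (snd (snd q)))"
      by (intro cmp_intro)
    show "polybd (\<lambda>x. 4 * (sz (bin (f x)) + 1) + 1)"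
      by (intro polybd_intro cmp_intro assms[THEN cmp_space])
    fix x ys zs assume "bin (f x) = zs @ ys"
    then have "length ys \<le> sz (bin (f x))" using length_le_sz[of "bin (f x)"] by simp
    moreover have "length (inc ys) \<le> length ys + 1" by (induction ys) (auto simp: inc)
    ultimately show "sz (rec_list [True] (\<lambda>b bs r. if b then False # r else True # bs) ys)
        \<le> 4 * (sz (bin (f x)) + 1) + 1"
      using sz_word(1)[of "inc ys"] unfolding inc_def[symmetric] by arith
  qed (rule cmp_const)
  ultimately show ?thesis by (intro cmp_nat) simp
qed

lemma cmp_pred:
  fixes f :: "'a::rep \<Rightarrow> nat"
  assumes "cmp b f"
  shows "cmp b (\<lambda>x. f x - 1)"
proof -
  define dec where "dec = rec_list [] (\<lambda>b bs r. if b then (if bs = [] then [] else False # bs) else True # r)"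
  have dec: "dec [] = []" "dec (b # bs) = (if b then (if bs = [] then [] else False # bs) else True # dec bs)" for b bs
    by (simp_all add: dec_def)
  have "dec (bin n) = bin (n - 1)" for n
  proof (induction n rule: bin.induct)
    case (1 n)
    show ?case
    proof (cases "n = 0")
      case False
      then have n: "bin n = odd n # bin (n div 2)" by (subst bin.simps) simp
      show ?thesis
      proof (cases "odd n")
        case True
        then obtain k where "n = 2 * k + 1" by (elim oddE)
        then show ?thesis using n bin_double[of False k] bin_inj[of k 0] by (auto simp: dec)
      next
        case e: False
        then obtain k where k: "n = 2 * k" by auto
        with False obtain j where "k = Suc j" by (cases k) auto
        then show ?thesis using n 1[OF False] bin_double[of True j] k by (simp add: dec)
      qed
    qed (simp add: dec bin.simps)
  qed
  moreover have "cmp b (\<lambda>x. dec (bin (f x)))"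
    unfolding dec_def
  proof (rule cmp_rec_list)
    show "cmp b (\<lambda>x. bin (f x))" by (intro cmp_intro assms)
    show "cmp b (\<lambda>q. if fst (snd q) then (if fst (snd (snd q)) = [] then [] else False # fst (snd (snd q)))
        else True # snd (snd (snd q)))"
      by (intro cmp_intro)
    show "polybd (\<lambda>x. 4 * sz (bin (f x)) + 1)"
      by (intro polybd_intro cmp_intro assms[THEN cmp_space])
    fix x ys zs assume "bin (f x) = zs @ ys"
    then have "length ys \<le> sz (bin (f x))" using length_le_sz[of "bin (f x)"] by simp
    moreover have "length (dec ys) \<le> length ys" by (induction ys) (auto simp: dec)
    ultimately show "sz (rec_list [] (\<lambda>b bs r. if b then (if bs = [] then [] else False # bs) else True # r) ys)
        \<le> 4 * sz (bin (f x)) + 1"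
      using sz_word(1)[of "dec ys"] unfolding dec_def[symmetric] by arith
  qed (rule cmp_const)
  ultimately show ?thesis by (intro cmp_nat) simp
qed

lemma cmp_unbin [cmp_intro]:
  assumes "cmp b f"
  shows "cmp b (\<lambda>x. unbin (f x))"
proof -
  define norm where "norm = rec_list [] (\<lambda>b (_ :: bool list) r. if b then True # r else if r = [] then [] else False # r)"
  have norm: "norm [] = []" "norm (b # bs) = (if b then True # norm bs else if norm bs = [] then [] else False # norm bs)" for b bs
    by (simp_all add: norm_def)
  have "norm bs = bin (unbin bs)" for bs
  proof (induction bs)
    case (Cons b bs)
    then show ?case using bin_inj[of "unbin bs" 0] by (simp add: norm bin_double del: bin_inj)
  qed (simp add: norm)
  moreover have "cmp b (\<lambda>x. norm (f x))"
    unfolding norm_def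
  proof (rule cmp_rec_list[OF assms])
    show "cmp b (\<lambda>q. if fst (snd q) then True # snd (snd (snd q)) else if snd (snd (snd q)) = [] then []
        else False # snd (snd (snd q)))"
      by (intro cmp_intro)
    show "polybd (\<lambda>x. 4 * sz (f x) + 1)"
      by (intro polybd_intro assms[THEN cmp_space])
    fix x ys zs assume "f x = zs @ ys"
    then have "length ys \<le> sz (f x)" using length_le_sz[of "f x"] by simp
    moreover have "length (norm ys) \<le> length ys" by (induction ys) (auto simp: norm)
    ultimately show "sz (rec_list [] (\<lambda>b (_ :: bool list) r. if b then True # r else if r = [] then [] else False # r) ys)
        \<le> 4 * sz (f x) + 1"
      using sz_word(1)[of "norm ys"] unfolding norm_def[symmetric] by arith
  qed (rule cmp_const)
  ultimately show ?thesis by (intro cmp_nat) simp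
qed

lemma cmp_length [cmp_intro]:
  assumes "cmp b l"
  shows "cmp b (\<lambda>x. length (l x))"
proof -
  have rec: "rec_list 0 (\<lambda>y _ r. Suc r) xs = length xs" for xs :: "'b list"
    by (induction xs) auto
  have "cmp b (\<lambda>x. rec_list 0 (\<lambda>y _ r. Suc r) (l x))"
  proof (rule cmp_rec_list[OF assms])
    show "cmp b (\<lambda>q. Suc (snd (snd (snd q))))" by (intro cmp_intro)
    show "polybd (\<lambda>x. 4 * sz (l x) + 1)" by (intro polybd_intro assms[THEN cmp_space])
    show "sz (rec_list 0 (\<lambda>y _ r. Suc r) ys) \<le> 4 * sz (l x) + 1" if "l x = zs @ ys" for x ys zs
      using length_le_sz[of "l x"] sz_nat_le[of "length ys"] that by (simp add: rec)
  qed (rule cmp_const)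
  then show ?thesis by (simp add: rec)
qed

text \<open>Exponentially long iterations are allowed in polynomial space.\<close>

lemma cmp_funpow:
  fixes s :: "'a::rep \<Rightarrow> 's::rep" and F :: "'a \<Rightarrow> 's \<Rightarrow> 's"
  assumes F: "cmp False (\<lambda>q. F (fst q) (snd q))" and n: "cmp False n" and s: "cmp False s"
    and G: "polybd G" "\<And>x i. i \<le> n x \<Longrightarrow> sz ((F x ^^ i) (s x)) \<le> G x"
  shows "cmp False (\<lambda>x. (F x ^^ n x) (s x))"
proof -
  define f where "f p = (fst p, fst (snd p) - 1, F (fst p) (snd (snd p)))" for p :: "'a \<times> nat \<times> 's"
  have it: "(f ^^ i) (x, k, y) = (x, k - i, (F x ^^ i) y)" for i x k y
    by (induction i) (simp_all add: f_def)
  let ?i = "\<lambda>x. (x, n x, s x)" and ?G = "\<lambda>x. sz x + (4 * sz (n x) + 1) + G x + 2"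
  have "cmp False (\<lambda>x. (x, 0 :: nat, (F x ^^ n x) (s x)))"
  proof (rule cmp_while)
    show "cmp False ?i" by (intro cmp_intro n s)
    show "cmp False f" unfolding f_def by (intro cmp_intro cmp_pred cmp_comp2[OF F])
    show "cmp False (\<lambda>p :: 'a \<times> nat \<times> 's. fst (snd p) \<noteq> 0)" by (intro cmp_intro)
    show "polybd ?G" by (intro polybd_intro n G)
    fix x
    have "sz ((f ^^ i) (?i x)) \<le> ?G x" if "i \<le> n x" for i
      using G(2)[OF that] sz_nat_mono[of "n x - i" "n x"] by (simp add: it)
    then show "\<exists>m. (x, 0 :: nat, (F x ^^ n x) (s x)) = (f ^^ m) (?i x) \<and> \<not> fst (snd ((f ^^ m) (?i x))) \<noteq> 0 \<and>
      (\<forall>i<m. fst (snd ((f ^^ i) (?i x))) \<noteq> 0) \<and> (\<forall>i\<le>m. sz ((f ^^ i) (?i x)) \<le> ?G x) \<and> (False \<longrightarrow> m \<le> ?G x)"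
      by (intro exI[of _ "n x"]) (auto simp: it)
  qed
  from cmp_snd[OF cmp_snd[OF this]] show ?thesis by simp
qed

lemma nat_prod_bound: "a < 2 ^ k \<Longrightarrow> b < 2 ^ l \<Longrightarrow> a * b < 2 ^ (k + l)" for a b :: nat
  by (simp add: power_add mult_strict_mono)

text \<open>In polynomial space one may add by counting, at the price of exponentially many steps.
  Multiplication, power and division are obtained from it in the same way, which is why they are
  stated for \<open>False\<close>.\<close>

lemma cmp_add [cmp_intro]:
  fixes f g :: "'a::rep \<Rightarrow> nat"
  assumes "cmp False f" "cmp False g"
  shows "cmp False (\<lambda>x. f x + g x)"
proof -
  have it: "(Suc ^^ i) a = a + i" for i a by (induction i) auto
  have "cmp False (\<lambda>x. (Suc ^^ g x) (f x))"
  proof (rule cmp_funpow[OF _ assms(2,1)])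
    show "cmp False (\<lambda>q :: 'a \<times> nat. Suc (snd q))" by (intro cmp_intro)
    show "polybd (\<lambda>x. 4 * (sz (f x) + sz (g x)) + 1)" by (intro polybd_intro assms)
    fix x i assume "i \<le> g x"
    then have "f x + i \<le> f x + g x" by simp
    also have "\<dots> < 2 ^ (sz (f x) + sz (g x))"
    proof -
      have "f x + 1 \<le> 2 ^ sz (f x)" "g x + 1 \<le> 2 ^ sz (g x)"
        using nat_less_sz[of "f x"] nat_less_sz[of "g x"] by auto
      from mult_le_mono[OF this] show ?thesis by (simp add: power_add algebra_simps)
    qed
    finally show "sz ((Suc ^^ i) (f x)) \<le> 4 * (sz (f x) + sz (g x)) + 1"
      unfolding it by (rule sz_nat)
  qed
  then show ?thesis by (simp only: it)
qed

lemma cmp_diff [cmp_intro]: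
  fixes f g :: "'a::rep \<Rightarrow> nat"
  assumes "cmp False f" "cmp False g"
  shows "cmp False (\<lambda>x. f x - g x)"
proof -
  have it: "((\<lambda>n. n - 1) ^^ i) a = a - i" for i a :: nat by (induction i) auto
  have "cmp False (\<lambda>x. ((\<lambda>n. n - 1) ^^ g x) (f x))"
  proof (rule cmp_funpow[OF _ assms(2,1)])
    show "cmp False (\<lambda>q :: 'a \<times> nat. snd q - 1)" by (intro cmp_pred cmp_intro)
    show "polybd (\<lambda>x. 4 * sz (f x) + 1)" by (intro polybd_intro assms)
    show "sz (((\<lambda>n. n - 1) ^^ i) (f x)) \<le> 4 * sz (f x) + 1" for x i
      unfolding it by (rule sz_nat_mono) simp
  qed
  then show ?thesis by (simp only: it)
qed

lemma cmp_mult [cmp_intro]: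
  fixes f g :: "'a::rep \<Rightarrow> nat"
  assumes "cmp False f" "cmp False g"
  shows "cmp False (\<lambda>x. f x * g x)"
proof -
  have it: "((+) a ^^ i) 0 = a * i" for i a :: nat by (induction i) auto
  have "cmp False (\<lambda>x. ((+) (f x) ^^ g x) 0)"
  proof (rule cmp_funpow[OF _ assms(2) cmp_const])
    show "cmp False (\<lambda>q. f (fst q) + snd q)" by (intro cmp_intro cmp_comp[OF assms(1)])
    show "polybd (\<lambda>x. 4 * (sz (f x) + sz (g x)) + 1)" by (intro polybd_intro assms)
    fix x i assume "i \<le> g x"
    then have "f x * i \<le> f x * g x" by simp
    also have "\<dots> < 2 ^ (sz (f x) + sz (g x))" by (intro nat_prod_bound nat_less_sz)
    finally show "sz (((+) (f x) ^^ i) 0) \<le> 4 * (sz (f x) + sz (g x)) + 1"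
      unfolding it by (rule sz_nat)
  qed
  then show ?thesis by (simp only: it)
qed

lemma cmp_le [cmp_intro]:
  fixes f g :: "'a::rep \<Rightarrow> nat"
  assumes "cmp False f" "cmp False g"
  shows "cmp False (\<lambda>x. f x \<le> g x)"
proof -
  have "(\<lambda>x. f x \<le> g x) = (\<lambda>x. f x - g x = 0)" by auto
  then show ?thesis by (simp only:) (intro cmp_intro assms)
qed

lemma cmp_less [cmp_intro]:
  fixes f g :: "'a::rep \<Rightarrow> nat"
  assumes "cmp False f" "cmp False g"
  shows "cmp False (\<lambda>x. f x < g x)"
proof -
  have "(\<lambda>x. f x < g x) = (\<lambda>x. Suc (f x) \<le> g x)" by (auto simp: Suc_le_eq)
  then show ?thesis by (simp only:) (intro cmp_intro assms)
qed

lemma cmp_power [cmp_intro]: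
  fixes f :: "'a::rep \<Rightarrow> nat"
  assumes "cmp False f"
  shows "cmp False (\<lambda>x. f x ^ k)"
  by (induction k) (simp_all only: power_0 power_Suc, intro cmp_intro, intro cmp_intro assms)

text \<open>The exponent has to be polynomial in value and not merely in length, since the result
  has about that many digits.\<close>

lemma cmp_powers [cmp_intro]:
  fixes f g :: "'a::rep \<Rightarrow> nat"
  assumes "cmp False f" "cmp False g" "polybd g"
  shows "cmp False (\<lambda>x. f x ^ g x)"
proof -
  have it: "((*) a ^^ i) 1 = a ^ i" for i a :: nat by (induction i) auto
  have "cmp False (\<lambda>x. ((*) (f x) ^^ g x) (1 :: nat))"
  proof (rule cmp_funpow[OF _ assms(2) cmp_const])
    show "cmp False (\<lambda>q. f (fst q) * snd q)" by (intro cmp_intro cmp_comp[OF assms(1)])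
    show "polybd (\<lambda>x. 4 * (sz (f x) * g x + 1) + 1)" by (intro polybd_intro assms)
    fix x i assume i: "i \<le> g x"
    have "f x ^ i \<le> (2 ^ sz (f x)) ^ i"
      using nat_less_sz[of "f x"] by (intro power_mono) auto
    also have "\<dots> \<le> 2 ^ (sz (f x) * g x)"
      using i by (auto simp flip: power_mult intro!: power_increasing)
    also have "\<dots> < 2 ^ (sz (f x) * g x + 1)" by simp
    finally show "sz (((*) (f x) ^^ i) 1) \<le> 4 * (sz (f x) * g x + 1) + 1"
      unfolding it by (rule sz_nat)
  qed
  then show ?thesis by (simp only: it)
qed

text \<open>The quotient is counted up while its successor still fits; the guard keeps it at 0 when
  the divisor is 0.\<close>

lemma cmp_div [cmp_intro]:
  fixes f g :: "'a::rep \<Rightarrow> nat"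
  assumes "cmp False f" "cmp False g"
  shows "cmp False (\<lambda>x. f x div g x)"
proof -
  define F where "F x q = (if g x \<noteq> 0 \<and> Suc q * g x \<le> f x then Suc q else q)" for x q
  have it: "(F x ^^ i) 0 = min i (f x div g x)" for i x
  proof (induction i)
    case (Suc i)
    show ?case
    proof (cases "g x = 0")
      case False
      then have "Suc q * g x \<le> f x \<longleftrightarrow> Suc q \<le> f x div g x" for q
        by (simp add: less_eq_div_iff_mult_less_eq)
      with Suc False show ?thesis by (auto simp: F_def min_def)
    qed (use Suc in \<open>simp add: F_def\<close>)
  qed simp
  have "cmp False (\<lambda>x. (F x ^^ f x) 0)"
  proof (rule cmp_funpow[OF _ assms(1) cmp_const])
    show "cmp False (\<lambda>q. F (fst q) (snd q))" unfolding F_def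
      by (intro cmp_intro cmp_comp[OF assms(1)] cmp_comp[OF assms(2)])
    show "polybd (\<lambda>x. 4 * sz (f x) + 1)" by (intro polybd_intro assms)
    show "sz ((F x ^^ i) 0) \<le> 4 * sz (f x) + 1" for x i
      unfolding it by (rule sz_nat_mono) (simp add: min.coboundedI2)
  qed
  then show ?thesis by (simp add: it min_absorb2)
qed

lemma cmp_mod [cmp_intro]:
  fixes f g :: "'a::rep \<Rightarrow> nat"
  assumes "cmp False f" "cmp False g"
  shows "cmp False (\<lambda>x. f x mod g x)"
proof -
  have "(\<lambda>x. f x mod g x) = (\<lambda>x. f x - f x div g x * g x)"
    by (simp add: modulo_nat_def)
  then show ?thesis by (simp only:) (intro cmp_intro assms)
qed

lemma cmp_all_less [cmp_intro]:
  assumes P: "cmp False (\<lambda>q. P (fst q) (snd q))" and n: "cmp False n"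
  shows "cmp False (\<lambda>x. \<forall>i<n x. P x (i :: nat))"
proof -
  define F where "F x s = (Suc (fst s), snd s \<and> P x (fst s))" for x and s :: "nat \<times> bool"
  have it: "(F x ^^ i) (0, True) = (i, \<forall>j<i. P x j)" for i x
    by (induction i) (auto simp: F_def less_Suc_eq)
  have "cmp False (\<lambda>x. (F x ^^ n x) (0, True))"
  proof (rule cmp_funpow[OF _ n cmp_const])
    show "cmp False (\<lambda>q. F (fst q) (snd q))" unfolding F_def
      by (intro cmp_intro cmp_comp2[OF P])
    show "polybd (\<lambda>x. Suc ((4 * sz (n x) + 1) + 3))" by (intro polybd_intro n)
    show "sz ((F x ^^ i) (0, True)) \<le> Suc ((4 * sz (n x) + 1) + 3)" if "i \<le> n x" for x i
      using sz_nat_mono[OF that] sz_bool(2)[of "\<forall>j<i. P x j"] unfolding it by simp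
  qed
  from cmp_snd[OF this] show ?thesis by (simp only: it snd_conv)
qed

lemma cmp_dvd [cmp_intro]:
  fixes f g :: "'a::rep \<Rightarrow> nat"
  assumes "cmp False f" "cmp False g"
  shows "cmp False (\<lambda>x. f x dvd g x)"
  unfolding dvd_eq_mod_eq_0 by (intro cmp_intro assms)

lemma cmp_drop [cmp_intro]:
  assumes n: "cmp False n" and l: "cmp False l"
  shows "cmp False (\<lambda>x. drop (n x) (l x))"
proof -
  have it: "(tl ^^ i) xs = drop i xs" for i and xs :: "'b list"
    by (induction i) (auto simp: drop_Suc tl_drop)
  have "cmp False (\<lambda>x. (tl ^^ n x) (l x))"
  proof (rule cmp_funpow[OF _ n l])
    show "cmp False (\<lambda>q :: 'a \<times> 'b list. tl (snd q))" by (intro cmp_intro)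
    show "polybd (\<lambda>x. sz (l x))" by (intro polybd_intro l)
    show "sz ((tl ^^ i) (l x)) \<le> sz (l x)" for x i unfolding it by (rule sz_drop)
  qed
  then show ?thesis by (simp only: it)
qed

lemma cmp_replicate [cmp_intro]:
  assumes n: "cmp False n" "polybd n" and f: "cmp False f"
  shows "cmp False (\<lambda>x. replicate (n x) (f x))"
proof -
  have it: "((#) a ^^ i) [] = replicate i a" for i and a :: 'b
    by (induction i) auto
  have "cmp False (\<lambda>x. ((#) (f x) ^^ n x) [])"
  proof (rule cmp_funpow[OF _ n(1) cmp_const])
    show "cmp False (\<lambda>q. f (fst q) # snd q)" by (intro cmp_intro cmp_comp[OF f])
    show "polybd (\<lambda>x. Suc (n x * Suc (sz (f x))))" by (intro polybd_intro f n)
    show "sz (((#) (f x) ^^ i) []) \<le> Suc (n x * Suc (sz (f x)))" if "i \<le> n x" for x i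
      using mult_le_mono1[OF that, of "Suc (sz (f x))"] unfolding it
      by (simp add: sz_list sum_list_replicate)
  qed
  then show ?thesis by (simp only: it)
qed

subsection \<open>Bounded recursion\<close>

text \<open>A recursive procedure whose body is a loop of \<open>J x\<close> recursive calls: the \<open>j\<close>-th call is
  \<open>q x j a\<close>, where \<open>a\<close> is the accumulator, and \<open>u x j a r\<close> updates the accumulator with its
  result \<open>r\<close>.  If the depth is polynomial, polynomial space suffices even for exponential \<open>J x\<close>.\<close>

locale loop_recursion =
  fixes J :: "'x::rep \<Rightarrow> nat" and q :: "'x \<Rightarrow> nat \<Rightarrow> 'acc::rep \<Rightarrow> 'x"
    and u :: "'x \<Rightarrow> nat \<Rightarrow> 'acc \<Rightarrow> 'r::rep \<Rightarrow> 'acc" and out :: "'x \<Rightarrow> 'acc \<Rightarrow> 'r"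
    and init :: "'x \<Rightarrow> 'acc"
begin

primrec acc :: "('x \<Rightarrow> 'r) \<Rightarrow> 'x \<Rightarrow> nat \<Rightarrow> 'acc" where
  "acc F x 0 = init x"
| "acc F x (Suc j) = u x j (acc F x j) (F (q x j (acc F x j)))"

text \<open>The first argument is fuel. Without fuel the loop is skipped, which is correct exactly
  where \<open>J x\<close> is 0.\<close>

primrec val :: "nat \<Rightarrow> 'x \<Rightarrow> 'r" where
  "val 0 x = out x (init x)"
| "val (Suc t) x = out x (acc (val t) x (J x))"

text \<open>An explicit call stack of frames \<open>(x, j, a)\<close>. The second component holds at
  most one returned result, and its presence tells a return from a call.\<close>

definition step :: "('x \<times> nat \<times> 'acc) list \<times> 'r list \<Rightarrow> ('x \<times> nat \<times> 'acc) list \<times> 'r list" where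
  "step s = (case fst s of [] \<Rightarrow> s | f # fs \<Rightarrow>
     (case snd s of
        [] \<Rightarrow> if fst (snd f) < J (fst f)
          then ((q (fst f) (fst (snd f)) (snd (snd f)), 0,
                 init (q (fst f) (fst (snd f)) (snd (snd f)))) # f # fs, [])
          else (fs, [out (fst f) (snd (snd f))])
      | r # _ \<Rightarrow> ((fst f, Suc (fst (snd f)), u (fst f) (fst (snd f)) (snd (snd f)) r) # fs, [])))"

definition runs where
  "runs P s n s' \<longleftrightarrow> (step ^^ n) s = s' \<and> (\<forall>i<n. P ((step ^^ i) s))"

lemma runs_0: "runs P s 0 s"
  by (simp add: runs_def)

lemma runs_Suc: "P s \<Longrightarrow> runs P (step s) n s' \<Longrightarrow> runs P s (Suc n) s'"
  by (auto simp: runs_def less_Suc_eq_0_disj funpow_swap1)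

lemma runs_trans:
  assumes "runs P s n s'" "runs P s' m s''"
  shows "runs P s (n + m) s''"
  using assms
proof (induction n arbitrary: s)
  case 0
  then show ?case by (simp add: runs_def)
next
  case (Suc n)
  then have "P s" "runs P (step s) n s'" by (auto simp: runs_def funpow_swap1 dest: spec[of _ "Suc _"])
  with Suc show ?case using runs_Suc by auto
qed

lemma runs_mono: "runs P s n s' \<Longrightarrow> (\<And>s. P s \<Longrightarrow> Q s) \<Longrightarrow> runs Q s n s'"
  by (auto simp: runs_def)

text \<open>\<open>gs\<close> is the part of the stack above the frames \<open>fs\<close> of the
  callers. It is nonempty until the call returns, and it has at most one frame per level of
  depth.\<close>

definition small :: "nat \<Rightarrow> ('x \<times> nat \<times> 'acc) list \<Rightarrow> nat \<Rightarrow> ('x \<times> nat \<times> 'acc) list \<times> 'r list \<Rightarrow> bool"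
where
  "small K fs m s \<longleftrightarrow> (\<exists>gs. gs \<noteq> [] \<and> fst s = gs @ fs \<and> length gs \<le> m \<and>
     (\<forall>g\<in>set gs. sz g \<le> K) \<and> sz (snd s) \<le> K)"

lemma small_push: "small K (f # fs) m s \<Longrightarrow> sz f \<le> K \<Longrightarrow> small K fs (Suc m) s"
  unfolding small_def
  by (elim exE, rename_tac gs, rule_tac x = "gs @ [f]" in exI) auto

text \<open>\<open>B t x\<close> marks \<open>x\<close> as a legitimate call of depth at most
  \<open>t\<close>. The outer induction is on the depth, the inner one on the number of calls still
  to be made. In \<open>size\<close> the fuel \<open>t - 1\<close> is that of the calls issued by
  \<open>x\<close>; for \<open>t\<close> equal to 0 there are none.\<close>

lemma machine_correct:
  assumes B0: "\<And>x. B 0 x \<Longrightarrow> J x = 0"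
    and size: "\<And>t x j. B t x \<Longrightarrow> j \<le> J x \<Longrightarrow> sz (x, j, acc (val (t - 1)) x j) \<le> K"
    and call: "\<And>t x j. B (Suc t) x \<Longrightarrow> j < J x \<Longrightarrow> B t (q x j (acc (val t) x j))"
    and ret: "\<And>t x. B t x \<Longrightarrow> sz [val t x] \<le> K" and K: "1 \<le> K"
    and x: "B t x"
  shows "\<exists>n. runs (small K fs (Suc t)) ((x, 0, init x) # fs, []) n (fs, [val t x])"
  using x
proof (induction t arbitrary: x fs)
  case 0
  then have "step ((x, 0, init x) # fs, []) = (fs, [val 0 x])"
    using B0 by (simp add: step_def)
  moreover have "small K fs (Suc 0) ((x, 0, init x) # fs, [])"
    unfolding small_def using size[OF 0, of 0] K by (intro exI[of _ "[(x, 0, init x)]"]) auto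
  ultimately show ?case using runs_Suc[OF _ runs_0] by fastforce
next
  case (Suc t)
  let ?a = "acc (val t) x"
  have sm: "small K fs (Suc (Suc t)) ((x, j, ?a j) # fs, [])" if "j \<le> J x" for j
    unfolding small_def using size[OF Suc.prems that] K
    by (intro exI[of _ "[(x, j, ?a j)]"]) auto
  have "\<exists>n. runs (small K fs (Suc (Suc t))) ((x, j, ?a j) # fs, []) n (fs, [val (Suc t) x])"
    if "j \<le> J x" for j
    using that
  proof (induction "J x - j" arbitrary: j)
    case 0
    then have "j = J x" by simp
    then have "step ((x, j, ?a j) # fs, []) = (fs, [val (Suc t) x])"
      by (simp add: step_def)
    then have "runs (small K fs (Suc (Suc t))) ((x, j, ?a j) # fs, []) (Suc 0) (fs, [val (Suc t) x])"
      using sm[OF 0(2)] by (intro runs_Suc) (simp_all add: runs_0)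
    then show ?case by blast
  next
    case (Suc k)
    then have j: "j < J x" by simp
    define y where "y = q x j (?a j)"
    let ?f = "(x, j, ?a j)"
    have B: "B t y" unfolding y_def by (rule call[OF \<open>B (Suc t) x\<close> j])
    have s1: "step (?f # fs, []) = ((y, 0, init y) # ?f # fs, [])"
      using j by (simp add: step_def y_def)
    obtain n where n: "runs (small K (?f # fs) (Suc t)) ((y, 0, init y) # ?f # fs, []) n (?f # fs, [val t y])"
      using \<open>\<And>x fs. B t x \<Longrightarrow> \<exists>n. runs (small K fs (Suc t)) ((x, 0, init x) # fs, []) n (fs, [val t x])\<close>[OF B]
      by blast
    have szf: "sz ?f \<le> K" using size[OF \<open>B (Suc t) x\<close>, of j] j by simp
    have r1: "runs (small K fs (Suc (Suc t))) (?f # fs, []) (Suc n) (?f # fs, [val t y])"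
      using j szf small_push
      by (intro runs_Suc sm, simp, unfold s1, intro runs_mono[OF n]) blast
    have s2: "step (?f # fs, [val t y]) = ((x, Suc j, ?a (Suc j)) # fs, [])"
      by (simp add: step_def y_def)
    obtain n' where n': "runs (small K fs (Suc (Suc t))) ((x, Suc j, ?a (Suc j)) # fs, []) n' (fs, [val (Suc t) x])"
    proof -
      have "k = J x - Suc j" "Suc j \<le> J x" using Suc.hyps(2) by simp_all
      from Suc.hyps(1)[OF this] that show thesis by blast
    qed
    have "small K fs (Suc (Suc t)) (?f # fs, [val t y])"
      unfolding small_def using szf ret[OF B] by (intro exI[of _ "[?f]"]) auto
    then have "runs (small K fs (Suc (Suc t))) (?f # fs, [val t y]) (Suc n') (fs, [val (Suc t) x])"
      using n' by (intro runs_Suc) (simp_all add: s2)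
    from runs_trans[OF r1 this] show ?case by blast
  qed
  from this[of 0] show ?case by simp
qed

text \<open>Space is depth times frame size. The invariant and the size bound may depend on the
  outermost input \<open>z\<close>, because the polynomial has to be one in the size of
  \<open>z\<close> and not in that of inner calls.\<close>

theorem cmp_val:
  fixes x0 :: "'z::rep \<Rightarrow> 'x" and t0 :: "'z \<Rightarrow> nat"
  assumes cmp_J: "cmp False J" and cmp_q: "cmp False (\<lambda>p. q (fst p) (fst (snd p)) (snd (snd p)))"
    and cmp_u: "cmp False (\<lambda>p. u (fst p) (fst (snd p)) (fst (snd (snd p))) (snd (snd (snd p))))"
    and cmp_out: "cmp False (\<lambda>p. out (fst p) (snd p))" and cmp_init: "cmp False init"
    and cmp_x0: "cmp False x0" and t0: "polybd t0" and G: "polybd G"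
    and B0: "\<And>z x. B z 0 x \<Longrightarrow> J x = 0"
    and size: "\<And>z t x. B z t x \<Longrightarrow> sz x \<le> G z"
    and acc: "\<And>z t x j. B z t x \<Longrightarrow> j \<le> J x \<Longrightarrow> sz (acc (val (t - 1)) x j) \<le> G z"
    and call: "\<And>z t x j. B z (Suc t) x \<Longrightarrow> j < J x \<Longrightarrow> B z t (q x j (acc (val t) x j))"
    and start: "\<And>z. B z (t0 z) (x0 z)"
  shows "cmp False (\<lambda>z. val (t0 z) (x0 z))"
proof -
  from polybd_sz[OF cmp_J] obtain pJ where pJ: "\<forall>x. sz (J x) \<le> poly pJ (sz x)"
    unfolding polybd_def by (elim exE)
  from polybd_sz[OF cmp_out] obtain po where po: "\<forall>p. sz (out (fst p) (snd p)) \<le> poly po (sz p)"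
    unfolding polybd_def by (elim exE)
  define K where "K z = 10 + (G z + (4 * poly pJ (G z) + 1) + G z) + poly po (Suc (G z + G z))" for z
  have polyK: "polybd K" unfolding K_def
    by (intro polybd_intro G)
  have szK: "sz (x, j, acc (val (t - 1)) x j) \<le> K z" if "B z t x" "j \<le> J x" for z t x j
  proof -
    have "sz j \<le> 4 * sz (J x) + 1" using that(2) by (rule sz_nat_mono)
    also have "\<dots> \<le> 4 * poly pJ (G z) + 1"
      using pJ[rule_format, of x] poly_nat_mono[OF size[OF that(1)], of pJ] by simp
    finally show ?thesis using size[OF that(1)] acc[OF that] by (simp add: K_def)
  qed
  have ret: "sz [val t x] \<le> K z" if "B z t x" for z t x
  proof -
    \<comment> \<open>Without fuel \<open>J x\<close> is 0 and the loop is empty, so one formula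
      covers both clauses of \<open>val\<close>.\<close>
    have v: "val t x = out x (acc (val (t - 1)) x (J x))"
      using B0 that by (cases t) auto
    let ?p = "(x, acc (val (t - 1)) x (J x))"
    have "sz (val t x) \<le> poly po (sz ?p)"
      using po[rule_format, of ?p] by (simp only: v fst_conv snd_conv)
    also have "\<dots> \<le> poly po (Suc (G z + G z))"
      using size[OF that] acc[OF that order.refl] by (intro poly_nat_mono) simp
    finally show ?thesis by (simp add: K_def)
  qed
  let ?i = "\<lambda>z. ([(x0 z, 0 :: nat, init (x0 z))], [] :: 'r list)"
  let ?H = "\<lambda>z. Suc (Suc (Suc (t0 z) * Suc (K z)) + K z)"
  have "cmp False (\<lambda>z. ([] :: ('x \<times> nat \<times> 'acc) list, [val (t0 z) (x0 z)]))"
  proof (rule cmp_while)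
    show "cmp False ?i" by (intro cmp_intro cmp_x0 cmp_comp[OF cmp_init])
    show "cmp False step" unfolding step_def
      by (intro cmp_intro cmp_comp[OF cmp_J] cmp_comp[OF cmp_init] cmp_comp3[OF cmp_q]
          cmp_comp4[OF cmp_u] cmp_comp2[OF cmp_out] cmp_less)
    show "cmp False (\<lambda>s :: ('x \<times> nat \<times> 'acc) list \<times> 'r list. fst s \<noteq> [])" by (intro cmp_intro)
    show "polybd ?H" by (intro polybd_intro polyK t0)
    fix z
    obtain n where n: "runs (small (K z) [] (Suc (t0 z))) ([(x0 z, 0, init (x0 z))], []) n ([], [val (t0 z) (x0 z)])"
      using machine_correct[of "B z" "K z" "t0 z" "x0 z" "[]"] B0 szK ret call start
      by (fastforce simp: K_def)
    have sm: "fst s \<noteq> [] \<and> sz s \<le> ?H z" if "small (K z) [] (Suc (t0 z)) s" for s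
    proof -
      from that[unfolded small_def] obtain gs where "gs \<noteq> [] \<and> fst s = gs @ [] \<and>
         length gs \<le> Suc (t0 z) \<and> (\<forall>g\<in>set gs. sz g \<le> K z) \<and> sz (snd s) \<le> K z" by (elim exE)
      then have gs: "gs \<noteq> []" "fst s = gs @ []" "length gs \<le> Suc (t0 z)" "\<forall>g\<in>set gs. sz g \<le> K z"
        "sz (snd s) \<le> K z" by blast+
      have "sz gs \<le> Suc (length gs * Suc (K z))" using gs(4) by (intro sz_list_le) auto
      also have "\<dots> \<le> Suc (Suc (t0 z) * Suc (K z))" 
        using mult_le_mono1[OF gs(3), of "Suc (K z)"] by (simp only: Suc_le_mono)
      finally show ?thesis using gs(1,2,5) by (cases s) auto
    qed
    have fin: "sz ([] :: ('x \<times> nat \<times> 'acc) list, [val (t0 z) (x0 z)]) \<le> ?H z"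
      using ret[OF start[of z]] by simp
    show "\<exists>n. ([] :: ('x \<times> nat \<times> 'acc) list, [val (t0 z) (x0 z)]) = (step ^^ n) (?i z) \<and>
      \<not> fst ((step ^^ n) (?i z)) \<noteq> [] \<and> (\<forall>i<n. fst ((step ^^ i) (?i z)) \<noteq> []) \<and>
      (\<forall>i\<le>n. sz ((step ^^ i) (?i z)) \<le> ?H z) \<and> (False \<longrightarrow> n \<le> ?H z)"
    proof (intro exI[of _ n] conjI allI impI)
      show "sz ((step ^^ i) (?i z)) \<le> ?H z" if "i \<le> n" for i
        using n sm fin that by (cases "i = n") (auto simp: runs_def)
    qed (use n sm in \<open>auto simp: runs_def\<close>)
  qed
  from cmp_hd[OF cmp_snd[OF this]] show ?thesis by simp
qed

end

section \<open>Simulation of Turing machines\<close>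

text \<open>A finite table is a nested case distinction; this puts the transition function of a
  fixed machine into the class.\<close>

lemma cmp_finite:
  fixes g :: "'a::rep \<Rightarrow> 'b::rep"
  assumes "finite A"
  shows "\<exists>h. cmp b h \<and> (\<forall>x\<in>A. h x = g x)"
  using assms
proof (induction A)
  case empty
  then show ?case using cmp_const by blast
next
  case (insert a A)
  then obtain h where h: "cmp b h" "\<forall>x\<in>A. h x = g x" by blast
  have "cmp b (\<lambda>x. if x = a then g a else h x)" by (intro cmp_intro h)
  then show ?case using h(2) by (intro exI[of _ "\<lambda>x. if x = a then g a else h x"]) auto
qed

definition first :: "nat list \<Rightarrow> nat" where
  "first xs = (case xs of [] \<Rightarrow> 0 | x # _ \<Rightarrow> x)"

definition nth0 :: "nat list \<Rightarrow> nat \<Rightarrow> nat" where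
  "nth0 xs i = (if i < length xs then xs ! i else 0)"

lemma first_nth0: "first xs = nth0 xs 0"
  by (cases xs) (auto simp: first_def nth0_def)

lemma nth0_Cons: "nth0 (x # xs) i = (if i = 0 then x else nth0 xs (i - 1))"
  by (auto simp: nth0_def nth_Cons')

lemma nth0_tl: "nth0 (tl xs) i = nth0 xs (Suc i)"
  by (auto simp: nth0_def nth_tl)

lemma nth0_drop: "nth0 (drop n xs) i = nth0 xs (n + i)"
  by (auto simp: nth0_def)

lemma nth0_append: "nth0 (xs @ ys) i = (if i < length xs then xs ! i else nth0 ys (i - length xs))"
  by (auto simp: nth0_def nth_append)

text \<open>A tape is represented by the cells left of the head, nearest first, and the cells from the
  head on to the right; moves are coded as \<open>0\<close>, \<open>1\<close>, \<open>2\<close>.\<close>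

definition act :: "nat \<times> nat \<Rightarrow> nat list \<times> nat list \<Rightarrow> nat list \<times> nat list" where
  "act a T = (if snd a = 1 then (fst T, fst a # tl (snd T))
     else if snd a = 2 then (fst a # fst T, tl (snd T))
     else (tl (fst T), first (fst T) # fst a # tl (snd T)))"

text \<open>The left list always reaches down to cell \<open>-b\<close>, so in the unfolded tape
  cell 0 has position \<open>b\<close>. The right list may stop early and is continued by
  blanks.\<close>

definition tape_is :: "nat \<Rightarrow> nat \<Rightarrow> nat list \<times> nat list \<Rightarrow> tape \<Rightarrow> bool" where
  "tape_is b n T U \<longleftrightarrow> \<bar>snd U\<bar> \<le> int b \<and> int (length (fst T)) = snd U + int b \<and>
     int (length (snd T)) \<le> int b + int n + 1 - snd U \<and>
     (\<forall>i<length (fst T). fst U (snd U - 1 - int i) = fst T ! i) \<and>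
     (\<forall>i. fst U (snd U + int i) = nth0 (snd T) i)"

lemma tape_is_read: "tape_is b n T U \<Longrightarrow> tape_read U = first (snd T)"
proof -
  assume "tape_is b n T U"
  then have "fst U (snd U + int 0) = nth0 (snd T) 0" unfolding tape_is_def by blast
  then show ?thesis by (cases U) (simp add: first_nth0)
qed

lemma tape_is_act:
  assumes T: "tape_is b n T U" and m: "m \<in> {-1, 0, 1}" and h: "\<bar>snd U + m\<bar> \<le> int b"
  shows "tape_is b n (act (s, nat (m + 1)) T) (tape_act (s, m) U)"
proof -
  obtain l r where lr: "T = (l, r)" by (cases T)
  obtain c k where ck: "U = (c, k)" by (cases U)
  have A: "\<bar>k\<bar> \<le> int b" "int (length l) = k + int b" "int (length r) \<le> int b + int n + 1 - k"
    "\<And>i. i < length l \<Longrightarrow> c (k - 1 - int i) = l ! i" "\<And>i. c (k + int i) = nth0 r i"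
    using T by (auto simp: tape_is_def lr ck)
  have r: "(c(k := s)) (k + int i) = nth0 (s # tl r) i" for i
    using A(5)[of i] by (cases i) (auto simp: nth0_Cons nth0_tl)
  have lenr: "int (length (s # tl r)) \<le> int b + int n + 1 - k"
    using A(1,3) by (cases r) auto
  consider "m = 0" | "m = 1" | "m = -1" using m by auto
  then show ?thesis
  proof cases
    case 1
    then show ?thesis using A(1,2,4) r lenr by (simp add: tape_is_def lr ck act_def)
  next
    case 2
    have "(c(k := s)) (k + 1 - 1 - int i) = (s # l) ! i" if "i < length (s # l)" for i
      using A(4)[of "i - 1"] that by (cases i) (auto simp: algebra_simps)
    moreover have "(c(k := s)) (k + 1 + int i) = nth0 (tl r) i" for i
      using r[of "Suc i"] by (simp add: nth0_Cons algebra_simps)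
    moreover have "int (length (tl r)) \<le> int b + int n - k"
      using lenr by simp
    ultimately show ?thesis using 2 A(2) h by (simp add: tape_is_def lr ck act_def)
  next
    case 3
    \<comment> \<open>After the move the head is still not below \<open>-b\<close>, so before it
      there was a cell to its left in the list.\<close>
    then have ne: "l \<noteq> []" using A(2) h by (auto simp: ck)
    have "(c(k := s)) (k - 2 - int i) = tl l ! i" if "i < length (tl l)" for i
      using A(4)[of "Suc i"] that by (auto simp: nth_tl algebra_simps)
    moreover have "(c(k := s)) (k - 1 + int i) = nth0 (first l # s # tl r) i" for i
    proof (cases i)
      case 0
      then show ?thesis using A(4)[of 0] ne by (cases l) (auto simp: nth0_Cons first_def)
    next
      case (Suc j)
      then show ?thesis using r[of j] by (simp add: nth0_Cons)
    qed
    moreover have "int (length (tl l)) = k - 1 + int b" using A(2) ne by (cases l) auto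
    ultimately show ?thesis using 3 h lenr by (simp add: tape_is_def lr ck act_def)
  qed
qed

text \<open>Converse of \<open>cmp_tm\<close>. The space bound allows the left halves of the tapes
  to be filled with polynomially many blanks in advance; from then on a step is a simple list
  operation, and the loop runs until the machine halts.\<close>

theorem pspace_cmp:
  assumes "pspace_computable f"
  shows "cmp False f"
proof -
  obtain M and p :: "nat poly" where M: "tm M" and comp: "computes_in_space M f (poly p)"
    using assms by (auto simp: pspace_computable_def)
  define K S where "K = num_tapes M" and "S = num_symbols M"
  have K: "2 \<le> K" and Q: "2 \<le> num_states M" and S: "3 \<le> S"
    using M by (auto simp: tm_def K_def S_def)
  have trans: "fst (tm_trans M q ss) < num_states M" "length (snd (tm_trans M q ss)) = K"
    "set (snd (tm_trans M q ss)) \<subseteq> {..<S} \<times> {-1, 0, 1}"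
    if "q < num_states M" "length ss = K" "set ss \<subseteq> {..<S}" for q ss
    using M that by (auto simp: tm_def K_def S_def)
  define tt where "tt x = (fst (tm_trans M (fst x) (snd x)),
    map (\<lambda>(s, m). (s, nat (m + 1))) (snd (tm_trans M (fst x) (snd x))))" for x
  have "finite ({..<num_states M} \<times> {ss. set ss \<subseteq> {..<S} \<and> length ss = K})"
    by (intro finite_cartesian_product finite_lists_length_eq) auto
  from cmp_finite[OF this, of False tt] obtain T where T: "cmp False T"
    "\<And>q ss. q < num_states M \<Longrightarrow> length ss = K \<Longrightarrow> set ss \<subseteq> {..<S} \<Longrightarrow> T (q, ss) = tt (q, ss)"
    by auto
  define rd where "rd s = (fst s, map (\<lambda>t. first (snd (snd t))) (snd s))"
    for s :: "nat \<times> (nat \<times> nat list \<times> nat list) list"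
  \<comment> \<open>Every tape carries its own number, so that a plain \<open>map\<close> can pick
    its action from the list.\<close>
  define st where "st s = (fst (T (rd s)),
      map (\<lambda>t. (fst t, act (hd (drop (fst t) (snd (T (rd s))))) (snd t))) (snd s))" for s
  define B where "B w = poly p (length w)" for w :: "bool list"
  define init where "init w = (0 :: nat, (0 :: nat, replicate (B w) (0 :: nat), map bit_symbol w) #
      map (\<lambda>j. (j, replicate (B w) 0, [])) [1..<K] :: (nat \<times> nat list \<times> nat list) list)" for w
  \<comment> \<open>The unfolded tape starts at cell \<open>- B w\<close>, so dropping
    \<open>B w\<close> symbols leads to the origin.\<close>
  define out where "out w s = map (\<lambda>x. x = 2) (takeWhile (\<lambda>x. x \<noteq> 0)
      (drop (B w) (rev (fst (snd (hd (tl (snd s))))) @ snd (snd (hd (tl (snd s)))))))"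
    for w and s :: "nat \<times> (nat \<times> nat list \<times> nat list) list"
  define conf where "conf = tm_config M"
  have conf_Suc: "conf w (Suc i) = tm_step M (conf w i)" for w i
    by (simp add: conf_def tm_config_def)
  have heads: "\<bar>snd U\<bar> \<le> int (B w)" if "U \<in> set (snd (conf w i))" for w i U
    using comp that by (auto simp: computes_in_space_def conf_def B_def)
  define good where "good w s c \<longleftrightarrow> fst s = fst c \<and> fst s < num_states M \<and> length (snd s) = K \<and>
     length (snd c) = K \<and> (\<forall>j<K. fst (snd s ! j) = j \<and> tape_is (B w) (length w) (snd (snd s ! j)) (snd c ! j) \<and>
       set (fst (snd (snd s ! j))) \<subseteq> {..<S} \<and> set (snd (snd (snd s ! j))) \<subseteq> {..<S})"
    for w s and c :: config
  have first: "first xs < S" if "set xs \<subseteq> {..<S}" for xs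
    using that S by (cases xs) (auto simp: first_def)
  have good_init: "good w (init w) (conf w 0)" for w
    unfolding good_def
  proof (intro conjI allI impI)
    have bs: "bit_symbol x < S" for x using S by (auto simp: bit_symbol_def)
    show "fst (init w) = fst (conf w 0)" "fst (init w) < num_states M" "length (snd (init w)) = K"
      "length (snd (conf w 0)) = K"
      using K Q by (auto simp: init_def conf_def tm_config_def tm_init_def K_def)
    fix j assume j: "j < K"
    have nth: "snd (init w) ! j = (j, replicate (B w) 0, if j = 0 then map bit_symbol w else [])"
      using j K by (cases j) (auto simp: init_def nth_append)
    have nthc: "snd (conf w 0) ! j = (if j = 0 then
        (\<lambda>i. if 0 \<le> i \<and> i < int (length w) then bit_symbol (w ! nat i) else 0, 0) else (\<lambda>_. 0, 0))"
      using j K by (cases j) (auto simp: conf_def tm_config_def tm_init_def K_def)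
    show "fst (snd (init w) ! j) = j" by (simp add: nth)
    show "tape_is (B w) (length w) (snd (snd (init w) ! j)) (snd (conf w 0) ! j)"
      by (auto simp: nth nthc tape_is_def nth0_def)
    show "set (fst (snd (snd (init w) ! j))) \<subseteq> {..<S}" "set (snd (snd (snd (init w) ! j))) \<subseteq> {..<S}"
      using S bs by (auto simp: nth)
  qed
  have good_step: "good w (st s) (conf w (Suc i))" if g: "good w s (conf w i)" and q: "fst s \<noteq> 1" for w s i
  proof -
    obtain c where c: "conf w i = c" by blast
    have g': "fst s = fst c" "fst s < num_states M" "length (snd s) = K" "length (snd c) = K"
      "\<And>j. j < K \<Longrightarrow> fst (snd s ! j) = j"
      "\<And>j. j < K \<Longrightarrow> tape_is (B w) (length w) (snd (snd s ! j)) (snd c ! j)"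
      "\<And>j. j < K \<Longrightarrow> set (fst (snd (snd s ! j))) \<subseteq> {..<S}"
      "\<And>j. j < K \<Longrightarrow> set (snd (snd (snd s ! j))) \<subseteq> {..<S}"
      using g by (auto simp: good_def c)
    define ss where "ss = map tape_read (snd c)"
    have ss: "length ss = K" by (simp add: ss_def g')
    have rd: "rd s = (fst s, ss)"
    proof -
      have "first (snd (snd (snd s ! j))) = tape_read (snd c ! j)" if "j < K" for j
        using tape_is_read[OF g'(6)[OF that]] by simp
      then show ?thesis unfolding rd_def ss_def using g'(3,4) by (auto intro!: nth_equalityI)
    qed
    have "ss ! j < S" if "j < K" for j
      using tape_is_read[OF g'(6)[OF that]] first[OF g'(8)[OF that]] that by (simp add: ss_def g')
    then have ssS: "set ss \<subseteq> {..<S}" using ss by (auto simp: in_set_conv_nth)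
    define as where "as = snd (tm_trans M (fst s) ss)"
    note tr = trans[OF g'(2) ss ssS, folded as_def]
    have T': "T (rd s) = (fst (tm_trans M (fst s) ss), map (\<lambda>(s, m). (s, nat (m + 1))) as)"
      unfolding rd using T(2)[OF g'(2) ss ssS] by (simp add: tt_def as_def)
    have next_: "conf w (Suc i) = (fst (tm_trans M (fst s) ss), map2 tape_act as (snd c))"
      unfolding conf_Suc c using q g'(1) by (cases c) (simp add: ss_def as_def case_prod_beta)
    have asj: "fst (as ! j) < S" "snd (as ! j) \<in> {-1, 0, 1}" if "j < K" for j
    proof -
      have "as ! j \<in> set as" using tr(2) that by simp
      then have "as ! j \<in> {..<S} \<times> {-1, 0, 1}" using tr(3) by blast
      then show "fst (as ! j) < S" "snd (as ! j) \<in> {-1, 0, 1}" by auto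
    qed
    have stj: "snd (st s) ! j = (j, act (fst (as ! j), nat (snd (as ! j) + 1)) (snd (snd s ! j)))"
      if "j < K" for j
      using that tr(2) g'(3,5) by (simp add: st_def T' hd_drop_conv_nth case_prod_beta)
    have cj: "snd (conf w (Suc i)) ! j = tape_act (fst (as ! j), snd (as ! j)) (snd c ! j)" if "j < K" for j
      using that tr(2) g'(4) by (simp add: next_)
    show ?thesis unfolding good_def
    proof (intro conjI allI impI)
      show "fst (st s) = fst (conf w (Suc i))" by (simp add: st_def T' next_)
      show "fst (st s) < num_states M" using tr(1) by (simp add: st_def T')
      show "length (snd (st s)) = K" using g' by (simp add: st_def)
      show len: "length (snd (conf w (Suc i))) = K" using tr(2) g' by (simp add: next_)
      fix j assume j: "j < K"
      obtain l r where lr: "snd (snd s ! j) = (l, r)" by (cases "snd (snd s ! j)")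
      have lrS: "set l \<subseteq> {..<S}" "set r \<subseteq> {..<S}" using g'(7,8)[OF j] by (auto simp: lr)
      then have tlS: "set (tl l) \<subseteq> {..<S}" "set (tl r) \<subseteq> {..<S}"
        by (cases l, simp, simp) (use lrS in \<open>cases r, simp, simp\<close>)
      show "fst (snd (st s) ! j) = j" by (simp add: stj j)
      have "snd (conf w (Suc i)) ! j \<in> set (snd (conf w (Suc i)))" using len j by simp
      from heads[OF this] have "\<bar>snd (snd c ! j) + snd (as ! j)\<bar> \<le> int (B w)"
        by (cases "snd c ! j"; cases "as ! j") (simp add: cj j)
      from tape_is_act[OF g'(6)[OF j] asj(2)[OF j] this, of "fst (as ! j)"]
      show "tape_is (B w) (length w) (snd (snd (st s) ! j)) (snd (conf w (Suc i)) ! j)"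
        by (simp add: stj cj j)
      show "set (fst (snd (snd (st s) ! j))) \<subseteq> {..<S}" "set (snd (snd (snd (st s) ! j))) \<subseteq> {..<S}"
        using lrS tlS first[OF lrS(1)] asj(1)[OF j] by (auto simp: stj j lr act_def)
    qed
  qed
  have halt: "\<exists>t. fst (conf w t) = 1" for w
    using comp by (auto simp: computes_in_space_def tm_outputs_def conf_def)
  define N where "N w = (LEAST t. fst (conf w t) = 1)" for w
  have N: "fst (conf w (N w)) = 1" "\<And>i. i < N w \<Longrightarrow> fst (conf w i) \<noteq> 1" for w
    unfolding N_def using LeastI_ex[OF halt[of w]] not_less_Least by blast+
  have good: "good w ((st ^^ i) (init w)) (conf w i)" if "i \<le> N w" for w i
    using that
  proof (induction i)
    case 0
    then show ?case using good_init by simp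
  next
    case (Suc i)
    then have "good w ((st ^^ i) (init w)) (conf w i)" by simp
    moreover from this have "fst ((st ^^ i) (init w)) \<noteq> 1" using N(2)[of i w] Suc by (simp add: good_def)
    ultimately show ?case using good_step by simp
  qed
  have "f w = out w ((st ^^ N w) (init w))" for w
  proof -
    obtain t where t: "tm_outputs M w t (f w)" using comp unfolding computes_in_space_def by blast
    \<comment> \<open>The output is specified at some halting time, the simulation stops at the
      first one; a halted configuration no longer changes.\<close>
    have const: "conf w (N w + i) = conf w (N w)" for i
      using N(1)[of w] by (induction i) (auto simp: conf_Suc, cases "conf w (N w)", simp)
    have "N w \<le> t" using t N(2)[of t w] by (force simp: tm_outputs_def conf_def not_less[symmetric])
    then have ct: "conf w t = conf w (N w)" using const[of "t - N w"] by simp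
    define s where "s = (st ^^ N w) (init w)"
    define l r where "l = fst (snd (snd s ! 1))" and "r = snd (snd (snd s ! 1))"
    define U where "U = snd (conf w (N w)) ! 1"
    have g: "good w s (conf w (N w))" unfolding s_def by (rule good) simp
    then have ti: "tape_is (B w) (length w) (l, r) U" using K by (simp add: good_def l_def r_def U_def)
    have hd: "hd (tl (snd s)) = snd s ! 1"
      using g K by (cases "snd s"; cases "tl (snd s)") (auto simp: good_def)
    have cell: "fst U (int i) = nth0 (drop (B w) (rev l @ r)) i" for i
    proof (cases "B w + i < length l")
      case True
      have len: "int (length l) = snd U + int (B w)" using ti by (simp add: tape_is_def)
      define j where "j = length l - Suc (B w + i)"
      have jl: "j < length l" using True by (auto simp: j_def)
      have "int j = snd U - 1 - int i" using True len by (auto simp: j_def)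
      have "\<forall>i<length l. fst U (snd U - 1 - int i) = l ! i" using ti by (simp add: tape_is_def)
      then have "fst U (snd U - 1 - int j) = l ! j" using jl by blast
      moreover have "snd U - 1 - int j = int i" using \<open>int j = snd U - 1 - int i\<close> by simp
      moreover have "nth0 (drop (B w) (rev l @ r)) i = l ! j"
        using True by (simp add: nth0_drop nth0_append rev_nth j_def del: drop_append)
      ultimately show ?thesis by simp
    next
      case False
      have len: "int (length l) = snd U + int (B w)" using ti by (simp add: tape_is_def)
      define j where "j = B w + i - length l"
      have "int i = snd U + int j" using False len by (simp add: j_def)
      moreover have "fst U (snd U + int j) = nth0 r j" using ti by (simp add: tape_is_def)
      moreover have "nth0 (drop (B w) (rev l @ r)) i = nth0 r j"
        using False by (simp add: nth0_drop nth0_append j_def del: drop_append)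
      ultimately show ?thesis by simp
    qed
    define z where "z = drop (B w) (rev l @ r)"
    have y: "\<forall>i<length (f w). nth0 z i = bit_symbol (f w ! i)" "nth0 z (length (f w)) = 0"
      using t ct cell unfolding tm_outputs_def tape_holds_def by (auto simp: conf_def U_def z_def)
    have "map (\<lambda>x. x = 2) (takeWhile (\<lambda>x. x \<noteq> 0) z) = y"
      if "\<forall>i<length y. nth0 z i = bit_symbol (y ! i)" "nth0 z (length y) = 0" for y z
      using that
    proof (induction y arbitrary: z)
      case Nil
      then show ?case by (cases z) (auto simp: nth0_def)
    next
      case (Cons x y)
      from Cons.prems(1)[rule_format, of 0] have 0: "nth0 z 0 = bit_symbol x" by simp
      then obtain z' where z: "z = bit_symbol x # z'"
        by (cases z) (auto simp: nth0_def bit_symbol_def split: if_splits)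
      have "map (\<lambda>x. x = 2) (takeWhile (\<lambda>x. x \<noteq> 0) z') = y"
      proof (rule Cons.IH)
        show "\<forall>i<length y. nth0 z' i = bit_symbol (y ! i)"
        proof (intro allI impI)
          fix i assume "i < length y"
          then show "nth0 z' i = bit_symbol (y ! i)"
            using Cons.prems(1)[rule_format, of "Suc i"] by (simp add: z nth0_Cons)
        qed
        show "nth0 z' (length y) = 0" using Cons.prems(2) by (simp add: z nth0_Cons)
      qed
      then show ?case by (simp add: z bit_symbol_def)
    qed
    from this[OF y] show ?thesis
      unfolding out_def s_def[symmetric] hd z_def l_def r_def by simp
  qed
  then have f: "f = (\<lambda>w. out w ((st ^^ N w) (init w)))" by auto
  have cB: "cmp False B"
    unfolding B_def by (induction p) (simp_all, intro cmp_intro, intro cmp_intro)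
  have pB: "polybd B"
    unfolding B_def
    by (rule polybd_le[of "\<lambda>w. poly p (sz w)"])
      (auto intro: polybd_poly polybd_sz_id poly_nat_mono less_imp_le[OF length_le_sz])
  have rep: "cmp False (\<lambda>w. replicate (B w) (0 :: nat))" by (intro cmp_intro cB pB)
  have cinit: "cmp False init"
    unfolding init_def bit_symbol_def
    by (intro cmp_intro cmp_comp[OF rep])
  have cfirst: "cmp False (\<lambda>x. first (g x))" if "cmp False g" for g :: "'a::rep \<Rightarrow> nat list"
    unfolding first_def by (intro cmp_intro that)
  have crd: "cmp False rd" unfolding rd_def by (intro cmp_intro cfirst)
  have cact: "cmp False (\<lambda>x. act (g x) (h x))" if "cmp False g" "cmp False h" for g and h :: "'a::rep \<Rightarrow> _"
    unfolding act_def by (intro cmp_intro cfirst that)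
  have cst: "cmp False st"
    unfolding st_def by (intro cmp_intro cact cmp_comp[OF T(1)] cmp_comp[OF crd])
  have ctw: "cmp False (\<lambda>x. takeWhile (\<lambda>x. x \<noteq> 0) (g x))" if "cmp False g" for g :: "'a::rep \<Rightarrow> nat list"
  proof -
    have rec: "rec_list [] (\<lambda>x _ r. if x \<noteq> 0 then x # r else []) xs = takeWhile (\<lambda>x. x \<noteq> 0) xs"
      for xs :: "nat list" by (induction xs) auto
    have tw: "sz (takeWhile P xs) \<le> sz xs" for P and xs :: "nat list"
      using sz_append_le(1)[of "takeWhile P xs" "dropWhile P xs"] by simp
    have "cmp False (\<lambda>x. rec_list [] (\<lambda>x _ r. if x \<noteq> 0 then x # r else []) (g x))"
    proof (rule cmp_rec_list[OF that])
      show "cmp False (\<lambda>q. if fst (snd q) \<noteq> (0 :: nat) then fst (snd q) # snd (snd (snd q)) else [])"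
        by (intro cmp_intro)
      show "polybd (\<lambda>x. sz (g x))" by (intro polybd_intro that)
      show "sz (rec_list [] (\<lambda>x _ r. if x \<noteq> 0 then x # r else []) ys) \<le> sz (g x)" if "g x = zs @ ys" for x ys zs
        unfolding rec using tw[of _ ys] sz_append_le(2)[of ys zs] that by (metis le_trans)
    qed (rule cmp_const)
    then show ?thesis by (simp only: rec)
  qed
  have cout: "cmp False (\<lambda>p. out (fst p) (snd p))"
    unfolding out_def by (intro cmp_intro ctw cmp_comp[OF cB])
  let ?G = "\<lambda>w. Suc ((4 * num_states M + 1) + Suc (K * Suc ((4 * K + 1) +
      2 * Suc ((2 * B w + length w + 1) * Suc (4 * S + 1)) + 5)))"
  have run: "cmp False (\<lambda>w. (st ^^ N w) (init w))"
  proof (rule cmp_while[OF cinit cst])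
    show "cmp False (\<lambda>s :: nat \<times> (nat \<times> nat list \<times> nat list) list. fst s \<noteq> 1)" by (intro cmp_intro)
    have "polybd (\<lambda>w :: bool list. length w)"
      by (rule polybd_le[OF polybd_sz_id]) (simp add: less_imp_le length_le_sz)
    then show "polybd ?G" by (intro polybd_intro pB)
    fix w
    have "sz s \<le> ?G w" if g: "good w s c" for s c
    proof -
      have "sz t \<le> (4 * K + 1) + 2 * Suc ((2 * B w + length w + 1) * Suc (4 * S + 1)) + 5"
        if "t \<in> set (snd s)" for t
      proof -
        have "length (snd s) = K" using g by (simp add: good_def)
        with that[unfolded in_set_conv_nth] obtain j where j: "j < K" "t = snd s ! j" by auto
        define l r where "l = fst (snd t)" and "r = snd (snd t)"
        have "fst (snd s ! j) = j \<and> tape_is (B w) (length w) (snd (snd s ! j)) (snd c ! j) \<and>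
            set (fst (snd (snd s ! j))) \<subseteq> {..<S} \<and> set (snd (snd (snd s ! j))) \<subseteq> {..<S}"
          using g j(1) unfolding good_def by blast
        then have t: "t = (j, l, r)"
          and ti: "tape_is (B w) (length w) (l, r) (snd c ! j)" "set l \<subseteq> {..<S}" "set r \<subseteq> {..<S}"
          by (simp_all add: l_def r_def j(2) prod_eq_iff)
        have len: "length l \<le> 2 * B w + length w + 1" "length r \<le> 2 * B w + length w + 1"
          using ti(1) by (auto simp: tape_is_def)
        have "sz xs \<le> Suc ((2 * B w + length w + 1) * Suc (4 * S + 1))"
          if "set xs \<subseteq> {..<S}" "length xs \<le> 2 * B w + length w + 1" for xs
        proof -
          have "sz x \<le> 4 * S + 1" if "x \<in> set xs" for x
            using sz_nat_le[of x] \<open>set xs \<subseteq> {..<S}\<close> that by (auto dest!: subsetD)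
          then have "sz xs \<le> Suc (length xs * Suc (4 * S + 1))" by (rule sz_list_le)
          also have "\<dots> \<le> Suc ((2 * B w + length w + 1) * Suc (4 * S + 1))"
            using that(2) by (simp only: Suc_le_mono mult_le_mono1)
          finally show ?thesis .
        qed
        from this[OF ti(2) len(1)] this[OF ti(3) len(2)] sz_nat_le[of j] j(1)
        show ?thesis by (simp add: t)
      qed
      then have "sz (snd s) \<le> Suc (length (snd s) * Suc ((4 * K + 1) +
          2 * Suc ((2 * B w + length w + 1) * Suc (4 * S + 1)) + 5))"
        by (rule sz_list_le)
      moreover have "sz (fst s) \<le> 4 * num_states M + 1"
        using sz_nat_le[of "fst s"] g by (simp add: good_def)
      ultimately show ?thesis using g by (cases s) (simp add: good_def)
    qed
    then have szs: "sz ((st ^^ i) (init w)) \<le> ?G w" if "i \<le> N w" for i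
      using good[OF that] by blast
    have eq: "fst ((st ^^ i) (init w)) = fst (conf w i)" if "i \<le> N w" for i
      using good[OF that] by (simp add: good_def)
    show "\<exists>n. (st ^^ N w) (init w) = (st ^^ n) (init w) \<and> \<not> fst ((st ^^ n) (init w)) \<noteq> 1 \<and>
       (\<forall>i<n. fst ((st ^^ i) (init w)) \<noteq> 1) \<and> (\<forall>i\<le>n. sz ((st ^^ i) (init w)) \<le> ?G w) \<and>
       (False \<longrightarrow> n \<le> ?G w)"
      using N(1)[of w] N(2)[of _ w] eq szs by (intro exI[of _ "N w"]) simp
  qed
  show ?thesis unfolding f by (intro cmp_comp2[OF cout] run cmp_intro)
qed

section \<open>Quantified formulas over a finite alphabet\<close>

text \<open>An analogue of quantified Boolean formulas in which variables range over an alphabet, so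
  that one variable holds a whole letter of a configuration.\<close>

datatype bf = Tru | Is nat nat | Not bf | Disj bf bf | Exi nat bf

primrec holds :: "nat \<Rightarrow> (nat \<Rightarrow> nat) \<Rightarrow> bf \<Rightarrow> bool" where
  "holds c \<rho> Tru \<longleftrightarrow> True"
| "holds c \<rho> (Is x a) \<longleftrightarrow> \<rho> x = a"
| "holds c \<rho> (Not \<phi>) \<longleftrightarrow> \<not> holds c \<rho> \<phi>"
| "holds c \<rho> (Disj \<phi> \<psi>) \<longleftrightarrow> holds c \<rho> \<phi> \<or> holds c \<rho> \<psi>"
| "holds c \<rho> (Exi x \<phi>) \<longleftrightarrow> (\<exists>a<c. holds c (\<rho>(x := a)) \<phi>)"

primrec fv :: "bf \<Rightarrow> nat set" where
  "fv Tru = {}"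
| "fv (Is x a) = {x}"
| "fv (Not \<phi>) = fv \<phi>"
| "fv (Disj \<phi> \<psi>) = fv \<phi> \<union> fv \<psi>"
| "fv (Exi x \<phi>) = fv \<phi> - {x}"

text \<open>In the game below the letter held by a variable is the action its strategy chooses in
  position \<open>0\<close>; playing this action leads to the position labelled by the letter.\<close>

primrec form_of :: "nat \<Rightarrow> bf \<Rightarrow> (nat, nat, nat) form" where
  "form_of k Tru = Or (Atom 0) (Neg (Atom 0))"
| "form_of k (Is x a) = foldr (\<lambda>i \<phi>. Bind i x \<phi>) [0..<k] (Next (Atom a))"
| "form_of k (Not \<phi>) = Neg (form_of k \<phi>)"
| "form_of k (Disj \<phi> \<psi>) = Or (form_of k \<phi>) (form_of k \<psi>)"
| "form_of k (Exi x \<phi>) = Ex x (form_of k \<phi>)"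

text \<open>Agent 0 alone decides the move. Still \<open>form_of\<close> binds every agent, since a
  temporal operator makes all of them free and the result has to be a sentence.\<close>

definition letter_game :: "nat \<Rightarrow> (nat, nat, nat, nat) cgs" where
  "letter_game c = \<lparr>actions = {..<c}, positions = {..<c}, init_pos = 0, move = (\<lambda>v a. a 0),
     label = (\<lambda>v. {v})\<rparr>"

lemma letter_game_cgs: "0 < c \<Longrightarrow> 0 < k \<Longrightarrow> cgs {..<k} (letter_game c)"
  by (auto simp: cgs_def letter_game_def PiE_iff)

lemma letter_game_presented: "presented (letter_game c)"
  by (simp add: presented_def letter_game_def)

lemma free_binds:
  "free A (foldr (\<lambda>i \<phi>. Bind i x \<phi>) is \<phi>) \<subseteq> insert (Inr x) (free A \<phi> - Inl ` set is)"
  by (induction "is") auto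

lemma free_form_of: "free {..<k} (form_of k \<phi>) \<subseteq> Inr ` fv \<phi>"
proof (induction \<phi>)
  case (Is x a)
  show ?case using free_binds[of "{..<k}" x "[0..<k]" "Next (Atom a)"]
    by (auto simp: lessThan_atLeast0)
qed auto

lemma form_over_form_of: "form_over {..<k} D (form_of k \<phi>)"
proof (induction \<phi>)
  case (Is x a)
  have "set is \<subseteq> {..<k} \<Longrightarrow> form_over {..<k} D (foldr (\<lambda>i \<phi>. Bind i x \<phi>) is (Next (Atom a)))" for "is"
    by (induction "is") auto
  from this[of "[0..<k]"] show ?case by (simp add: subset_iff)
qed auto

lemma sat_value_binds:
  "sat_value A G (foldr (\<lambda>i \<phi>. Bind i x \<phi>) is \<phi>) \<chi> v =
     sat_value A G \<phi> (\<lambda>l. case l of Inl i \<Rightarrow> if i \<in> set is then \<chi> (Inr x) else \<chi> l | Inr y \<Rightarrow> \<chi> l) v"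
proof (induction "is" arbitrary: \<chi>)
  case Nil
  have "(\<lambda>l. case l of Inl i \<Rightarrow> if i \<in> set [] then \<chi> (Inr x) else \<chi> l | Inr y \<Rightarrow> \<chi> l) = \<chi>"
    by (auto simp: fun_eq_iff split: sum.split)
  then show ?case by (simp only: foldr.simps id_apply)
next
  case (Cons i "is")
  show ?case
    by (simp add: Cons) (rule arg_cong[where f = "\<lambda>\<chi>. sat_value A G \<phi> \<chi> v"],
      auto simp: fun_eq_iff split: sum.split)
qed

text \<open>\<open>Next\<close> occurs only directly before atoms, so everything else is evaluated
  in position 0, where a strategy matters only through the action it takes there. The maximum over
  strategies thus becomes a quantifier over letters, and all values are 0 or 1.\<close>

lemma sat_value_form_of:
  assumes k: "0 < k" and c: "0 < c"
  shows "range \<chi> \<subseteq> strategies (letter_game c) \<Longrightarrow>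
    sat_value {..<k} (letter_game c) (form_of k \<phi>) \<chi> 0 = of_bool (holds c (\<lambda>x. \<chi> (Inr x) 0) \<phi>)"
proof (induction \<phi> arbitrary: \<chi>)
  case (Is x a)
  define \<chi>' where "\<chi>' = (\<lambda>l. case l of Inl i \<Rightarrow> if i \<in> set [0..<k] then \<chi> (Inr x) else \<chi> l | Inr y \<Rightarrow> \<chi> l)"
  have "sat_value {..<k} (letter_game c) (form_of k (Is x a)) \<chi> 0
    = sat_value {..<k} (letter_game c) (Next (Atom a)) \<chi>' 0"
    unfolding form_of.simps sat_value_binds \<chi>'_def ..
  also have "\<dots> = of_bool (\<chi> (Inr x) 0 = a)"
    using k by (simp add: letter_game_def \<chi>'_def)
  finally show ?case by simp
next
  case (Exi x \<phi>)
  let ?G = "letter_game c" and ?S = "strategies (letter_game c)"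
  have fin: "finite ?S"
    by (simp add: strategies_def letter_game_def finite_PiE)
  have "?S \<noteq> {}"
    using c by (auto simp: strategies_def letter_game_def PiE_eq_empty_iff)
  have val: "sat_value {..<k} ?G (form_of k \<phi>) (\<chi>(Inr x := \<sigma>)) 0 =
      of_bool (holds c ((\<lambda>y. \<chi> (Inr y) 0)(x := \<sigma> 0)) \<phi>)" if "\<sigma> \<in> ?S" for \<sigma>
  proof -
    have "range (\<chi>(Inr x := \<sigma>)) \<subseteq> ?S" using Exi.prems that by auto
    moreover have "(\<lambda>y. (\<chi>(Inr x := \<sigma>)) (Inr y) 0) = (\<lambda>y. \<chi> (Inr y) 0)(x := \<sigma> 0)" by auto
    ultimately show ?thesis using Exi.IH[of "\<chi>(Inr x := \<sigma>)"] by (simp only:)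
  qed
  have "(\<exists>\<sigma>\<in>?S. holds c ((\<lambda>y. \<chi> (Inr y) 0)(x := \<sigma> 0)) \<phi>) \<longleftrightarrow>
      (\<exists>a<c. holds c ((\<lambda>y. \<chi> (Inr y) 0)(x := a)) \<phi>)"
  proof (intro iffI; elim bexE exE conjE)
    fix \<sigma> assume "\<sigma> \<in> ?S" "holds c ((\<lambda>y. \<chi> (Inr y) 0)(x := \<sigma> 0)) \<phi>"
    moreover have "\<sigma> 0 < c" using \<open>\<sigma> \<in> ?S\<close> c by (auto simp: strategies_def letter_game_def PiE_iff)
    ultimately show "\<exists>a<c. holds c ((\<lambda>y. \<chi> (Inr y) 0)(x := a)) \<phi>" by blast
  next
    fix a assume a: "a < c" "holds c ((\<lambda>y. \<chi> (Inr y) 0)(x := a)) \<phi>"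
    have "(\<lambda>v\<in>{..<c}. a) \<in> ?S" "(\<lambda>v\<in>{..<c}. a) 0 = a"
      using a(1) by (auto simp: strategies_def letter_game_def)
    with a(2) show "\<exists>\<sigma>\<in>?S. holds c ((\<lambda>y. \<chi> (Inr y) 0)(x := \<sigma> 0)) \<phi>"
      by (metis (no_types, lifting))
  qed
  moreover have "Max ((\<lambda>\<sigma>. sat_value {..<k} ?G (form_of k \<phi>) (\<chi>(Inr x := \<sigma>)) 0) ` ?S) =
      of_bool (\<exists>\<sigma>\<in>?S. holds c ((\<lambda>y. \<chi> (Inr y) 0)(x := \<sigma> 0)) \<phi>)"
  proof (rule Max_eqI)
    show "finite ((\<lambda>\<sigma>. sat_value {..<k} ?G (form_of k \<phi>) (\<chi>(Inr x := \<sigma>)) 0) ` ?S)"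
      using fin by simp
    show "y \<le> of_bool (\<exists>\<sigma>\<in>?S. holds c ((\<lambda>y. \<chi> (Inr y) 0)(x := \<sigma> 0)) \<phi>)"
      if "y \<in> (\<lambda>\<sigma>. sat_value {..<k} ?G (form_of k \<phi>) (\<chi>(Inr x := \<sigma>)) 0) ` ?S" for y
      using that by (auto simp: val)
    show "of_bool (\<exists>\<sigma>\<in>?S. holds c ((\<lambda>y. \<chi> (Inr y) 0)(x := \<sigma> 0)) \<phi>) \<in>
      (\<lambda>\<sigma>. sat_value {..<k} ?G (form_of k \<phi>) (\<chi>(Inr x := \<sigma>)) 0) ` ?S"
    proof (cases "\<exists>\<sigma>\<in>?S. holds c ((\<lambda>y. \<chi> (Inr y) 0)(x := \<sigma> 0)) \<phi>")
      case True
      then obtain \<sigma> where "\<sigma> \<in> ?S" "holds c ((\<lambda>y. \<chi> (Inr y) 0)(x := \<sigma> 0)) \<phi>" by blast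
      then show ?thesis using True by (intro image_eqI[of _ _ \<sigma>]) (auto simp: val)
    next
      case False
      obtain \<sigma> where "\<sigma> \<in> ?S" using \<open>?S \<noteq> {}\<close> by blast
      then show ?thesis using False by (intro image_eqI[of _ _ \<sigma>]) (auto simp: val)
    qed
  qed
  ultimately show ?case by simp
qed (auto simp: letter_game_def max_def)

section \<open>Derived connectives and truth tables\<close>

definition And :: "bf \<Rightarrow> bf \<Rightarrow> bf" where
  "And \<phi> \<psi> = Not (Disj (Not \<phi>) (Not \<psi>))"

definition ands :: "bf list \<Rightarrow> bf \<Rightarrow> bf" where
  "ands \<phi>s \<psi> = foldr And \<phi>s \<psi>"

definition exs :: "nat list \<Rightarrow> bf \<Rightarrow> bf" where
  "exs xs \<phi> = foldr Exi xs \<phi>"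

lemma holds_And [simp]: "holds c \<rho> (And \<phi> \<psi>) \<longleftrightarrow> holds c \<rho> \<phi> \<and> holds c \<rho> \<psi>"
  by (simp add: And_def)

lemma holds_ands [simp]: "holds c \<rho> (ands \<phi>s \<psi>) \<longleftrightarrow> (\<forall>\<phi>\<in>set \<phi>s. holds c \<rho> \<phi>) \<and> holds c \<rho> \<psi>"
  by (induction \<phi>s) (auto simp: ands_def)

lemma fv_And [simp]: "fv (And \<phi> \<psi>) = fv \<phi> \<union> fv \<psi>"
  by (simp add: And_def)

lemma fv_ands [simp]: "fv (ands \<phi>s \<psi>) = (\<Union>\<phi>\<in>set \<phi>s. fv \<phi>) \<union> fv \<psi>"
  by (induction \<phi>s) (auto simp: ands_def)

lemma fv_exs [simp]: "fv (exs xs \<phi>) = fv \<phi> - set xs"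
  by (induction xs) (auto simp: exs_def)

text \<open>Keeping whole assignments below \<open>c\<close> turns a block of bounded quantifiers
  into one quantifier over assignments that agree outside the block.\<close>

lemma holds_exs:
  assumes "\<forall>n. \<rho> n < c"
  shows "holds c \<rho> (exs xs \<phi>) \<longleftrightarrow>
    (\<exists>\<rho>'. (\<forall>n. n \<notin> set xs \<longrightarrow> \<rho>' n = \<rho> n) \<and> (\<forall>n. \<rho>' n < c) \<and> holds c \<rho>' \<phi>)"
  using assms
proof (induction xs arbitrary: \<rho>)
  case Nil
  have "(\<exists>\<rho>'. (\<forall>n. \<rho>' n = \<rho> n) \<and> (\<forall>n. \<rho>' n < c) \<and> holds c \<rho>' \<phi>) \<longleftrightarrow> holds c \<rho> \<phi>"
  proof
    assume "\<exists>\<rho>'. (\<forall>n. \<rho>' n = \<rho> n) \<and> (\<forall>n. \<rho>' n < c) \<and> holds c \<rho>' \<phi>"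
    then obtain \<rho>' where "\<forall>n. \<rho>' n = \<rho> n" "holds c \<rho>' \<phi>" by blast
    then have "\<rho>' = \<rho>" by auto
    then show "holds c \<rho> \<phi>" using \<open>holds c \<rho>' \<phi>\<close> by simp
  qed (use Nil in auto)
  then show ?case by (simp add: exs_def)
next
  case (Cons x xs)
  have "holds c \<rho> (exs (x # xs) \<phi>) \<longleftrightarrow> (\<exists>a<c. holds c (\<rho>(x := a)) (exs xs \<phi>))"
    by (simp add: exs_def)
  also have "\<dots> \<longleftrightarrow> (\<exists>a<c. \<exists>\<rho>'. (\<forall>n. n \<notin> set xs \<longrightarrow> \<rho>' n = (\<rho>(x := a)) n) \<and> (\<forall>n. \<rho>' n < c) \<and> holds c \<rho>' \<phi>)"
    using Cons.prems by (intro ex_cong1 conj_cong refl Cons.IH) simp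
  also have "\<dots> \<longleftrightarrow> (\<exists>\<rho>'. (\<forall>n. n \<notin> set (x # xs) \<longrightarrow> \<rho>' n = \<rho> n) \<and> (\<forall>n. \<rho>' n < c) \<and> holds c \<rho>' \<phi>)"
  proof
    assume "\<exists>a<c. \<exists>\<rho>'. (\<forall>n. n \<notin> set xs \<longrightarrow> \<rho>' n = (\<rho>(x := a)) n) \<and> (\<forall>n. \<rho>' n < c) \<and> holds c \<rho>' \<phi>"
    then obtain a \<rho>' where "\<forall>n. n \<notin> set xs \<longrightarrow> \<rho>' n = (\<rho>(x := a)) n" "\<forall>n. \<rho>' n < c" "holds c \<rho>' \<phi>"
      by blast
    then show "\<exists>\<rho>'. (\<forall>n. n \<notin> set (x # xs) \<longrightarrow> \<rho>' n = \<rho> n) \<and> (\<forall>n. \<rho>' n < c) \<and> holds c \<rho>' \<phi>"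
      by (intro exI[of _ \<rho>']) auto
  next
    assume "\<exists>\<rho>'. (\<forall>n. n \<notin> set (x # xs) \<longrightarrow> \<rho>' n = \<rho> n) \<and> (\<forall>n. \<rho>' n < c) \<and> holds c \<rho>' \<phi>"
    then obtain \<rho>' where "\<forall>n. n \<notin> set (x # xs) \<longrightarrow> \<rho>' n = \<rho> n" "\<forall>n. \<rho>' n < c" "holds c \<rho>' \<phi>"
      by blast
    then show "\<exists>a<c. \<exists>\<rho>'. (\<forall>n. n \<notin> set xs \<longrightarrow> \<rho>' n = (\<rho>(x := a)) n) \<and> (\<forall>n. \<rho>' n < c) \<and> holds c \<rho>' \<phi>"
      by (intro exI[of _ "\<rho>' x"] exI[of _ \<rho>'] conjI) auto
  qed
  finally show ?case .
qed

text \<open>The truth table of \<open>P\<close> over the letters. Its size is exponential in the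
  number of variables, of which never more than six are used.\<close>

fun pred_form :: "nat \<Rightarrow> (nat list \<Rightarrow> bool) \<Rightarrow> nat list \<Rightarrow> bf" where
  "pred_form c P [] = (if P [] then Tru else Not Tru)"
| "pred_form c P (x # xs) =
     foldr (\<lambda>a \<phi>. Disj (And (Is x a) (pred_form c (\<lambda>l. P (a # l)) xs)) \<phi>) [0..<c] (Not Tru)"

lemma holds_disjs: "holds c \<rho> (foldr (\<lambda>a \<phi>. Disj (h a) \<phi>) as (Not Tru)) \<longleftrightarrow> (\<exists>a\<in>set as. holds c \<rho> (h a))"
  by (induction "as") auto

lemma holds_pred_form:
  "\<forall>x\<in>set xs. \<rho> x < c \<Longrightarrow> holds c \<rho> (pred_form c P xs) \<longleftrightarrow> P (map \<rho> xs)"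
  by (induction xs arbitrary: P) (auto simp: holds_disjs)

lemma fv_disjs: "fv (foldr (\<lambda>a \<phi>. Disj (h a) \<phi>) as (Not Tru)) = (\<Union>a\<in>set as. fv (h a))"
  by (induction "as") auto

lemma fv_pred_form: "fv (pred_form c P xs) \<subseteq> set xs"
proof (induction xs arbitrary: P)
  case (Cons x xs)
  then show ?case
    by (simp add: fv_disjs UN_subset_iff) (meson subset_insertI subset_trans)
qed auto

declare pred_form.simps [simp del]

section \<open>Savitch's formula\<close>

text \<open>The kind occupies the three low bits, and the index enters as a power of two. The binary
  numeral is then a unary index behind three bits, so names can be written in polynomial time
  without arithmetic.\<close>

definition name :: "nat \<Rightarrow> nat \<Rightarrow> nat" where
  "name \<kappa> i = 8 * 2 ^ i + \<kappa>"

lemma name_inj: "\<kappa> < 8 \<Longrightarrow> \<kappa>' < 8 \<Longrightarrow> name \<kappa> i = name \<kappa>' j \<longleftrightarrow> \<kappa> = \<kappa>' \<and> i = j"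
proof
  assume k: "\<kappa> < 8" "\<kappa>' < 8" and eq: "name \<kappa> i = name \<kappa>' j"
  have "name \<kappa> i mod 8 = \<kappa>" "name \<kappa>' j mod 8 = \<kappa>'" "name \<kappa> i div 8 = 2 ^ i" "name \<kappa>' j div 8 = 2 ^ j"
    using k by (simp_all add: name_def)
  then have "\<kappa> = \<kappa>'" "(2::nat) ^ i = 2 ^ j" using eq by metis+
  then show "\<kappa> = \<kappa>' \<and> i = j" by simp
qed simp

definition names :: "nat \<Rightarrow> nat \<Rightarrow> nat list" where
  "names m \<kappa> = map (name \<kappa>) [0..<m]"

definition content :: "nat \<Rightarrow> (nat \<Rightarrow> nat) \<Rightarrow> nat \<Rightarrow> nat list" where
  "content m \<rho> \<kappa> = map \<rho> (names m \<kappa>)"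

definition vecs :: "nat \<Rightarrow> nat \<Rightarrow> nat list set" where
  "vecs c m = {X. length X = m \<and> set X \<subseteq> {..<c}}"

lemma content_nth [simp]: "i < m \<Longrightarrow> content m \<rho> \<kappa> ! i = \<rho> (name \<kappa> i)"
  by (simp add: content_def names_def)

lemma content_length [simp]: "length (content m \<rho> \<kappa>) = m"
  by (simp add: content_def names_def)

lemma content_vecs: "\<forall>n. \<rho> n < c \<Longrightarrow> content m \<rho> \<kappa> \<in> vecs c m"
  by (auto simp: vecs_def) (auto simp: content_def)

definition expresses :: "nat \<Rightarrow> nat \<Rightarrow> nat \<Rightarrow> nat \<Rightarrow> bf \<Rightarrow> (nat list \<Rightarrow> nat list \<Rightarrow> bool) \<Rightarrow> bool" where
  "expresses c m \<kappa> \<kappa>' \<phi> R \<longleftrightarrow>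
     (\<forall>\<rho>. (\<forall>n. \<rho> n < c) \<longrightarrow> holds c \<rho> \<phi> = R (content m \<rho> \<kappa>) (content m \<rho> \<kappa>'))"

text \<open>The entries are the selector and then one letter each of x, y, z, u, v. Selector 0
  equates \<open>(u, v)\<close> with \<open>(x, z)\<close>, every other letter equates it with
  \<open>(z, y)\<close>.\<close>

definition half_rel :: "nat list \<Rightarrow> bool" where
  "half_rel l = (if l ! 0 = 0 then l ! 4 = l ! 1 \<and> l ! 5 = l ! 3 else l ! 4 = l ! 3 \<and> l ! 5 = l ! 2)"

text \<open>Halving a path from \<open>x\<close> to \<open>y\<close> at \<open>z\<close>: the universally quantified selector, of kind \<open>5\<close>,
  lets the pair \<open>(u, v)\<close> range over the two halves.\<close>

definition halve :: "nat \<Rightarrow> nat \<Rightarrow> nat \<Rightarrow> nat \<Rightarrow> nat \<Rightarrow> nat \<Rightarrow> bf \<Rightarrow> bf" where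
  "halve c m x y u v \<phi> = exs (names m 2) (Not (Exi (name 5 0) (Not (exs (names m u) (exs (names m v)
     (ands (map (\<lambda>i. pred_form c half_rel [name 5 0, name x i, name y i, name 2 i, name u i, name v i]) [0..<m]) \<phi>))))))"

lemma assign_content:
  assumes "Z \<in> vecs c m" "\<forall>n. \<rho> n < c"
  obtains \<rho>' where "\<forall>n. n \<notin> set (names m \<kappa>) \<longrightarrow> \<rho>' n = \<rho> n" "\<forall>n. \<rho>' n < c" "content m \<rho>' \<kappa> = Z"
proof -
  define \<rho>' where "\<rho>' n = (case map_of (zip (names m \<kappa>) Z) n of Some a \<Rightarrow> a | None \<Rightarrow> \<rho> n)" for n
  have len: "length (names m \<kappa>) = length Z" "length Z = m" using assms(1) by (simp_all add: names_def vecs_def)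
  have dist: "distinct (names m \<kappa>)"
    by (auto simp: names_def distinct_map inj_on_def name_def)
  have "\<forall>n. n \<notin> set (names m \<kappa>) \<longrightarrow> \<rho>' n = \<rho> n"
    using len by (auto simp: \<rho>'_def map_of_eq_None_iff[symmetric] split: option.split dest!: map_of_SomeD set_zip_leftD)
  moreover have "\<rho>' n < c" for n
    using assms by (auto simp: \<rho>'_def vecs_def split: option.split dest!: map_of_SomeD set_zip_rightD)
  moreover have "content m \<rho>' \<kappa> = Z"
  proof (rule nth_equalityI)
    fix i assume "i < length (content m \<rho>' \<kappa>)"
    then have i: "i < m" by simp
    then have "map_of (zip (names m \<kappa>) Z) (names m \<kappa> ! i) = Some (Z ! i)"
      using len dist by (intro map_of_zip_nth) auto
    then show "content m \<rho>' \<kappa> ! i = Z ! i" using i by (simp add: \<rho>'_def content_def names_def)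
  qed (use len in simp)
  ultimately show thesis using that by blast
qed

lemma names_disjoint: "\<kappa> < 8 \<Longrightarrow> \<kappa>' < 8 \<Longrightarrow> \<kappa> \<noteq> \<kappa>' \<Longrightarrow> name \<kappa> i \<notin> set (names m \<kappa>')"
  by (auto simp: names_def name_inj)

lemma content_cong: "\<forall>i<m. \<rho> (name \<kappa> i) = \<rho>' (name \<kappa> i) \<Longrightarrow> content m \<rho> \<kappa> = content m \<rho>' \<kappa>"
  by (auto simp: content_def names_def)

text \<open>The selector is a letter and not a bit: all nonzero letters stand for the second half,
  and \<open>2 \<le> c\<close> provides one.\<close>

lemma all_selectors: "2 \<le> c \<Longrightarrow> (\<forall>a<c :: nat. if a = 0 then A else B) \<longleftrightarrow> A \<and> B"
proof
  assume c: "2 \<le> c" and all: "\<forall>a<c. if a = 0 then A else B"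
  from all[rule_format, of 0] all[rule_format, of 1] c show "A \<and> B" by simp
qed auto

text \<open>For each selector the equations pin down \<open>u\<close> and \<open>v\<close>, so
  quantifying them existentially is mere substitution. Names of different kinds are disjoint, hence
  the inner blocks leave the contents of \<open>x\<close>, \<open>y\<close> and the midpoint, of
  kind 2, alone.\<close>

lemma expresses_halve:
  assumes \<phi>: "expresses c m u v \<phi> R" and c: "2 \<le> c"
    and k: "x < 5" "y < 5" "u < 5" "v < 5" "distinct [2, x, y, u, v]"
  shows "expresses c m x y (halve c m x y u v \<phi>) (\<lambda>X Y. \<exists>Z\<in>vecs c m. R X Z \<and> R Z Y)"
  unfolding expresses_def
proof (intro allI impI)
  fix \<rho> :: "nat \<Rightarrow> nat" assume \<rho>: "\<forall>n. \<rho> n < c"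
  let ?body = "ands (map (\<lambda>i. pred_form c half_rel [name 5 0, name x i, name y i, name 2 i, name u i, name v i]) [0..<m]) \<phi>"
  have body: "holds c \<tau> ?body \<longleftrightarrow>
      (if \<tau> (name 5 0) = 0 then content m \<tau> u = content m \<tau> x \<and> content m \<tau> v = content m \<tau> 2
       else content m \<tau> u = content m \<tau> 2 \<and> content m \<tau> v = content m \<tau> y) \<and>
      R (content m \<tau> u) (content m \<tau> v)" if "\<forall>n. \<tau> n < c" for \<tau>
  proof -
    have 1: "holds c \<tau> ?body \<longleftrightarrow> (\<forall>i<m. half_rel (map \<tau> [name 5 0, name x i, name y i, name 2 i, name u i, name v i])) \<and>
        holds c \<tau> \<phi>"
      using that by (auto simp: holds_pred_form)
    have 2: "holds c \<tau> \<phi> \<longleftrightarrow> R (content m \<tau> u) (content m \<tau> v)"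
      using \<phi> that by (simp add: expresses_def)
    have 3: "(\<forall>i<m. half_rel (map \<tau> [name 5 0, name x i, name y i, name 2 i, name u i, name v i])) \<longleftrightarrow>
      (if \<tau> (name 5 0) = 0 then content m \<tau> u = content m \<tau> x \<and> content m \<tau> v = content m \<tau> 2
       else content m \<tau> u = content m \<tau> 2 \<and> content m \<tau> v = content m \<tau> y)"
      by (cases "\<tau> (name 5 0) = 0") (auto simp: half_rel_def list_eq_iff_nth_eq)
    show ?thesis unfolding 1 2 3 ..
  qed
  have inner: "holds c \<tau> (exs (names m u) (exs (names m v) ?body)) \<longleftrightarrow>
      (if \<tau> (name 5 0) = 0 then R (content m \<tau> x) (content m \<tau> 2) else R (content m \<tau> 2) (content m \<tau> y))"
    (is "?l \<longleftrightarrow> ?r") if \<tau>: "\<forall>n. \<tau> n < c" for \<tau>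
  proof
    assume ?l
    then obtain \<tau>1 where 1: "\<forall>n. n \<notin> set (names m u) \<longrightarrow> \<tau>1 n = \<tau> n" "\<forall>n. \<tau>1 n < c"
      "holds c \<tau>1 (exs (names m v) ?body)" using holds_exs[OF \<tau>] by blast
    then obtain \<tau>2 where 2: "\<forall>n. n \<notin> set (names m v) \<longrightarrow> \<tau>2 n = \<tau>1 n" "\<forall>n. \<tau>2 n < c" "holds c \<tau>2 ?body"
      using holds_exs[OF 1(2)] by blast
    have same: "\<tau>2 (name \<kappa> i) = \<tau> (name \<kappa> i)" if "\<kappa> < 8" "\<kappa> \<noteq> u" "\<kappa> \<noteq> v" for \<kappa> i
      using 1(1) 2(1) names_disjoint that k by simp
    have "content m \<tau>2 x = content m \<tau> x" "content m \<tau>2 y = content m \<tau> y" "content m \<tau>2 2 = content m \<tau> 2"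
      "\<tau>2 (name 5 0) = \<tau> (name 5 0)"
      using k by (auto intro!: content_cong same)
    then show ?r using body[OF 2(2)] 2(3) by (auto split: if_splits)
  next
    assume r: ?r
    define U V where "U = (if \<tau> (name 5 0) = 0 then content m \<tau> x else content m \<tau> 2)"
      and "V = (if \<tau> (name 5 0) = 0 then content m \<tau> 2 else content m \<tau> y)"
    have UV: "U \<in> vecs c m" "V \<in> vecs c m" "R U V"
      using r content_vecs[OF \<tau>] by (auto simp: U_def V_def split: if_splits)
    obtain \<tau>1 where 1: "\<forall>n. n \<notin> set (names m u) \<longrightarrow> \<tau>1 n = \<tau> n" "\<forall>n. \<tau>1 n < c" "content m \<tau>1 u = U"
      by (rule assign_content[OF UV(1) \<tau>])
    obtain \<tau>2 where 2: "\<forall>n. n \<notin> set (names m v) \<longrightarrow> \<tau>2 n = \<tau>1 n" "\<forall>n. \<tau>2 n < c" "content m \<tau>2 v = V"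
      by (rule assign_content[OF UV(2) 1(2)])
    have same: "\<tau>2 (name \<kappa> i) = \<tau> (name \<kappa> i)" if "\<kappa> < 8" "\<kappa> \<noteq> u" "\<kappa> \<noteq> v" for \<kappa> i
      using 1(1) 2(1) names_disjoint that k by simp
    have "content m \<tau>2 x = content m \<tau> x" "content m \<tau>2 y = content m \<tau> y" "content m \<tau>2 2 = content m \<tau> 2"
      "\<tau>2 (name 5 0) = \<tau> (name 5 0)"
      using k by (auto intro!: content_cong same)
    moreover have "content m \<tau>2 u = content m \<tau>1 u"
      using 2(1) names_disjoint k by (intro content_cong) auto
    ultimately have "holds c \<tau>2 ?body"
      unfolding body[OF 2(2)] using 1(3) 2(3) UV(3) by (auto simp: U_def V_def split: if_splits)
    then show ?l using holds_exs[OF \<tau>] holds_exs[OF 1(2)] 1 2 by blast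
  qed
  have all: "holds c \<tau> (Not (Exi (name 5 0) (Not (exs (names m u) (exs (names m v) ?body))))) \<longleftrightarrow>
      R (content m \<tau> x) (content m \<tau> 2) \<and> R (content m \<tau> 2) (content m \<tau> y)" if \<tau>: "\<forall>n. \<tau> n < c" for \<tau>
  proof -
    have "content m (\<tau>(name 5 0 := a)) \<kappa> = content m \<tau> \<kappa>" if "\<kappa> < 5" for a \<kappa>
      using that by (intro content_cong) (auto simp: name_inj)
    then have "holds c (\<tau>(name 5 0 := a)) (exs (names m u) (exs (names m v) ?body)) \<longleftrightarrow>
       (if a = 0 then R (content m \<tau> x) (content m \<tau> 2) else R (content m \<tau> 2) (content m \<tau> y))" if "a < c" for a
      using inner[of "\<tau>(name 5 0 := a)"] \<tau> that k by simp
    then have "holds c \<tau> (Not (Exi (name 5 0) (Not (exs (names m u) (exs (names m v) ?body))))) \<longleftrightarrow>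
      (\<forall>a<c. if a = 0 then R (content m \<tau> x) (content m \<tau> 2) else R (content m \<tau> 2) (content m \<tau> y))"
      by simp
    then show ?thesis unfolding all_selectors[OF c] .
  qed
  show "holds c \<rho> (halve c m x y u v \<phi>) \<longleftrightarrow>
     (\<exists>Z\<in>vecs c m. R (content m \<rho> x) Z \<and> R Z (content m \<rho> y))" (is "?l \<longleftrightarrow> ?r")
  proof
    assume ?l
    then obtain \<tau> where \<tau>: "\<forall>n. n \<notin> set (names m 2) \<longrightarrow> \<tau> n = \<rho> n" "\<forall>n. \<tau> n < c"
      "R (content m \<tau> x) (content m \<tau> 2) \<and> R (content m \<tau> 2) (content m \<tau> y)"
      unfolding halve_def holds_exs[OF \<rho>] using all by blast
    have "content m \<tau> x = content m \<rho> x" "content m \<tau> y = content m \<rho> y"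
      using \<tau>(1) names_disjoint k by (auto intro!: content_cong)
    then have "R (content m \<rho> x) (content m \<tau> 2)" "R (content m \<tau> 2) (content m \<rho> y)"
      using \<tau>(3) by simp_all
    then show ?r using content_vecs[OF \<tau>(2)] by blast
  next
    assume ?r
    then obtain Z where Z: "Z \<in> vecs c m" "R (content m \<rho> x) Z" "R Z (content m \<rho> y)" by blast
    obtain \<tau> where \<tau>: "\<forall>n. n \<notin> set (names m 2) \<longrightarrow> \<tau> n = \<rho> n" "\<forall>n. \<tau> n < c" "content m \<tau> 2 = Z"
      by (rule assign_content[OF Z(1) \<rho>])
    have "content m \<tau> x = content m \<rho> x" "content m \<tau> y = content m \<rho> y"
      using \<tau>(1) names_disjoint k by (auto intro!: content_cong)
    then have "holds c \<tau> (Not (Exi (name 5 0) (Not (exs (names m u) (exs (names m v) ?body)))))"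
      unfolding all[OF \<tau>(2)] using \<tau>(3) Z by simp
    then show ?l unfolding halve_def holds_exs[OF \<rho>] using \<tau>(1,2) by blast
  qed
qed

lemma fv_UN: "(\<And>i. i < m \<Longrightarrow> fv (h i) \<subseteq> S) \<Longrightarrow> (\<Union>\<phi>\<in>set (map h [0..<m]). fv \<phi>) \<subseteq> S"
  by (simp add: UN_subset_iff)

lemma fv_halve:
  assumes "fv \<phi> \<subseteq> set (names m u) \<union> set (names m v)"
  shows "fv (halve c m x y u v \<phi>) \<subseteq> set (names m x) \<union> set (names m y)"
proof -
  have "fv (pred_form c half_rel [name 5 0, name x i, name y i, name 2 i, name u i, name v i]) \<subseteq>
      {name 5 0} \<union> set (names m x) \<union> set (names m y) \<union> set (names m 2) \<union> set (names m u) \<union> set (names m v)"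
    if "i < m" for i
    using fv_pred_form[of c half_rel "[name 5 0, name x i, name y i, name 2 i, name u i, name v i]"] that
    by (auto simp: names_def)
  then have "fv (ands (map (\<lambda>i. pred_form c half_rel [name 5 0, name x i, name y i, name 2 i, name u i, name v i]) [0..<m]) \<phi>) \<subseteq>
      {name 5 0} \<union> set (names m x) \<union> set (names m y) \<union> set (names m 2) \<union> set (names m u) \<union> set (names m v)"
    (is "?S \<subseteq> _")
    unfolding fv_ands by (intro Un_least fv_UN) (use assms in auto)
  moreover have "fv (halve c m x y u v \<phi>) = ?S - set (names m v) - set (names m u) - {name 5 0} - set (names m 2)"
    by (simp add: halve_def)
  ultimately show ?thesis by blast
qed

section \<open>The reachability formula\<close>

definition step_form :: "nat \<Rightarrow> nat \<Rightarrow> (nat \<Rightarrow> nat \<Rightarrow> nat \<Rightarrow> nat \<Rightarrow> nat) \<Rightarrow> nat \<Rightarrow> bf" where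
  "step_form c m f blank =
     And (pred_form c (\<lambda>l. l ! 4 = f (l ! 0) (l ! 1) (l ! 2) (l ! 3)) [name 0 0, name 0 0, name 0 0, name 0 1, name 1 0])
     (ands (map (\<lambda>i. pred_form c (\<lambda>l. l ! 4 = f (l ! 0) (l ! 1) (l ! 2) (l ! 3))
          [name 0 0, name 0 i, name 0 (Suc i), name 0 (Suc (Suc i)), name 1 (Suc i)]) [0..<m])
     (Is (name 1 (Suc m)) blank))"

text \<open>Two halvings per round exchange the pair of kinds 0, 1 with the pair 3, 4 and back, so
  finitely many kinds of names suffice. One round quadruples the number of steps.\<close>

definition savitch :: "nat \<Rightarrow> nat \<Rightarrow> (nat \<Rightarrow> nat \<Rightarrow> nat \<Rightarrow> nat \<Rightarrow> nat) \<Rightarrow> nat \<Rightarrow> nat \<Rightarrow> bf" where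
  "savitch c m f blank T =
     ((\<lambda>\<phi>. halve c (m + 2) 0 1 3 4 (halve c (m + 2) 3 4 0 1 \<phi>)) ^^ T) (step_form c m f blank)"

definition accept_form ::
  "nat \<Rightarrow> nat \<Rightarrow> (nat \<Rightarrow> nat \<Rightarrow> nat \<Rightarrow> nat \<Rightarrow> nat) \<Rightarrow> nat \<Rightarrow> (nat \<Rightarrow> bool) \<Rightarrow> (nat \<Rightarrow> nat) \<Rightarrow> nat \<Rightarrow> bf"
where
  "accept_form c m f blank acc ini T =
     exs (names (m + 2) 0) (exs (names (m + 2) 1)
       (ands (map (\<lambda>i. Is (name 0 i) (ini i)) [0..<m + 2])
         (And (pred_form c (\<lambda>l. acc (l ! 0)) [name 1 0]) (savitch c m f blank T))))"

lemma name_in_names [simp]: "i < m \<Longrightarrow> name \<kappa> i \<in> set (names m \<kappa>)"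
  by (simp add: names_def)

lemma fv_savitch: "fv (savitch c m f blank T) \<subseteq> set (names (m + 2) 0) \<union> set (names (m + 2) 1)"
proof (induction T)
  case 0
  let ?N = "set (names (m + 2) 0) \<union> set (names (m + 2) 1)"
  have 1: "fv (pred_form c P [name 0 0, name 0 i, name 0 (Suc i), name 0 (Suc (Suc i)), name 1 (Suc i)]) \<subseteq> ?N"
    if "i < m" for P i
    by (rule subset_trans[OF fv_pred_form]) (use that in simp)
  have 2: "fv (pred_form c P [name 0 0, name 0 0, name 0 0, name 0 1, name 1 0]) \<subseteq> ?N" for P
    by (rule subset_trans[OF fv_pred_form]) simp
  have "fv (step_form c m f blank) \<subseteq> ?N"
    unfolding step_form_def fv_And fv_ands
    by (intro Un_least fv_UN 1 2) simp_all
  then show ?case by (simp add: savitch_def)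
next
  case (Suc T)
  have "savitch c m f blank (Suc T) = halve c (m + 2) 0 1 3 4 (halve c (m + 2) 3 4 0 1 (savitch c m f blank T))"
    by (simp add: savitch_def)
  then show ?case using Suc by (simp only:) (intro fv_halve)
qed

lemma fv_accept_form: "fv (accept_form c m f blank acc ini T) = {}"
proof -
  have "fv (pred_form c (\<lambda>l. acc (l ! 0)) [name 1 0]) \<subseteq> set (names (m + 2) 1)"
    by (rule subset_trans[OF fv_pred_form]) simp
  moreover have "(\<Union>\<phi>\<in>set (map (\<lambda>i. Is (name 0 i) (ini i)) [0..<m + 2]). fv \<phi>) \<subseteq> set (names (m + 2) 0)"
    by (auto simp del: upt_Suc)
  ultimately show ?thesis
    using fv_savitch[of c m f blank T] unfolding accept_form_def fv_exs fv_ands fv_And by blast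
qed

text \<open>\<open>v t i\<close> is the letter of cell \<open>i\<close> at time \<open>t\<close>.\<close>

locale local_run =
  fixes c m :: nat and f :: "nat \<Rightarrow> nat \<Rightarrow> nat \<Rightarrow> nat \<Rightarrow> nat" and blank :: nat and v :: "nat \<Rightarrow> nat \<Rightarrow> nat"
  assumes c: "2 \<le> c" and v_less: "v t i < c" and v_blank: "Suc m \<le> i \<Longrightarrow> v t i = blank"
    and v_step: "v (Suc t) i = f (v t 0) (v t (i - 1)) (v t i) (v t (Suc i))"
begin

definition V :: "nat \<Rightarrow> nat list" where
  "V t = map (v t) [0..<m + 2]"

text \<open>\<open>R\<close> has to be right only when started in a word of the run, and there it
  determines its target. In this form relations compose, whatever they say about other
  words.\<close>

definition tracks :: "(nat list \<Rightarrow> nat list \<Rightarrow> bool) \<Rightarrow> nat \<Rightarrow> bool" where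
  "tracks R n \<longleftrightarrow> (\<forall>t. \<forall>Y\<in>vecs c (m + 2). R (V t) Y \<longleftrightarrow> Y = V (t + n))"

lemma V_vecs: "V t \<in> vecs c (m + 2)"
  using v_less by (auto simp: V_def vecs_def)

lemma tracks_double:
  assumes "tracks R n"
  shows "tracks (\<lambda>X Y. \<exists>Z\<in>vecs c (m + 2). R X Z \<and> R Z Y) (n + n)"
  unfolding tracks_def
proof (intro allI ballI)
  fix t Y assume "Y \<in> vecs c (m + 2)"
  then show "(\<exists>Z\<in>vecs c (m + 2). R (V t) Z \<and> R Z Y) \<longleftrightarrow> Y = V (t + (n + n))"
    using assms V_vecs by (auto simp: tracks_def add.assoc)
qed

lemma V_nth [simp]: "i < m + 2 \<Longrightarrow> V t ! i = v t i"
  by (simp add: V_def del: upt_Suc)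

lemma step_form_tracks: "\<exists>R. expresses c (m + 2) 0 1 (step_form c m f blank) R \<and> tracks R 1"
proof (intro exI conjI)
  let ?R = "\<lambda>X Y. Y ! 0 = f (X ! 0) (X ! 0) (X ! 0) (X ! 1) \<and>
     (\<forall>i<m. Y ! Suc i = f (X ! 0) (X ! i) (X ! Suc i) (X ! Suc (Suc i))) \<and> Y ! Suc m = blank"
  show "expresses c (m + 2) 0 1 (step_form c m f blank) ?R"
    unfolding expresses_def
  proof (intro allI impI)
    fix \<rho> :: "nat \<Rightarrow> nat" assume \<rho>: "\<forall>n. \<rho> n < c"
    show "holds c \<rho> (step_form c m f blank) \<longleftrightarrow> ?R (content (m + 2) \<rho> 0) (content (m + 2) \<rho> 1)"
      using \<rho> by (auto simp: step_form_def holds_pred_form)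
  qed
  show "tracks ?R 1"
    unfolding tracks_def
  proof (intro allI ballI)
    fix t Y assume Y: "Y \<in> vecs c (m + 2)"
    have "Y = V (t + 1) \<longleftrightarrow> (\<forall>i<m + 2. Y ! i = v (Suc t) i)"
      using Y by (auto simp: vecs_def list_eq_iff_nth_eq V_def simp del: upt_Suc)
    \<comment> \<open>Splits off the two boundary cells: cell 0 uses itself as left neighbour, in
      keeping with \<open>0 - 1 = 0\<close>, and the last cell, whose right neighbour lies outside
      the word, is known to be blank.\<close>
    also have "\<dots> \<longleftrightarrow> Y ! 0 = v (Suc t) 0 \<and> (\<forall>i<m. Y ! Suc i = v (Suc t) (Suc i)) \<and> Y ! Suc m = v (Suc t) (Suc m)"
      using All_less_Suc2[of "Suc m" "\<lambda>i. Y ! i = v (Suc t) i"]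
        All_less_Suc[of m "\<lambda>i. Y ! Suc i = v (Suc t) (Suc i)"] by auto
    finally show "?R (V t) Y \<longleftrightarrow> Y = V (t + 1)"
      using v_blank[of "Suc m" "Suc t"] by (simp add: v_step[of t 0] v_step[of t "Suc _"] del: upt_Suc)
  qed
qed

lemma savitch_tracks: "\<exists>R. expresses c (m + 2) 0 1 (savitch c m f blank T) R \<and> tracks R (4 ^ T)"
proof (induction T)
  case 0
  then show ?case using step_form_tracks by (simp add: savitch_def)
next
  case (Suc T)
  then obtain R where R: "expresses c (m + 2) 0 1 (savitch c m f blank T) R" "tracks R (4 ^ T)" by blast
  have "savitch c m f blank (Suc T) = halve c (m + 2) 0 1 3 4 (halve c (m + 2) 3 4 0 1 (savitch c m f blank T))"
    by (simp add: savitch_def)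
  moreover have "expresses c (m + 2) 0 1 (halve c (m + 2) 0 1 3 4 (halve c (m + 2) 3 4 0 1 (savitch c m f blank T)))
     (\<lambda>X Y. \<exists>Z\<in>vecs c (m + 2). (\<exists>W\<in>vecs c (m + 2). R X W \<and> R W Z) \<and> (\<exists>W\<in>vecs c (m + 2). R Z W \<and> R W Y))"
    by (intro expresses_halve R c) auto
  moreover have "tracks (\<lambda>X Y. \<exists>Z\<in>vecs c (m + 2). (\<exists>W\<in>vecs c (m + 2). R X W \<and> R W Z) \<and>
      (\<exists>W\<in>vecs c (m + 2). R Z W \<and> R W Y)) (4 ^ Suc T)"
  proof -
    have "(4 :: nat) ^ Suc T = 4 ^ T + 4 ^ T + (4 ^ T + 4 ^ T)" by simp
    then show ?thesis using tracks_double[OF tracks_double[OF R(2)]] by (simp only:)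
  qed
  ultimately show ?case by auto
qed

lemma holds_accept_form:
  assumes "\<forall>n. \<rho> n < c" and ini: "\<And>i. i < m + 2 \<Longrightarrow> ini i = v 0 i"
  shows "holds c \<rho> (accept_form c m f blank acc ini T) \<longleftrightarrow> acc (v (4 ^ T) 0)"
proof -
  obtain R where R: "expresses c (m + 2) 0 1 (savitch c m f blank T) R" "tracks R (4 ^ T)"
    using savitch_tracks by blast
  let ?body = "ands (map (\<lambda>i. Is (name 0 i) (ini i)) [0..<m + 2])
         (And (pred_form c (\<lambda>l. acc (l ! 0)) [name 1 0]) (savitch c m f blank T))"
  have body: "holds c \<tau> ?body \<longleftrightarrow> content (m + 2) \<tau> 0 = V 0 \<and> content (m + 2) \<tau> 1 = V (4 ^ T) \<and> acc (v (4 ^ T) 0)"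
    if \<tau>: "\<forall>n. \<tau> n < c" for \<tau>
  proof -
    have "content (m + 2) \<tau> 0 = V 0 \<longleftrightarrow> (\<forall>i<m + 2. \<tau> (name 0 i) = ini i)"
      using ini by (auto simp: list_eq_iff_nth_eq V_def simp del: upt_Suc)
    then have "holds c \<tau> ?body \<longleftrightarrow> content (m + 2) \<tau> 0 = V 0 \<and> acc (content (m + 2) \<tau> 1 ! 0) \<and>
        R (content (m + 2) \<tau> 0) (content (m + 2) \<tau> 1)"
      using R(1) \<tau> by (auto simp: expresses_def holds_pred_form simp del: upt_Suc)
    moreover have "content (m + 2) \<tau> 1 ! 0 = v (4 ^ T) 0" if "content (m + 2) \<tau> 1 = V (4 ^ T)"
      unfolding that by simp
    ultimately show ?thesis
      using R(2)[unfolded tracks_def, rule_format, of "content (m + 2) \<tau> 1" 0] content_vecs[OF \<tau>]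
      by (auto simp del: content_nth)
  qed
  show ?thesis
  proof
    assume "holds c \<rho> (accept_form c m f blank acc ini T)"
    then obtain \<tau> where \<tau>: "\<forall>n. \<tau> n < c" "holds c \<tau> (exs (names (m + 2) 1) ?body)"
      unfolding accept_form_def holds_exs[OF assms(1)] by blast
    then obtain \<tau>' where "\<forall>n. \<tau>' n < c" "holds c \<tau>' ?body"
      unfolding holds_exs[OF \<tau>(1)] by blast
    then show "acc (v (4 ^ T) 0)" using body by blast
  next
    assume a: "acc (v (4 ^ T) 0)"
    obtain \<tau> where \<tau>: "\<forall>n. n \<notin> set (names (m + 2) 0) \<longrightarrow> \<tau> n = \<rho> n" "\<forall>n. \<tau> n < c" "content (m + 2) \<tau> 0 = V 0"
      by (rule assign_content[OF V_vecs assms(1)])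
    obtain \<tau>' where \<tau>': "\<forall>n. n \<notin> set (names (m + 2) 1) \<longrightarrow> \<tau>' n = \<tau> n" "\<forall>n. \<tau>' n < c"
      "content (m + 2) \<tau>' 1 = V (4 ^ T)"
      by (rule assign_content[OF V_vecs \<tau>(2)])
    have "content (m + 2) \<tau>' 0 = content (m + 2) \<tau> 0"
      using \<tau>'(1) names_disjoint[of 0 1] by (intro content_cong) auto
    then have "holds c \<tau>' ?body" using body[OF \<tau>'(2)] \<tau>(3) \<tau>'(3) a by simp
    then have "holds c \<tau> (exs (names (m + 2) 1) ?body)"
      unfolding holds_exs[OF \<tau>(2)] using \<tau>' by blast
    then show "holds c \<rho> (accept_form c m f blank acc ini T)"
      unfolding accept_form_def holds_exs[OF assms(1)] using \<tau> by blast
  qed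
qed

end

text \<open>Within \<open>card A\<close> steps some value repeats and the sequence becomes periodic;
  being eventually constant, it already has its limit throughout the period. This takes the place of
  a bound on the running time of a machine of which only the space is bounded.\<close>

lemma eventually_constant_iterates:
  fixes x :: "nat \<Rightarrow> 'a"
  assumes step: "\<And>t. x (Suc t) = g (x t)" and A: "\<And>t. x t \<in> A" "finite A"
    and const: "\<And>t. t0 \<le> t \<Longrightarrow> x t = y" and t: "card A \<le> t"
  shows "x t = y"
proof -
  have "\<not> inj_on x {..card A}"
  proof
    assume "inj_on x {..card A}"
    then have "card (x ` {..card A}) = Suc (card A)" by (simp add: card_image)
    moreover have "card (x ` {..card A}) \<le> card A" using A by (intro card_mono) auto
    ultimately show False by simp
  qed
  then obtain a b where ab: "a < b" "b \<le> card A" "x a = x b"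
    by (auto simp: inj_on_def) (metis linorder_neqE_nat)
  have shift: "x i = x j \<Longrightarrow> x (i + n) = x (j + n)" for i j n
    by (induction n) (auto simp: step)
  have per: "x (a + n * (b - a)) = x a" for n
  proof (induction n)
    case (Suc n)
    have "x (a + n * (b - a) + (b - a)) = x (a + (b - a))" by (rule shift[OF Suc])
    moreover have "a + Suc n * (b - a) = a + n * (b - a) + (b - a)" "a + (b - a) = b" using ab(1) by simp_all
    ultimately show ?case using ab(3) by (simp only:)
  qed simp
  \<comment> \<open>Enough periods lead beyond \<open>t0\<close>, where the sequence is
    constant.\<close>
  have "t0 \<le> a + t0 * (b - a)" using ab(1) by (cases "b - a") auto
  then have xa: "x a = y" using const per[of t0] by metis
  have gy: "g y = y" using step[of t0] const[of t0] const[of "Suc t0"] by simp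
  have "x (a + n) = y" for n
    by (induction n) (simp_all add: xa step gy)
  from this[of "t - a"] show ?thesis using ab t by simp
qed

section \<open>Machine configurations as words\<close>

text \<open>Letter \<open>0\<close> of a configuration holds the state and the symbols under the heads, letter \<open>i\<close>
  the symbols at distance \<open>i\<close> to the left and to the right of each head.  One step of the machine
  then acts locally.\<close>

datatype letter = Head nat "nat list" | Cells "nat list" "nat list"

definition vec :: "config \<Rightarrow> nat \<Rightarrow> letter" where
  "vec C i = (if i = 0 then Head (fst C) (map tape_read (snd C))
     else Cells (map (\<lambda>T. fst T (snd T - int i)) (snd C)) (map (\<lambda>T. fst T (snd T + int i)) (snd C)))"

text \<open>The neighbour of letter 1 is the head letter. The symbol meant there is the one just
  written, and it is supplied as \<open>s\<close>.\<close>

fun left_sym :: "letter \<Rightarrow> nat \<Rightarrow> nat \<Rightarrow> nat" where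
  "left_sym (Head q ss) j s = s"
| "left_sym (Cells ls rs) j s = ls ! j"

fun right_sym :: "letter \<Rightarrow> nat \<Rightarrow> nat \<Rightarrow> nat" where
  "right_sym (Head q ss) j s = s"
| "right_sym (Cells ls rs) j s = rs ! j"

text \<open>Selects by the direction of the head, in the order stay, right, left; each alternative
  may depend on the symbol written.\<close>

definition pick :: "nat \<times> int \<Rightarrow> (nat \<Rightarrow> nat) \<Rightarrow> (nat \<Rightarrow> nat) \<Rightarrow> (nat \<Rightarrow> nat) \<Rightarrow> nat" where
  "pick a x y z = (if snd a = 0 then x (fst a) else if snd a = 1 then y (fst a) else z (fst a))"

text \<open>Cells are addressed relative to the heads, so a move shifts the whole tape. Every cell
  must know the directions, and for this reason the head letter is the first argument at every
  index.\<close>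

fun local_step :: "tm \<Rightarrow> letter \<Rightarrow> letter \<Rightarrow> letter \<Rightarrow> letter \<Rightarrow> letter" where
  "local_step M (Cells _ _) xl xm xr = xm"
| "local_step M (Head q ss) xl xm xr =
     (if q = 1 then xm
      else let as = snd (tm_trans M q ss) in
        case xm of
          Head _ _ \<Rightarrow> Head (fst (tm_trans M q ss))
            (map (\<lambda>j. pick (as ! j) (\<lambda>s. s) (right_sym xr j) (left_sym xr j)) [0..<num_tapes M])
        | Cells ls rs \<Rightarrow> Cells
            (map (\<lambda>j. pick (as ! j) (\<lambda>_. ls ! j) (left_sym xl j) (left_sym xr j)) [0..<num_tapes M])
            (map (\<lambda>j. pick (as ! j) (\<lambda>_. rs ! j) (right_sym xr j) (right_sym xl j)) [0..<num_tapes M]))"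

definition tm_ok :: "tm \<Rightarrow> config \<Rightarrow> bool" where
  "tm_ok M C \<longleftrightarrow> fst C < num_states M \<and> length (snd C) = num_tapes M \<and>
     (\<forall>T\<in>set (snd C). \<forall>z. fst T z < num_symbols M)"

lemma tm_ok_trans:
  assumes M: "tm M" and C: "tm_ok M C"
  defines "a \<equiv> tm_trans M (fst C) (map tape_read (snd C))"
  shows "fst a < num_states M" "length (snd a) = num_tapes M"
    "j < num_tapes M \<Longrightarrow> fst (snd a ! j) < num_symbols M \<and> snd (snd a ! j) \<in> {-1, 0, 1}"
proof -
  have r: "tape_read T = fst T (snd T)" for T by (cases T) simp
  have "length (map tape_read (snd C)) = num_tapes M" "set (map tape_read (snd C)) \<subseteq> {..<num_symbols M}"
    using C by (auto simp: tm_ok_def r)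
  then have *: "fst a < num_states M" "length (snd a) = num_tapes M"
     "set (snd a) \<subseteq> {..<num_symbols M} \<times> {-1, 0, 1}"
    using M C unfolding a_def tm_def tm_ok_def by blast+
  then show "fst a < num_states M" "length (snd a) = num_tapes M" by auto
  show "fst (snd a ! j) < num_symbols M \<and> snd (snd a ! j) \<in> {-1, 0, 1}" if "j < num_tapes M"
  proof -
    have "snd a ! j \<in> set (snd a)" using *(2) that by simp
    then have "snd a ! j \<in> {..<num_symbols M} \<times> {-1, 0, 1}" using *(3) by blast
    then show ?thesis by (auto simp: mem_Times_iff)
  qed
qed

lemma tm_step_eq:
  assumes "fst C \<noteq> 1"
  shows "tm_step M C = (fst (tm_trans M (fst C) (map tape_read (snd C))),
    map2 tape_act (snd (tm_trans M (fst C) (map tape_read (snd C)))) (snd C))"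
  using assms by (cases C) (simp add: case_prod_beta)

lemma tape_act_eq: "tape_act a T = ((fst T)(snd T := fst a), snd T + snd a)"
  by (cases a; cases T) simp

lemma tm_ok_step:
  assumes "tm M" "tm_ok M C"
  shows "tm_ok M (tm_step M C)"
proof (cases "fst C = 1")
  case True
  then show ?thesis using assms by (cases C) simp
next
  case False
  note tr = tm_ok_trans[OF assms]
  show ?thesis
    unfolding tm_ok_def tm_step_eq[OF False]
  proof (intro conjI ballI)
    fix T assume "T \<in> set (snd (fst (tm_trans M (fst C) (map tape_read (snd C))),
      map2 tape_act (snd (tm_trans M (fst C) (map tape_read (snd C)))) (snd C)))"
    then obtain j where "j < num_tapes M"
      "T = tape_act (snd (tm_trans M (fst C) (map tape_read (snd C))) ! j) (snd C ! j)"
      using tr(2) assms(2) by (auto simp: tm_ok_def in_set_conv_nth)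
    moreover from this(1) have "\<forall>z. fst (snd C ! j) z < num_symbols M"
      using assms(2) by (simp add: tm_ok_def)
    ultimately show "\<forall>z. fst T z < num_symbols M" using tr(3) by (simp add: tape_act_eq)
  qed (use tr(1,2) assms(2) in \<open>simp_all add: tm_ok_def\<close>)
qed

lemma vec_step:
  assumes M: "tm M" and C: "tm_ok M C"
  shows "vec (tm_step M C) i = local_step M (vec C 0) (vec C (i - 1)) (vec C i) (vec C (Suc i))"
proof (cases "fst C = 1")
  case True
  then show ?thesis by (cases C) (simp add: vec_def)
next
  case False
  define as where "as = snd (tm_trans M (fst C) (map tape_read (snd C)))"
  note tr = tm_ok_trans[OF M C, folded as_def]
  have len: "length (snd C) = num_tapes M" using C by (simp add: tm_ok_def)
  have r: "tape_read T = fst T (snd T)" for T by (cases T) simp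
  have m: "snd (as ! j) = 0 \<or> snd (as ! j) = 1 \<or> snd (as ! j) = -1" if "j < num_tapes M" for j
    using tr(3)[OF that] by auto
  have mid: "fst (tape_act (as ! j) T) (snd (tape_act (as ! j) T)) =
      pick (as ! j) (\<lambda>s. s) (\<lambda>_. fst T (snd T + 1)) (\<lambda>_. fst T (snd T - 1))"
    if "j < num_tapes M" for j T
    using m[OF that] by (auto simp: pick_def tape_act_eq)
  \<comment> \<open>After a move to the right, the cell at distance 1 on the left is the one just
    written; all others hold old symbols at a shifted distance.\<close>
  have left: "fst (tape_act (as ! j) T) (snd (tape_act (as ! j) T) - int i) =
      pick (as ! j) (\<lambda>_. fst T (snd T - int i)) (\<lambda>s. if i = 1 then s else fst T (snd T - int (i - 1)))
        (\<lambda>_. fst T (snd T - int (Suc i)))"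
    if "j < num_tapes M" "i \<noteq> 0" for j T
    using m[OF that(1)] that(2) by (auto simp: pick_def tape_act_eq of_nat_diff algebra_simps)
  have right: "fst (tape_act (as ! j) T) (snd (tape_act (as ! j) T) + int i) =
      pick (as ! j) (\<lambda>_. fst T (snd T + int i)) (\<lambda>_. fst T (snd T + int (Suc i)))
        (\<lambda>s. if i = 1 then s else fst T (snd T + int (i - 1)))"
    if "j < num_tapes M" "i \<noteq> 0" for j T
    using m[OF that(1)] that(2) by (auto simp: pick_def tape_act_eq of_nat_diff algebra_simps)
  have pickc: "pick a x y z = pick a x' y' z'"
    if "x (fst a) = x' (fst a)" "y (fst a) = y' (fst a)" "z (fst a) = z' (fst a)" for a x y z x' y' z'
    using that by (simp add: pick_def)
  show ?thesis
  proof (cases "i = 0")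
    case True
    then show ?thesis using False len tr(2)
      by (simp add: vec_def tm_step_eq Let_def as_def[symmetric])
        (auto simp: r mid intro!: nth_equalityI pickc)
  next
    case i: False
    then show ?thesis using False len tr(2)
      by (simp add: vec_def tm_step_eq Let_def as_def[symmetric])
        (auto simp: left right intro!: nth_equalityI pickc)
  qed
qed

definition input_sym :: "bool list \<Rightarrow> nat \<Rightarrow> nat" where
  "input_sym w i = (case drop i w of [] \<Rightarrow> 0 | b # _ \<Rightarrow> bit_symbol b)"

text \<open>The given machine is first turned into a program and compiled again, since a compiled
  machine halts with the answer under its output head and acceptance then depends on letter 0 alone.
  Alphabet and local rule depend on \<open>L\<close> only; the word enters through the length and
  the initial letters.\<close>

theorem pspace_local_run:
  assumes "L \<in> PSPACE"
  shows "\<exists>c f blank acc h0 h1 v. \<exists>p :: nat poly. \<forall>w. local_run c (poly p (length w)) f blank (v w) \<and>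
     (\<forall>i. v w 0 i = (if i = 0 then h0 (input_sym w i) else h1 (input_sym w i))) \<and>
     (\<exists>t0. \<forall>t\<ge>t0. v w t = v w t0 \<and> acc (v w t 0) = (w \<in> L))"
proof -
  from assms have "pspace_computable (\<lambda>w. [w \<in> L])" by (simp add: PSPACE_def)
  from cmp_tm[OF pspace_cmp[OF this]] obtain M and p :: "nat poly" where M: "tm M"
    and space: "computes_in_space M (\<lambda>w. [w \<in> L]) (poly p)"
    and halt: "\<And>w i. fst (tm_config M w i) = 1 \<Longrightarrow>
       snd (tm_config M w i) ! 1 = stack_tape (map bit_symbol (rev [w \<in> L]))"
    by blast
  define conf where "conf = tm_config M"
  define K Q S where "K = num_tapes M" and "Q = num_states M" and "S = num_symbols M"
  have KQS: "2 \<le> K" "2 \<le> Q" "3 \<le> S" using M by (auto simp: tm_def K_def Q_def S_def)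
  have conf_Suc: "conf w (Suc t) = tm_step M (conf w t)" for w t by (simp add: conf_def tm_config_def)
  have ok: "tm_ok M (conf w t)" for w t
  proof (induction t)
    case 0
    have "bit_symbol b < S" for b using KQS(3) by (simp add: bit_symbol_def)
    then show ?case using KQS
      by (auto simp: conf_def tm_config_def tm_init_def tm_ok_def K_def Q_def S_def)
  next
    case (Suc t)
    then show ?case unfolding conf_Suc by (rule tm_ok_step[OF M])
  qed
  have heads: "\<bar>snd T\<bar> \<le> int (poly p (length w))" if "T \<in> set (snd (conf w t))" for w t T
    using space that unfolding computes_in_space_def conf_def by blast
  \<comment> \<open>Cells beyond the head bound are never written, and on the right the input
    reaches at most \<open>length w\<close> cells.\<close>
  have blanks: "fst T z = 0" if "T \<in> set (snd (conf w t))" "z < - int (poly p (length w)) \<or> z > int (poly p (length w)) + int (length w)"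
    for w t T z
    using that
  proof (induction t arbitrary: T)
    case 0
    then show ?case by (auto simp: conf_def tm_config_def tm_init_def)
  next
    case (Suc t)
    show ?case
    proof (cases "fst (conf w t) = 1")
      case True
      then have "conf w (Suc t) = conf w t" by (cases "conf w t") (simp add: conf_Suc)
      then show ?thesis using Suc by simp
    next
      case False
      from Suc.prems(1) obtain a U where U: "T = tape_act a U" "U \<in> set (snd (conf w t))"
        by (auto simp: conf_Suc tm_step_eq[OF False] dest: set_zip_rightD)
      have "z \<noteq> snd U" using heads[OF U(2)] Suc.prems(2) by auto
      then show ?thesis using Suc.IH[OF U(2) Suc.prems(2)] U(1) by (simp add: tape_act_eq)
    qed
  qed
  define A where "A = case_prod Head ` ({..<Q} \<times> {xs. set xs \<subseteq> {..<S} \<and> length xs = K}) \<union>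
    case_prod Cells ` ({xs. set xs \<subseteq> {..<S} \<and> length xs = K} \<times> {xs. set xs \<subseteq> {..<S} \<and> length xs = K})"
  have finA: "finite A"
    unfolding A_def by (intro finite_UnI finite_imageI finite_cartesian_product finite_lists_length_eq) auto
  have memA: "Head q ss \<in> A \<longleftrightarrow> q < Q \<and> set ss \<subseteq> {..<S} \<and> length ss = K"
    "Cells ls rs \<in> A \<longleftrightarrow> set ls \<subseteq> {..<S} \<and> length ls = K \<and> set rs \<subseteq> {..<S} \<and> length rs = K" for q ss ls rs
    by (auto simp: A_def image_iff)
  have r: "tape_read T = fst T (snd T)" for T by (cases T) simp
  have vecA: "vec (conf w t) i \<in> A" for w t i
    using ok[of w t] by (auto simp: memA vec_def tm_ok_def K_def Q_def S_def r)
  obtain e where e: "bij_betw e A {0..<card A}" using ex_bij_betw_finite_nat[OF finA] by blast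
  define d where "d = the_inv_into A e"
  have d: "d (e x) = x" if "x \<in> A" for x
    unfolding d_def using e that by (intro the_inv_into_f_f) (auto simp: bij_betw_def)
  have ec: "e x < card A" if "x \<in> A" for x
    using e that by (auto simp: bij_betw_def)
  define f where "f x0 xl xm xr = e (local_step M (d x0) (d xl) (d xm) (d xr))" for x0 xl xm xr
  define v where "v w t i = e (vec (conf w t) i)" for w t i
  define bl where "bl = Cells (replicate K 0) (replicate K 0)"
  define acc where "acc a \<longleftrightarrow> (\<exists>ss. d a = Head 1 ss \<and> ss ! 1 = 2)" for a
  define h0 where "h0 s = e (Head 0 (s # replicate (K - 1) 0))" for s
  define h1 where "h1 s = e (Cells (replicate K 0) (s # replicate (K - 1) 0))" for s
  \<comment> \<open>A head is at most \<open>poly p n\<close> away from the origin, and cells beyond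
    \<open>poly p n + n\<close> are blank, for \<open>n\<close> the input length; the sum bounds the
    distance of nonblank cells from a head.\<close>
  define P where "P = 2 * p + [:0, 1:]"
  have r1: "local_run (card A) (poly P (length w)) f (e bl) (v w)" for w
  proof
    have "{Head 0 (replicate K 0), bl} \<subseteq> A" using KQS by (auto simp: memA bl_def)
    from card_mono[OF finA this] show "2 \<le> card A" by (simp add: bl_def)
    show "v w t i < card A" for t i unfolding v_def by (intro ec vecA)
    show "v w (Suc t) i = f (v w t 0) (v w t (i - 1)) (v w t i) (v w t (Suc i))" for t i
      by (simp only: v_def f_def d[OF vecA] conf_Suc vec_step[OF M ok])
    fix i t assume i: "Suc (poly P (length w)) \<le> i"
    have "fst T (snd T - int i) = 0 \<and> fst T (snd T + int i) = 0" if "T \<in> set (snd (conf w t))" for T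
      using heads[OF that] i by (auto intro!: blanks[OF that] simp: P_def)
    moreover have "length (snd (conf w t)) = K" using ok[of w t] by (simp add: tm_ok_def K_def)
    ultimately have "vec (conf w t) i = bl"
      using i by (auto simp: vec_def bl_def intro!: nth_equalityI)
    then show "v w t i = e bl" by (simp add: v_def)
  qed
  have r2: "v w 0 i = (if i = 0 then h0 (input_sym w i) else h1 (input_sym w i))" for w i
  proof -
    have sym: "input_sym w i = (if i < length w then bit_symbol (w ! i) else 0)" for i
      by (cases "i < length w") (simp_all add: input_sym_def Cons_nth_drop_Suc[symmetric])
    obtain K' where "K = Suc K'" using KQS(1) by (cases K) auto
    then show ?thesis
      by (auto simp: v_def h0_def h1_def vec_def conf_def tm_config_def tm_init_def sym r
          K_def[symmetric] intro!: arg_cong[of _ _ e])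
  qed
  have r3: "\<exists>t0. \<forall>t\<ge>t0. v w t = v w t0 \<and> acc (v w t 0) = (w \<in> L)" for w
  proof -
    obtain t0 where t0: "fst (conf w t0) = 1"
      using space unfolding computes_in_space_def tm_outputs_def conf_def by blast
    have const: "conf w t = conf w t0" if "t0 \<le> t" for t
      using that
    proof (induction t rule: dec_induct)
      case (step t)
      then show ?case using t0 by (cases "conf w t0") (simp add: conf_Suc)
    qed simp
    have "tape_read (snd (conf w t0) ! 1) = bit_symbol (w \<in> L)"
      using halt[of w t0] t0 by (simp add: conf_def)
    moreover have "length (snd (conf w t0)) = K" using ok[of w t0] by (simp add: tm_ok_def K_def)
    ultimately have acc: "acc (v w t0 0) = (w \<in> L)"
      using d[OF vecA[of w t0 0]] t0 KQS(1)
      by (simp add: acc_def v_def) (simp add: vec_def bit_symbol_def)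
    show ?thesis
    proof (intro exI[of _ t0] allI impI)
      fix t assume "t0 \<le> t"
      then have "v w t = v w t0" unfolding v_def by (simp only: const[OF \<open>t0 \<le> t\<close>])
      then show "v w t = v w t0 \<and> acc (v w t 0) = (w \<in> L)" using acc by simp
    qed
  qed
  show ?thesis
    by (intro exI[of _ "card A"] exI[of _ f] exI[of _ "e bl"] exI[of _ acc] exI[of _ h0] exI[of _ h1]
        exI[of _ v] exI[of _ P] allI conjI r1 r2 r3)
qed

section \<open>Reading codes\<close>

lemma cmp_enc_word [cmp_intro]: "cmp b f \<Longrightarrow> cmp b (\<lambda>x. enc_word (f x))"
  unfolding enc_word_def by (intro cmp_intro)

lemma cmp_enc_nat [cmp_intro]: "cmp b f \<Longrightarrow> cmp b (\<lambda>x. enc_nat (f x))"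
  unfolding enc_nat_def by (intro cmp_intro)

lemma enc_word_simps [simp]:
  "enc_word [] = [False]" "enc_word (b # w) = True # b # enc_word w"
  by (simp_all add: enc_word_def)

lemma enc_word_nonempty [simp]: "enc_word w \<noteq> []"
  by (cases w) auto

lemma enc_nat_nonempty [simp]: "enc_nat n \<noteq> []"
  by (simp add: enc_nat_def)

lemma length_enc_word [simp]: "length (enc_word w) = 2 * length w + 1"
  by (induction w) auto

definition read_step :: "bool list \<times> bool list \<times> bool \<Rightarrow> bool list \<times> bool list \<times> bool" where
  "read_step s = (if snd (snd s) then s else
     (case fst s of [] \<Rightarrow> ([], fst (snd s), True)
      | x # w \<Rightarrow> if x then (case w of [] \<Rightarrow> ([], fst (snd s), True) | b # w' \<Rightarrow> (w', fst (snd s) @ [b], False))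
          else (w, fst (snd s), True)))"

text \<open>Total on all words. Whether a code was really present is tested later, by encoding the
  result again and comparing.\<close>

definition read_code :: "bool list \<Rightarrow> bool list \<times> bool list" where
  "read_code w = (let s = (read_step ^^ length w) (w, [], False) in (fst (snd s), fst s))"

definition read_nat :: "bool list \<Rightarrow> nat \<times> bool list" where
  "read_nat w = (unbin (fst (read_code w)), snd (read_code w))"

lemma funpow_fixed: "f x = x \<Longrightarrow> (f ^^ n) x = x"
  by (induction n) auto

lemma funpow_le_fixed:
  assumes "(f ^^ n) x = y" "f y = y" "n \<le> m"
  shows "(f ^^ m) x = y"
proof -
  have "(f ^^ m) x = (f ^^ (m - n)) ((f ^^ n) x)"
    using assms(3) by (metis comp_apply funpow_add le_add_diff_inverse2)
  then show ?thesis using assms funpow_fixed by metis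
qed

lemma read_steps: "(read_step ^^ Suc (length v)) (enc_word v @ r, u, False) = (r, u @ v, True)"
proof (induction v arbitrary: u)
  case (Cons b v)
  have "read_step (enc_word (b # v) @ r, u, False) = (enc_word v @ r, u @ [b], False)"
    by (simp add: read_step_def)
  then show ?case using Cons[of "u @ [b]"] by (simp add: funpow_swap1)
qed (simp add: read_step_def)

lemma read_code [simp]: "read_code (enc_word v @ r) = (v, r)"
proof -
  have "(read_step ^^ length (enc_word v @ r)) (enc_word v @ r, [], False) = (r, v, True)"
    by (rule funpow_le_fixed[OF read_steps[of v r "[]", simplified append_Nil]]) (simp_all add: read_step_def)
  then show ?thesis by (simp add: read_code_def)
qed

lemma read_nat [simp]: "read_nat (enc_nat n @ r) = (n, r)"
  by (simp add: read_nat_def enc_nat_def)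

lemma read_step_length:
  "length (fst (read_step s)) + length (fst (snd (read_step s))) \<le> length (fst s) + length (fst (snd s))"
  by (auto simp: read_step_def split: list.split)

lemma read_steps_length:
  "length (fst ((read_step ^^ i) s)) + length (fst (snd ((read_step ^^ i) s))) \<le> length (fst s) + length (fst (snd s))"
proof (induction i)
  case (Suc i)
  then show ?case using read_step_length[of "(read_step ^^ i) s"] by simp
qed simp

lemma read_code_length: "w \<noteq> [] \<Longrightarrow> length (fst (read_code w)) + length (snd (read_code w)) < length w"
proof -
  assume w: "w \<noteq> []"
  then obtain n where n: "length w = Suc n" by (cases w) auto
  have "length (fst (read_step (w, [], False))) + length (fst (snd (read_step (w, [], False)))) < length w"
    using w by (auto simp: read_step_def split: list.split)
  moreover have "(read_step ^^ length w) (w, [], False) = (read_step ^^ n) (read_step (w, [], False))"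
    by (simp add: n funpow_swap1)
  ultimately show ?thesis
    using read_steps_length[of n "read_step (w, [], False)"] by (simp add: read_code_def Let_def)
qed

lemma length_bin_unbin: "length (bin (unbin u)) \<le> length u"
  using bin_length[OF unbin_less] .

lemma read_nat_length: "w \<noteq> [] \<Longrightarrow> length (bin (fst (read_nat w))) + length (snd (read_nat w)) < length w"
  using read_code_length[of w] length_bin_unbin[of "fst (read_code w)"] by (simp add: read_nat_def)

lemma polybd_length: "cmp False f \<Longrightarrow> polybd (\<lambda>x. length (f x))"
  by (rule polybd_le[OF polybd_sz]) (auto intro: less_imp_le length_le_sz)

lemma cmp_read_code' : "cmp False read_code"
  unfolding read_code_def Let_def
proof (intro cmp_intro)
  have "cmp False (\<lambda>w. (read_step ^^ length w) (w, [], False))"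
  proof (rule cmp_funpow)
    show "cmp False (\<lambda>q :: bool list \<times> bool list \<times> bool list \<times> bool. read_step (snd q))"
      unfolding read_step_def by (intro cmp_intro)
    show "cmp False (\<lambda>w :: bool list. length w)" "cmp False (\<lambda>w :: bool list. (w, [] :: bool list, False))"
      by (intro cmp_intro)+
    show "polybd (\<lambda>w :: bool list. 8 * length w + 10)"
      by (intro polybd_intro polybd_length cmp_intro)
    show "sz ((read_step ^^ i) (w, [], False)) \<le> 8 * length w + 10" for w i
    proof -
      obtain a b c where s: "(read_step ^^ i) (w, [], False) = (a, b, c)" by (cases "(read_step ^^ i) (w, [], False)")
      have "length a + length b \<le> length w" using read_steps_length[of i "(w, [], False)"] by (simp add: s)
      then show ?thesis using sz_word(1)[of a] sz_word(1)[of b] sz_bool(2)[of c] by (simp add: s)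
    qed
  qed
  then show "cmp False (\<lambda>w. (read_step ^^ length w) (w, [], False))"
    "cmp False (\<lambda>w. (read_step ^^ length w) (w, [], False))" by auto
qed

lemmas cmp_read_code [cmp_intro] = cmp_comp[OF cmp_read_code']

lemma cmp_read_nat [cmp_intro]: "cmp False f \<Longrightarrow> cmp False (\<lambda>x. read_nat (f x))"
  unfolding read_nat_def by (intro cmp_intro)

section \<open>Reading games\<close>

definition nats_step :: "nat list \<times> bool list \<Rightarrow> nat list \<times> bool list" where
  "nats_step s = (if snd s = [] then s else (fst s @ [fst (read_nat (snd s))], snd (read_nat (snd s))))"

definition read_nats :: "nat \<Rightarrow> bool list \<Rightarrow> nat list \<times> bool list" where
  "read_nats n w = (nats_step ^^ n) ([], w)"

text \<open>A potential argument: the bits consumed by a number exceed the length of its numeral,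
  and six units per bit pay for its tree. So the list stays small even when a malformed input
  announces exponentially many numbers.\<close>

lemma nats_step_sz: "sz (fst (nats_step s)) + 6 * length (snd (nats_step s)) \<le> sz (fst s) + 6 * length (snd s)"
proof (cases "snd s = []")
  case False
  let ?n = "fst (read_nat (snd s))"
  have "sz ?n \<le> 4 * length (bin ?n) + 1" using sz_word(1)[of "bin ?n"] by (simp add: sz_nat_bin)
  moreover have "sz (fst s @ [?n]) + 1 = sz (fst s) + (sz ?n + 2)"
    using sz_append[of "fst s" "[?n]"] by simp
  ultimately show ?thesis using read_nat_length[OF False] False by (simp add: nats_step_def)
qed (simp add: nats_step_def)

lemma nats_steps_sz:
  "sz (fst ((nats_step ^^ i) s)) + 6 * length (snd ((nats_step ^^ i) s)) \<le> sz (fst s) + 6 * length (snd s)"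
proof (induction i)
  case (Suc i)
  then show ?case using nats_step_sz[of "(nats_step ^^ i) s"] by simp
qed simp

lemma nats_steps: "(nats_step ^^ length xs) (ys, concat (map enc_nat xs) @ r) = (ys @ xs, r)"
proof (induction xs arbitrary: ys)
  case (Cons x xs)
  have "nats_step (ys, concat (map enc_nat (x # xs)) @ r) = (ys @ [x], concat (map enc_nat xs) @ r)"
    by (simp add: nats_step_def)
  then show ?case using Cons[of "ys @ [x]"] by (simp add: funpow_swap1)
qed simp

lemma read_nats [simp]: "length xs = n \<Longrightarrow> read_nats n (concat (map enc_nat xs) @ r) = (xs, r)"
  using nats_steps[of xs "[]" r] by (simp add: read_nats_def)

lemma cmp_read_nats [cmp_intro]:
  assumes "cmp False n" "cmp False f"
  shows "cmp False (\<lambda>x. read_nats (n x) (f x))"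
  unfolding read_nats_def
proof (rule cmp_funpow)
  show "cmp False (\<lambda>q :: 'a \<times> nat list \<times> bool list. nats_step (snd q))"
    unfolding nats_step_def by (intro cmp_intro)
  show "cmp False n" "cmp False (\<lambda>x. ([] :: nat list, f x))" by (intro cmp_intro assms)+
  show "polybd (\<lambda>x. 10 * length (f x) + 10)" by (intro polybd_intro polybd_length assms)
  show "sz ((nats_step ^^ i) ([], f x)) \<le> 10 * length (f x) + 10" for x i
  proof -
    obtain a b where s: "(nats_step ^^ i) ([], f x) = (a, b)" by (cases "(nats_step ^^ i) ([], f x)")
    show ?thesis using nats_steps_sz[of i "([], f x)"] sz_word(1)[of b] by (simp add: s)
  qed
qed

type_synonym row = "nat list \<times> nat list"

definition enc_row :: "row \<Rightarrow> bool list" where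
  "enc_row x = concat (map enc_nat (fst x)) @ enc_list enc_nat (snd x)"

definition read_row :: "nat \<Rightarrow> bool list \<Rightarrow> row \<times> bool list" where
  "read_row m w = (let a = read_nats m w; b = read_nat (snd a); c = read_nats (fst b) (snd b)
     in ((fst a, fst c), snd c))"

definition rows_step :: "nat \<Rightarrow> row list \<times> bool list \<Rightarrow> row list \<times> bool list" where
  "rows_step m s = (if snd s = [] then s else (fst s @ [fst (read_row m (snd s))], snd (read_row m (snd s))))"

definition read_rows :: "nat \<Rightarrow> nat \<Rightarrow> bool list \<Rightarrow> row list \<times> bool list" where
  "read_rows n m w = (rows_step m ^^ n) ([], w)"

lemma read_row [simp]: "length (fst x) = m \<Longrightarrow> read_row m (enc_row x @ r) = (x, r)"
  by (simp add: read_row_def enc_row_def enc_list_def Let_def)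

lemma enc_row_nonempty [simp]: "enc_row x \<noteq> []"
  by (simp add: enc_row_def enc_list_def)

lemma read_nats_sz: "sz (fst (read_nats n w)) + 6 * length (snd (read_nats n w)) \<le> 1 + 6 * length w"
  using nats_steps_sz[of n "([], w)"] by (simp add: read_nats_def)

text \<open>The same potential one level up. Each row consumes at least one bit, and ten units per
  bit also pay for the pair and the list cell.\<close>

lemma rows_step_sz: "sz (fst (rows_step m s)) + 10 * length (snd (rows_step m s)) \<le> sz (fst s) + 10 * length (snd s)"
proof (cases "snd s = []")
  case False
  let ?w = "snd s"
  define a b c where "a = read_nats m ?w" and "b = read_nat (snd a)" and "c = read_nats (fst b) (snd b)"
  have 1: "sz (fst a) + 6 * length (snd a) \<le> 1 + 6 * length ?w" unfolding a_def by (rule read_nats_sz)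
  have 2: "sz (fst c) + 6 * length (snd c) \<le> 1 + 6 * length (snd b)" unfolding c_def by (rule read_nats_sz)
  have pos: "0 < sz (fst a)" "0 < sz (fst c)" by simp_all
  have 3: "length (snd b) < length (snd a) \<or> length (snd b) \<le> length (snd a) \<and> snd a = []"
  proof (cases "snd a = []")
    case True
    have "read_nat [] = (0, [])" by (simp add: read_nat_def read_code_def)
    then show ?thesis using True by (simp add: b_def)
  next
    case False
    then show ?thesis using read_nat_length[OF False] by (simp add: b_def)
  qed
  have "length (snd c) < length ?w"
  proof (cases "snd a = []")
    case True
    then show ?thesis using 2 3 pos False by (cases ?w) auto
  next
    case False
    then show ?thesis using 1 2 3 pos by auto
  qed
  moreover have "sz (fst s @ [(fst a, fst c)]) + 1 = sz (fst s) + (sz (fst a) + sz (fst c) + 3)"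
    using sz_append[of "fst s" "[(fst a, fst c)]"] by simp
  moreover have "length (snd b) \<le> length (snd a)" using 3 by auto
  ultimately show ?thesis using 1 2 False
    by (simp add: rows_step_def read_row_def Let_def flip: a_def b_def c_def)
qed (simp add: rows_step_def)

lemma rows_steps_sz:
  "sz (fst ((rows_step m ^^ i) s)) + 10 * length (snd ((rows_step m ^^ i) s)) \<le> sz (fst s) + 10 * length (snd s)"
proof (induction i)
  case (Suc i)
  then show ?case using rows_step_sz[of m "(rows_step m ^^ i) s"] by simp
qed simp

lemma rows_steps:
  "\<forall>x\<in>set xs. length (fst x) = m \<Longrightarrow>
    (rows_step m ^^ length xs) (ys, concat (map enc_row xs) @ r) = (ys @ xs, r)"
proof (induction xs arbitrary: ys)
  case (Cons x xs)
  then have "rows_step m (ys, concat (map enc_row (x # xs)) @ r) = (ys @ [x], concat (map enc_row xs) @ r)"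
    by (simp add: rows_step_def)
  then show ?case using Cons(1)[of "ys @ [x]"] Cons(2) by (simp add: funpow_swap1)
qed simp

lemma read_rows [simp]:
  "\<forall>x\<in>set xs. length (fst x) = m \<Longrightarrow> length xs = n \<Longrightarrow>
    read_rows n m (concat (map enc_row xs) @ r) = (xs, r)"
  using rows_steps[of xs m "[]" r] by (simp add: read_rows_def)

lemma cmp_read_row [cmp_intro]:
  "cmp False m \<Longrightarrow> cmp False f \<Longrightarrow> cmp False (\<lambda>x. read_row (m x) (f x))"
  unfolding read_row_def Let_def by (intro cmp_intro)

lemma cmp_read_rows [cmp_intro]:
  assumes "cmp False n" "cmp False m" "cmp False f"
  shows "cmp False (\<lambda>x. read_rows (n x) (m x) (f x))"
  unfolding read_rows_def
proof (rule cmp_funpow)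
  show "cmp False (\<lambda>q. rows_step (m (fst q)) (snd q))"
    unfolding rows_step_def by (intro cmp_intro cmp_comp[OF assms(2)])
  show "cmp False n" "cmp False (\<lambda>x. ([] :: row list, f x))" by (intro cmp_intro assms)+
  show "polybd (\<lambda>x. 14 * length (f x) + 10)" by (intro polybd_intro polybd_length assms)
  show "sz ((rows_step (m x) ^^ i) ([], f x)) \<le> 14 * length (f x) + 10" for x i
  proof -
    obtain a b where s: "(rows_step (m x) ^^ i) ([], f x) = (a, b)" by (cases "(rows_step (m x) ^^ i) ([], f x)")
    show ?thesis using rows_steps_sz[where m = "m x" and i = i and s = "([], f x)"] sz_word(1)[of b] by (simp add: s)
  qed
qed

lemma cmp_enc_row [cmp_intro]: "cmp b f \<Longrightarrow> cmp b (\<lambda>x. enc_row (f x))"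
  unfolding enc_row_def enc_list_def by (intro cmp_intro)

text \<open>A game is presented as \<open>(i, c, rows)\<close>: the initial position, the number of actions, and for
  each position its moves, in the order of the profiles, and its labels.\<close>

type_synonym game = "nat \<times> nat \<times> row list"

definition enc_game :: "game \<Rightarrow> bool list" where
  "enc_game g = enc_nat (length (snd (snd g))) @ enc_nat (fst (snd g)) @ enc_nat (fst g) @
     concat (map enc_row (snd (snd g)))"

definition read_game :: "nat \<Rightarrow> bool list \<Rightarrow> game \<times> bool list" where
  "read_game k w = (let n = read_nat w; c = read_nat (snd n); i = read_nat (snd c);
      rs = read_rows (fst n) (fst c ^ k) (snd i) in ((fst i, fst c, fst rs), snd rs))"

text \<open>Strictly increasing labels make the presentation unique, matching the sorted lists in
  \<open>enc_cgs\<close>. Indexing is written with \<open>hd\<close> and \<open>drop\<close> because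
  these are known to be computable.\<close>

definition game_ok :: "nat \<Rightarrow> game \<Rightarrow> bool" where
  "game_ok k g \<longleftrightarrow> 0 < fst (snd g) \<and> fst g < length (snd (snd g)) \<and>
     (\<forall>x\<in>set (snd (snd g)). length (fst x) = fst (snd g) ^ k \<and> (\<forall>v\<in>set (fst x). v < length (snd (snd g))) \<and>
        (\<forall>i<length (snd x) - 1. hd (drop i (snd x)) < hd (drop (Suc i) (snd x))))"

lemma read_game [simp]: "game_ok k g \<Longrightarrow> read_game k (enc_game g @ r) = (g, r)"
  by (simp add: read_game_def enc_game_def Let_def game_ok_def)

lemma cmp_read_game [cmp_intro]: "cmp False f \<Longrightarrow> cmp False (\<lambda>x. read_game k (f x))"
  unfolding read_game_def Let_def by (intro cmp_intro)

lemma cmp_enc_game [cmp_intro]: "cmp b f \<Longrightarrow> cmp b (\<lambda>x. enc_game (f x))"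
  unfolding enc_game_def by (intro cmp_intro)

lemma cmp_game_ok': "cmp False (\<lambda>g. game_ok k g)"
  unfolding game_ok_def by (intro cmp_intro cmp_pred)

lemmas cmp_game_ok [cmp_intro] = cmp_comp[OF cmp_game_ok']

text \<open>The first agent is the least significant digit, in base \<open>c\<close>; this is the
  order in which \<open>List.n_lists\<close> runs through the profiles.\<close>

definition index :: "nat \<Rightarrow> nat list \<Rightarrow> nat" where
  "index c xs = foldr (\<lambda>a r. a + c * r) xs 0"

lemma concat_blocks: "concat (map (\<lambda>n. map (\<lambda>y. y + c * n) [0..<c]) [0..<m]) = [0..<c * m]"
proof (induction m)
  case (Suc m)
  have "[0..<c * Suc m] = [0..<c * m] @ [c * m..<c + c * m]"
    using upt_add_eq_append[of 0 "c * m" c] by (simp add: add.commute)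
  then show ?case using Suc map_add_upt[of "c * m" c] by simp
qed simp

lemma map_index_n_lists: "map (index c) (List.n_lists k [0..<c]) = [0..<c ^ k]"
proof (induction k)
  case (Suc k)
  have "map (index c) (List.n_lists (Suc k) [0..<c]) =
      concat (map (\<lambda>n. map (\<lambda>y. y + c * n) [0..<c]) (map (index c) (List.n_lists k [0..<c])))"
    by (simp add: map_concat comp_def index_def)
  then show ?case using concat_blocks[of c "c ^ k"] Suc by simp
qed (simp add: index_def)

lemma index_nth:
  assumes "length xs = k" "set xs \<subseteq> {..<c}"
  shows "index c xs < c ^ k" "List.n_lists k [0..<c] ! index c xs = xs"
proof -
  have "xs \<in> set (List.n_lists k [0..<c])" using assms by (auto simp: set_n_lists)
  then obtain n where n: "n < length (List.n_lists k [0..<c])" "xs = List.n_lists k [0..<c] ! n"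
    unfolding in_set_conv_nth by (elim exE conjE) simp
  then have "index c xs = map (index c) (List.n_lists k [0..<c]) ! n" by simp
  also have "\<dots> = n" using n(1) unfolding map_index_n_lists by (simp add: length_n_lists)
  finally show "index c xs < c ^ k" "List.n_lists k [0..<c] ! index c xs = xs"
    using n by (simp_all add: length_n_lists)
qed

lemma profile_list:
  assumes "a \<in> {..<k} \<rightarrow>\<^sub>E {..<c}"
  shows "length (map a [0..<k]) = k" "set (map a [0..<k]) \<subseteq> {..<c}"
proof -
  show "set (map a [0..<k]) \<subseteq> {..<c}"
  proof
    fix x assume "x \<in> set (map a [0..<k])"
    then obtain i where "i < k" "x = a i" by auto
    then show "x \<in> {..<c}" using PiE_mem[OF assms, of i] by simp
  qed
qed simp

text \<open>Agreement is required only on positions and on genuine profiles, because elsewhere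
  \<open>G\<close> is arbitrary and its code says nothing.\<close>

definition presents :: "nat \<Rightarrow> game \<Rightarrow> (nat, nat, nat, nat) cgs \<Rightarrow> bool" where
  "presents k g G \<longleftrightarrow> positions G = {..<length (snd (snd g))} \<and> actions G = {..<fst (snd g)} \<and>
     init_pos G = fst g \<and>
     (\<forall>v<length (snd (snd g)). label G v = set (snd (snd (snd g) ! v)) \<and>
        (\<forall>a\<in>{..<k} \<rightarrow>\<^sub>E {..<fst (snd g)}. move G v a = fst (snd (snd g) ! v) ! index (fst (snd g)) (map a [0..<k])))"

lemma sorted_hd_drop:
  "(\<forall>i<length xs - 1. hd (drop i xs) < hd (drop (Suc i) xs)) \<longleftrightarrow> sorted_wrt (<) (xs :: nat list)"
proof -
  have "hd (drop i xs) = xs ! i" if "i < length xs" for i using that by (rule hd_drop_conv_nth)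
  then have "(\<forall>i<length xs - 1. hd (drop i xs) < hd (drop (Suc i) xs)) \<longleftrightarrow>
      (\<forall>i. Suc i < length xs \<longrightarrow> xs ! i < xs ! Suc i)"
    by (auto simp: less_diff_conv)
  also have "\<dots> \<longleftrightarrow> sorted_wrt (<) xs"
    by (rule sorted_wrt_iff_nth_Suc_transp[symmetric]) (auto intro: transpI)
  finally show ?thesis .
qed

lemma presented_game:
  assumes G: "cgs {..<k} G" "presented G"
  obtains g where "game_ok k g" "presents k g G" "enc_cgs k G = enc_game g"
proof -
  define N c where "N = card (positions G)" and "c = card (actions G)"
  have pos: "positions G = {..<N}" and act: "actions G = {..<c}" and fin: "\<And>v. v < N \<Longrightarrow> finite (label G v)"
    using G(2) by (auto simp: presented_def N_def c_def)
  define rows where "rows = map (\<lambda>v. (map (\<lambda>as. move G v (\<lambda>a\<in>{..<k}. as ! a)) (List.n_lists k [0..<c]),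
      sorted_list_of_set (label G v))) [0..<N]"
  define g where "g = (init_pos G, c, rows)"
  have len: "length rows = N" by (simp add: rows_def)
  have c: "0 < c" using G(1) act by (cases c) (auto simp: cgs_def)
  have prof: "(\<lambda>a\<in>{..<k}. as ! a) \<in> {..<k} \<rightarrow>\<^sub>E {..<c}" if "as \<in> set (List.n_lists k [0..<c])" for as
    using that by (auto simp: set_n_lists subset_iff)
  have mv: "move G v a < N" if "v < N" "a \<in> {..<k} \<rightarrow>\<^sub>E {..<c}" for v a
    using G(1) that pos act by (auto simp: cgs_def)
  have "game_ok k g"
    unfolding game_ok_def sorted_hd_drop
  proof (intro conjI ballI)
    show "0 < fst (snd g)" "fst g < length (snd (snd g))"
      using c G(1) pos by (auto simp: g_def len cgs_def)
    fix x assume "x \<in> set (snd (snd g))"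
    then obtain v where v: "v < N" and x: "x = (map (\<lambda>as. move G v (\<lambda>a\<in>{..<k}. as ! a)) (List.n_lists k [0..<c]),
      sorted_list_of_set (label G v))" by (auto simp: g_def rows_def)
    show "length (fst x) = fst (snd g) ^ k" by (simp add: x g_def length_n_lists)
    show "sorted_wrt (<) (snd x)" by (simp add: x)
    fix u assume "u \<in> set (fst x)"
    then show "u < length (snd (snd g))" using mv[OF v prof] by (auto simp: x g_def len)
  qed
  moreover have "presents k g G"
    unfolding presents_def
  proof (intro conjI allI impI ballI)
    fix v assume "v < length (snd (snd g))"
    then have v: "v < N" by (simp add: g_def len)
    then show "label G v = set (snd (snd (snd g) ! v))" using fin by (simp add: g_def rows_def)
    fix a assume a: "a \<in> {..<k} \<rightarrow>\<^sub>E {..<fst (snd g)}"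
    let ?as = "map a [0..<k]"
    have as: "length ?as = k" "set ?as \<subseteq> {..<c}" using profile_list[OF a] by (simp_all add: g_def)
    have "(\<lambda>i\<in>{..<k}. ?as ! i) = a"
    proof
      fix i
      show "(\<lambda>i\<in>{..<k}. ?as ! i) i = a i" using PiE_arb[OF a, of i] by (cases "i < k") auto
    qed
    then show "move G v a = fst (snd (snd g) ! v) ! index (fst (snd g)) ?as"
      using index_nth[OF as] v by (simp add: g_def rows_def length_n_lists)
  qed (simp_all add: g_def len pos act)
  moreover have "enc_cgs k G = enc_game g"
    by (simp add: enc_cgs_def enc_game_def g_def len rows_def enc_row_def comp_def flip: N_def c_def)
  ultimately show thesis using that by blast
qed

lemma game_presented:
  assumes g: "game_ok k g"
  obtains G where "cgs {..<k} G" "presented G" "presents k g G" "enc_cgs k G = enc_game g"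
proof -
  define N c rows where "N = length (snd (snd g))" and "c = fst (snd g)" and "rows = snd (snd g)"
  define G where "G = \<lparr>actions = {..<c}, positions = {..<N}, init_pos = fst g,
     move = (\<lambda>v a. fst (rows ! v) ! index c (map a [0..<k])), label = (\<lambda>v. set (snd (rows ! v)))\<rparr>"
  have ok: "0 < c" "fst g < N" "\<And>v. v < N \<Longrightarrow> length (fst (rows ! v)) = c ^ k"
    "\<And>v u. v < N \<Longrightarrow> u \<in> set (fst (rows ! v)) \<Longrightarrow> u < N"
    "\<And>v. v < N \<Longrightarrow> sorted_wrt (<) (snd (rows ! v))"
  proof -
    note g' = g[unfolded game_ok_def sorted_hd_drop, folded N_def c_def rows_def]
    show "0 < c" "fst g < N" using g' by auto
    fix v assume "v < N"
    then have "rows ! v \<in> set rows" by (simp add: N_def rows_def)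
    with g' have "length (fst (rows ! v)) = c ^ k \<and> (\<forall>u\<in>set (fst (rows ! v)). u < N) \<and> sorted_wrt (<) (snd (rows ! v))"
      by blast
    then show "length (fst (rows ! v)) = c ^ k" "\<And>u. u \<in> set (fst (rows ! v)) \<Longrightarrow> u < N"
      "sorted_wrt (<) (snd (rows ! v))" by auto
  qed
  have "cgs {..<k} G"
    unfolding cgs_def
  proof (intro conjI ballI)
    fix v a assume "v \<in> positions G" "a \<in> {..<k} \<rightarrow>\<^sub>E actions G"
    then have "v < N" "a \<in> {..<k} \<rightarrow>\<^sub>E {..<c}" by (auto simp: G_def)
    then have "fst (rows ! v) ! index c (map a [0..<k]) \<in> set (fst (rows ! v))"
      using index_nth(1)[OF profile_list] ok(3) by simp
    then show "move G v a \<in> positions G" using ok(4) \<open>v < N\<close> by (simp add: G_def)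
  qed (use ok in \<open>auto simp: G_def\<close>)
  moreover have "presented G" by (simp add: presented_def G_def)
  moreover have "presents k g G"
    by (simp add: presents_def G_def N_def c_def rows_def)
  moreover have "enc_cgs k G = enc_game g"
  proof -
    have 1: "map (\<lambda>as. move G v (\<lambda>a\<in>{..<k}. as ! a)) (List.n_lists k [0..<c]) = fst (rows ! v)" if "v < N" for v
    proof -
      have "map (\<lambda>as. move G v (\<lambda>a\<in>{..<k}. as ! a)) (List.n_lists k [0..<c]) =
          map (\<lambda>n. fst (rows ! v) ! n) (map (index c) (List.n_lists k [0..<c]))"
        unfolding map_map
      proof (rule map_cong[OF refl])
        fix as assume "as \<in> set (List.n_lists k [0..<c])"
        then have "length as = k" by (simp add: set_n_lists)
        then have "map (\<lambda>a\<in>{..<k}. as ! a) [0..<k] = as" by (auto intro!: nth_equalityI)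
        then show "move G v (\<lambda>a\<in>{..<k}. as ! a) = ((\<lambda>n. fst (rows ! v) ! n) \<circ> index c) as" by (simp add: G_def)
      qed
      also have "\<dots> = fst (rows ! v)"
        unfolding map_index_n_lists using ok(3)[OF that] by (auto intro!: nth_equalityI)
      finally show ?thesis .
    qed
    have 2: "sorted_list_of_set (label G v) = snd (rows ! v)" if "v < N" for v
    proof -
      have "distinct (snd (rows ! v))" "sorted (snd (rows ! v))"
        using ok(5)[OF that] by (simp_all add: strict_sorted_iff)
      then show ?thesis by (simp add: G_def sorted_list_of_set.idem_if_sorted_distinct)
    qed
    have row: "concat (map (\<lambda>as. enc_nat (move G v (\<lambda>a\<in>{..<k}. as ! a))) (List.n_lists k [0..<c])) @
        enc_list enc_nat (sorted_list_of_set (label G v)) = enc_row (rows ! v)" if "v < N" for v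
      unfolding enc_row_def 2[OF that] 1[OF that, symmetric] map_map comp_def ..
    have "card (positions G) = N" "card (actions G) = c" "init_pos G = fst g" by (simp_all add: G_def)
    then have "enc_cgs k G = enc_nat N @ enc_nat c @ enc_nat (fst g) @
        concat (map (\<lambda>v. concat (map (\<lambda>as. enc_nat (move G v (\<lambda>a\<in>{..<k}. as ! a))) (List.n_lists k [0..<c])) @
        enc_list enc_nat (sorted_list_of_set (label G v))) [0..<N])"
      by (simp only: enc_cgs_def)
    also have "map (\<lambda>v. concat (map (\<lambda>as. enc_nat (move G v (\<lambda>a\<in>{..<k}. as ! a))) (List.n_lists k [0..<c])) @
        enc_list enc_nat (sorted_list_of_set (label G v))) [0..<N] = map (\<lambda>v. enc_row (rows ! v)) [0..<N]"
      by (rule map_cong[OF refl]) (use row in simp)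
    also have "map (\<lambda>v. enc_row (rows ! v)) [0..<N] = map enc_row rows"
      by (rule nth_equalityI) (simp_all add: N_def rows_def)
    finally show ?thesis by (simp add: enc_game_def N_def c_def rows_def)
  qed
  ultimately show thesis using that by blast
qed

section \<open>Scanning formulas\<close>

text \<open>A scope lists the agents and the variables that may occur free.\<close>

type_synonym scope = "nat list \<times> nat list"

locale discounted =
  fixes k :: nat and D :: "(nat \<Rightarrow> real) set" and code :: "(nat \<Rightarrow> real) \<Rightarrow> bool list"
    and f :: "bool list \<Rightarrow> bool list"
  assumes k: "0 < k" and disc: "\<And>d. d \<in> D \<Longrightarrow> discounting d" and inj: "inj_on code D"
    and cmp_f: "cmp False f"
    and f_val: "\<And>d i. d \<in> D \<Longrightarrow> \<exists>r. d i = of_rat r \<and> f (enc_word (code d) @ replicate i True) = enc_rat r"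
    and f_none: "\<And>w i. w \<notin> code ` D \<Longrightarrow> f (enc_word w @ replicate i True) = []"
begin

definition full :: "scope \<Rightarrow> bool" where
  "full B \<longleftrightarrow> (\<forall>a<k. a \<in> set (fst B))"

text \<open>Without scopes the scanner stands still, and the flag keeps this state from being
  accepted.\<close>

definition fail :: "bool list \<times> scope list \<times> bool" where
  "fail = ([], [], False)"

text \<open>The input is a sequence of formula codes, one for each scope of the stack.  Unless \<open>s\<close> holds,
  the scopes are ignored and the scanner only finds the end of the formulas.\<close>

definition scan_tag ::
  "bool \<Rightarrow> nat \<Rightarrow> bool list \<Rightarrow> scope \<Rightarrow> scope list \<Rightarrow> bool \<Rightarrow> bool list \<times> scope list \<times> bool"
where
  "scan_tag s t w B R ok = (let a = read_nat w; b = read_nat (snd a); c = read_code w in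
     if t = 0 then (if w = enc_nat (fst a) @ snd a then (snd a, R, ok) else fail)
     else if t = 1 then (w, B # R, ok)
     else if t = 2 then (w, B # B # R, ok)
     else if t = 3 then
       (if w = enc_nat (fst a) @ snd a then (snd a, (fst B, fst a # snd B) # R, ok) else fail)
     else if t = 4 then
       (if w = enc_nat (fst a) @ snd a \<and> snd a = enc_nat (fst b) @ snd b
        then (snd b, (fst a # fst B, snd B) # R, ok \<and> (s \<longrightarrow> fst a < k \<and> fst b \<in> set (snd B))) else fail)
     else if t = 5 then (w, B # R, ok \<and> (s \<longrightarrow> full B))
     else if t = 6 then (w, B # B # R, ok \<and> (s \<longrightarrow> full B))
     else if t = 7 then
       (if w = enc_word (fst c) @ snd c
        then (snd c, B # B # R, ok \<and> (s \<longrightarrow> full B \<and> f (enc_word (fst c)) \<noteq> [])) else fail)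
     else fail)"

definition scan_step :: "bool \<Rightarrow> bool list \<times> scope list \<times> bool \<Rightarrow> bool list \<times> scope list \<times> bool" where
  "scan_step s x = (case fst (snd x) of [] \<Rightarrow> x
     | B # R \<Rightarrow> if fst x = enc_nat (fst (read_nat (fst x))) @ snd (read_nat (fst x))
        then scan_tag s (fst (read_nat (fst x))) (snd (read_nat (fst x))) B R (snd (snd x)) else fail)"

definition scan :: "bool \<Rightarrow> bool list \<Rightarrow> bool list \<times> scope list \<times> bool" where
  "scan s w = (scan_step s ^^ length w) (w, [([], [])], True)"

definition skip :: "bool list \<Rightarrow> bool list" where
  "skip w = fst (scan False w)"

abbreviation enc :: "(nat, nat, nat) form \<Rightarrow> bool list" where
  "enc \<equiv> enc_form code"

definition scope_set :: "scope \<Rightarrow> (nat + nat) set" where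
  "scope_set B = Inl ` set (fst B) \<union> Inr ` set (snd B)"

text \<open>Being a sentence becomes an inherited attribute: the names allowed to be free are handed
  down, so that a scan from left to right can check it.\<close>

definition admissible :: "scope \<Rightarrow> (nat, nat, nat) form \<Rightarrow> bool" where
  "admissible B \<phi> \<longleftrightarrow> form_over {..<k} D \<phi> \<and> free {..<k} \<phi> \<subseteq> scope_set B"

lemma full_iff: "full B \<longleftrightarrow> Inl ` {..<k} \<subseteq> scope_set B"
  by (auto simp: full_def scope_set_def)

lemma admissible_simps:
  "admissible B (Atom p)"
  "admissible B (Neg \<phi>) \<longleftrightarrow> admissible B \<phi>"
  "admissible B (Or \<phi> \<psi>) \<longleftrightarrow> admissible B \<phi> \<and> admissible B \<psi>"
  "admissible B (Ex x \<phi>) \<longleftrightarrow> admissible (fst B, x # snd B) \<phi>"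
  "admissible B (Bind a x \<phi>) \<longleftrightarrow> a < k \<and> x \<in> set (snd B) \<and> admissible (a # fst B, snd B) \<phi>"
  "admissible B (Next \<phi>) \<longleftrightarrow> full B \<and> admissible B \<phi>"
  "admissible B (Until \<phi> \<psi>) \<longleftrightarrow> full B \<and> admissible B \<phi> \<and> admissible B \<psi>"
  "admissible B (DUntil d \<phi> \<psi>) \<longleftrightarrow> d \<in> D \<and> full B \<and> admissible B \<phi> \<and> admissible B \<psi>"
  unfolding full_iff by (auto simp: admissible_def scope_set_def)

text \<open>The machine for the discounts is queried at argument 0. Codes of rationals are nonempty,
  so an empty answer means an unknown name.\<close>

lemma known_code: "f (enc_word u) \<noteq> [] \<longleftrightarrow> u \<in> code ` D"
proof (cases "u \<in> code ` D")
  case True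
  then obtain d where d: "d \<in> D" "u = code d" by blast
  obtain r where "f (enc_word (code d) @ replicate 0 True) = enc_rat r" using f_val[OF d(1)] by blast
  moreover have "enc_rat r \<noteq> []" by (simp add: enc_rat_def split: prod.split)
  ultimately show ?thesis using d by simp
next
  case False
  then show ?thesis using f_none[of u 0] by simp
qed

lemma scan_step_tag [simp]: "scan_step s (enc_nat t @ w, B # R, ok) = scan_tag s t w B R ok"
  by (simp add: scan_step_def)

text \<open>Every step consumes a nonempty tag, so the code is long enough to count the steps. For
  \<open>s\<close> false any formula will do, since only its end is sought.\<close>

lemma scan_complete:
  assumes "s \<longrightarrow> admissible B \<phi>"
  shows "\<exists>n\<le>length (enc \<phi>). (scan_step s ^^ n) (enc \<phi> @ r, B # R, ok) = (r, R, ok)"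
  using assms
proof (induction \<phi> arbitrary: B R r)
  case (Atom p)
  have "(scan_step s ^^ 1) (enc (Atom p) @ r, B # R, ok) = (r, R, ok)"
    by (simp add: scan_tag_def Let_def)
  moreover have "1 \<le> length (enc (Atom p))" by (simp add: enc_nat_def)
  ultimately show ?case by blast
next
  case (Neg \<phi>)
  have adm: "s \<longrightarrow> admissible B \<phi>" using Neg.prems by (simp add: admissible_simps)
  obtain n where n: "n \<le> length (enc \<phi>)" "(scan_step s ^^ n) (enc \<phi> @ r, B # R, ok) = (r, R, ok)"
    using Neg.IH[OF adm] by blast
  have "scan_step s (enc (Neg \<phi>) @ r, B # R, ok) = (enc \<phi> @ r, B # R, ok)"
    by (simp add: scan_tag_def Let_def)
  then have "(scan_step s ^^ Suc n) (enc (Neg \<phi>) @ r, B # R, ok) = (r, R, ok)"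
    using n(2) by (simp only: funpow_Suc_right comp_apply)
  moreover have "Suc n \<le> length (enc (Neg \<phi>))" using n(1) by (simp add: enc_nat_def)
  ultimately show ?case by blast
next
  case (Or \<phi> \<psi>)
  have adm: "s \<longrightarrow> admissible B \<phi>" "s \<longrightarrow> admissible B \<psi>" using Or.prems by (simp_all add: admissible_simps)
  obtain n where n: "n \<le> length (enc \<phi>)"
    "(scan_step s ^^ n) (enc \<phi> @ enc \<psi> @ r, B # B # R, ok) = (enc \<psi> @ r, B # R, ok)"
    using Or.IH(1)[OF adm(1)] by blast
  obtain m where m: "m \<le> length (enc \<psi>)" "(scan_step s ^^ m) (enc \<psi> @ r, B # R, ok) = (r, R, ok)"
    using Or.IH(2)[OF adm(2)] by blast
  have "scan_step s (enc (Or \<phi> \<psi>) @ r, B # R, ok) = (enc \<phi> @ enc \<psi> @ r, B # B # R, ok)"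
    by (simp add: scan_tag_def Let_def)
  then have "(scan_step s ^^ (m + n + 1)) (enc (Or \<phi> \<psi>) @ r, B # R, ok) = (r, R, ok)"
    using n(2) m(2) by (simp only: funpow_add comp_apply) simp
  moreover have "m + n + 1 \<le> length (enc (Or \<phi> \<psi>))" using n(1) m(1) by (simp add: enc_nat_def)
  ultimately show ?case by blast
next
  case (Ex x \<phi>)
  let ?B = "(fst B, x # snd B)"
  have adm: "s \<longrightarrow> admissible ?B \<phi>" using Ex.prems by (simp add: admissible_simps)
  obtain n where n: "n \<le> length (enc \<phi>)" "(scan_step s ^^ n) (enc \<phi> @ r, ?B # R, ok) = (r, R, ok)"
    using Ex.IH[OF adm] by blast
  have "scan_step s (enc (Ex x \<phi>) @ r, B # R, ok) = (enc \<phi> @ r, ?B # R, ok)"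
    by (simp add: scan_tag_def Let_def)
  then have "(scan_step s ^^ Suc n) (enc (Ex x \<phi>) @ r, B # R, ok) = (r, R, ok)"
    using n(2) by (simp only: funpow_Suc_right comp_apply)
  moreover have "Suc n \<le> length (enc (Ex x \<phi>))" using n(1) by (simp add: enc_nat_def)
  ultimately show ?case by blast
next
  case (Bind a x \<phi>)
  let ?B = "(a # fst B, snd B)"
  have adm: "s \<longrightarrow> admissible ?B \<phi>" using Bind.prems by (simp add: admissible_simps)
  obtain n where n: "n \<le> length (enc \<phi>)" "(scan_step s ^^ n) (enc \<phi> @ r, ?B # R, ok) = (r, R, ok)"
    using Bind.IH[OF adm] by blast
  have "scan_step s (enc (Bind a x \<phi>) @ r, B # R, ok) = (enc \<phi> @ r, ?B # R, ok)"
    using Bind.prems by (simp add: scan_tag_def Let_def admissible_simps)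
  then have "(scan_step s ^^ Suc n) (enc (Bind a x \<phi>) @ r, B # R, ok) = (r, R, ok)"
    using n(2) by (simp only: funpow_Suc_right comp_apply)
  moreover have "Suc n \<le> length (enc (Bind a x \<phi>))" using n(1) by (simp add: enc_nat_def)
  ultimately show ?case by blast
next
  case (Next \<phi>)
  have adm: "s \<longrightarrow> admissible B \<phi>" using Next.prems by (simp add: admissible_simps)
  obtain n where n: "n \<le> length (enc \<phi>)" "(scan_step s ^^ n) (enc \<phi> @ r, B # R, ok) = (r, R, ok)"
    using Next.IH[OF adm] by blast
  have "scan_step s (enc (Next \<phi>) @ r, B # R, ok) = (enc \<phi> @ r, B # R, ok)"
    using Next.prems by (simp add: scan_tag_def Let_def admissible_simps)
  then have "(scan_step s ^^ Suc n) (enc (Next \<phi>) @ r, B # R, ok) = (r, R, ok)"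
    using n(2) by (simp only: funpow_Suc_right comp_apply)
  moreover have "Suc n \<le> length (enc (Next \<phi>))" using n(1) by (simp add: enc_nat_def)
  ultimately show ?case by blast
next
  case (Until \<phi> \<psi>)
  have adm: "s \<longrightarrow> admissible B \<phi>" "s \<longrightarrow> admissible B \<psi>" using Until.prems by (simp_all add: admissible_simps)
  obtain n where n: "n \<le> length (enc \<phi>)"
    "(scan_step s ^^ n) (enc \<phi> @ enc \<psi> @ r, B # B # R, ok) = (enc \<psi> @ r, B # R, ok)"
    using Until.IH(1)[OF adm(1)] by blast
  obtain m where m: "m \<le> length (enc \<psi>)" "(scan_step s ^^ m) (enc \<psi> @ r, B # R, ok) = (r, R, ok)"
    using Until.IH(2)[OF adm(2)] by blast
  have "scan_step s (enc (Until \<phi> \<psi>) @ r, B # R, ok) = (enc \<phi> @ enc \<psi> @ r, B # B # R, ok)"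
    using Until.prems by (simp add: scan_tag_def Let_def admissible_simps)
  then have "(scan_step s ^^ (m + n + 1)) (enc (Until \<phi> \<psi>) @ r, B # R, ok) = (r, R, ok)"
    using n(2) m(2) by (simp only: funpow_add comp_apply) simp
  moreover have "m + n + 1 \<le> length (enc (Until \<phi> \<psi>))" using n(1) m(1) by (simp add: enc_nat_def)
  ultimately show ?case by blast
next
  case (DUntil d \<phi> \<psi>)
  have adm: "s \<longrightarrow> admissible B \<phi>" "s \<longrightarrow> admissible B \<psi>" using DUntil.prems by (simp_all add: admissible_simps)
  obtain n where n: "n \<le> length (enc \<phi>)"
    "(scan_step s ^^ n) (enc \<phi> @ enc \<psi> @ r, B # B # R, ok) = (enc \<psi> @ r, B # R, ok)"
    using DUntil.IH(1)[OF adm(1)] by blast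
  obtain m where m: "m \<le> length (enc \<psi>)" "(scan_step s ^^ m) (enc \<psi> @ r, B # R, ok) = (r, R, ok)"
    using DUntil.IH(2)[OF adm(2)] by blast
  have "scan_step s (enc (DUntil d \<phi> \<psi>) @ r, B # R, ok) = (enc \<phi> @ enc \<psi> @ r, B # B # R, ok)"
    using DUntil.prems known_code[of "code d"] by (simp add: scan_tag_def Let_def admissible_simps)
  then have "(scan_step s ^^ (m + n + 1)) (enc (DUntil d \<phi> \<psi>) @ r, B # R, ok) = (r, R, ok)"
    using n(2) m(2) by (simp only: funpow_add comp_apply) simp
  moreover have "m + n + 1 \<le> length (enc (DUntil d \<phi> \<psi>))" using n(1) m(1) by (simp add: enc_nat_def)
  ultimately show ?case by blast
qed

lemma scan_done: "(scan_step s ^^ n) (r, [], ok) = (r, [], ok)"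
  by (rule funpow_fixed) (simp add: scan_step_def)

lemma scan_enc:
  assumes "s \<longrightarrow> admissible ([], []) \<phi>"
  shows "scan s (enc \<phi> @ r) = (r, [], True)"
proof -
  obtain n where n: "n \<le> length (enc \<phi>)" "(scan_step s ^^ n) (enc \<phi> @ r, [([], [])], True) = (r, [], True)"
    using scan_complete[OF assms] by blast
  then show ?thesis
    unfolding scan_def by (intro funpow_le_fixed[OF n(2)]) (simp_all add: scan_step_def)
qed

lemma skip_enc [simp]: "skip (enc \<phi> @ r) = r"
  by (simp add: skip_def scan_enc)

text \<open>Each step compares the input with the encoding of what it has read, so acceptance can
  only come from genuine codes. The induction is on the number of steps and needs the whole stack of
  scopes, one formula for each.\<close>

lemma scan_sound:
  assumes "(scan_step True ^^ n) (w, Bs, ok) = (r, [], True)"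
  shows "ok \<and> (\<exists>\<phi>s. list_all2 admissible Bs \<phi>s \<and> w = concat (map enc \<phi>s) @ r)"
  using assms
proof (induction n arbitrary: w Bs ok)
  case 0
  then show ?case by auto
next
  case (Suc n)
  show ?case
  proof (cases Bs)
    case Nil
    then show ?thesis using Suc.prems scan_done[where n = "Suc n" and s = True] by auto
  next
    case (Cons B R)
    have nofail: "(scan_step True ^^ n) fail \<noteq> (r, [], True)" by (simp add: fail_def scan_done)
    define t u where "t = fst (read_nat w)" and "u = snd (read_nat w)"
    have next_: "(scan_step True ^^ n) (scan_step True (w, Bs, ok)) = (r, [], True)"
      using Suc.prems by (simp only: funpow_Suc_right comp_apply)
    then have w: "w = enc_nat t @ u" and tag: "(scan_step True ^^ n) (scan_tag True t u B R ok) = (r, [], True)"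
      using nofail by (auto simp: scan_step_def Cons t_def u_def split: if_splits)
    note tag = tag[unfolded scan_tag_def Let_def]
    have step: "ok' \<and> (\<exists>\<phi>s. list_all2 admissible Bs' \<phi>s \<and> w' = concat (map enc \<phi>s) @ r)"
      if "(scan_step True ^^ n) (w', Bs', ok') = (r, [], True)" for w' Bs' ok'
      by (rule Suc.IH[OF that])
    consider "t = 0" | "t = 1" | "t = 2" | "t = 3" | "t = 4" | "t = 5" | "t = 6" | "t = 7" | "t > 7" by arith
    then show ?thesis
    proof cases
      case 1
      define a v where "a = fst (read_nat u)" and "v = snd (read_nat u)"
      have "(scan_step True ^^ n) (v, R, ok) = (r, [], True)" "u = enc_nat a @ v"
        using tag 1 nofail by (auto simp: a_def v_def split: if_splits)
      from step[OF this(1)] this(2) obtain \<phi>s where "ok" "list_all2 admissible R \<phi>s" "v = concat (map enc \<phi>s) @ r" by auto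
      then show ?thesis using w 1 \<open>u = enc_nat a @ v\<close> Cons
        by (intro conjI exI[of _ "Atom a # \<phi>s"]) (auto simp: admissible_simps)
    next
      case 2
      then have "(scan_step True ^^ n) (u, B # R, ok) = (r, [], True)" using tag by simp
      from step[OF this] obtain \<phi> \<phi>s where "ok" "admissible B \<phi>" "list_all2 admissible R \<phi>s"
        "u = enc \<phi> @ concat (map enc \<phi>s) @ r" by (auto simp: list_all2_Cons1)
      then show ?thesis using w 2 Cons
        by (intro conjI exI[of _ "Neg \<phi> # \<phi>s"]) (auto simp: admissible_simps)
    next
      case 3
      then have "(scan_step True ^^ n) (u, B # B # R, ok) = (r, [], True)" using tag by simp
      from step[OF this] obtain \<phi> \<psi> \<phi>s where "ok" "admissible B \<phi>" "admissible B \<psi>" "list_all2 admissible R \<phi>s"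
        "u = enc \<phi> @ enc \<psi> @ concat (map enc \<phi>s) @ r" by (auto simp: list_all2_Cons1)
      then show ?thesis using w 3 Cons
        by (intro conjI exI[of _ "Or \<phi> \<psi> # \<phi>s"]) (auto simp: admissible_simps)
    next
      case 4
      define a v where "a = fst (read_nat u)" and "v = snd (read_nat u)"
      have "(scan_step True ^^ n) (v, (fst B, a # snd B) # R, ok) = (r, [], True)" and u: "u = enc_nat a @ v"
        using tag 4 nofail by (auto simp: a_def v_def split: if_splits)
      from step[OF this(1)] obtain \<phi> \<phi>s where "ok" "admissible (fst B, a # snd B) \<phi>" "list_all2 admissible R \<phi>s"
        "v = enc \<phi> @ concat (map enc \<phi>s) @ r" by (auto simp: list_all2_Cons1)
      then show ?thesis using w 4 Cons u
        by (intro conjI exI[of _ "Ex a \<phi> # \<phi>s"]) (auto simp: admissible_simps)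
    next
      case 5
      define a v where "a = fst (read_nat u)" and "v = snd (read_nat u)"
      define x z where "x = fst (read_nat v)" and "z = snd (read_nat v)"
      have "(scan_step True ^^ n) (z, (a # fst B, snd B) # R, ok \<and> a < k \<and> x \<in> set (snd B)) = (r, [], True)"
        and u: "u = enc_nat a @ v" and v: "v = enc_nat x @ z"
        using tag 5 nofail by (auto simp: a_def v_def x_def z_def split: if_splits)
      from step[OF this(1)] obtain \<phi> \<phi>s where "ok" "a < k" "x \<in> set (snd B)" "admissible (a # fst B, snd B) \<phi>"
        "list_all2 admissible R \<phi>s" "z = enc \<phi> @ concat (map enc \<phi>s) @ r" by (auto simp: list_all2_Cons1)
      then show ?thesis using w 5 Cons u v
        by (intro conjI exI[of _ "Bind a x \<phi> # \<phi>s"]) (auto simp: admissible_simps)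
    next
      case 6
      then have "(scan_step True ^^ n) (u, B # R, ok \<and> full B) = (r, [], True)" using tag by simp
      from step[OF this] obtain \<phi> \<phi>s where "ok" "full B" "admissible B \<phi>" "list_all2 admissible R \<phi>s"
        "u = enc \<phi> @ concat (map enc \<phi>s) @ r" by (auto simp: list_all2_Cons1)
      then show ?thesis using w 6 Cons
        by (intro conjI exI[of _ "Next \<phi> # \<phi>s"]) (auto simp: admissible_simps)
    next
      case 7
      then have "(scan_step True ^^ n) (u, B # B # R, ok \<and> full B) = (r, [], True)" using tag by simp
      from step[OF this] obtain \<phi> \<psi> \<phi>s where "ok" "full B" "admissible B \<phi>" "admissible B \<psi>" "list_all2 admissible R \<phi>s"
        "u = enc \<phi> @ enc \<psi> @ concat (map enc \<phi>s) @ r" by (auto simp: list_all2_Cons1)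
      then show ?thesis using w 7 Cons
        by (intro conjI exI[of _ "Until \<phi> \<psi> # \<phi>s"]) (auto simp: admissible_simps)
    next
      case 8
      define c v where "c = fst (read_code u)" and "v = snd (read_code u)"
      have "(scan_step True ^^ n) (v, B # B # R, ok \<and> full B \<and> f (enc_word c) \<noteq> []) = (r, [], True)"
        and u: "u = enc_word c @ v"
        using tag 8 nofail by (auto simp: c_def v_def split: if_splits)
      from step[OF this(1)] obtain \<phi> \<psi> \<phi>s where *: "ok" "full B" "f (enc_word c) \<noteq> []" "admissible B \<phi>" "admissible B \<psi>"
        "list_all2 admissible R \<phi>s" "v = enc \<phi> @ enc \<psi> @ concat (map enc \<phi>s) @ r" by (auto simp: list_all2_Cons1)
      obtain d where "d \<in> D" "c = code d" using *(3) known_code by blast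
      then show ?thesis using w 8 Cons u *
        by (intro conjI exI[of _ "DUntil d \<phi> \<psi> # \<phi>s"]) (auto simp: admissible_simps)
    next
      case 9
      then show ?thesis using tag nofail by simp
    qed
  qed
qed

lemma scan_valid:
  assumes "scan True w = (r, [], True)"
  obtains \<phi> where "admissible ([], []) \<phi>" "w = enc \<phi> @ r"
  using scan_sound[OF assms[unfolded scan_def]] that by (auto simp: list_all2_Cons1)

text \<open>One step adds at most one scope to the stack and at most one name to a scope, and each
  name was read from the input.\<close>

definition scan_bound :: "nat \<Rightarrow> nat \<Rightarrow> bool list \<times> scope list \<times> bool \<Rightarrow> bool" where
  "scan_bound L i x \<longleftrightarrow> length (fst x) \<le> L \<and> length (fst (snd x)) \<le> Suc i \<and>
     (\<forall>B\<in>set (fst (snd x)). length (fst B) \<le> i \<and> length (snd B) \<le> i \<and>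
        (\<forall>a\<in>set (fst B) \<union> set (snd B). length (bin a) \<le> L))"

lemma scan_bound_step:
  assumes "scan_bound L i x"
  shows "scan_bound L (Suc i) (scan_step s x)"
proof -
  have len: "length (bin (fst (read_nat w))) \<le> length w" "length (snd (read_nat w)) \<le> length w"
    "length (snd (read_code w)) \<le> length w" for w
  proof -
    have 0: "read_nat [] = (0, [])" "read_code [] = ([], [])" by (simp_all add: read_nat_def read_code_def)
    show "length (bin (fst (read_nat w))) \<le> length w" "length (snd (read_nat w)) \<le> length w"
      "length (snd (read_code w)) \<le> length w"
      using read_nat_length[of w] read_code_length[of w] by (cases "w = []"; simp add: 0)+
  qed
  have fail: "scan_bound L (Suc i) fail" by (simp add: scan_bound_def fail_def)
  obtain w Bs ok where x: "x = (w, Bs, ok)" by (cases x)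
  show ?thesis
  proof (cases Bs)
    case Nil
    then show ?thesis using assms by (simp add: x scan_step_def scan_bound_def)
  next
    case (Cons B R)
    define t u where "t = fst (read_nat w)" and "u = snd (read_nat w)"
    define a v where "a = fst (read_nat u)" and "v = snd (read_nat u)"
    define z c where "z = snd (read_nat v)" and "c = snd (read_code u)"
    have l: "length u \<le> L" "length v \<le> L" "length z \<le> L" "length c \<le> L" "length (bin a) \<le> L"
      using assms len[of w] len[of u] len[of v]
      by (auto simp: x scan_bound_def t_def u_def a_def v_def z_def c_def)
    have R: "length R \<le> i" "\<And>B'. B' \<in> insert B (set R) \<Longrightarrow> length (fst B') \<le> i \<and> length (snd B') \<le> i \<and>
        (\<forall>a\<in>set (fst B') \<union> set (snd B'). length (bin a) \<le> L)"
      using assms by (auto simp: scan_bound_def x Cons)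
    have ok: "scan_bound L (Suc i) (w', Bs', ok')"
      if "length w' \<le> L" and sh: "Bs' = R \<or> Bs' = B # R \<or> Bs' = B # B # R \<or> Bs' = (a # fst B, snd B) # R \<or> Bs' = (fst B, a # snd B) # R"
      for w' Bs' ok'
    proof -
      have "length Bs' \<le> Suc (Suc i)" using sh R(1) by auto
      moreover have "length (fst B') \<le> Suc i \<and> length (snd B') \<le> Suc i \<and>
          (\<forall>a\<in>set (fst B') \<union> set (snd B'). length (bin a) \<le> L)" if B': "B' \<in> set Bs'" for B'
      proof -
        consider "B' \<in> insert B (set R)" | "B' = (a # fst B, snd B)" | "B' = (fst B, a # snd B)"
          using sh B' by auto
        then show ?thesis
        proof cases
          case 1
          from R(2)[OF this] show ?thesis by simp
        next
          case 2
          then show ?thesis using R(2)[of B] l(5) by simp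
        next
          case 3
          then show ?thesis using R(2)[of B] l(5) by simp
        qed
      qed
      ultimately show ?thesis using that(1) by (simp add: scan_bound_def)
    qed
    have ite: "scan_bound L (Suc i) (if P then p else q)"
      if "scan_bound L (Suc i) p" "scan_bound L (Suc i) q" for P p q
      using that by simp
    have "scan_bound L (Suc i) (scan_tag s t u B R ok)"
      unfolding scan_tag_def Let_def a_def[symmetric] v_def[symmetric] z_def[symmetric] c_def[symmetric]
      by (intro ite fail ok l) simp_all
    then show ?thesis using fail by (simp add: x Cons scan_step_def flip: t_def u_def)
  qed
qed

lemma scan_bound_sz:
  assumes "scan_bound L i x" "i \<le> L"
  shows "sz x \<le> (4 * L + 1) + Suc (Suc L * Suc (Suc (2 * Suc (L * Suc (4 * L + 1))))) + 5"
proof -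
  obtain w Bs ok where x: "x = (w, Bs, ok)" by (cases x)
  have B: "sz B \<le> Suc (2 * Suc (L * Suc (4 * L + 1)))" if "B \<in> set Bs" for B
  proof -
    obtain as xs where B: "B = (as, xs)" by (cases B)
    have "length as \<le> L \<and> length xs \<le> L \<and> (\<forall>a\<in>set as \<union> set xs. length (bin a) \<le> L)"
      using assms that by (force simp: scan_bound_def x B)
    moreover have "sz ys \<le> Suc (L * Suc (4 * L + 1))" if "length ys \<le> L" "\<forall>a\<in>set ys. length (bin a) \<le> L" for ys
    proof -
      have "sz a \<le> 4 * L + 1" if "a \<in> set ys" for a
      proof -
        have "length (bin a) \<le> L" using \<open>\<forall>a\<in>set ys. length (bin a) \<le> L\<close> that by blast
        then show ?thesis using sz_word(1)[of "bin a"] by (simp add: sz_nat_bin)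
      qed
      then have "sz ys \<le> Suc (length ys * Suc (4 * L + 1))" by (rule sz_list_le)
      also have "\<dots> \<le> Suc (L * Suc (4 * L + 1))" using mult_le_mono1[OF that(1)] by (simp only: Suc_le_mono)
      finally show ?thesis .
    qed
    ultimately have "sz as \<le> Suc (L * Suc (4 * L + 1))" "sz xs \<le> Suc (L * Suc (4 * L + 1))" by auto
    then show ?thesis by (simp add: B)
  qed
  have "sz Bs \<le> Suc (length Bs * Suc (Suc (2 * Suc (L * Suc (4 * L + 1)))))"
    using B by (rule sz_list_le)
  also have "\<dots> \<le> Suc (Suc L * Suc (Suc (2 * Suc (L * Suc (4 * L + 1)))))"
  proof -
    have "length Bs \<le> Suc L" using assms by (simp add: scan_bound_def x)
    from mult_le_mono1[OF this] show ?thesis by (simp only: Suc_le_mono)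
  qed
  finally have "sz Bs \<le> Suc (Suc L * Suc (Suc (2 * Suc (L * Suc (4 * L + 1)))))" .
  moreover have "sz w \<le> 4 * L + 1" using sz_word(1)[of w] assms by (simp add: scan_bound_def x)
  ultimately show ?thesis using sz_bool(2)[of ok] by (simp add: x)
qed

lemma cmp_scan [cmp_intro]:
  assumes "cmp False w"
  shows "cmp False (\<lambda>x. scan s (w x))"
proof -
  have cf: "cmp False (\<lambda>x. f (g x))" if "cmp False g" for g :: "'x::rep \<Rightarrow> _" by (rule cmp_comp[OF cmp_f that])
  have "cmp False (\<lambda>w. scan s w)"
    unfolding scan_def
  proof (rule cmp_funpow)
    show "cmp False (\<lambda>q :: bool list \<times> bool list \<times> scope list \<times> bool. scan_step s (snd q))"
      unfolding scan_step_def scan_tag_def fail_def full_def Let_def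
      by (intro cmp_intro cf)
    show "cmp False (\<lambda>w :: bool list. length w)" "cmp False (\<lambda>w :: bool list. (w, [([] :: nat list, [] :: nat list)], True))"
      by (intro cmp_intro)+
    let ?G = "\<lambda>L. (4 * L + 1) + Suc (Suc L * Suc (Suc (2 * Suc (L * Suc (4 * L + 1))))) + 5"
    show "polybd (\<lambda>w :: bool list. ?G (length w))"
      by (intro polybd_intro polybd_length cmp_intro)
    fix w :: "bool list" and i assume i: "i \<le> length w"
    have "scan_bound (length w) i ((scan_step s ^^ i) (w, [([], [])], True))" for i
      by (induction i) (simp_all add: scan_bound_step, simp add: scan_bound_def)
    then show "sz ((scan_step s ^^ i) (w, [([], [])], True)) \<le> ?G (length w)"
      using i by (rule scan_bound_sz)
  qed
  from cmp_comp[OF this assms] show ?thesis .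
qed

lemma cmp_skip [cmp_intro]: "cmp False w \<Longrightarrow> cmp False (\<lambda>x. skip (w x))"
  unfolding skip_def by (intro cmp_intro)

end

section \<open>Evaluation over a game\<close>

lemma Min_insert_lessThan:
  fixes b :: "nat \<Rightarrow> real"
  shows "Min (insert 1 (b ` {..<Suc i})) = min (b i) (Min (insert 1 (b ` {..<i})))"
proof -
  have "insert 1 (b ` {..<Suc i}) = insert (b i) (insert 1 (b ` {..<i}))" by (auto simp: lessThan_Suc)
  then show ?thesis by (simp add: Min_insert)
qed

text \<open>Cutting a cycle out of a path reaches the same position earlier, hence with a larger
  discount factor and fewer obligations.\<close>

lemma lasso_bound:
  fixes d :: "nat \<Rightarrow> real" and l r :: "'v \<Rightarrow> real"
  assumes d: "antimono d" and r: "\<And>i. 0 \<le> r (\<pi> i)" and \<pi>: "\<And>i. \<pi> (Suc i) = F (\<pi> i)"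
    and N: "range \<pi> \<subseteq> V" "finite V" "card V \<le> N"
  shows "\<exists>j<N. min (d i * r (\<pi> i)) (Min (insert 1 ((\<lambda>j. d j * l (\<pi> j)) ` {..<i})))
    \<le> min (d j * r (\<pi> j)) (Min (insert 1 ((\<lambda>j. d j * l (\<pi> j)) ` {..<j})))"
    (is "\<exists>j<N. ?T i \<le> ?T j")
proof (induction i rule: less_induct)
  case (less i)
  show ?case
  proof (cases "i < N")
    case False
    have "\<not> inj_on \<pi> {..i}"
    proof
      assume "inj_on \<pi> {..i}"
      then have "card (\<pi> ` {..i}) = Suc i" by (simp add: card_image)
      moreover have "card (\<pi> ` {..i}) \<le> card V" using N by (intro card_mono) auto
      ultimately show False using False N(3) by simp
    qed
    then obtain p q where pq: "p < q" "q \<le> i" "\<pi> p = \<pi> q"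
      by (auto simp: inj_on_def) (metis linorder_neqE_nat)
    have shift: "\<pi> (p + n) = \<pi> (q + n)" for n by (induction n) (simp_all add: \<pi> pq(3))
    define j where "j = p + (i - q)"
    have j: "j < i" "\<pi> j = \<pi> i" using pq shift[of "i - q"] by (simp_all add: j_def)
    have "d i * r (\<pi> i) \<le> d j * r (\<pi> j)"
      using j r antimonoD[OF d, of j i] by (simp add: mult_right_mono)
    moreover have "Min (insert 1 ((\<lambda>j. d j * l (\<pi> j)) ` {..<i})) \<le> Min (insert 1 ((\<lambda>j. d j * l (\<pi> j)) ` {..<j}))"
      using j(1) by (intro Min_antimono) auto
    ultimately have "?T i \<le> ?T j" by linarith
    moreover obtain m where "m < N" "?T j \<le> ?T m" using less[OF j(1)] by blast
    ultimately show ?thesis by (meson order_trans)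
  qed blast
qed

primrec until_run :: "(nat \<Rightarrow> real) \<Rightarrow> nat \<Rightarrow> real" where
  "until_run b 0 = 1"
| "until_run b (Suc i) = min (until_run b i) (b i)"

primrec until_best :: "(nat \<Rightarrow> real) \<Rightarrow> (nat \<Rightarrow> real) \<Rightarrow> nat \<Rightarrow> real" where
  "until_best a b 0 = 0"
| "until_best a b (Suc i) = max (until_best a b i) (min (a i) (until_run b i))"

lemma until_run: "Min (insert 1 (b ` {..<i})) = until_run b i"
  by (induction i) (simp_all only: Min_insert_lessThan until_run.simps min.commute, simp)

lemma until_best_upper: "i < n \<Longrightarrow> min (a i) (until_run b i) \<le> until_best a b n"
  by (induction n) (auto simp: less_Suc_eq)

lemma until_best_cases: "until_best a b n = 0 \<or> (\<exists>i<n. until_best a b n = min (a i) (until_run b i))"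
  by (induction n) (auto simp: max_def less_Suc_eq)

text \<open>The maximum starts at 0, which does not exceed the supremum because the term at index 0
  is nonnegative; the remaining terms are dominated by the first \<open>N\<close>.\<close>

lemma SUP_until_best:
  assumes "0 \<le> a 0" and dom: "\<And>i. \<exists>j<N. min (a i) (until_run b i) \<le> min (a j) (until_run b j)"
  shows "(SUP i. min (a i) (until_run b i)) = until_best a b N"
proof (rule antisym)
  have up: "min (a i) (until_run b i) \<le> until_best a b N" for i
    using dom[of i] until_best_upper[of _ N a b] by (meson order_trans)
  then show "(SUP i. min (a i) (until_run b i)) \<le> until_best a b N" by (intro cSUP_least) auto
  have bdd: "bdd_above (range (\<lambda>i. min (a i) (until_run b i)))" using up by (auto simp: bdd_above_def)
  have "0 \<le> min (a 0) (until_run b 0)" using assms(1) by simp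
  also have "\<dots> \<le> (SUP i. min (a i) (until_run b i))" by (rule cSUP_upper[OF UNIV_I bdd])
  finally have "0 \<le> (SUP i. min (a i) (until_run b i))" .
  then show "until_best a b N \<le> (SUP i. min (a i) (until_run b i))"
    using until_best_cases[of a b N] cSUP_upper[OF UNIV_I bdd] by auto
qed

section \<open>Assignments, strategies and moves as data\<close>

type_synonym asg = "((bool \<times> nat) \<times> nat) list"

definition lookup :: "asg \<Rightarrow> bool \<times> nat \<Rightarrow> nat" where
  "lookup \<chi> l = rec_list 0 (\<lambda>e _ r. if fst e = l then snd e else r) \<chi>"

lemma lookup_simps [simp]:
  "lookup [] l = 0" "lookup (e # \<chi>) l = (if fst e = l then snd e else lookup \<chi> l)"
  by (simp_all add: lookup_def)

lemma lookup_less: "\<forall>e\<in>set \<chi>. snd e < n \<Longrightarrow> 0 < n \<Longrightarrow> lookup \<chi> l < n"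
  by (induction \<chi>) auto

lemma cmp_lookup [cmp_intro]:
  assumes "cmp b \<chi>" "cmp b l"
  shows "cmp b (\<lambda>x. lookup (\<chi> x) (l x))"
proof -
  have bd: "sz (rec_list 0 (\<lambda>e _ r. if fst e = l then snd e else r) ys) \<le> Suc (sz ys)" for l and ys :: asg
  proof (induction ys)
    case (Cons e ys)
    then show ?case by (cases e) auto
  qed (simp add: sz_nat_bin)
  have "cmp b (\<lambda>x. rec_list 0 (\<lambda>e _ r. if fst e = l x then snd e else r) (\<chi> x))"
  proof (rule cmp_rec_list)
    show "cmp b (\<lambda>q. if fst (fst (snd q)) = l (fst q) then snd (fst (snd q)) else snd (snd (snd q)))"
      by (intro cmp_intro cmp_comp[OF assms(2)])
    show "polybd (\<lambda>x. Suc (sz (\<chi> x)))" by (intro polybd_intro assms[THEN cmp_space])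
    fix x and ys zs :: asg assume "\<chi> x = zs @ ys"
    then have "sz ys \<le> sz (\<chi> x)" by (simp add: sz_append_le)
    then show "sz (rec_list 0 (\<lambda>e _ r. if fst e = l x then snd e else r) ys) \<le> Suc (sz (\<chi> x))"
      using bd[of "l x" ys] by simp
  qed (intro cmp_intro assms)+
  then show ?thesis by (simp add: lookup_def)
qed

text \<open>Of a game only the number of actions and the rows are kept.  The number \<open>j\<close> codes the strategy
  whose value at \<open>v\<close> is the \<open>v\<close>-th digit of \<open>j\<close> in base \<open>c\<close>.\<close>

type_synonym arena = "nat \<times> row list"

text \<open>The minimum changes nothing on positions; it keeps the exponent polynomial on arbitrary
  inputs, as computability of powers demands.\<close>

definition strat :: "arena \<Rightarrow> nat \<Rightarrow> nat \<Rightarrow> nat" where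
  "strat g j v = j div fst g ^ min v (length (snd g)) mod fst g"

definition succ :: "nat \<Rightarrow> arena \<Rightarrow> asg \<Rightarrow> nat \<Rightarrow> nat" where
  "succ k g \<chi> v = hd (drop (index (fst g) (map (\<lambda>a. strat g (lookup \<chi> (True, a)) v) [0..<k]))
     (fst (hd (drop v (snd g)))))"

fun key :: "nat + nat \<Rightarrow> bool \<times> nat" where
  "key (Inl a) = (True, a)"
| "key (Inr x) = (False, x)"

text \<open>Names missing from the list get the code 0, which also denotes a strategy, so every list
  gives a total assignment.\<close>

definition asgn :: "arena \<Rightarrow> asg \<Rightarrow> nat + nat \<Rightarrow> nat \<Rightarrow> nat" where
  "asgn g \<chi> l = (\<lambda>v\<in>{..<length (snd g)}. strat g (lookup \<chi> (key l)) v)"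

lemma asgn_variable: "asgn g (((False, x), j) # \<chi>) = (asgn g \<chi>)(Inr x := \<lambda>v\<in>{..<length (snd g)}. strat g j v)"
proof
  fix l :: "nat + nat"
  show "asgn g (((False, x), j) # \<chi>) l = ((asgn g \<chi>)(Inr x := \<lambda>v\<in>{..<length (snd g)}. strat g j v)) l"
    by (cases l) (auto simp: asgn_def)
qed

lemma asgn_agent: "asgn g (((True, a), lookup \<chi> (False, x)) # \<chi>) = (asgn g \<chi>)(Inl a := asgn g \<chi> (Inr x))"
proof
  fix l :: "nat + nat"
  show "asgn g (((True, a), lookup \<chi> (False, x)) # \<chi>) l = ((asgn g \<chi>)(Inl a := asgn g \<chi> (Inr x))) l"
    by (cases l) (auto simp: asgn_def)
qed

text \<open>\<open>as\<close> is a fixed list, in the application that of the agents, so the program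
  may be assembled by recursion on it.\<close>

lemma cmp_index:
  assumes h: "cmp False (\<lambda>q. h (fst q) (snd q))" and c: "cmp False c"
  shows "cmp False (\<lambda>x. index (c x) (map (h x) as))"
proof (induction as)
  case Nil
  show ?case by (simp only: index_def list.map foldr_Nil id_apply) (intro cmp_intro)
next
  case (Cons a as)
  have "cmp False (\<lambda>x. h x a)" using cmp_comp2[OF h cmp_id cmp_const[of False a]] .
  then have "cmp False (\<lambda>x. h x a + c x * index (c x) (map (h x) as))" by (intro cmp_intro Cons c)
  then show ?case by (simp add: index_def)
qed

lemma polybd_min: "cmp False l \<Longrightarrow> polybd (\<lambda>x. min (g x) (length (l x)))"
  by (rule polybd_le[OF polybd_length]) auto

lemma cmp_min [cmp_intro]:
  fixes f g :: "'a::rep \<Rightarrow> nat"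
  assumes "cmp False f" "cmp False g"
  shows "cmp False (\<lambda>x. min (f x) (g x))"
  unfolding min_def by (intro cmp_intro assms)

lemma cmp_strat [cmp_intro]:
  assumes "cmp False g" "cmp False j" "cmp False v"
  shows "cmp False (\<lambda>x. strat (g x) (j x) (v x))"
  unfolding strat_def by (intro cmp_intro polybd_min assms)

lemma cmp_succ [cmp_intro]:
  assumes "cmp False g" "cmp False \<chi>" "cmp False v"
  shows "cmp False (\<lambda>x. succ k (g x) (\<chi> x) (v x))"
  unfolding succ_def
  by (intro cmp_intro cmp_index assms cmp_comp[OF assms(1)] cmp_comp[OF assms(2)] cmp_comp[OF assms(3)])

lemma digit_less: "index c xs < c ^ length xs" if "set xs \<subseteq> {..<c}"
  using index_nth(1)[OF refl that] .

lemma index_digit: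
  "set xs \<subseteq> {..<c} \<Longrightarrow> v < length xs \<Longrightarrow> index c xs div c ^ v mod c = xs ! v"
proof (induction xs arbitrary: v)
  case (Cons x xs)
  then have x: "x < c" by simp
  have i: "index c (x # xs) = x + c * index c xs" by (simp add: index_def)
  show ?case
  proof (cases v)
    case 0
    then show ?thesis using x by (simp add: i)
  next
    case (Suc u)
    have "index c (x # xs) div c ^ v = (x + c * index c xs) div c div c ^ u"
      by (simp add: Suc i div_mult2_eq)
    also have "(x + c * index c xs) div c = index c xs" using x by simp
    finally show ?thesis using Cons Suc by simp
  qed
qed simp

lemma strategies_image:
  assumes g: "game_ok k g" "presents k g G"
  shows "strategies G = (\<lambda>j. \<lambda>v\<in>{..<length (snd (snd g))}. strat (snd g) j v) ` {..<fst (snd g) ^ length (snd (snd g))}"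
    (is "_ = ?f ` _")
proof (intro subset_antisym subsetI)
  define c N where "c = fst (snd g)" and "N = length (snd (snd g))"
  have str: "strategies G = {..<N} \<rightarrow>\<^sub>E {..<c}" using g(2) by (simp add: strategies_def presents_def c_def N_def)
  have c: "0 < c" using g(1) by (simp add: game_ok_def c_def)
  fix \<sigma>
  show "\<sigma> \<in> ?f ` {..<fst (snd g) ^ length (snd (snd g))}" if "\<sigma> \<in> strategies G"
  proof -
    have \<sigma>: "\<sigma> \<in> {..<N} \<rightarrow>\<^sub>E {..<c}" using that str by simp
    define xs where "xs = map \<sigma> [0..<N]"
    have xs: "set xs \<subseteq> {..<c}" "length xs = N" using profile_list[OF \<sigma>] by (simp_all add: xs_def)
    have "?f (index c xs) = \<sigma>"
    proof
      fix v
      show "?f (index c xs) v = \<sigma> v"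
      proof (cases "v < N")
        case True
        then have "strat (snd g) (index c xs) v = xs ! v"
          using index_digit[OF xs(1), of v] xs(2) by (simp add: strat_def min_def flip: c_def N_def)
        then show ?thesis using True by (simp add: xs_def flip: N_def)
      next
        case False
        then show ?thesis using PiE_arb[OF \<sigma>, of v] by (simp flip: N_def)
      qed
    qed
    moreover have "index c xs < c ^ N" using digit_less[OF xs(1)] xs(2) by simp
    ultimately show ?thesis by (intro image_eqI[of _ _ "index c xs"]) (simp_all add: c_def N_def)
  qed
  show "\<sigma> \<in> strategies G" if "\<sigma> \<in> ?f ` {..<fst (snd g) ^ length (snd (snd g))}"
    using that c by (auto simp: str strat_def simp flip: c_def N_def split: if_splits)
qed

lemma range_asgn:
  assumes g: "game_ok k g" "presents k g G"
  shows "range (asgn (snd g) \<chi>) \<subseteq> strategies G"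
proof -
  have "0 < fst (snd g)" using g(1) by (simp add: game_ok_def)
  then show ?thesis using g(2) by (auto simp: asgn_def strategies_def presents_def strat_def)
qed

lemma succ_move:
  assumes g: "game_ok k g" "presents k g G" and v: "v < length (snd (snd g))"
  shows "succ k (snd g) \<chi> v < length (snd (snd g))"
    "move G v (\<lambda>a\<in>{..<k}. asgn (snd g) \<chi> (Inl a) v) = succ k (snd g) \<chi> v"
proof -
  define c N where "c = fst (snd g)" and "N = length (snd (snd g))"
  define a where "a = (\<lambda>a\<in>{..<k}. asgn (snd g) \<chi> (Inl a) v)"
  have c: "0 < c" using g(1) by (simp add: game_ok_def c_def)
  have a: "a \<in> {..<k} \<rightarrow>\<^sub>E {..<c}"
    using c v by (auto simp: a_def asgn_def strat_def c_def)
  have as: "map (\<lambda>a. strat (snd g) (lookup \<chi> (True, a)) v) [0..<k] = map a [0..<k]"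
    using v by (auto simp: a_def asgn_def)
  have i: "index c (map a [0..<k]) < c ^ k" using index_nth(1)[OF profile_list[OF a]] .
  have row: "snd (snd g) ! v \<in> set (snd (snd g))" using v by simp
  then have len: "length (fst (snd (snd g) ! v)) = c ^ k" "\<forall>u\<in>set (fst (snd (snd g) ! v)). u < N"
    using g(1) unfolding game_ok_def c_def N_def by blast+
  have s: "succ k (snd g) \<chi> v = fst (snd (snd g) ! v) ! index c (map a [0..<k])"
    using v i len(1) by (simp only: succ_def as hd_drop_conv_nth c_def)
  then show "succ k (snd g) \<chi> v < length (snd (snd g))" using len i by (simp add: N_def)
  show "move G v (\<lambda>a\<in>{..<k}. asgn (snd g) \<chi> (Inl a) v) = succ k (snd g) \<chi> v"
    using g(2) v a unfolding presents_def s a_def[symmetric] c_def by blast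
qed

lemma outcome_succ:
  assumes g: "game_ok k g" "presents k g G" and v: "v < length (snd (snd g))"
  shows "outcome {..<k} G (asgn (snd g) \<chi>) v i = (succ k (snd g) \<chi> ^^ i) v"
    "(succ k (snd g) \<chi> ^^ i) v < length (snd (snd g))"
proof -
  have "outcome {..<k} G (asgn (snd g) \<chi>) v i = (succ k (snd g) \<chi> ^^ i) v \<and>
      (succ k (snd g) \<chi> ^^ i) v < length (snd (snd g))"
    by (induction i) (simp_all add: v succ_move[OF g])
  then show "outcome {..<k} G (asgn (snd g) \<chi>) v i = (succ k (snd g) \<chi> ^^ i) v"
    "(succ k (snd g) \<chi> ^^ i) v < length (snd (snd g))" by auto
qed

text \<open>Satisfaction values are unreduced fractions.\<close>

type_synonym fraction = "nat \<times> nat"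

definition rv :: "fraction \<Rightarrow> real" where "rv p = real (fst p) / real (snd p)"

definition unit_fraction :: "nat \<Rightarrow> fraction \<Rightarrow> bool" where
  "unit_fraction E p \<longleftrightarrow> fst p \<le> snd p \<and> 0 < snd p \<and> snd p \<le> 2 ^ E"

definition qle :: "fraction \<Rightarrow> fraction \<Rightarrow> bool" where
  "qle p q \<longleftrightarrow> fst p * snd q \<le> fst q * snd p"

definition "qmax p q = (if qle p q then q else p)"
definition "qmin p q = (if qle p q then p else q)"
definition qmul :: "fraction \<Rightarrow> fraction \<Rightarrow> fraction" where
  "qmul p q = (fst p * fst q, snd p * snd q)"
definition qneg :: "fraction \<Rightarrow> fraction" where "qneg p = (snd p - fst p, snd p)"

lemma rv_nonneg [simp]: "0 \<le> rv p"
  by (simp add: rv_def)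

lemma rv_0 [simp]: "rv (0, b) = 0" and rv_1 [simp]: "rv (Suc 0, Suc 0) = 1"
  by (simp_all add: rv_def)

lemma rv_le: "unit_fraction E p \<Longrightarrow> unit_fraction F q \<Longrightarrow> rv p \<le> rv q \<longleftrightarrow> qle p q"
  by (simp add: unit_fraction_def rv_def qle_def field_simps flip: of_nat_mult)

lemma rv_qmax: "unit_fraction E p \<Longrightarrow> unit_fraction F q \<Longrightarrow> rv (qmax p q) = max (rv p) (rv q)"
  by (auto simp: qmax_def max_def rv_le)

lemma rv_qmin: "unit_fraction E p \<Longrightarrow> unit_fraction F q \<Longrightarrow> rv (qmin p q) = min (rv p) (rv q)"
  by (auto simp: qmin_def min_def rv_le)

lemma rv_qmul: "rv (qmul p q) = rv p * rv q"
  by (simp add: rv_def qmul_def)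

lemma rv_qneg: "unit_fraction E p \<Longrightarrow> rv (qneg p) = 1 - rv p"
  by (simp add: unit_fraction_def rv_def qneg_def of_nat_diff field_simps)

lemma unit_fraction_qmax: "unit_fraction E p \<Longrightarrow> unit_fraction E q \<Longrightarrow> unit_fraction E (qmax p q)"
  and unit_fraction_qmin: "unit_fraction E p \<Longrightarrow> unit_fraction E q \<Longrightarrow> unit_fraction E (qmin p q)"
  by (simp_all add: qmax_def qmin_def)

text \<open>Only multiplication raises the exponent of the denominator bound; maximum, minimum and
  complement keep it.\<close>

lemma unit_fraction_qmul: "unit_fraction E p \<Longrightarrow> unit_fraction F q \<Longrightarrow> unit_fraction (E + F) (qmul p q)"
  by (auto simp: unit_fraction_def qmul_def power_add intro: mult_le_mono)

lemma unit_fraction_qneg: "unit_fraction E p \<Longrightarrow> unit_fraction E (qneg p)"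
  by (simp add: unit_fraction_def qneg_def)

lemma unit_fraction_mono: "unit_fraction E p \<Longrightarrow> E \<le> F \<Longrightarrow> unit_fraction F p"
  unfolding unit_fraction_def by (meson order_trans one_le_numeral power_increasing)

lemma unit_fraction_01 [simp]: "unit_fraction E (0, Suc 0)" "unit_fraction E (Suc 0, Suc 0)"
  by (simp_all add: unit_fraction_def)

lemma sz_fraction: "unit_fraction E p \<Longrightarrow> sz p \<le> 8 * E + 11"
proof -
  assume p: "unit_fraction E p"
  have "(2 :: nat) ^ E < 2 ^ Suc E" by simp
  then have "fst p < 2 ^ Suc E" "snd p < 2 ^ Suc E"
    using p unfolding unit_fraction_def by linarith+
  then have "sz (fst p) \<le> 4 * Suc E + 1" "sz (snd p) \<le> 4 * Suc E + 1" by (simp_all only: sz_nat)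
  then show ?thesis by (cases p) simp
qed

lemma cmp_fraction [cmp_intro]:
  assumes "cmp False p" "cmp False q"
  shows "cmp False (\<lambda>x. qle (p x) (q x))" "cmp False (\<lambda>x. qmax (p x) (q x))"
    "cmp False (\<lambda>x. qmin (p x) (q x))" "cmp False (\<lambda>x. qmul (p x) (q x))"
  unfolding qmax_def qmin_def qmul_def qle_def by (intro cmp_intro assms)+

lemma cmp_qneg [cmp_intro]: "cmp False p \<Longrightarrow> cmp False (\<lambda>x. qneg (p x))"
  unfolding qneg_def by (intro cmp_intro)

text \<open>A node of the evaluation: an arena, the code of a formula followed by anything, an assignment
  and a position.\<close>

type_synonym node = "arena \<times> bool list \<times> asg \<times> nat"

definition tag :: "node \<Rightarrow> nat" where "tag x = fst (read_nat (fst (snd x)))"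
definition body :: "node \<Rightarrow> bool list" where "body x = snd (read_nat (fst (snd x)))"

definition tasks :: "node \<Rightarrow> nat" where
  "tasks x = (if tag x = 0 then 0 else if tag x = 2 then 2
     else if tag x = 3 then fst (fst x) ^ length (snd (fst x))
     else if tag x = 6 \<or> tag x = 7 then 2 * length (snd (fst x)) else 1)"

text \<open>The accumulator consists of the current position on the path, the best value so far and
  the minimum of the discounted left values; 0 and 1 are neutral for maximum and minimum.\<close>

definition start :: "node \<Rightarrow> nat \<times> fraction \<times> fraction" where
  "start x = (snd (snd (snd x)), (0, 1), (1, 1))"

definition result :: "node \<Rightarrow> nat \<times> fraction \<times> fraction \<Rightarrow> fraction" where
  "result x a = (if tag x = 0 then
       (if fst (read_nat (body x)) \<in> set (snd (hd (drop (snd (snd (snd x))) (snd (fst x)))))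
        then (1, 1) else (0, 1))
     else if tag x = 1 then qneg (fst (snd a)) else fst (snd a))"

lemma cmp_tag [cmp_intro]: "cmp False x \<Longrightarrow> cmp False (\<lambda>y. tag (x y))"
  and cmp_body [cmp_intro]: "cmp False x \<Longrightarrow> cmp False (\<lambda>y. body (x y))"
  unfolding tag_def body_def by (intro cmp_intro, assumption)+

lemma read_nat_enc [simp]: "read_nat (enc_nat n) = (n, [])"
  using read_nat[of n "[]"] by simp

context discounted
begin

definition disc_at :: "bool list \<Rightarrow> nat \<Rightarrow> fraction" where
  "disc_at u i = (let y = f (enc_word u @ replicate i True) in
     (fst (read_nat y), fst (read_nat (snd (read_nat y)))))"

text \<open>The plain until is evaluated as one with constant weight 1, so both share the loop. The
  minimum keeps the unary argument short on every input.\<close>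

definition weight :: "node \<Rightarrow> nat \<Rightarrow> fraction" where
  "weight x i = (if tag x = 7 then disc_at (fst (read_code (body x))) (min i (length (snd (fst x))))
     else (1, 1))"

text \<open>An until is evaluated along the path in even steps for the right and odd steps for the left
  subformula.\<close>

definition call :: "node \<Rightarrow> nat \<Rightarrow> nat \<times> fraction \<times> fraction \<Rightarrow> node" where
  "call x j a = (let t = tag x; w = body x; \<chi> = fst (snd (snd x)); v = snd (snd (snd x)); r = read_nat w in
     (fst x,
      (if t = 2 then (if j = 0 then w else skip w)
       else if t = 3 then snd r
       else if t = 4 then snd (read_nat (snd r))
       else if t = 6 then (if even j then skip w else w)
       else if t = 7 then (if even j then skip (snd (read_code w)) else snd (read_code w))
       else w),
      (if t = 3 then ((False, fst r), j) # \<chi>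
       else if t = 4 then ((True, fst r), lookup \<chi> (False, fst (read_nat (snd r)))) # \<chi>
       else \<chi>),
      (if t = 5 then succ k (fst x) \<chi> v else if t = 6 \<or> t = 7 then fst a else v)))"

definition update :: "node \<Rightarrow> nat \<Rightarrow> nat \<times> fraction \<times> fraction \<Rightarrow> fraction \<Rightarrow> nat \<times> fraction \<times> fraction" where
  "update x j a r = (if tag x = 6 \<or> tag x = 7 then
       (if even j then (fst a, qmax (fst (snd a)) (qmin (qmul (weight x (j div 2)) r) (snd (snd a))), snd (snd a))
        else (succ k (fst x) (fst (snd (snd x))) (fst a), fst (snd a),
              qmin (snd (snd a)) (qmul (weight x (j div 2)) r)))
     else (fst a, qmax (fst (snd a)) r, snd (snd a)))"

sublocale eval: loop_recursion tasks call update result start .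

lemma cmp_weight [cmp_intro]:
  assumes "cmp False x" "cmp False i"
  shows "cmp False (\<lambda>y. weight (x y) (i y))"
  unfolding weight_def disc_at_def Let_def
  by (intro cmp_intro assms polybd_min cmp_comp[OF cmp_f])

lemma cmp_tasks: "cmp False tasks"
  unfolding tasks_def by (intro cmp_intro polybd_length)

lemma cmp_start: "cmp False start"
  unfolding start_def by (intro cmp_intro)

lemma cmp_result: "cmp False (\<lambda>p. result (fst p) (snd p))"
  unfolding result_def by (intro cmp_intro)

lemma cmp_call: "cmp False (\<lambda>p. call (fst p) (fst (snd p)) (snd (snd p)))"
  unfolding call_def Let_def by (intro cmp_intro)

lemma cmp_update: "cmp False (\<lambda>p. update (fst p) (fst (snd p)) (fst (snd (snd p))) (snd (snd (snd p))))"
  unfolding update_def by (intro cmp_intro)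

lemma disc_at_code:
  assumes d: "d \<in> D" and len: "length (f (enc_word (code d) @ replicate i True)) \<le> H"
  shows "rv (disc_at (code d) i) = d i" "unit_fraction H (disc_at (code d) i)"
proof -
  obtain r where r: "d i = of_rat r" "f (enc_word (code d) @ replicate i True) = enc_rat r"
    using f_val[OF d] by blast
  obtain a b where q: "quotient_of r = (a, b)" by (cases "quotient_of r")
  have b: "0 < b" using quotient_of_denom_pos[OF q] .
  have di: "d i = of_int a / of_int b" using quotient_of_div[OF q] by (simp add: r(1) of_rat_divide)
  have d01: "0 \<le> d i" "d i \<le> 1" using disc[OF d] unfolding discounting_def by (auto simp: image_subset_iff)
  have a: "0 \<le> a" "a \<le> b" using d01 b by (auto simp: di zero_le_divide_iff)
  have y: "f (enc_word (code d) @ replicate i True) = enc_nat (nat a) @ enc_nat (nat b)"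
    by (simp add: r(2) enc_rat_def q)
  then have at: "disc_at (code d) i = (nat a, nat b)" by (simp add: disc_at_def Let_def)
  show "rv (disc_at (code d) i) = d i" using a b by (simp add: at rv_def di)
  have "length (bin (nat b)) \<le> H" using len by (simp add: y enc_nat_def)
  moreover have "nat b < 2 ^ length (bin (nat b))" using unbin_less[of "bin (nat b)"] by simp
  ultimately have "nat b \<le> 2 ^ H"
    by (meson less_imp_le order_trans one_le_numeral power_increasing)
  then show "unit_fraction H (disc_at (code d) i)" using a b by (simp add: at unit_fraction_def)
qed

end

text \<open>\<open>L\<close> stands for the length of the input word and \<open>H\<close> for the
  length of every discount that can be queried, with a name of length at most \<open>L\<close> and
  an argument at most the number of positions.\<close>

locale evaluation = discounted +
  fixes g :: game and G :: "(nat, nat, nat, nat) cgs" and L H :: nat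
  assumes g: "game_ok k g" "presents k g G"
    and H: "\<And>u i. length u \<le> L \<Longrightarrow> i \<le> length (snd (snd g)) \<Longrightarrow>
      length (f (enc_word u @ replicate i True)) \<le> H"
begin

abbreviation N where "N \<equiv> length (snd (snd g))"
abbreviation c where "c \<equiv> fst (snd g)"

text \<open>The fuel \<open>t\<close> is at least the length of the formula code. A call extends the
  assignment by at most one entry while using up fuel, so \<open>t + length \<chi>\<close> does not
  grow. Anything may follow the code, as subformulas are not cut off at their end.\<close>

definition node_ok :: "nat \<Rightarrow> (nat, nat, nat) form \<Rightarrow> node \<Rightarrow> bool" where
  "node_ok t \<phi> x \<longleftrightarrow> (case x of (a, w, \<chi>, v) \<Rightarrow>
     a = snd g \<and> form_over {..<k} D \<phi> \<and> (\<exists>r. w = enc \<phi> @ r) \<and> length (enc \<phi>) \<le> t \<and> length w \<le> L \<and>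
     t + length \<chi> \<le> L \<and> v < N \<and> (\<forall>e\<in>set \<chi>. snd e < c ^ N \<and> length (bin (snd (fst e))) \<le> L))"

definition acc_ok :: "nat \<Rightarrow> nat \<times> fraction \<times> fraction \<Rightarrow> bool" where
  "acc_ok t a \<longleftrightarrow> fst a < N \<and> unit_fraction (t * H) (fst (snd a)) \<and> unit_fraction (t * H) (snd (snd a))"

definition meaning :: "(nat, nat, nat) form \<Rightarrow> asg \<Rightarrow> nat \<Rightarrow> real" where
  "meaning \<phi> \<chi> v = sat_value {..<k} G \<phi> (asgn (snd g) \<chi>) v"

lemma c: "0 < c"
  using g(1) by (simp add: game_ok_def)

lemma N: "0 < N"
  using g(1) by (auto simp: game_ok_def)

lemma length_enc_nat: "length (enc_nat n) = 2 * length (bin n) + 1"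
  by (simp add: enc_nat_def)

lemma tag_enc [simp]:
  "tag (a, enc (Atom p) @ r, s) = 0" "tag (a, enc (Neg \<phi>) @ r, s) = 1"
  "tag (a, enc (Or \<phi> \<psi>) @ r, s) = 2" "tag (a, enc (Ex y \<phi>) @ r, s) = 3"
  "tag (a, enc (Bind i y \<phi>) @ r, s) = 4" "tag (a, enc (Next \<phi>) @ r, s) = 5"
  "tag (a, enc (Until \<phi> \<psi>) @ r, s) = 6" "tag (a, enc (DUntil d \<phi> \<psi>) @ r, s) = 7"
  by (simp_all add: tag_def)

lemma body_enc [simp]:
  "body (a, enc (Atom p) @ r, s) = enc_nat p @ r" "body (a, enc (Neg \<phi>) @ r, s) = enc \<phi> @ r"
  "body (a, enc (Or \<phi> \<psi>) @ r, s) = enc \<phi> @ enc \<psi> @ r"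
  "body (a, enc (Ex y \<phi>) @ r, s) = enc_nat y @ enc \<phi> @ r"
  "body (a, enc (Bind i y \<phi>) @ r, s) = enc_nat i @ enc_nat y @ enc \<phi> @ r"
  "body (a, enc (Next \<phi>) @ r, s) = enc \<phi> @ r"
  "body (a, enc (Until \<phi> \<psi>) @ r, s) = enc \<phi> @ enc \<psi> @ r"
  "body (a, enc (DUntil d \<phi> \<psi>) @ r, s) = enc_word (code d) @ enc \<phi> @ enc \<psi> @ r"
  by (simp_all add: body_def)

lemma call_enc:
  "call (b, enc (Neg \<phi>) @ r, \<chi>, v) j a = (b, enc \<phi> @ r, \<chi>, v)"
  "call (b, enc (Or \<phi> \<psi>) @ r, \<chi>, v) j a = (b, if j = 0 then enc \<phi> @ enc \<psi> @ r else enc \<psi> @ r, \<chi>, v)"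
  "call (b, enc (Ex y \<phi>) @ r, \<chi>, v) j a = (b, enc \<phi> @ r, ((False, y), j) # \<chi>, v)"
  "call (b, enc (Bind i y \<phi>) @ r, \<chi>, v) j a = (b, enc \<phi> @ r, ((True, i), lookup \<chi> (False, y)) # \<chi>, v)"
  "call (b, enc (Next \<phi>) @ r, \<chi>, v) j a = (b, enc \<phi> @ r, \<chi>, succ k b \<chi> v)"
  "call (b, enc (Until \<phi> \<psi>) @ r, \<chi>, v) j a = (b, if even j then enc \<psi> @ r else enc \<phi> @ enc \<psi> @ r, \<chi>, fst a)"
  "call (b, enc (DUntil d \<phi> \<psi>) @ r, \<chi>, v) j a = (b, if even j then enc \<psi> @ r else enc \<phi> @ enc \<psi> @ r, \<chi>, fst a)"
  by (simp_all add: call_def Let_def del: enc_form.simps)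

lemma tasks_enc:
  "tasks (b, enc (Atom p) @ r, s) = 0" "tasks (b, enc (Neg \<phi>) @ r, s) = 1"
  "tasks (b, enc (Or \<phi> \<psi>) @ r, s) = 2" "tasks (b, enc (Ex y \<phi>) @ r, s) = fst b ^ length (snd b)"
  "tasks (b, enc (Bind i y \<phi>) @ r, s) = 1" "tasks (b, enc (Next \<phi>) @ r, s) = 1"
  "tasks (b, enc (Until \<phi> \<psi>) @ r, s) = 2 * length (snd b)"
  "tasks (b, enc (DUntil d \<phi> \<psi>) @ r, s) = 2 * length (snd b)"
  by (simp_all add: tasks_def del: enc_form.simps)

fun child :: "(nat, nat, nat) form \<Rightarrow> nat \<Rightarrow> (nat, nat, nat) form" where
  "child (Atom p) j = Atom p"
| "child (Neg \<phi>) j = \<phi>"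
| "child (Or \<phi> \<psi>) j = (if j = 0 then \<phi> else \<psi>)"
| "child (Ex x \<phi>) j = \<phi>"
| "child (Bind a x \<phi>) j = \<phi>"
| "child (Next \<phi>) j = \<phi>"
| "child (Until \<phi> \<psi>) j = (if even j then \<psi> else \<phi>)"
| "child (DUntil d \<phi> \<psi>) j = (if even j then \<psi> else \<phi>)"

lemma node_ok_call:
  assumes x: "node_ok (Suc t) \<phi> x" and j: "j < tasks x" and a: "fst a < N"
  shows "node_ok t (child \<phi> j) (call x j a)"
proof -
  obtain b w \<chi> v where xw: "x = (b, w, \<chi>, v)" by (cases x) auto
  from x obtain r where r: "w = enc \<phi> @ r" by (auto simp: node_ok_def xw)
  note x = x[unfolded xw r node_ok_def prod.case] and j = j[unfolded xw r]
  show ?thesis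
  proof (cases \<phi>)
    case (Atom p)
    with j show ?thesis by (simp add: tasks_enc del: enc_form.simps)
  next
    case (Neg \<psi>)
    show ?thesis unfolding xw r Neg call_enc child.simps
      using x Neg by (auto simp: node_ok_def length_enc_nat)
  next
    case (Or \<psi> \<psi>')
    show ?thesis unfolding xw r Or call_enc child.simps
      using x Or by (auto simp: node_ok_def length_enc_nat)
  next
    case (Ex y \<psi>)
    have "j < c ^ N" using j x unfolding Ex tasks_enc by simp
    then show ?thesis unfolding xw r Ex call_enc child.simps
      using x Ex by (auto simp: node_ok_def length_enc_nat)
  next
    case (Bind i y \<psi>)
    have "lookup \<chi> (False, y) < c ^ N" using x c by (intro lookup_less) auto
    then show ?thesis unfolding xw r Bind call_enc child.simps
      using x Bind by (auto simp: node_ok_def length_enc_nat)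
  next
    case (Next \<psi>)
    have "succ k b \<chi> v < N" using succ_move(1)[OF g] x by simp
    then show ?thesis unfolding xw r Next call_enc child.simps
      using x Next by (auto simp: node_ok_def length_enc_nat)
  next
    case (Until \<psi> \<psi>')
    show ?thesis unfolding xw r Until call_enc child.simps
      using x a Until by (auto simp: node_ok_def length_enc_nat)
  next
    case (DUntil d \<psi> \<psi>')
    show ?thesis unfolding xw r DUntil call_enc child.simps
      using x a DUntil by (auto simp: node_ok_def length_enc_nat)
  qed
qed

lemma weight_ok:
  assumes x: "node_ok t \<phi> x"
  shows "unit_fraction H (weight x i)"
    "\<phi> = DUntil d \<psi> \<psi>' \<Longrightarrow> i \<le> N \<Longrightarrow> rv (weight x i) = d i"
proof -
  obtain b w \<chi> v where xw: "x = (b, w, \<chi>, v)" by (cases x) auto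
  from x obtain r where r: "w = enc \<phi> @ r" by (auto simp: node_ok_def xw)
  note x = x[unfolded xw r node_ok_def prod.case]
  have *: "rv (weight x i) = d (min i N)" "unit_fraction H (weight x i)" if "\<phi> = DUntil d \<psi> \<psi>'" for d \<psi> \<psi>'
  proof -
    have d: "d \<in> D" "length (code d) \<le> L" using x that by auto
    have "weight x i = disc_at (code d) (min i N)"
      using x by (simp add: weight_def xw r that del: enc_form.simps)
    then show "rv (weight x i) = d (min i N)" "unit_fraction H (weight x i)"
      using disc_at_code[OF d(1) H[OF d(2)], of "min i N"] by simp_all
  qed
  show "unit_fraction H (weight x i)"
  proof (cases "\<exists>d \<psi> \<psi>'. \<phi> = DUntil d \<psi> \<psi>'")
    case False
    then have "tag x \<noteq> 7" by (cases \<phi>) (simp_all add: xw r del: enc_form.simps)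
    then show ?thesis by (simp add: weight_def)
  qed (use * in blast)
  show "\<phi> = DUntil d \<psi> \<psi>' \<Longrightarrow> i \<le> N \<Longrightarrow> rv (weight x i) = d i" using *(1) by (simp add: min_def)
qed

definition values_ok :: "nat \<Rightarrow> bool" where
  "values_ok t \<longleftrightarrow> (\<forall>\<phi> x. node_ok t \<phi> x \<longrightarrow> unit_fraction (t * H) (eval.val t x))"

text \<open>A level multiplies a value from the level below by at most one weight, and then only
  takes maxima and minima. The exponent thus grows by \<open>H\<close> per level, however many calls
  the loop makes.\<close>

lemma acc_ok:
  assumes x: "node_ok (Suc t) \<phi> x" and t: "values_ok t" and j: "j \<le> tasks x"
  shows "acc_ok (Suc t) (eval.acc (eval.val t) x j)"
  using j
proof (induction j)
  case 0
  have "snd (snd (snd x)) < N" using x by (auto simp: node_ok_def split: prod.splits)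
  then show ?case unfolding eval.acc.simps by (simp add: start_def acc_ok_def)
next
  case (Suc j)
  define a where "a = eval.acc (eval.val t) x j"
  define r where "r = eval.val t (call x j a)"
  have a: "acc_ok (Suc t) a" using Suc by (simp add: a_def)
  then have "fst a < N" by (simp add: acc_ok_def)
  then have "node_ok t (child \<phi> j) (call x j a)" using node_ok_call[OF x] Suc.prems by (meson Suc_le_eq)
  then have r: "unit_fraction (t * H) r" using t unfolding values_ok_def r_def by blast
  then have r1: "unit_fraction (Suc t * H) r" by (rule unit_fraction_mono) simp
  have r2: "unit_fraction (Suc t * H) (qmul (weight x i) r)" for i
    using unit_fraction_qmul[OF weight_ok(1)[OF x] r] by simp
  have "succ k (fst x) (fst (snd (snd x))) (fst a) < N"
    using succ_move(1)[OF g \<open>fst a < N\<close>] x by (simp add: node_ok_def split: prod.splits)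
  then have "acc_ok (Suc t) (update x j a r)"
    using a r1 r2 unfolding acc_ok_def update_def
    by (simp add: unit_fraction_qmax unit_fraction_qmin del: mult_Suc)
  then show ?case by (simp add: a_def r_def)
qed

lemma values_ok: "values_ok t"
proof (induction t)
  case 0
  \<comment> \<open>No formula has an empty code, so there is no node without fuel.\<close>
  have "\<not> node_ok 0 \<phi> x" for \<phi> x by (cases \<phi>) (auto simp: node_ok_def split: prod.splits)
  then show ?case by (simp add: values_ok_def)
next
  case (Suc t)
  show ?case unfolding values_ok_def
  proof (intro allI impI)
    fix \<phi> x assume x: "node_ok (Suc t) \<phi> x"
    have "acc_ok (Suc t) (eval.acc (eval.val t) x (tasks x))" by (rule acc_ok[OF x Suc order.refl])
    then show "unit_fraction (Suc t * H) (eval.val (Suc t) x)"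
      by (simp add: result_def acc_ok_def unit_fraction_qneg del: mult_Suc)
  qed
qed

end

section \<open>Correctness of the evaluation\<close>

context evaluation
begin

definition pos :: "asg \<Rightarrow> nat \<Rightarrow> nat \<Rightarrow> nat" where
  "pos \<chi> v i = (succ k (snd g) \<chi> ^^ i) v"

lemma pos_less: "v < N \<Longrightarrow> pos \<chi> v i < N"
  unfolding pos_def by (rule outcome_succ(2)[OF g])

lemma SUP_until:
  fixes d :: "nat \<Rightarrow> real"
  assumes v: "v < N" and d: "antimono d" "0 \<le> d 0" and nonneg: "\<And>u. u < N \<Longrightarrow> 0 \<le> meaning \<psi> \<chi> u"
  shows "(SUP i. min (d i * sat_value {..<k} G \<psi> (asgn (snd g) \<chi>) (outcome {..<k} G (asgn (snd g) \<chi>) v i))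
      (Min (insert 1 ((\<lambda>j. d j * sat_value {..<k} G \<phi> (asgn (snd g) \<chi>) (outcome {..<k} G (asgn (snd g) \<chi>) v j)) ` {..<i}))))
    = until_best (\<lambda>i. d i * meaning \<psi> \<chi> (pos \<chi> v i)) (\<lambda>i. d i * meaning \<phi> \<chi> (pos \<chi> v i)) N"
  unfolding outcome_succ(1)[OF g v] meaning_def[symmetric] pos_def[symmetric] until_run
proof (rule SUP_until_best)
  show "0 \<le> d 0 * meaning \<psi> \<chi> (pos \<chi> v 0)" using d(2) nonneg[OF pos_less[OF v]] by simp
  have "\<exists>j<N. min (d i * meaning \<psi> \<chi> (pos \<chi> v i)) (Min (insert 1 ((\<lambda>j. d j * meaning \<phi> \<chi> (pos \<chi> v j)) ` {..<i})))
    \<le> min (d j * meaning \<psi> \<chi> (pos \<chi> v j)) (Min (insert 1 ((\<lambda>j. d j * meaning \<phi> \<chi> (pos \<chi> v j)) ` {..<j})))" for i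
  proof (rule lasso_bound[OF d(1)])
    show "range (pos \<chi> v) \<subseteq> {..<N}" using pos_less[OF v] by auto
    show "pos \<chi> v (Suc i) = succ k (snd g) \<chi> (pos \<chi> v i)" for i by (simp add: pos_def)
  qed (use nonneg[OF pos_less[OF v]] in simp_all)
  then show "\<exists>j<N. min (d i * meaning \<psi> \<chi> (pos \<chi> v i)) (until_run (\<lambda>i. d i * meaning \<phi> \<chi> (pos \<chi> v i)) i)
    \<le> min (d j * meaning \<psi> \<chi> (pos \<chi> v j)) (until_run (\<lambda>i. d i * meaning \<phi> \<chi> (pos \<chi> v i)) j)" for i
    unfolding until_run .
qed

context
  fixes t :: nat
  assumes IH: "\<And>\<phi> x. node_ok t \<phi> x \<Longrightarrow> rv (eval.val t x) = meaning \<phi> (fst (snd (snd x))) (snd (snd (snd x)))"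
begin

abbreviation "run x j \<equiv> eval.acc (eval.val t) x j"

lemma call_value:
  assumes x: "node_ok (Suc t) \<phi> x" and j: "j < tasks x" and a: "fst a < N"
  shows "rv (eval.val t (call x j a)) =
      meaning (child \<phi> j) (fst (snd (snd (call x j a)))) (snd (snd (snd (call x j a))))"
    "unit_fraction (t * H) (eval.val t (call x j a))"
  using IH[OF node_ok_call[OF assms]] node_ok_call[OF assms] values_ok[of t] unfolding values_ok_def by blast+

lemma run_ok:
  assumes "node_ok (Suc t) \<phi> x" "j \<le> tasks x"
  shows "fst (run x j) < N" "unit_fraction (Suc t * H) (fst (snd (run x j)))"
    "unit_fraction (Suc t * H) (snd (snd (run x j)))"
  using acc_ok[OF assms(1) values_ok assms(2)] by (simp_all add: acc_ok_def)

text \<open>Serves all connectives except the untils: negation, binding and next are treated as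
  maxima over a single call.\<close>

lemma run_max:
  assumes x: "node_ok (Suc t) \<phi> x" and tag: "tag x \<noteq> 6" "tag x \<noteq> 7" and j: "j \<le> tasks x"
    and h: "\<And>j a. j < tasks x \<Longrightarrow> meaning (child \<phi> j) (fst (snd (snd (call x j a)))) (snd (snd (snd (call x j a)))) = h j"
  shows "rv (fst (snd (run x j))) = Max (insert 0 (h ` {..<j}))"
  using j
proof (induction j)
  case 0
  show ?case unfolding eval.acc.simps by (simp add: start_def)
next
  case (Suc j)
  let ?v = "eval.val t (call x j (run x j))"
  have j: "j < tasks x" "j \<le> tasks x" using Suc.prems by simp_all
  note v = call_value[OF x j(1) run_ok(1)[OF x j(2)]]
  have "rv (fst (snd (run x (Suc j)))) = max (rv (fst (snd (run x j)))) (rv ?v)"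
    using tag rv_qmax[OF run_ok(2)[OF x j(2)] v(2)] by (simp add: update_def)
  also have "\<dots> = max (Max (insert 0 (h ` {..<j}))) (h j)"
    using Suc.IH[OF j(2)] v(1) h[OF j(1)] by simp
  also have "\<dots> = Max (insert (h j) (insert 0 (h ` {..<j})))" by (simp add: max.commute)
  also have "insert (h j) (insert 0 (h ` {..<j})) = insert 0 (h ` {..<Suc j})" by (auto simp: lessThan_Suc)
  finally show ?case .
qed

text \<open>A round consists of two calls. The right subformula is combined with the obligations of
  earlier positions before the left one at the same position is added to them, which gives the
  strict range of the inner minimum.\<close>

lemma run_until:
  assumes x: "node_ok (Suc t) \<phi> x" and xw: "x = (snd g, w, \<chi>, v)"
    and \<phi>: "\<phi> = Until \<psi> \<psi>' \<or> \<phi> = DUntil d \<psi> \<psi>'"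
    and d: "\<And>i. i \<le> N \<Longrightarrow> rv (weight x i) = d i" and i: "i \<le> N"
  shows "fst (run x (2 * i)) = pos \<chi> v i \<and>
    rv (fst (snd (run x (2 * i)))) =
      until_best (\<lambda>i. d i * meaning \<psi>' \<chi> (pos \<chi> v i)) (\<lambda>i. d i * meaning \<psi> \<chi> (pos \<chi> v i)) i \<and>
    rv (snd (snd (run x (2 * i)))) = until_run (\<lambda>i. d i * meaning \<psi> \<chi> (pos \<chi> v i)) i"
  using i
proof (induction i)
  case 0
  show ?case unfolding mult_0_right eval.acc.simps by (simp add: start_def pos_def xw)
next
  case (Suc i)
  from x obtain r where r: "w = enc \<phi> @ r" by (auto simp: node_ok_def xw)
  have tag: "tag x = 6 \<or> tag x = 7" and tasks: "tasks x = 2 * N"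
    and called: "\<And>j a. call x j a = (snd g, if even j then enc \<psi>' @ r else enc \<psi> @ enc \<psi>' @ r, \<chi>, fst a)"
    using \<phi> unfolding xw r by (auto simp: tasks_enc call_enc simp del: enc_form.simps)
  have child: "child \<phi> j = (if even j then \<psi>' else \<psi>)" for j using \<phi> by auto
  define a a' where "a = run x (2 * i)" and "a' = run x (Suc (2 * i))"
  have i: "i \<le> N" "2 * i < tasks x" "Suc (2 * i) < tasks x" using Suc.prems by (simp_all add: tasks)
  have IHi: "fst a = pos \<chi> v i"
    "rv (fst (snd a)) = until_best (\<lambda>i. d i * meaning \<psi>' \<chi> (pos \<chi> v i)) (\<lambda>i. d i * meaning \<psi> \<chi> (pos \<chi> v i)) i"
    "rv (snd (snd a)) = until_run (\<lambda>i. d i * meaning \<psi> \<chi> (pos \<chi> v i)) i"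
    using Suc.IH i(1) by (simp_all add: a_def)
  note ok = run_ok[OF x less_imp_le[OF i(2)], folded a_def] and ok' = run_ok[OF x less_imp_le[OF i(3)], folded a'_def]
  define p where "p = eval.val t (call x (2 * i) a)"
  define q where "q = eval.val t (call x (Suc (2 * i)) a')"
  have a': "a' = (fst a, qmax (fst (snd a)) (qmin (qmul (weight x i) p) (snd (snd a))), snd (snd a))"
    using tag by (auto simp: a'_def a_def p_def update_def)
  have a'': "run x (2 * Suc i) = (succ k (snd g) \<chi> (fst a'), fst (snd a'), qmin (snd (snd a')) (qmul (weight x i) q))"
    using tag by (auto simp: a'_def q_def update_def xw)
  have p: "rv p = meaning \<psi>' \<chi> (pos \<chi> v i)" "unit_fraction (t * H) p"
    using call_value[OF x i(2) ok(1)] by (simp_all add: p_def called child IHi(1))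
  have q: "rv q = meaning \<psi> \<chi> (pos \<chi> v i)" "unit_fraction (t * H) q"
    using call_value[OF x i(3) ok'(1)] by (simp_all add: q_def called child a' IHi(1))
  have wp: "unit_fraction (Suc t * H) (qmul (weight x i) p)" "unit_fraction (Suc t * H) (qmul (weight x i) q)"
    using unit_fraction_qmul[OF weight_ok(1)[OF x] p(2)] unit_fraction_qmul[OF weight_ok(1)[OF x] q(2)] by simp_all
  note s = rv_qmax[OF ok(2) unit_fraction_qmin[OF wp(1) ok(3)]] rv_qmin[OF wp(1) ok(3)] rv_qmin[OF ok(3) wp(2)]
  show ?case
    unfolding a'' a' by (simp add: s rv_qmul p(1) q(1) d[OF i(1)] IHi pos_def del: mult_Suc)
qed

lemma val_Suc_meaning:
  assumes x: "node_ok (Suc t) \<phi> x"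
  shows "rv (eval.val (Suc t) x) = meaning \<phi> (fst (snd (snd x))) (snd (snd (snd x)))"
proof -
  obtain b w \<chi> v where xw: "x = (b, w, \<chi>, v)" by (cases x) auto
  from x obtain r where r: "w = enc \<phi> @ r" by (auto simp: node_ok_def xw)
  have ok: "b = snd g" "form_over {..<k} D \<phi>" "v < N" using x by (auto simp: node_ok_def xw)
  note xr = x[unfolded xw r]
  have px: "fst (snd (snd x)) = \<chi>" "snd (snd (snd x)) = v" by (simp_all add: xw)
  define R where "R = run x (tasks x)"
  have val: "eval.val (Suc t) x = result x R" by (simp add: R_def)
  have res: "tag x = 1 \<Longrightarrow> result x R = qneg (fst (snd R))"
    "tag x \<noteq> 0 \<Longrightarrow> tag x \<noteq> 1 \<Longrightarrow> result x R = fst (snd R)"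
    by (simp_all add: result_def)
  have val_max: "rv (fst (snd R)) = Max (insert 0 (h ` {..<tasks x}))"
    if "tag x \<noteq> 6" "tag x \<noteq> 7" "\<And>j a. j < tasks x \<Longrightarrow> meaning (child \<phi> j) (fst (snd (snd (call x j a)))) (snd (snd (snd (call x j a)))) = h j"
    for h
    unfolding R_def using that by (intro run_max[OF x]) auto
  \<comment> \<open>Satisfaction values are seen to be nonnegative without a separate proof: the
    induction hypothesis equates them with fractions.\<close>
  have nonneg: "0 \<le> meaning (child \<phi> j) (fst (snd (snd (call x j a)))) (snd (snd (snd (call x j a))))"
    if "j < tasks x" "fst a < N" for j a
    using call_value(1)[OF x that] rv_nonneg[of "eval.val t (call x j a)"] by simp
  \<comment> \<open>Of the accumulator a call uses at most the position, so the other components may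
    be anything.\<close>
  have nonneg0: "0 \<le> meaning (child \<phi> j) (fst (snd (snd (call x j (v, undefined))))) (snd (snd (snd (call x j (v, undefined)))))"
    if "j < tasks x" for j
    using nonneg[OF that] ok(3) by simp
  note unit = run_ok(2)[OF x order.refl, folded R_def]
  show ?thesis
  proof (cases \<phi>)
    case (Atom p)
    have "snd (snd g) ! v = hd (drop v (snd (snd g)))" using ok(3) by (simp add: hd_drop_conv_nth)
    then have "label G v = set (snd (hd (drop v (snd (snd g)))))" using g(2) ok(3) by (simp add: presents_def)
    then show ?thesis
      unfolding val xw r Atom by (simp add: result_def meaning_def ok(1) del: enc_form.simps)
  next
    case (Neg \<psi>)
    have tk: "tasks x = 1" "tag x = 1" unfolding xw r Neg by (simp_all add: tasks_enc del: enc_form.simps)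
    have "rv (fst (snd R)) = Max (insert 0 ((\<lambda>_. meaning \<psi> \<chi> v) ` {..<tasks x}))"
      by (rule val_max) (simp add: tk, simp add: tk, simp add: xw r Neg call_enc del: enc_form.simps)
    moreover have "0 \<le> meaning \<psi> \<chi> v"
      using nonneg0[of 0] tk by (simp add: xw r Neg call_enc del: enc_form.simps)
    ultimately have "rv (fst (snd R)) = meaning \<psi> \<chi> v" by (simp add: tk lessThan_Suc)
    then have "rv (eval.val (Suc t) x) = 1 - meaning \<psi> \<chi> v"
      using rv_qneg[OF unit] by (simp add: val res tk del: eval.val.simps)
    then show ?thesis by (simp add: px Neg meaning_def del: eval.val.simps)
  next
    case (Or \<psi> \<psi>')
    have tk: "tasks x = 2" "tag x = 2" unfolding xw r Or by (simp_all add: tasks_enc del: enc_form.simps)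
    have "rv (fst (snd R)) = Max (insert 0 ((\<lambda>j. meaning (if j = 0 then \<psi> else \<psi>') \<chi> v) ` {..<tasks x}))"
      by (rule val_max) (simp add: tk, simp add: tk, simp add: xw r Or call_enc del: enc_form.simps)
    moreover have "0 \<le> meaning \<psi> \<chi> v" "0 \<le> meaning \<psi>' \<chi> v"
      using nonneg0[of 0] nonneg0[of 1] tk by (simp_all add: xw r Or call_enc del: enc_form.simps)
    moreover have "{..<2 :: nat} = {0, 1}" by auto
    ultimately have "rv (fst (snd R)) = max (meaning \<psi> \<chi> v) (meaning \<psi>' \<chi> v)"
      by (simp add: tk)
    then show ?thesis by (simp add: val res tk del: eval.val.simps add: px Or meaning_def)
  next
    case (Ex y \<psi>)
    have tk: "tasks x = c ^ N" "tag x = 3" unfolding xw r Ex ok by (simp_all add: tasks_enc del: enc_form.simps)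
    let ?h = "\<lambda>j. meaning \<psi> (((False, y), j) # \<chi>) v"
    have "rv (fst (snd R)) = Max (insert 0 (?h ` {..<tasks x}))"
      by (rule val_max) (simp add: tk, simp add: tk, simp add: xw r Ex call_enc del: enc_form.simps)
    moreover have pos: "0 \<le> ?h j" if "j < c ^ N" for j
      using nonneg0[of j] tk that by (simp add: xw r Ex call_enc del: enc_form.simps)
    have "{..<c ^ N} \<noteq> {}" using c by (auto simp: lessThan_empty_iff)
    \<comment> \<open>The start value 0 is absorbed, as the values are nonnegative and there is at
      least one strategy code.\<close>
    then have "Max (insert 0 (?h ` {..<c ^ N})) = Max (?h ` {..<c ^ N})"
      using pos[of 0] c by (subst Max_insert) (auto simp: max_def Max_ge_iff intro!: bexI[of _ 0])
    ultimately have 1: "rv (fst (snd R)) = Max (?h ` {..<c ^ N})" by (simp add: tk)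
    have "?h ` {..<c ^ N} = (\<lambda>\<sigma>. sat_value {..<k} G \<psi> ((asgn (snd g) \<chi>)(Inr y := \<sigma>)) v) ` strategies G"
      unfolding strategies_image[OF g] image_image meaning_def asgn_variable ..
    then show ?thesis using 1 by (simp add: val res tk del: eval.val.simps add: px Ex meaning_def)
  next
    case (Bind i y \<psi>)
    have tk: "tasks x = 1" "tag x = 4" unfolding xw r Bind by (simp_all add: tasks_enc del: enc_form.simps)
    let ?\<chi> = "((True, i), lookup \<chi> (False, y)) # \<chi>"
    have "rv (fst (snd R)) = Max (insert 0 ((\<lambda>_. meaning \<psi> ?\<chi> v) ` {..<tasks x}))"
      by (rule val_max) (simp add: tk, simp add: tk, simp add: xw r Bind call_enc del: enc_form.simps)
    moreover have "0 \<le> meaning \<psi> ?\<chi> v"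
      using nonneg0[of 0] tk by (simp add: xw r Bind call_enc del: enc_form.simps)
    ultimately have "rv (fst (snd R)) = meaning \<psi> ?\<chi> v" by (simp add: tk lessThan_Suc)
    then show ?thesis by (simp add: val res tk del: eval.val.simps add: px Bind meaning_def asgn_agent)
  next
    case (Next \<psi>)
    have tk: "tasks x = 1" "tag x = 5" unfolding xw r Next by (simp_all add: tasks_enc del: enc_form.simps)
    let ?u = "succ k (snd g) \<chi> v"
    have "rv (fst (snd R)) = Max (insert 0 ((\<lambda>_. meaning \<psi> \<chi> ?u) ` {..<tasks x}))"
      by (rule val_max) (simp add: tk, simp add: tk, simp add: xw r Next call_enc ok del: enc_form.simps)
    moreover have "0 \<le> meaning \<psi> \<chi> ?u"
      using nonneg0[of 0] tk by (simp add: xw r Next call_enc ok del: enc_form.simps)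
    ultimately have "rv (fst (snd R)) = meaning \<psi> \<chi> ?u" by (simp add: tk lessThan_Suc)
    moreover have "outcome {..<k} G (asgn (snd g) \<chi>) v 1 = ?u" using outcome_succ(1)[OF g ok(3), of \<chi> 1] by simp
    ultimately show ?thesis
      by (simp add: val res tk del: eval.val.simps add: px Next meaning_def del: outcome.simps One_nat_def)
  next
    case (Until \<psi> \<psi>')
    have tk: "tasks x = 2 * N" "tag x = 6" unfolding xw r Until ok by (simp_all add: tasks_enc del: enc_form.simps)
    have R: "run x (2 * N) = R" by (simp only: R_def tk)
    have nn: "0 \<le> meaning \<psi>' \<chi> u" if "u < N" for u
      using nonneg[of 0 "(u, undefined)"] tk N that by (simp add: xw r Until call_enc del: enc_form.simps)
    have "rv (weight x i) = 1" for i
      unfolding xw r Until by (simp add: weight_def del: enc_form.simps)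
    from run_until[OF x xw[unfolded ok(1)] disjI1[OF Until] this order.refl]
    have "rv (eval.val (Suc t) x) =
        until_best (\<lambda>i. 1 * meaning \<psi>' \<chi> (pos \<chi> v i)) (\<lambda>i. 1 * meaning \<psi> \<chi> (pos \<chi> v i)) N"
      by (simp add: val res tk R del: eval.val.simps)
    then show ?thesis
      using SUP_until[OF ok(3) _ _ nn, of "\<lambda>_. 1" \<psi>] by (simp add: px Until meaning_def del: eval.val.simps)
  next
    case (DUntil d \<psi> \<psi>')
    have tk: "tasks x = 2 * N" "tag x = 7" unfolding xw r DUntil ok by (simp_all add: tasks_enc del: enc_form.simps)
    have R: "run x (2 * N) = R" by (simp only: R_def tk)
    have nn: "0 \<le> meaning \<psi>' \<chi> u" if "u < N" for u
      using nonneg[of 0 "(u, undefined)"] tk N that by (simp add: xw r DUntil call_enc del: enc_form.simps)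
    have d: "antimono d" "0 \<le> d 0"
      using disc[of d] ok(2) by (auto simp: DUntil discounting_def image_subset_iff)
    have "rv (weight x i) = d i" if "i \<le> N" for i
      using weight_ok(2)[OF x DUntil that] by (simp add: xw ok(1))
    from run_until[OF x xw[unfolded ok(1)] disjI2[OF DUntil] this order.refl]
    have "rv (eval.val (Suc t) x) =
        until_best (\<lambda>i. d i * meaning \<psi>' \<chi> (pos \<chi> v i)) (\<lambda>i. d i * meaning \<psi> \<chi> (pos \<chi> v i)) N"
      by (simp add: val res tk R del: eval.val.simps)
    then show ?thesis
      using SUP_until[OF ok(3) d nn, of \<psi>] by (simp add: px DUntil meaning_def del: eval.val.simps)
  qed
qed

end

lemma val_meaning:
  "node_ok t \<phi> x \<Longrightarrow> rv (eval.val t x) = meaning \<phi> (fst (snd (snd x))) (snd (snd (snd x)))"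
proof (induction t arbitrary: \<phi> x)
  case 0
  then show ?case by (cases \<phi>) (auto simp: node_ok_def split: prod.splits)
next
  case (Suc t)
  show ?case by (rule val_Suc_meaning[OF Suc.IH Suc.prems])
qed

end

section \<open>Sizes of nodes and accumulators\<close>

context evaluation
begin

lemma node_ok_depth: "node_ok t \<phi> x \<Longrightarrow> 0 < t \<and> t \<le> L"
proof -
  assume "node_ok t \<phi> x"
  then have "length (enc \<phi>) \<le> t" "t \<le> L" by (auto simp: node_ok_def split: prod.splits)
  moreover have "enc \<phi> \<noteq> []" by (cases \<phi>) simp_all
  then have "0 < length (enc \<phi>)" by blast
  ultimately show ?thesis by linarith
qed

lemma sz_node:
  assumes x: "node_ok t \<phi> x" and M: "sz (snd g) \<le> M"
  shows "sz x \<le> 10 + M + (4 * L + 1) + Suc (L * Suc (20 + 4 * L + 4 * (M * M))) + (4 * M + 1)"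
proof -
  obtain w \<chi> v where xw: "x = (snd g, w, \<chi>, v)" using x by (cases x) (auto simp: node_ok_def)
  have N: "N < M" using M length_le_sz[of "snd (snd g)"] by (cases "snd g") simp
  have "sz c \<le> M" using M by (cases "snd g") simp
  then have "c < 2 ^ M" using nat_less_sz[of c] by (meson less_le_trans one_le_numeral power_increasing)
  \<comment> \<open>A strategy code has fewer than \<open>M\<close> digits of at most
    \<open>M\<close> bits each, hence at most \<open>M * M\<close> bits.\<close>
  then have "c ^ N \<le> (2 ^ M) ^ N" by (intro power_mono) auto
  also have "\<dots> \<le> 2 ^ (M * M)" using N by (simp flip: power_mult)
  finally have cN: "c ^ N \<le> 2 ^ (M * M)" .
  have "sz e \<le> 20 + 4 * L + 4 * (M * M)" if "e \<in> set \<chi>" for e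
  proof -
    obtain b y j where e: "e = ((b, y), j)" by (cases e) auto
    have "j < c ^ N" "length (bin y) \<le> L" using x that by (auto simp: node_ok_def xw e)
    then have "sz j \<le> 4 * (M * M) + 1" "sz y \<le> 4 * L + 1"
      using cN sz_nat[of j "M * M"] sz_word(1)[of "bin y"] by (simp_all add: sz_nat_bin)
    then show ?thesis using sz_bool(2)[of b] by (simp add: e)
  qed
  then have "sz \<chi> \<le> Suc (length \<chi> * Suc (20 + 4 * L + 4 * (M * M)))" by (rule sz_list_le)
  also have "\<dots> \<le> Suc (L * Suc (20 + 4 * L + 4 * (M * M)))"
  proof -
    have "length \<chi> \<le> L" using x by (simp add: node_ok_def xw)
    from mult_le_mono1[OF this] show ?thesis by (simp only: Suc_le_mono)
  qed
  finally have "sz \<chi> \<le> Suc (L * Suc (20 + 4 * L + 4 * (M * M)))" .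
  moreover have "sz w \<le> 4 * L + 1" using sz_word(1)[of w] x by (simp add: node_ok_def xw)
  moreover have "sz v \<le> 4 * M + 1"
    using sz_nat_le[of v] x N by (simp add: node_ok_def xw)
  ultimately show ?thesis using M by (simp add: xw)
qed

lemma sz_acc:
  assumes a: "acc_ok t a" and t: "t \<le> L" and M: "sz (snd g) \<le> M"
  shows "sz a \<le> 10 + (4 * M + 1) + 2 * (8 * (L * H) + 11)"
proof -
  have N: "N < M" using M length_le_sz[of "snd (snd g)"] by (cases "snd g") simp
  obtain v p q where aw: "a = (v, p, q)" by (cases a)
  have E: "t * H \<le> L * H" using t by simp
  then have "sz p \<le> 8 * (L * H) + 11" "sz q \<le> 8 * (L * H) + 11"
    using a sz_fraction[OF unit_fraction_mono[OF _ E]] by (auto simp: acc_ok_def aw)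
  moreover have "sz v \<le> 4 * M + 1" using sz_nat_le[of v] a N by (simp add: acc_ok_def aw)
  ultimately show ?thesis by (simp add: aw)
qed

end

section \<open>The decision procedure\<close>

context discounted
begin

definition instance_of :: "bool list \<Rightarrow> game \<times> fraction" where
  "instance_of w = (let s = read_game k (skip w); a = read_nat (snd s); b = read_nat (snd a) in
     (fst s, fst a, fst b))"

definition enc_instance :: "game \<times> fraction \<Rightarrow> bool list" where
  "enc_instance y = enc_game (fst y) @ enc_nat (fst (snd y)) @ enc_nat (snd (snd y))"

text \<open>Thresholds are coded in lowest terms. A search through all candidates for a common
  divisor checks this, slowly but in little space.\<close>

definition instance_ok :: "game \<times> fraction \<Rightarrow> bool" where
  "instance_ok y \<longleftrightarrow> game_ok k (fst y) \<and> fst (snd y) \<le> snd (snd y) \<and> 0 < snd (snd y) \<and>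
     (\<forall>d<Suc (snd (snd y)). d dvd fst (snd y) \<and> d dvd snd (snd y) \<longrightarrow> d = 1)"

text \<open>Reading tolerates anything. Validity demands that what follows the formula is exactly
  the encoding of what was read, which also rules out trailing bits.\<close>

definition valid :: "bool list \<Rightarrow> bool" where
  "valid w \<longleftrightarrow> instance_ok (instance_of w) \<and> scan True w = (enc_instance (instance_of w), [], True)"

text \<open>Invalid words get a node that makes no calls, so that the evaluation respects its space
  bound on every input.\<close>

definition root :: "bool list \<Rightarrow> node" where
  "root w = (if valid w then (snd (fst (instance_of w)), w, [], fst (fst (instance_of w)))
     else ((0, []), [], [], 0))"

definition decide :: "bool list \<Rightarrow> bool" where
  "decide w \<longleftrightarrow> valid w \<and> qle (snd (instance_of w)) (eval.val (length w) (root w))"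

lemma cmp_instance_of [cmp_intro]: "cmp False w \<Longrightarrow> cmp False (\<lambda>x. instance_of (w x))"
  unfolding instance_of_def Let_def by (intro cmp_intro)

lemma cmp_valid: "cmp False valid"
  unfolding valid_def instance_ok_def enc_instance_def
  by (intro cmp_intro cmp_comp[OF cmp_instance_of[OF cmp_id]])

lemma cmp_root: "cmp False root"
  unfolding root_def by (intro cmp_intro cmp_comp[OF cmp_valid])

lemma valid_enc:
  assumes "admissible ([], []) \<phi>" "instance_ok y"
  shows "valid (enc \<phi> @ enc_instance y)" "instance_of (enc \<phi> @ enc_instance y) = y"
proof -
  obtain g a b where y: "y = (g, a, b)" by (cases y)
  have "game_ok k g" using assms(2) by (simp add: instance_ok_def y)
  then show "instance_of (enc \<phi> @ enc_instance y) = y"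
    by (simp add: instance_of_def enc_instance_def Let_def y)
  then show "valid (enc \<phi> @ enc_instance y)"
    using assms by (simp add: valid_def scan_enc)
qed

lemma valid_cases:
  assumes "valid w"
  obtains \<phi> where "admissible ([], []) \<phi>" "w = enc \<phi> @ enc_instance (instance_of w)"
    "instance_ok (instance_of w)"
  using assms scan_valid[of w "enc_instance (instance_of w)"] unfolding valid_def by blast

lemma output_bound:
  "\<exists>p :: nat poly. \<forall>u i L N. length u \<le> L \<longrightarrow> i \<le> N \<longrightarrow> length (f (enc_word u @ replicate i True)) \<le> poly p (4 * (2 * L + 1 + N) + 1)"
proof -
  from polybd_sz[OF cmp_f] obtain p where p: "\<forall>w. sz (f w) \<le> poly p (sz w)"
    unfolding polybd_def by (elim exE)
  show ?thesis
  proof (intro exI[of _ p] allI impI)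
    fix u :: "bool list" and i L N :: nat
    assume "length u \<le> L" "i \<le> N"
    then have "sz (enc_word u @ replicate i True) \<le> 4 * (2 * L + 1 + N) + 1"
      using sz_word(1)[of "enc_word u @ replicate i True"] by simp
    from poly_nat_mono[OF this, of p] show "length (f (enc_word u @ replicate i True)) \<le> poly p (4 * (2 * L + 1 + N) + 1)"
      using p[rule_format, of "enc_word u @ replicate i True"] length_le_sz[of "f (enc_word u @ replicate i True)"]
      by simp
  qed
qed

lemma evaluation_output_bound:
  assumes p: "\<forall>u i L N. length u \<le> L \<longrightarrow> i \<le> N \<longrightarrow> length (f (enc_word u @ replicate i True)) \<le> poly p (4 * (2 * L + 1 + N) + 1)"
    and "game_ok k g" "presents k g G"
  shows "evaluation k D code f g G L (poly p (4 * (2 * L + 1 + length (snd (snd g))) + 1))"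
  using assms by unfold_locales auto

theorem decide_iff:
  assumes \<phi>: "admissible ([], []) \<phi>" and y: "instance_ok (g, a, b)" and G: "presents k g G"
  shows "decide (enc \<phi> @ enc_instance (g, a, b)) \<longleftrightarrow> real a / real b \<le> sentence_value {..<k} G \<phi>"
proof -
  define w where "w = enc \<phi> @ enc_instance (g, a, b)"
  have w: "valid w" "instance_of w = (g, a, b)" using valid_enc[OF \<phi> y] by (simp_all add: w_def)
  obtain p where p: "\<forall>u i L N. length u \<le> L \<longrightarrow> i \<le> N \<longrightarrow> length (f (enc_word u @ replicate i True)) \<le> poly p (4 * (2 * L + 1 + N) + 1)"
    using output_bound by blast
  have g: "game_ok k g" using y by (simp add: instance_ok_def)
  interpret ev: evaluation k D code f g G "length w" "poly p (4 * (2 * length w + 1 + length (snd (snd g))) + 1)"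
    by (rule evaluation_output_bound[OF p g G])
  have x: "ev.node_ok (length w) \<phi> (root w)"
    using \<phi> g unfolding ev.node_ok_def root_def
    by (auto simp: w w_def[symmetric] admissible_def game_ok_def) (auto simp: w_def)
  have "free {..<k} \<phi> = {}" using \<phi> by (simp add: admissible_def scope_set_def)
  then have "sentence_value {..<k} G \<phi> = sat_value {..<k} G \<phi> (asgn (snd g) []) (fst g)"
    using sentence_value_eq[OF _ range_asgn[OF g G]] G by (simp add: sentence_def presents_def)
  also have "\<dots> = rv (eval.val (length w) (root w))"
    using ev.val_meaning[OF x] by (simp add: ev.meaning_def root_def w)
  finally have v: "sentence_value {..<k} G \<phi> = rv (eval.val (length w) (root w))" .
  have "\<exists>E. unit_fraction E (eval.val (length w) (root w))"
    using ev.values_ok[of "length w"] x unfolding ev.values_ok_def by blast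
  moreover have "\<exists>E. unit_fraction E (a, b)"
  proof
    show "unit_fraction b (a, b)" using y less_exp[of b] by (simp add: instance_ok_def unit_fraction_def less_imp_le)
  qed
  ultimately have "rv (a, b) \<le> rv (eval.val (length w) (root w)) \<longleftrightarrow> qle (a, b) (eval.val (length w) (root w))"
    using rv_le by blast
  then show ?thesis unfolding decide_def w_def[symmetric] v using w by (simp add: rv_def)
qed

text \<open>The facts of \<open>evaluation\<close> hold for one game at a time, while the polynomial
  must serve all words. They are therefore used with an explicit locale premise inside an invariant
  indexed by the input word.\<close>

lemma cmp_decide: "cmp False decide"
proof -
  obtain p where p: "\<forall>u i L N. length u \<le> L \<longrightarrow> i \<le> N \<longrightarrow> length (f (enc_word u @ replicate i True)) \<le> poly p (4 * (2 * L + 1 + N) + 1)"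
    using output_bound by blast
  define gm where "gm w = fst (instance_of w)" for w
  have cmp_g: "cmp False (\<lambda>w. gm w)" unfolding gm_def by (intro cmp_intro)
  define N where "N w = length (snd (snd (gm w)))" for w
  define H where "H w = poly p (4 * (2 * length w + 1 + N w) + 1)" for w :: "bool list"
  define M where "M w = sz (snd (gm w))" for w
  have polyN: "polybd N" unfolding N_def by (intro polybd_length cmp_intro cmp_g)
  have polyL: "polybd (\<lambda>w :: bool list. length w)" by (intro polybd_length cmp_intro)
  have polyM: "polybd M" unfolding M_def by (intro polybd_sz[of False] cmp_intro cmp_g)
  have polyH: "polybd H" unfolding H_def by (intro polybd_intro polyL polyN)
  \<comment> \<open>Structure and formula are existentially quantified: the program does not know
    them, and the bounds only require that they exist. Invalid words lead to the one node without
    calls.\<close>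
  define B where "B w t x \<longleftrightarrow> (if valid w then \<exists>G \<phi>. presents k (gm w) G \<and>
      evaluation k D code f (gm w) G (length w) (H w) \<and> evaluation.node_ok k D code (gm w) (length w) t \<phi> x
      else x = ((0, []), [], [], 0))" for w t x
  define K where "K w = (10 + M w + (4 * length w + 1) + Suc (length w * Suc (20 + 4 * length w + 4 * (M w * M w))) + (4 * M w + 1))
      + (10 + (4 * M w + 1) + 2 * (8 * (length w * H w) + 11)) + (sz (root []) + sz (start (root [])))" for w
  have polyK: "polybd K" unfolding K_def by (intro polybd_intro polyL polyM polyH)
  have not_valid: "\<not> valid []"
  proof
    assume "valid []"
    then obtain \<phi> where "[] = enc \<phi> @ enc_instance (instance_of [])" by (rule valid_cases)
    then show False by (cases \<phi>) simp_all
  qed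
  have dummy: "root [] = ((0, []), [], [], 0)" "tasks (root []) = 0"
    by (simp_all add: root_def not_valid tasks_def tag_def read_nat_def read_code_def)
  have "cmp False (\<lambda>w. eval.val (length w) (root w))"
  proof (rule eval.cmp_val[where B = B and G = K, OF cmp_tasks cmp_call cmp_update cmp_result cmp_start cmp_root polyL polyK])
    fix w x assume "B w 0 x"
    then show "tasks x = 0"
      unfolding B_def
    proof (split if_splits, elim disjE conjE exE)
      fix G \<phi> assume ev: "evaluation k D code f (gm w) G (length w) (H w)"
        and x: "evaluation.node_ok k D code (gm w) (length w) 0 \<phi> x"
      show ?thesis using evaluation.node_ok_depth[OF ev x] by simp
    qed (use dummy in simp)
  next
    fix w t x assume "B w t x"
    then show "sz x \<le> K w"
      unfolding B_def
    proof (split if_splits, elim disjE conjE exE)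
      fix G \<phi> assume ev: "evaluation k D code f (gm w) G (length w) (H w)"
        and x: "evaluation.node_ok k D code (gm w) (length w) t \<phi> x"
      show ?thesis using evaluation.sz_node[OF ev x, of "M w"] by (simp add: K_def M_def)
    qed (use dummy in \<open>simp add: K_def\<close>)
  next
    fix w t x j assume "B w t x" and j: "j \<le> tasks x"
    then show "sz (eval.acc (eval.val (t - 1)) x j) \<le> K w"
      unfolding B_def
    proof (split if_splits, elim disjE conjE exE)
      fix G \<phi> assume ev: "evaluation k D code f (gm w) G (length w) (H w)"
        and x: "evaluation.node_ok k D code (gm w) (length w) t \<phi> x"
      have t: "t \<noteq> 0" "t \<le> length w" using evaluation.node_ok_depth[OF ev x] by simp_all
      then obtain u where u: "t = Suc u" using not0_implies_Suc by blast
      have "evaluation.acc_ok (gm w) (H w) t (eval.acc (eval.val u) x j)"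
        using evaluation.acc_ok[OF ev x[unfolded u] evaluation.values_ok[OF ev] j] u by simp
      from evaluation.sz_acc[OF ev this t(2), of "M w"] show ?thesis by (simp add: K_def M_def u)
    next
      assume x: "x = ((0, []), [], [], 0)"
      then have "j = 0" using dummy j by simp
      then show ?thesis unfolding x dummy(1)[symmetric] by (simp add: K_def)
    qed
  next
    fix w t x j assume B: "B w (Suc t) x" and j: "j < tasks x"
    then have valid: "valid w" using dummy by (auto simp: B_def split: if_splits)
    from B obtain G \<phi> where G: "presents k (gm w) G" and ev: "evaluation k D code f (gm w) G (length w) (H w)"
      and x: "evaluation.node_ok k D code (gm w) (length w) (Suc t) \<phi> x"
      unfolding B_def if_P[OF valid] by (elim exE conjE)
    have "evaluation.acc_ok (gm w) (H w) (Suc t) (eval.acc (eval.val t) x j)"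
      using evaluation.acc_ok[OF ev x evaluation.values_ok[OF ev] less_imp_le[OF j]] .
    then have "fst (eval.acc (eval.val t) x j) < length (snd (snd (gm w)))"
      unfolding evaluation.acc_ok_def[OF ev] by blast
    from evaluation.node_ok_call[OF ev x j this] G ev valid show "B w t (call x j (eval.acc (eval.val t) x j))"
      unfolding B_def by auto
  next
    fix w
    show "B w (length w) (root w)"
    proof (cases "valid w")
      case True
      then obtain \<phi> where \<phi>: "admissible ([], []) \<phi>" "w = enc \<phi> @ enc_instance (instance_of w)"
        and y: "instance_ok (instance_of w)" by (rule valid_cases)
      have g: "game_ok k (gm w)" using y by (simp add: instance_ok_def gm_def)
      obtain G where G: "presents k (gm w) G" using game_presented[OF g] by blast
      have ev: "evaluation k D code f (gm w) G (length w) (H w)"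
        unfolding H_def N_def by (rule evaluation_output_bound[OF p g G])
      have "length (enc \<phi>) \<le> length w" using arg_cong[OF \<phi>(2), of length] by simp
      then have "evaluation.node_ok k D code (gm w) (length w) (length w) \<phi> (root w)"
        unfolding evaluation.node_ok_def[OF ev]
        using \<phi> g True by (auto simp: root_def gm_def admissible_def game_ok_def)
      then show ?thesis using True ev G by (auto simp: B_def)
    qed (simp add: B_def root_def)
  qed
  note val = this
  show ?thesis unfolding decide_def by (intro cmp_intro val cmp_valid)
qed

lemma enc_rat_fraction:
  assumes "instance_ok (g, a, b)"
  shows "enc_rat (Fract (int a) (int b)) = enc_nat a @ enc_nat b"
    "0 \<le> Fract (int a) (int b)" "Fract (int a) (int b) \<le> 1"
    "of_rat (Fract (int a) (int b)) = real a / real b"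
proof -
  have ab: "a \<le> b" "0 < b" using assms by (simp_all add: instance_ok_def)
  have "gcd a b dvd a \<and> gcd a b dvd b" "gcd a b < Suc b" using ab by (simp_all add: gcd_le2_nat less_Suc_eq_le)
  then have "gcd a b = 1" using assms unfolding instance_ok_def fst_conv snd_conv by blast
  then have "coprime (int a) (int b)" by (simp add: coprime_iff_gcd_eq_1)
  then have "quotient_of (Fract (int a) (int b)) = (int a, int b)"
    using ab by (simp add: quotient_of_Fract normalize_stable)
  then show "enc_rat (Fract (int a) (int b)) = enc_nat a @ enc_nat b" by (simp add: enc_rat_def)
  show "0 \<le> Fract (int a) (int b)" "Fract (int a) (int b) \<le> 1"
    using ab by (simp_all add: zero_le_Fract_iff Fract_le_one_iff)
  show "of_rat (Fract (int a) (int b)) = real a / real b" using ab by (simp add: of_rat_rat)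
qed

lemma fraction_of_rat:
  assumes "0 \<le> \<theta>" "\<theta> \<le> 1" and g: "game_ok k g"
  obtains a b where "instance_ok (g, a, b)" "enc_rat \<theta> = enc_nat a @ enc_nat b" "of_rat \<theta> = real a / real b"
proof -
  obtain a b where q: "quotient_of \<theta> = (a, b)" by (cases "quotient_of \<theta>")
  have b: "0 < b" "coprime a b" using quotient_of_denom_pos[OF q] quotient_of_coprime[OF q] .
  have \<theta>: "\<theta> = of_int a / of_int b" using quotient_of_div[OF q] .
  have a: "0 \<le> a" "a \<le> b" using assms(1,2) b by (auto simp: \<theta> zero_le_divide_iff)
  have "instance_ok (g, nat a, nat b)"
    unfolding instance_ok_def fst_conv snd_conv
  proof (intro conjI allI impI)
    fix d assume "d dvd nat a \<and> d dvd nat b"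
    then have "int d dvd a" "int d dvd b" using a b by (auto simp: int_dvd_int_iff[symmetric])
    then have "is_unit (int d)" using b(2) by (rule coprime_common_divisor[rotated])
    then show "d = 1" by simp
  qed (use a b g in auto)
  moreover have "enc_rat \<theta> = enc_nat (nat a) @ enc_nat (nat b)" by (simp add: enc_rat_def q)
  moreover have "of_rat \<theta> = real (nat a) / real (nat b)" using a b by (simp add: \<theta> of_rat_divide)
  ultimately show thesis by (rule that)
qed

lemma admissible_sentence: "admissible ([], []) \<phi> \<longleftrightarrow> form_over {..<k} D \<phi> \<and> sentence {..<k} \<phi>"
  by (simp add: admissible_def sentence_def scope_set_def)

lemma decide_code:
  assumes \<phi>: "form_over {..<k} D \<phi>" "sentence {..<k} \<phi>" and G: "cgs {..<k} G" "presented G"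
    and \<theta>: "0 \<le> \<theta>" "\<theta> \<le> 1"
  shows "decide (enc \<phi> @ enc_cgs k G @ enc_rat \<theta>) \<longleftrightarrow> of_rat \<theta> \<le> sentence_value {..<k} G \<phi>"
proof -
  obtain g where g: "game_ok k g" "presents k g G" "enc_cgs k G = enc_game g" by (rule presented_game[OF G])
  obtain a b where ab: "instance_ok (g, a, b)" "enc_rat \<theta> = enc_nat a @ enc_nat b" "of_rat \<theta> = real a / real b"
    by (rule fraction_of_rat[OF \<theta> g(1)])
  have "admissible ([], []) \<phi>" using \<phi> by (simp add: admissible_sentence)
  from decide_iff[OF this ab(1) g(2)] show ?thesis by (simp add: g(3) ab(2,3) enc_instance_def)
qed

theorem decide_threshold: "decide w \<longleftrightarrow> w \<in> threshold_model_checking k D code"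
proof
  assume w: "decide w"
  then have "valid w" by (simp add: decide_def)
  then obtain \<phi> where \<phi>: "admissible ([], []) \<phi>" "w = enc \<phi> @ enc_instance (instance_of w)"
    "instance_ok (instance_of w)" by (rule valid_cases)
  obtain g a b where y: "instance_of w = (g, a, b)" by (cases "instance_of w")
  have ok: "instance_ok (g, a, b)" using \<phi>(3) by (simp add: y)
  then have "game_ok k g" by (simp add: instance_ok_def)
  then obtain G where G: "cgs {..<k} G" "presented G" "presents k g G" "enc_cgs k G = enc_game g" by (rule game_presented)
  note \<theta> = enc_rat_fraction[OF ok]
  have we: "w = enc \<phi> @ enc_cgs k G @ enc_rat (Fract (int a) (int b))"
    using \<phi>(2) by (simp add: y enc_instance_def G(4) \<theta>(1))
  have \<phi>': "form_over {..<k} D \<phi>" "sentence {..<k} \<phi>" using \<phi>(1) by (simp_all add: admissible_sentence)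
  have "of_rat (Fract (int a) (int b)) \<le> sentence_value {..<k} G \<phi>"
    using w decide_code[OF \<phi>' G(1,2) \<theta>(2,3)] by (simp only: we)
  then show "w \<in> threshold_model_checking k D code"
    unfolding threshold_model_checking_def using we \<phi>' G(1,2) \<theta>(2,3) by blast
next
  assume "w \<in> threshold_model_checking k D code"
  then show "decide w" unfolding threshold_model_checking_def using decide_code by auto
qed

end

section \<open>Writing the formula\<close>

text \<open>The reduction has to run in polynomial time, so its numbers are lengths of words and are
  handled by list operations.\<close>

abbreviation unary :: "nat \<Rightarrow> bool list" where
  "unary n \<equiv> replicate n True"

lemma cmp_unary_length: "cmp b l \<Longrightarrow> cmp b (\<lambda>x. unary (length (l x)))" for l :: "'a::rep \<Rightarrow> bool list"
proof -
  assume "cmp b l"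
  then have "cmp b (\<lambda>x. map (\<lambda>_. True) (l x))" by (intro cmp_intro)
  then show ?thesis by (simp add: map_replicate_const)
qed

text \<open>Horner's scheme in unary: multiplying by the input length means concatenating one copy
  per input letter.\<close>

lemma cmp_unary_poly: "cmp b (\<lambda>w :: bool list. unary (poly p (length w)))"
proof (induction p)
  case 0
  show ?case by (simp add: cmp_const)
next
  case (pCons a p)
  have "cmp b (\<lambda>w :: bool list. unary a @ concat (map (\<lambda>_. unary (poly p (length w))) w))"
    by (intro cmp_intro cmp_comp[OF pCons.IH])
  moreover have "concat (map (\<lambda>_. unary n) w) = unary (length w * n)" for n and w :: "bool list"
    by (induction w) (simp_all add: replicate_add)
  ultimately show ?case by (simp add: replicate_add)
qed

definition iota :: "bool list \<Rightarrow> bool list list" where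
  "iota l = map unary [0..<length l]"

lemma cmp_iota [cmp_intro]:
  assumes l: "cmp b l"
  shows "cmp b (\<lambda>x. iota (l x))"
proof -
  have rec: "rec_list [] (\<lambda>_ ys r. r @ [unary (length ys)]) l = iota l" for l :: "bool list"
    by (induction l) (simp_all add: iota_def)
  have "cmp b (\<lambda>x. rec_list [] (\<lambda>_ ys r. r @ [unary (length ys)]) (l x))"
  proof (rule cmp_rec_list[OF l])
    let ?G = "\<lambda>n. Suc (n * Suc (4 * n + 1))"
    show "polybd (\<lambda>x. ?G (sz (l x)))" by (intro polybd_intro l[THEN cmp_space])
    fix x ys zs assume x: "l x = zs @ ys"
    have "length (l x) \<le> sz (l x)" using length_le_sz[of "l x"] by simp
    then have n: "length ys \<le> sz (l x)" by (simp add: x)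
    have "sz (iota ys) \<le> Suc (length (iota ys) * Suc (4 * sz (l x) + 1))"
    proof (rule sz_list_le)
      fix u assume "u \<in> set (iota ys)"
      then have "length u \<le> sz (l x)" using n by (auto simp: iota_def)
      then show "sz u \<le> 4 * sz (l x) + 1" using sz_word(1)[of u] by simp
    qed
    also have "\<dots> \<le> ?G (sz (l x))"
      using mult_le_mono1[OF n, of "Suc (4 * sz (l x) + 1)"] by (simp add: iota_def)
    finally show "sz (rec_list [] (\<lambda>_ ys r. r @ [unary (length ys)]) ys) \<le> ?G (sz (l x))"
      by (simp only: rec)
  qed (intro cmp_intro cmp_unary_length)+
  then show ?thesis by (simp only: rec)
qed

lemma bin_power2: "bin (2 ^ n) = replicate n False @ [True]"
proof (induction n)
  case (Suc n)
  then show ?case using bin_double[of False "2 ^ n"] by simp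
qed (simp add: bin.simps)

lemma bin_name:
  assumes "\<kappa> < 8"
  shows "bin (name \<kappa> n) = [odd \<kappa>, odd (\<kappa> div 2), odd (\<kappa> div 4)] @ replicate n False @ [True]"
proof -
  have expand: "K = p + 2 * q \<Longrightarrow> q = r + 2 * s \<Longrightarrow> s = t \<Longrightarrow> 8 * z + K = p + 2 * (r + 2 * (t + 2 * z))"
    for K p q r s t z :: nat by simp
  have "\<kappa> = of_bool (odd \<kappa>) + 2 * (\<kappa> div 2)" by simp
  moreover have "\<kappa> div 2 = of_bool (odd (\<kappa> div 2)) + 2 * (\<kappa> div 4)" by (simp add: of_bool_def) presburger
  moreover have "\<kappa> div 4 = of_bool (odd (\<kappa> div 4))" using assms by (simp add: of_bool_def) presburger
  ultimately have "name \<kappa> n = of_bool (odd \<kappa>) + 2 * (of_bool (odd (\<kappa> div 2)) + 2 * (of_bool (odd (\<kappa> div 4)) + 2 * 2 ^ n))"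
    unfolding name_def by (rule expand)
  then show ?thesis by (simp only: bin_double bin_power2) simp
qed

lemma cmp_name [cmp_intro]:
  assumes "cmp b l" "\<kappa> < 8"
  shows "cmp b (\<lambda>x. name \<kappa> (length (l x :: bool list)))"
proof (rule cmp_nat)
  have "cmp b (\<lambda>x. [odd \<kappa>, odd (\<kappa> div 2), odd (\<kappa> div 4)] @ map (\<lambda>_. False) (l x) @ [True])"
    by (intro cmp_intro assms(1))
  then show "cmp b (\<lambda>x. bin (name \<kappa> (length (l x))))"
    by (simp add: bin_name[OF assms(2)] map_replicate_const)
qed

lemma cmp_unary_drop:
  fixes l :: "'a::rep \<Rightarrow> bool list" and w :: "'a \<Rightarrow> 'e::rep list"
  assumes l: "cmp b l" and w: "cmp b w"
  shows "cmp b (\<lambda>x. drop (length (l x)) (w x))"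
proof -
  have rec: "rec_list w (\<lambda>_ _ r. tl r) l = drop (length l) w" for l :: "bool list" and w :: "'e list"
    by (induction l) (simp_all add: drop_Suc tl_drop)
  have "cmp b (\<lambda>x. rec_list (w x) (\<lambda>_ _ r. tl r) (l x))"
  proof (rule cmp_rec_list[OF l w])
    show "polybd (\<lambda>x. sz (w x))" by (intro polybd_intro w[THEN cmp_space])
    show "sz (rec_list (w x) (\<lambda>_ _ r. tl r) ys) \<le> sz (w x)" for x and ys :: "bool list"
      by (simp add: rec sz_drop)
  qed (intro cmp_intro)
  then show ?thesis by (simp only: rec)
qed

text \<open>\<open>h\<close> may be arbitrary, since only its values at the blank and at the two
  bits occur, and these are constants.\<close>

lemma cmp_input_sym:
  assumes "cmp b l" "cmp b w"
  shows "cmp b (\<lambda>x. h (input_sym (w x) (length (l x :: bool list))))"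
proof -
  have "cmp b (\<lambda>x. case drop (length (l x)) (w x) of [] \<Rightarrow> h 0 | s # _ \<Rightarrow> if s then h (bit_symbol True) else h (bit_symbol False))"
    by (intro cmp_intro cmp_unary_drop assms)
  moreover have "(case ys of [] \<Rightarrow> h 0 | s # _ \<Rightarrow> if s then h (bit_symbol True) else h (bit_symbol False)) =
      h (case ys of [] \<Rightarrow> 0 | s # _ \<Rightarrow> bit_symbol s)" for ys
    by (cases ys) auto
  ultimately show ?thesis by (simp add: input_sym_def)
qed

context discounted
begin

definition code_of :: "bf \<Rightarrow> bool list" where
  "code_of \<phi> = enc (form_of k \<phi>)"

lemma cmp_code_Is [cmp_intro]:
  assumes "cmp b n" "cmp b a"
  shows "cmp b (\<lambda>x. code_of (Is (n x) (a x)))"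
proof -
  have binds: "enc (foldr (\<lambda>i \<phi>. Bind i x \<phi>) is \<phi>) = concat (map (\<lambda>i. enc_nat 4 @ enc_nat i @ enc_nat x) is) @ enc \<phi>"
    for x "is" \<phi> by (induction "is") simp_all
  have "cmp b (\<lambda>x. concat (map (\<lambda>i. enc_nat 4 @ enc_nat i @ enc_nat (n x)) [0..<k]) @ enc_nat 5 @ enc_nat 0 @ enc_nat (a x))"
    by (intro cmp_intro assms cmp_comp[OF assms(1)])
  then show ?thesis by (simp only: code_of_def form_of.simps binds enc_form.simps)
qed

lemma cmp_code_Not [cmp_intro]: "cmp b (\<lambda>x. code_of (F x)) \<Longrightarrow> cmp b (\<lambda>x. code_of (Not (F x)))"
  unfolding code_of_def form_of.simps enc_form.simps by (intro cmp_intro)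

lemma cmp_code_Disj [cmp_intro]:
  "cmp b (\<lambda>x. code_of (F x)) \<Longrightarrow> cmp b (\<lambda>x. code_of (F' x)) \<Longrightarrow> cmp b (\<lambda>x. code_of (Disj (F x) (F' x)))"
  unfolding code_of_def form_of.simps enc_form.simps by (intro cmp_intro)

lemma cmp_code_And [cmp_intro]:
  "cmp b (\<lambda>x. code_of (F x)) \<Longrightarrow> cmp b (\<lambda>x. code_of (F' x)) \<Longrightarrow> cmp b (\<lambda>x. code_of (And (F x) (F' x)))"
  unfolding And_def by (intro cmp_code_Not cmp_code_Disj)

text \<open>Alphabet, predicate and number of names are fixed, so the truth table is a constant
  template into which computed names are inserted.\<close>

lemma cmp_code_pred_form [cmp_intro]:
  assumes "\<forall>n\<in>set ns. cmp b n"
  shows "cmp b (\<lambda>x. code_of (pred_form c P (map (\<lambda>n. n x) ns)))"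
  using assms
proof (induction ns arbitrary: P)
  case Nil
  show ?case by (simp add: cmp_const)
next
  case (Cons n ns)
  have "cmp b (\<lambda>x. code_of (foldr (\<lambda>a \<phi>. Disj (And (Is (n x) a) (pred_form c (\<lambda>l. P (a # l)) (map (\<lambda>n. n x) ns))) \<phi>)
      as (Not Tru)))" for as
  proof (induction "as")
    case Nil
    show ?case by (simp add: cmp_const)
  next
    case (Cons a as)
    have "cmp b (\<lambda>x. code_of (pred_form c (\<lambda>l. P (a # l)) (map (\<lambda>n. n x) ns)))"
      using \<open>\<forall>n\<in>set (n # ns). cmp b n\<close> by (intro \<open>\<And>P. _ \<Longrightarrow> cmp b (\<lambda>x. code_of (pred_form c P _))\<close>) simp
    moreover have "cmp b n" using \<open>\<forall>n\<in>set (n # ns). cmp b n\<close> by simp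
    ultimately show ?case using Cons unfolding foldr.simps comp_apply
      by (intro cmp_code_Disj cmp_code_And cmp_code_Is cmp_const)
  qed
  then show ?case by (simp only: list.map pred_form.simps)
qed

definition exs_code :: "nat list \<Rightarrow> bool list" where
  "exs_code xs = concat (map (\<lambda>x. enc_nat 3 @ enc_nat x) xs)"

lemma code_of_exs: "code_of (exs xs \<phi>) = exs_code xs @ code_of \<phi>"
  by (induction xs) (simp_all add: exs_def exs_code_def code_of_def)

text \<open>In prefix notation a conjunction adds a word in front of its last member: negation,
  disjunction, negation, the first member, negation.\<close>

definition ands_code :: "bf list \<Rightarrow> bool list" where
  "ands_code \<phi>s = concat (map (\<lambda>\<phi>. enc_nat 1 @ enc_nat 2 @ enc_nat 1 @ code_of \<phi> @ enc_nat 1) \<phi>s)"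

lemma code_of_ands: "code_of (ands \<phi>s \<psi>) = ands_code \<phi>s @ code_of \<psi>"
  by (induction \<phi>s) (simp_all add: ands_def ands_code_def code_of_def And_def)

lemma map_upt_iota: "map h [0..<length l] = map (\<lambda>u. h (length u)) (iota l)"
  by (simp add: iota_def)

lemma cmp_exs_code [cmp_intro]:
  assumes "cmp b l" "\<kappa> < 8"
  shows "cmp b (\<lambda>x. exs_code (names (length (l x :: bool list)) \<kappa>))"
  unfolding exs_code_def names_def map_upt_iota map_map comp_def
  by (intro cmp_intro assms)

lemma cmp_ands_code:
  assumes "cmp b (\<lambda>q. code_of (F (fst q) (length (snd q :: bool list))))" "cmp b l"
  shows "cmp b (\<lambda>x. ands_code (map (F x) [0..<length (l x :: bool list)]))"
  unfolding ands_code_def map_upt_iota map_map comp_def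
  by (intro cmp_intro assms)

definition halve_code :: "nat \<Rightarrow> nat \<Rightarrow> nat \<Rightarrow> nat \<Rightarrow> nat \<Rightarrow> nat \<Rightarrow> bool list" where
  "halve_code c m x y u v = exs_code (names m 2) @ enc_nat 1 @ exs_code [name 5 0] @ enc_nat 1 @
     exs_code (names m u) @ exs_code (names m v) @
     ands_code (map (\<lambda>i. pred_form c half_rel [name 5 0, name x i, name y i, name 2 i, name u i, name v i]) [0..<m])"

lemma code_of_halve: "code_of (halve c m x y u v \<phi>) = halve_code c m x y u v @ code_of \<phi>"
proof -
  have n: "code_of (Not \<psi>) = enc_nat 1 @ code_of \<psi>" for \<psi> by (simp add: code_of_def)
  have e: "code_of (Exi z \<psi>) = exs_code [z] @ code_of \<psi>" for z \<psi> by (simp add: code_of_def exs_code_def)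
  show ?thesis unfolding halve_def halve_code_def code_of_exs code_of_ands n e append_assoc ..
qed

lemma cmp_halve_code [cmp_intro]:
  assumes l: "cmp b l" and k: "x < 8" "y < 8" "u < 8" "v < 8"
  shows "cmp b (\<lambda>z. halve_code c (length (l z :: bool list)) x y u v)"
proof -
  have "cmp b (\<lambda>q :: 'a \<times> bool list. code_of (pred_form c half_rel (map (\<lambda>n. n q)
      [\<lambda>_. name 5 0, \<lambda>q. name x (length (snd q)), \<lambda>q. name y (length (snd q)), \<lambda>q. name 2 (length (snd q)),
       \<lambda>q. name u (length (snd q)), \<lambda>q. name v (length (snd q))])))"
    by (rule cmp_code_pred_form) (auto intro!: cmp_name cmp_const cmp_snd cmp_id k)
  then have "cmp b (\<lambda>q :: 'a \<times> bool list. code_of (pred_form c half_rel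
      [name 5 0, name x (length (snd q)), name y (length (snd q)), name 2 (length (snd q)),
       name u (length (snd q)), name v (length (snd q))]))" by simp
  then show ?thesis unfolding halve_code_def by (intro cmp_intro cmp_ands_code l k) simp
qed

lemma cmp_step_form:
  assumes l: "cmp b l"
  shows "cmp b (\<lambda>x. code_of (step_form c (length (l x :: bool list)) h blank))"
proof -
  let ?P = "\<lambda>l. l ! 4 = h (l ! 0) (l ! 1) (l ! 2) (l ! 3)"
  have "cmp b (\<lambda>q :: 'a \<times> bool list. code_of (pred_form c ?P (map (\<lambda>n. n q)
      [\<lambda>_. name 0 0, \<lambda>q. name 0 (length (snd q)), \<lambda>q. name 0 (length (True # snd q)), \<lambda>q. name 0 (length (True # True # snd q)),
       \<lambda>q. name 1 (length (True # snd q))])))"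
    by (rule cmp_code_pred_form) (auto simp del: list.size intro!: cmp_name cmp_const cmp_snd cmp_id cmp_intro)
  then have 1: "cmp b (\<lambda>q :: 'a \<times> bool list. code_of (pred_form c ?P
      [name 0 0, name 0 (length (snd q)), name 0 (Suc (length (snd q))), name 0 (Suc (Suc (length (snd q)))),
       name 1 (Suc (length (snd q)))]))" by simp
  have "cmp b (\<lambda>x. name 1 (length (True # l x)))" by (intro cmp_intro l) simp
  then have 2: "cmp b (\<lambda>x. name 1 (Suc (length (l x))))" by simp
  show ?thesis
    unfolding step_form_def And_def
    by (intro cmp_code_Not cmp_code_Disj cmp_const, unfold code_of_ands, intro cmp_intro cmp_ands_code 1 2 l)
qed

text \<open>Each halving contains the inner formula once and at its end, so the code is a fixed word
  repeated T times before that of the base formula, and a plain concatenation writes it.\<close>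

lemma code_of_savitch:
  "code_of (savitch c m h blank T) =
    concat (map (\<lambda>_. halve_code c (m + 2) 0 1 3 4 @ halve_code c (m + 2) 3 4 0 1) (unary T)) @ code_of (step_form c m h blank)"
  by (induction T) (simp_all add: savitch_def code_of_halve)

lemma cmp_accept_form:
  assumes l: "cmp b l" and T: "cmp b T" and ini: "cmp b (\<lambda>q. ini (fst q) (length (snd q :: bool list)))"
  shows "cmp b (\<lambda>x. code_of (accept_form c (length (l x :: bool list)) h blank acc (ini x) (length (T x :: bool list))))"
proof -
  have ll: "length (l x) + 2 = length (True # True # l x)" for x by simp
  have l2: "cmp b (\<lambda>x. True # True # l x)" by (intro cmp_intro l)
  have "cmp b (\<lambda>q :: 'a \<times> bool list. code_of (pred_form c (\<lambda>l. acc (l ! 0)) [name 1 0]))" by (rule cmp_const)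
  have s: "cmp b (\<lambda>x. code_of (savitch c (length (l x)) h blank (length (T x))))"
    unfolding code_of_savitch ll
    by (intro cmp_intro cmp_halve_code cmp_unary_length cmp_step_form l l2 T cmp_comp[OF l2]) simp_all
  have 1: "cmp b (\<lambda>q. code_of (Is (name 0 (length (snd q :: bool list))) (ini (fst q) (length (snd q)))))"
    by (intro cmp_intro ini) simp
  show ?thesis
    unfolding accept_form_def code_of_exs code_of_ands ll
    by (intro cmp_intro cmp_exs_code cmp_ands_code cmp_code_And cmp_const 1 s l2) simp_all
qed

end

context local_run
begin

text \<open>The words \<open>V t\<close> determine their successors, the last cell being always
  blank, and there are \<open>c ^ (m + 2)\<close> candidates. So the limit is reached by then,
  wherever \<open>t0\<close> lies.\<close>

lemma V_limit:
  assumes const: "\<And>t. t0 \<le> t \<Longrightarrow> v t = v t0" and n: "c ^ (m + 2) \<le> n"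
  shows "V n = V t0"
proof (rule eventually_constant_iterates[where A = "vecs c (m + 2)"
      and g = "\<lambda>X. map (\<lambda>i. if i = Suc m then blank else f (X ! 0) (X ! (i - 1)) (X ! i) (X ! Suc i)) [0..<m + 2]"])
  show "V (Suc t) = map (\<lambda>i. if i = Suc m then blank else f (V t ! 0) (V t ! (i - 1)) (V t ! i) (V t ! Suc i)) [0..<m + 2]" for t
  proof (rule nth_equalityI)
    fix i assume "i < length (V (Suc t))"
    then have i: "i < m + 2" by (simp add: V_def)
    show "V (Suc t) ! i = map (\<lambda>i. if i = Suc m then blank else f (V t ! 0) (V t ! (i - 1)) (V t ! i) (V t ! Suc i)) [0..<m + 2] ! i"
    proof (cases "i = Suc m")
      case True
      then show ?thesis using v_blank[of i "Suc t"] i by (simp del: upt_Suc)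
    next
      case False
      then show ?thesis using i by (simp add: v_step[of t i] del: upt_Suc)
    qed
  qed (simp add: V_def)
  show "V t \<in> vecs c (m + 2)" for t by (rule V_vecs)
  have vecs: "vecs c (m + 2) = {X. set X \<subseteq> {..<c} \<and> length X = m + 2}" by (auto simp: vecs_def)
  show "finite (vecs c (m + 2))" unfolding vecs by (rule finite_lists_length_eq) simp
  show "card (vecs c (m + 2)) \<le> n" unfolding vecs card_lists_length_eq[OF finite_lessThan] card_lessThan by (rule n)
  show "V t = V t0" if "t0 \<le> t" for t using const[OF that] by (simp add: V_def)
qed

end

section \<open>The reduction and the two bounds\<close>

context discounted
begin

theorem threshold_hard: "PSPACE_hard (threshold_model_checking k D code)"
  unfolding PSPACE_hard_def
proof
  fix A :: "bool list set" assume "A \<in> PSPACE"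
  from pspace_local_run[OF this] obtain c h blank acc h0 h1 v and p :: "nat poly" where
    R: "\<forall>w. local_run c (poly p (length w)) h blank (v w) \<and>
       (\<forall>i. v w 0 i = (if i = 0 then h0 (input_sym w i) else h1 (input_sym w i))) \<and>
       (\<exists>t0. \<forall>t\<ge>t0. v w t = v w t0 \<and> acc (v w t 0) = (w \<in> A))"
    by (elim exE)
  have run: "\<And>w. local_run c (poly p (length w)) h blank (v w)"
    and v0: "\<And>w i. v w 0 i = (if i = 0 then h0 (input_sym w i) else h1 (input_sym w i))"
    and lim: "\<And>w. \<exists>t0. \<forall>t\<ge>t0. v w t = v w t0 \<and> acc (v w t 0) = (w \<in> A)"
    using R by simp_all
  have c: "2 \<le> c" using run[of "[]"] by (simp add: local_run_def)
  \<comment> \<open>With \<open>c * (m + 2)\<close> rounds the formula covers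
    \<open>4 ^ (c * (m + 2))\<close> steps, at least the number \<open>c ^ (m + 2)\<close> of words,
    because \<open>c \<le> 4 ^ c\<close>.\<close>
  define q where "q = smult c (p + [:2:])"
  define \<Phi> where "\<Phi> w = accept_form c (poly p (length w)) h blank acc
     (\<lambda>i. if i = 0 then h0 (input_sym w i) else h1 (input_sym w i)) (poly q (length w))" for w
  \<comment> \<open>The formula has value 0 or 1, so the threshold 1 asks for its truth.\<close>
  define red where "red w = enc (form_of k (\<Phi> w)) @ enc_cgs k (letter_game c) @ enc_rat 1" for w
  have "cmp True (\<lambda>w. code_of (accept_form c (length (unary (poly p (length w)))) h blank acc
     (\<lambda>i. if i = 0 then h0 (input_sym w i) else h1 (input_sym w i)) (length (unary (poly q (length w))))))"
  proof (rule cmp_accept_form)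
    show "cmp True (\<lambda>q :: bool list \<times> bool list. if length (snd q) = 0 then h0 (input_sym (fst q) (length (snd q)))
        else h1 (input_sym (fst q) (length (snd q))))"
      by (intro cmp_intro cmp_input_sym)
  qed (rule cmp_unary_poly)+
  then have "cmp True (\<lambda>w. code_of (\<Phi> w))" by (simp only: \<Phi>_def length_replicate)
  then have "cmp True red" unfolding red_def code_of_def by (intro cmp_intro) (auto simp only:)
  from cmp_tm[OF this] have poly: "polytime_computable red"
    unfolding polytime_computable_def by blast
  have "w \<in> A \<longleftrightarrow> red w \<in> threshold_model_checking k D code" for w
  proof -
    interpret local_run c "poly p (length w)" h blank "v w" by (rule run)
    let ?m = "poly p (length w)" and ?T = "poly q (length w)" and ?G = "letter_game c"
    obtain t0 where t0: "\<And>t. t0 \<le> t \<Longrightarrow> v w t = v w t0 \<and> acc (v w t 0) = (w \<in> A)" using lim[of w] by blast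
    have const: "v w t = v w t0" if "t0 \<le> t" for t using t0[OF that] by (rule conjunct1)
    have "c ^ (?m + 2) \<le> (4 ^ c) ^ (?m + 2)"
    proof (rule power_mono)
      have "c \<le> 2 ^ c" by (rule less_imp_le[OF less_exp])
      also have "(2 :: nat) ^ c \<le> 4 ^ c" by (rule power_mono) simp_all
      finally show "c \<le> 4 ^ c" .
    qed simp
    also have "\<dots> = 4 ^ ?T" by (simp add: q_def power_mult power_add)
    finally have n: "c ^ (?m + 2) \<le> 4 ^ ?T" .
    have "V (4 ^ ?T) = V t0" by (rule V_limit[OF _ n]) (rule const)
    then have "V (4 ^ ?T) ! 0 = V t0 ! 0" by (rule arg_cong)
    then have "v w (4 ^ ?T) 0 = v w t0 0" by simp
    then have acc: "acc (v w (4 ^ ?T) 0) = (w \<in> A)" using t0[OF order.refl] by simp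
    have sent: "sentence {..<k} (form_of k (\<Phi> w))"
      using free_form_of[of k "\<Phi> w"] by (simp add: sentence_def \<Phi>_def fv_accept_form)
    have G: "cgs {..<k} ?G" "presented ?G" using c k by (simp_all add: letter_game_cgs letter_game_presented)
    define \<chi> :: "nat + nat \<Rightarrow> nat \<Rightarrow> nat" where "\<chi> l = (\<lambda>u\<in>{..<c}. 0)" for l
    have \<chi>: "range \<chi> \<subseteq> strategies ?G" using c by (auto simp: \<chi>_def strategies_def letter_game_def)
    have "sentence_value {..<k} ?G (form_of k (\<Phi> w)) = sat_value {..<k} ?G (form_of k (\<Phi> w)) \<chi> (init_pos ?G)"
      by (rule sentence_value_eq[OF sent \<chi>])
    also have "\<dots> = of_bool (holds c (\<lambda>x. \<chi> (Inr x) 0) (\<Phi> w))"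
      using sat_value_form_of[OF k _ \<chi>] c by (simp add: letter_game_def)
    also have "holds c (\<lambda>x. \<chi> (Inr x) 0) (\<Phi> w) \<longleftrightarrow> w \<in> A"
      unfolding \<Phi>_def acc[symmetric] by (rule holds_accept_form) (use c in \<open>simp_all add: \<chi>_def v0\<close>)
    finally have "sentence_value {..<k} ?G (form_of k (\<Phi> w)) = of_bool (w \<in> A)" .
    then have "decide (red w) \<longleftrightarrow> w \<in> A"
      using decide_code[OF form_over_form_of sent G, of 1] by (simp add: red_def)
    then show ?thesis by (simp add: decide_threshold)
  qed
  with poly show "polytime_reducible A (threshold_model_checking k D code)"
    unfolding polytime_reducible_def by blast
qed

theorem threshold_PSPACE: "threshold_model_checking k D code \<in> PSPACE"
proof -
  have "cmp False (\<lambda>w. [decide w])" by (intro cmp_intro cmp_decide)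
  from cmp_tm[OF this] show ?thesis
    unfolding PSPACE_def pspace_computable_def by (auto simp: decide_threshold)
qed

end

theorem theorem1:
  fixes D :: "(nat \<Rightarrow> real) set"
    and code :: "(nat \<Rightarrow> real) \<Rightarrow> bool list"
    and k :: nat
  assumes "0 < k"
    and "\<forall>d\<in>D. discounting d"
    and "pspace_computable_family code D"
  shows "PSPACE_complete (threshold_model_checking k D code)"
proof -
  from assms(3) obtain f where f: "pspace_computable f"
    "\<forall>d\<in>D. \<forall>i. \<exists>r. d i = of_rat r \<and> f (enc_word (code d) @ replicate i True) = enc_rat r"
    "\<forall>w. w \<notin> code ` D \<longrightarrow> (\<forall>i. f (enc_word w @ replicate i True) = [])" and inj: "inj_on code D"
    unfolding pspace_computable_family_def by blast
  \<comment> \<open>\<open>pspace_cmp\<close> turns the machine for the discounts into a program,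
    the form in which scanner and evaluator call it.\<close>
  interpret discounted k D code f
    using assms(1,2) f inj pspace_cmp by unfold_locales auto
  show ?thesis unfolding PSPACE_complete_def using threshold_PSPACE threshold_hard by blast
qed

end
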